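(* Let $X\subset\mathbb{R}^n$ be an $s$-set with $n-1<s\le n$ (of positive $\mathcal{H}_s$-measure), let $k\ge1$ be an integer, $1\le q\le\infty$, and let $\omega$ be a quasipower $k$-majorant. Then there is a linear continuous extension operator $$T_k:\dot{C}_q^{k,\omega}(X)\to\dot{\Lambda}^{k,\omega}(\mathbb{R}^n),$$ that is, a linear operator, bounded with respect to the seminorms of the two spaces, such that $(T_kf)|_X=f$ $\mathcal{H}_s$-almost everywhere on $X$ for every $f\in\dot{C}_q^{k,\omega}(X)$. In particular, $\dot{C}_q^{k,\omega}(X)$ is isomorphic (with equivalence of seminorms, functions on $X$ being identified when they agree $\mathcal{H}_s$-almost everywhere) to the trace space $\dot{\Lambda}^{k,\omega}(\mathbb{R}^n)|_X$.
   Context: $\mathcal{H}_s$ is the $s$-dimensional Hausdorff measure. $s$-sets: for $K\subset\mathbb{R}^n$ and $x\in K$, $B_r(x;K)$ is the intersection with $K$ of the open Euclidean ball of radius $r$ centered at $x$. $K$ is an $s$-set if there are $a,b>0$ such that $br^s\le\mathcal{H}_s(B_r(x;K))\le ar^s$ for every $x\in K$ and $0<r\le\operatorname{diam}(K)$. Cubes: $Q_r(x)$ is the closed cube in $\mathbb{R}^n$ with center $x$ and radius $r$ (half the side length); $r_Q$ is the radius of $Q$. $\mathcal{K}_X$ is the family of closed cubes with centers in $X$ and radii at most $4\operatorname{diam}X$. For $x\in X$, $X_r(x):=Q_r(x)\cap X$. Local best approximation: $\mathcal{P}_{k-1}\subset\mathbb{R}[x_1,\dots,x_n]$ is the space of polynomials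 of degree at most $k-1$. For $Q=Q_r(x)\in\mathcal{K}_X$, $$\mathcal{E}_k(f;Q):=\inf_{p\in\mathcal{P}_{k-1}}\left\{\frac{1}{\mathcal{H}_s(X_r(x))}\int_{X_r(x)}|f-p|^q\,d\mathcal{H}_s\right\}^{1/q}$$ (with the usual essential supremum modification for $q=\infty$). Morrey–Campanato space: $\dot{C}_q^{k,\omega}(X)$ consists of the $\mathcal{H}_s$-measurable functions $f:X\to\mathbb{R}$ with $f|_{Q\cap X}\in L_q(Q\cap X,\mathcal{H}_s)$ for all $Q\in\mathcal{K}_X$ and finite seminorm $$|f|_{\dot{C}_q^{k,\omega}(X)}:=\sup\left\{\frac{\mathcal{E}_k(f;Q)}{\omega(r_Q)}:Q\in\mathcal{K}_X\right\}.$$ Quasipower $k$-majorant: a nondecreasing function $\omega:(0,\infty)\to(0,\infty)$ with $\omega(+0)=0$, $t\mapsto\omega(t)/t^k$ nonincreasing, and $$C_\omega:=\sup_{t>0}\left\{\frac{1}{\omega(t)}\int_0^t\frac{\omega(u)}{u}\,du\right\}<\infty.$$ Lipschitz space: $\dot{\Lambda}^{k,\omega}(\mathbb{R}^n)$ consists of locally bounded functions $f:\mathbb{R}^n\to\mathbb{R}$ with finite seminorm $$|f|_{\dot{\Lambda}^{k,\omega}(\mathbb{R}^n)}:=\sup\left\{\frac{|\Delta_h^kf(x)|}{\omega(|h|)}:x,h\in\mathbb{R}^n,\ h\neq0\right\},\qquad \Delta_h^kf(x):=\sum_{j=0}^k(-1)^{k-j}\binom{k}{j}f(x+jh).$$ Trace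 space: $\dot{\Lambda}^{k,\omega}(\mathbb{R}^n)|_X$ consists of the restrictions $g|_X$ of functions $g\in\dot{\Lambda}^{k,\omega}(\mathbb{R}^n)$, with the seminorm $|f|:=\inf\{|g|_{\dot{\Lambda}^{k,\omega}(\mathbb{R}^n)}:f=g|_X\}$. *)

theory Defs
  imports "HOL-Probability.Essential_Supremum"
begin

section \<open>Hausdorff measure\<close>

text \<open>
  The outer measure is not normalised. Since \<open>0 powr s = 0\<close>, covering sets of diameter zero
  contribute nothing; this is the usual definition for \<open>s > 0\<close>, the only case used here.
  The clause \<open>bounded (U i)\<close> is needed because \<^const>\<open>diameter\<close> is real-valued and has no
  meaning for unbounded sets.
\<close>

definition hausdorff_pre :: "real \<Rightarrow> real \<Rightarrow> 'a::metric_space set \<Rightarrow> ennreal" where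
  "hausdorff_pre s \<delta> A =
     (INF U \<in> {U :: nat \<Rightarrow> 'a set. A \<subseteq> (\<Union>i. U i) \<and> (\<forall>i. bounded (U i) \<and> diameter (U i) \<le> \<delta>)}.
        \<Sum>i. ennreal (diameter (U i) powr s))"

definition hausdorff_outer :: "real \<Rightarrow> 'a::metric_space set \<Rightarrow> ennreal" where
  "hausdorff_outer s A = (SUP \<delta>\<in>{0<..}. hausdorff_pre s \<delta> A)"

text \<open>
  The measure \<open>\<H>\<^sub>s\<close> on a subset \<open>A\<close>: the outer measure on the subsets of \<open>A\<close>, restricted to those
  that are Caratheodory measurable in \<open>A\<close>. This makes sense whether or not \<open>A\<close> is itself a
  measurable subset of the ambient space.
\<close>

definition hausdorff_on :: "real \<Rightarrow> 'a::metric_space set \<Rightarrow> 'a measure" where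
  "hausdorff_on s A =
     measure_of A (lambda_system A (Pow A) (hausdorff_outer s)) (hausdorff_outer s)"

lemma hausdorff_pre_mono: "A \<subseteq> B \<Longrightarrow> hausdorff_pre s \<delta> A \<le> hausdorff_pre s \<delta> B"
  unfolding hausdorff_pre_def by (rule INF_superset_mono) auto

lemma hausdorff_outer_mono: "A \<subseteq> B \<Longrightarrow> hausdorff_outer s A \<le> hausdorff_outer s B"
  unfolding hausdorff_outer_def by (intro SUP_mono) (auto intro: hausdorff_pre_mono)

lemma hausdorff_outer_empty: "hausdorff_outer s ({} :: 'a::metric_space set) = 0"
proof -
  have "hausdorff_pre s \<delta> ({} :: 'a set) \<le> 0" if "\<delta> > 0" for \<delta> :: real
    unfolding hausdorff_pre_def
    by (rule INF_lower2[of "\<lambda>_. {}"]) (use that in auto)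
  then have "hausdorff_outer s ({} :: 'a set) \<le> 0"
    unfolding hausdorff_outer_def by (intro SUP_least) auto
  then show ?thesis by simp
qed

lemma hausdorff_pre_UN:
  fixes A :: "nat \<Rightarrow> 'a::metric_space set"
  shows "hausdorff_pre s \<delta> (\<Union>n. A n) \<le> (\<Sum>n. hausdorff_pre s \<delta> (A n))"
proof (rule ennreal_le_epsilon)
  fix e :: real
  assume e: "0 < e" and fin: "(\<Sum>n. hausdorff_pre s \<delta> (A n)) < top"
  have fin_n: "hausdorff_pre s \<delta> (A n) \<noteq> \<infinity>" for n
    using fin by (auto simp add: less_top dest!: ennreal_suminf_lessD)
  have "\<exists>U. A n \<subseteq> (\<Union>i. U i) \<and> (\<forall>i. bounded (U i) \<and> diameter (U i) \<le> \<delta>) \<and>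
          (\<Sum>i. ennreal (diameter (U i) powr s)) \<le> hausdorff_pre s \<delta> (A n) + ennreal (e * (1/2) ^ Suc n)"
    for n
  proof -
    have "0 < e * (1/2) ^ Suc n" using e by simp
    from INF_approx_ennreal[OF this hausdorff_pre_def fin_n[of n]]
    obtain U where "U \<in> {U. A n \<subseteq> (\<Union>i. U i) \<and> (\<forall>i. bounded (U i) \<and> diameter (U i) \<le> \<delta>)}"
      "(\<Sum>i. ennreal (diameter (U i) powr s)) < hausdorff_pre s \<delta> (A n) + ennreal (e * (1/2) ^ Suc n)"
      by blast
    then show ?thesis by (intro exI[of _ U]) auto
  qed
  then have "\<forall>n. \<exists>U. A n \<subseteq> (\<Union>i. U i) \<and> (\<forall>i. bounded (U i) \<and> diameter (U i) \<le> \<delta>) \<and>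
          (\<Sum>i. ennreal (diameter (U i) powr s)) \<le> hausdorff_pre s \<delta> (A n) + ennreal (e * (1/2) ^ Suc n)"
    by (rule allI)
  from choice[OF this] obtain B where B_all:
    "\<forall>n. A n \<subseteq> (\<Union>i. B n i) \<and> (\<forall>i. bounded (B n i) \<and> diameter (B n i) \<le> \<delta>) \<and>
      (\<Sum>i. ennreal (diameter (B n i) powr s)) \<le> hausdorff_pre s \<delta> (A n) + ennreal (e * (1/2) ^ Suc n)"
    by (rule exE)
  have B: "A n \<subseteq> (\<Union>i. B n i)" "bounded (B n i)" "diameter (B n i) \<le> \<delta>"
      "(\<Sum>i. ennreal (diameter (B n i) powr s))
         \<le> hausdorff_pre s \<delta> (A n) + ennreal (e * (1/2) ^ Suc n)" for n i
    using spec[OF B_all, of n] by (simp_all only: simp_thms)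
  define C where "C = case_prod B \<circ> prod_decode"
  have cover: "(\<Union>n. A n) \<subseteq> (\<Union>i. C i)"
  proof
    fix x assume "x \<in> (\<Union>n. A n)"
    then obtain n i where "x \<in> B n i" using B(1) by blast
    then have "x \<in> C (prod_encode (n, i))" by (simp add: C_def)
    then show "x \<in> (\<Union>i. C i)" by blast
  qed
  have "hausdorff_pre s \<delta> (\<Union>n. A n) \<le> (\<Sum>i. ennreal (diameter (C i) powr s))"
    unfolding hausdorff_pre_def
  proof (rule INF_lower, intro CollectI conjI allI)
    show "bounded (C i)" "diameter (C i) \<le> \<delta>" for i
      by (simp_all add: C_def split_def B(2,3))
  qed (rule cover)
  also have "\<dots> = (\<Sum>n. \<Sum>i. ennreal (diameter (B n i) powr s))"
    unfolding C_def comp_def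
    by (rule suminf_ennreal_2dimen[where f = "\<lambda>p. ennreal (diameter (case_prod B p) powr s)"])
       (simp only: prod.case)
  also have "\<dots> \<le> (\<Sum>n. hausdorff_pre s \<delta> (A n) + ennreal (e * (1/2) ^ Suc n))"
    by (intro suminf_le B(4)) auto
  also have "\<dots> = (\<Sum>n. hausdorff_pre s \<delta> (A n)) + (\<Sum>n. ennreal (e * (1/2) ^ Suc n))"
    by (rule suminf_add[symmetric]) auto
  also have "(\<Sum>n. ennreal (e * (1/2) ^ Suc n)) = ennreal e"
  proof -
    have "(\<lambda>n. e * (1/2) ^ Suc n) sums (e * 1)"
      by (intro sums_mult power_half_series)
    then show ?thesis
      using e by (subst suminf_ennreal2) (auto simp: sums_iff)
  qed
  finally show "hausdorff_pre s \<delta> (\<Union>n. A n) \<le> (\<Sum>n. hausdorff_pre s \<delta> (A n)) + ennreal e" .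
qed

lemma outer_measure_space_hausdorff:
  "outer_measure_space (Pow A) (hausdorff_outer s :: 'a::metric_space set \<Rightarrow> ennreal)"
proof -
  have "countably_subadditive (Pow A) (hausdorff_outer s)"
    unfolding countably_subadditive_def
  proof safe
    fix B :: "nat \<Rightarrow> 'a set"
    show "hausdorff_outer s (\<Union>i. B i) \<le> (\<Sum>i. hausdorff_outer s (B i))"
      unfolding hausdorff_outer_def[of s "\<Union>i. B i"]
    proof (rule SUP_least)
      fix \<delta> :: real assume "\<delta> \<in> {0<..}"
      then have "hausdorff_pre s \<delta> (B i) \<le> hausdorff_outer s (B i)" for i
        unfolding hausdorff_outer_def by (rule SUP_upper)
      then have "(\<Sum>i. hausdorff_pre s \<delta> (B i)) \<le> (\<Sum>i. hausdorff_outer s (B i))"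
        by (intro suminf_le) auto
      with hausdorff_pre_UN[of s \<delta> B]
      show "hausdorff_pre s \<delta> (\<Union>i. B i) \<le> (\<Sum>i. hausdorff_outer s (B i))"
        by (rule order_trans)
    qed
  qed
  then show ?thesis
    unfolding outer_measure_space_def positive_def increasing_def
    by (auto simp: hausdorff_outer_empty hausdorff_outer_mono)
qed

lemma measure_space_hausdorff:
  "measure_space A (lambda_system A (Pow A) (hausdorff_outer s)) (hausdorff_outer s)"
  by (rule sigma_algebra.caratheodory_lemma[OF sigma_algebra_Pow outer_measure_space_hausdorff])

lemma space_hausdorff_on [simp]: "space (hausdorff_on s A) = A"
  unfolding hausdorff_on_def
  by (rule space_measure_of) (auto simp: lambda_system_def)

lemma sets_hausdorff_on: "sets (hausdorff_on s A) = lambda_system A (Pow A) (hausdorff_outer s)"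
  unfolding hausdorff_on_def
  using measure_space_hausdorff[of A s]
  by (intro sigma_algebra.sets_measure_of_eq) (auto simp: measure_space_def)

lemma emeasure_hausdorff_on:
  "B \<in> sets (hausdorff_on s A) \<Longrightarrow> emeasure (hausdorff_on s A) B = hausdorff_outer s B"
  using measure_space_hausdorff[of A s]
  by (intro emeasure_measure_of[OF hausdorff_on_def])
     (auto simp: sets_hausdorff_on lambda_system_def measure_space_def)

section \<open>\<open>s\<close>-sets and cubes\<close>

text \<open>The diameter with values in \<open>[0,\<infinity>]\<close>, so that unbounded sets have diameter \<open>\<infinity>\<close>.\<close>

definition ediam :: "'a::metric_space set \<Rightarrow> ennreal" where
  "ediam K = (SUP (x, y) \<in> K \<times> K. ennreal (dist x y))"

definition s_set :: "real \<Rightarrow> 'a::metric_space set \<Rightarrow> bool" where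
  "s_set s K \<longleftrightarrow>
     (\<exists>a>0. \<exists>b>0. \<forall>x\<in>K. \<forall>r>0. ennreal r \<le> ediam K \<longrightarrow>
        ennreal (b * r powr s) \<le> hausdorff_outer s (ball x r \<inter> K) \<and>
        hausdorff_outer s (ball x r \<inter> K) \<le> ennreal (a * r powr s))"

definition cube :: "real ^ 'n \<Rightarrow> real \<Rightarrow> (real ^ 'n) set" where
  "cube x r = {y. \<forall>i. \<bar>y $ i - x $ i\<bar> \<le> r}"

text \<open>Cubes are represented by their pairs (center, radius).\<close>

definition cubes :: "(real ^ 'n) set \<Rightarrow> ((real ^ 'n) \<times> real) set" where
  "cubes X = {(x, r). x \<in> X \<and> 0 < r \<and> ennreal r \<le> 4 * ediam X}"

section \<open>Local best approximation and Morrey--Campanato spaces\<close>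

text \<open>Polynomial functions in \<open>n\<close> real variables of total degree at most \<open>d\<close>;
  \<open>\<alpha>\<close> ranges over the multi-indices.\<close>

definition polys :: "nat \<Rightarrow> (real ^ 'n \<Rightarrow> real) set" where
  "polys d = {p. \<exists>c :: ('n \<Rightarrow> nat) \<Rightarrow> real.
     p = (\<lambda>x. \<Sum>\<alpha> | (\<Sum>i\<in>UNIV. \<alpha> i) \<le> d. c \<alpha> * (\<Prod>i\<in>UNIV. (x $ i) ^ \<alpha> i))}"

definition in_Lq :: "ennreal \<Rightarrow> 'a measure \<Rightarrow> ('a \<Rightarrow> real) \<Rightarrow> bool" where
  "in_Lq q M f \<longleftrightarrow> f \<in> borel_measurable M \<and>
     (if q = \<infinity> then esssup M (\<lambda>y. ennreal \<bar>f y\<bar>) < \<infinity>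
      else integrable M (\<lambda>y. \<bar>f y\<bar> powr enn2real q))"

definition mean_Lq :: "ennreal \<Rightarrow> 'a measure \<Rightarrow> ('a \<Rightarrow> real) \<Rightarrow> real" where
  "mean_Lq q M f =
     (if q = \<infinity> then enn2real (esssup M (\<lambda>y. ennreal \<bar>f y\<bar>))
      else (1 / measure M (space M) * (\<integral>y. \<bar>f y\<bar> powr enn2real q \<partial>M)) powr (1 / enn2real q))"

text \<open>\<open>\<E>\<^sub>k(f; Q\<^sub>r(x))\<close> for \<open>f\<close> in \<open>L\<^sub>q(X \<inter> Q\<^sub>r(x))\<close>. The definition is meant for \<open>k \<ge> 1\<close>.\<close>

definition best_approx ::
  "real \<Rightarrow> ennreal \<Rightarrow> nat \<Rightarrow> (real ^ 'n) set \<Rightarrow> (real ^ 'n \<Rightarrow> real) \<Rightarrow> real ^ 'n \<Rightarrow> real \<Rightarrow> real" where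
  "best_approx s q k X f x r =
     (INF p \<in> polys (k - 1). mean_Lq q (hausdorff_on s (cube x r \<inter> X)) (\<lambda>y. f y - p y))"

text \<open>
  A function \<open>X \<rightarrow> \<real>\<close> is represented by a total function of which only the values on \<open>X\<close> matter.
  Seminorms take values in \<open>[0,\<infinity>]\<close>.
\<close>

definition campanato_seminorm ::
  "real \<Rightarrow> ennreal \<Rightarrow> nat \<Rightarrow> (real \<Rightarrow> real) \<Rightarrow> (real ^ 'n) set \<Rightarrow> (real ^ 'n \<Rightarrow> real) \<Rightarrow> ennreal" where
  "campanato_seminorm s q k \<omega> X f =
     (SUP (x, r) \<in> cubes X. ennreal (best_approx s q k X f x r / \<omega> r))"

definition campanato ::
  "real \<Rightarrow> ennreal \<Rightarrow> nat \<Rightarrow> (real \<Rightarrow> real) \<Rightarrow> (real ^ 'n) set \<Rightarrow> (real ^ 'n \<Rightarrow> real) set" where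
  "campanato s q k \<omega> X =
     {f. f \<in> borel_measurable (hausdorff_on s X) \<and>
         (\<forall>(x, r) \<in> cubes X. in_Lq q (hausdorff_on s (cube x r \<inter> X)) f) \<and>
         campanato_seminorm s q k \<omega> X f < \<infinity>}"

section \<open>Lipschitz spaces and their traces\<close>

definition quasipower_majorant :: "nat \<Rightarrow> (real \<Rightarrow> real) \<Rightarrow> bool" where
  "quasipower_majorant k \<omega> \<longleftrightarrow>
     (\<forall>t>0. \<omega> t > 0) \<and>
     mono_on {0<..} \<omega> \<and>
     (\<omega> \<longlongrightarrow> 0) (at_right 0) \<and>
     antimono_on {0<..} (\<lambda>t. \<omega> t / t ^ k) \<and>
     (SUP t\<in>{0<..}. (\<integral>\<^sup>+u\<in>{0<..<t}. ennreal (\<omega> u / u) \<partial>lborel) / ennreal (\<omega> t)) < \<infinity>"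

definition finite_diff :: "nat \<Rightarrow> 'a::real_vector \<Rightarrow> ('a \<Rightarrow> real) \<Rightarrow> 'a \<Rightarrow> real" where
  "finite_diff k h f x = (\<Sum>j=0..k. (-1) ^ (k - j) * real (k choose j) * f (x + real j *\<^sub>R h))"

definition lipschitz_seminorm ::
  "nat \<Rightarrow> (real \<Rightarrow> real) \<Rightarrow> ('a::real_normed_vector \<Rightarrow> real) \<Rightarrow> ennreal" where
  "lipschitz_seminorm k \<omega> f =
     (SUP (x, h) \<in> {(x, h). h \<noteq> 0}. ennreal (\<bar>finite_diff k h f x\<bar> / \<omega> (norm h)))"

definition lipschitz_space ::
  "nat \<Rightarrow> (real \<Rightarrow> real) \<Rightarrow> ('a::real_normed_vector \<Rightarrow> real) set" where
  "lipschitz_space k \<omega> =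
     {f. (\<forall>x. \<exists>r>0. bounded (f ` ball x r)) \<and> lipschitz_seminorm k \<omega> f < \<infinity>}"

definition trace_space ::
  "nat \<Rightarrow> (real \<Rightarrow> real) \<Rightarrow> 'a::real_normed_vector set \<Rightarrow> ('a \<Rightarrow> real) set" where
  "trace_space k \<omega> X = {f. \<exists>g \<in> lipschitz_space k \<omega>. \<forall>x\<in>X. f x = g x}"

definition trace_seminorm ::
  "nat \<Rightarrow> (real \<Rightarrow> real) \<Rightarrow> 'a::real_normed_vector set \<Rightarrow> ('a \<Rightarrow> real) \<Rightarrow> ennreal" where
  "trace_seminorm k \<omega> X f =
     (INF g \<in> {g \<in> lipschitz_space k \<omega>. \<forall>x\<in>X. f x = g x}. lipschitz_seminorm k \<omega> g)"

section \<open>Extension operators and isomorphisms\<close>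

definition ae_eq_on :: "real \<Rightarrow> 'a::metric_space set \<Rightarrow> ('a \<Rightarrow> real) \<Rightarrow> ('a \<Rightarrow> real) \<Rightarrow> bool" where
  "ae_eq_on s X f g \<longleftrightarrow> (AE x in hausdorff_on s X. f x = g x)"

text \<open>The first two conditions say that \<open>T\<close> is a map from functions on \<open>X\<close> to the Lipschitz space:
  its value depends only on the restriction of the argument to \<open>X\<close>.\<close>

definition extension_operator ::
  "real \<Rightarrow> ennreal \<Rightarrow> nat \<Rightarrow> (real \<Rightarrow> real) \<Rightarrow> (real ^ 'n) set \<Rightarrow>
     ((real ^ 'n \<Rightarrow> real) \<Rightarrow> (real ^ 'n \<Rightarrow> real)) \<Rightarrow> bool" where
  "extension_operator s q k \<omega> X T \<longleftrightarrow>
     (\<forall>f \<in> campanato s q k \<omega> X. T f \<in> lipschitz_space k \<omega>) \<and>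
     (\<forall>f \<in> campanato s q k \<omega> X. \<forall>g \<in> campanato s q k \<omega> X. (\<forall>x\<in>X. f x = g x) \<longrightarrow> T f = T g) \<and>
     (\<forall>f \<in> campanato s q k \<omega> X. \<forall>g \<in> campanato s q k \<omega> X. \<forall>a b :: real.
        T (\<lambda>x. a * f x + b * g x) = (\<lambda>x. a * T f x + b * T g x)) \<and>
     (\<exists>C\<ge>0. \<forall>f \<in> campanato s q k \<omega> X.
        lipschitz_seminorm k \<omega> (T f) \<le> ennreal C * campanato_seminorm s q k \<omega> X f) \<and>
     (\<forall>f \<in> campanato s q k \<omega> X. ae_eq_on s X (T f) f)"

text \<open>
  \<open>\<Phi>\<close> induces a linear isomorphism between the quotients \<open>V/E\<close> and \<open>W/E\<close> of two spaces of functions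
  by the equivalence relation \<open>E\<close>, with equivalence of the seminorms \<open>N\<close> and \<open>P\<close>. The conditions
  are, in order: \<open>\<Phi>\<close> maps into \<open>W\<close>; it is well defined and injective on classes; surjective on
  classes; linear on classes; and the seminorms of any two representatives of corresponding
  classes are comparable.
\<close>

definition induces_iso ::
  "(('a \<Rightarrow> real) \<Rightarrow> ('a \<Rightarrow> real) \<Rightarrow> bool) \<Rightarrow>
     ('a \<Rightarrow> real) set \<Rightarrow> (('a \<Rightarrow> real) \<Rightarrow> ennreal) \<Rightarrow>
     ('a \<Rightarrow> real) set \<Rightarrow> (('a \<Rightarrow> real) \<Rightarrow> ennreal) \<Rightarrow>
     (('a \<Rightarrow> real) \<Rightarrow> ('a \<Rightarrow> real)) \<Rightarrow> bool" where
  "induces_iso E V N W P \<Phi> \<longleftrightarrow>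
     (\<forall>f\<in>V. \<Phi> f \<in> W) \<and>
     (\<forall>f\<in>V. \<forall>g\<in>V. E (\<Phi> f) (\<Phi> g) \<longleftrightarrow> E f g) \<and>
     (\<forall>h\<in>W. \<exists>f\<in>V. E (\<Phi> f) h) \<and>
     (\<forall>f\<in>V. \<forall>g\<in>V. \<forall>a b :: real.
        E (\<Phi> (\<lambda>x. a * f x + b * g x)) (\<lambda>x. a * \<Phi> f x + b * \<Phi> g x)) \<and>
     (\<exists>c>0. \<exists>C>0. \<forall>f\<in>V. \<forall>h\<in>W. E (\<Phi> f) h \<longrightarrow>
        ennreal c * N f \<le> P h \<and> P h \<le> ennreal C * N f)"

end

theory Submission
  imports Defs "HOL-Library.Multiset"
begin

text \<open>
  The extension operator. Because \<open>s > n - 1\<close>, the set \<open>X\<close> is not contained in a thin slab at any point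
  and scale. By induction on the degree this yields a Remez inequality: on a cube centered in \<open>X\<close>, the
  supremum of a polynomial is controlled by its mean over \<open>X\<close>. Hence \<open>L\<^sub>2\<close>-orthogonal projection is a
  linear, uniformly bounded choice of near-best polynomials for \<open>f\<close>, and the polynomials of neighbouring
  cubes of comparable radius \<open>r\<close> differ by \<open>O(\<omega>(r))\<close>. They are glued by partitions of unity over dyadic
  lattices, using at each point the finest scale that still sees \<open>X\<close>. Near \<open>X\<close> the condition
  \<open>\<integral>\<^sub>0\<^sup>t \<omega>(u)/u du = O(\<omega>(t))\<close> sums the errors over all scales. At distance \<open>D\<close> from \<open>X\<close>, the
  difference of order \<open>k\<close> with step \<open>h\<close> is \<open>O(\<omega>(D) (\<bar>h\<bar>/D)\<^sup>k)\<close>, hence \<open>O(\<omega>(\<bar>h\<bar>))\<close> by the monotonicity of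
  \<open>\<omega>(t)/t\<^sup>k\<close>.

  The converse embedding is Whitney's theorem: a locally bounded function with small differences of
  order \<open>k\<close> is close on a cube to its Newton interpolation polynomial of degree \<open>k - 1\<close>. Kemperman's
  identity turns the hypothesis into a bound on mixed differences; an almost additive function that is
  small on the coordinate vectors is small, and this lowers the order of the mixed differences step by
  step.
\<close>

section \<open>Polynomial functions\<close>

text \<open>No derivatives of the extension are taken. Smoothness at scale D is recorded by the
  difference bounds of \<open>smooth_seq\<close> along the very points that
  \<open>finite_diff\<close> samples, and these bounds survive sums and products. The exponent q
  matters only in passing from L_q means to means of absolute values, for the extension, and from
  uniform bounds to L_q means, for the converse. In between all local analysis is done in L_1, where
  the projection is controlled because the Remez inequality bounds the sup norm of an orthonormal
  basis. Three ranges of radii have to be reconciled: the s-set bounds hold up to the diameter,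
  cubes go up to four diameters, and the gluing wants every positive radius. Hence the quartered
  radii in the measure and Remez estimates, and the truncation of large radii, harmless because such
  cubes contain all of X. Finally, \<open>hausdorff_on\<close> builds each local measure afresh from
  the outer measure, so Caratheodory's criterion has to be proved before local measures can be
  treated as restrictions of the one on X.\<close>

inductive polyfun :: "nat \<Rightarrow> (real ^ 'n::finite \<Rightarrow> real) \<Rightarrow> bool" where
  const: "polyfun d (\<lambda>_. c)"
| add: "polyfun d p \<Longrightarrow> polyfun d q \<Longrightarrow> polyfun d (\<lambda>x. p x + q x)"
| coord: "polyfun d p \<Longrightarrow> polyfun (Suc d) (\<lambda>x. x $ i * p x)"

lemma polyfun_mono: "polyfun d p \<Longrightarrow> d \<le> e \<Longrightarrow> polyfun e p"
proof (induction arbitrary: e rule: polyfun.induct)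
  case (coord d p i)
  then obtain e' where "e = Suc e'" "d \<le> e'" by (cases e) auto
  then show ?case using coord.IH by (auto intro: polyfun.coord)
qed (auto intro: polyfun.intros)

lemma polyfun_cmult: "polyfun d p \<Longrightarrow> polyfun d (\<lambda>x. c * p x)"
proof (induction rule: polyfun.induct)
  case (const d c')
  show ?case by (rule polyfun.const)
next
  case (add d p q)
  from polyfun.add[OF add.IH] show ?case by (simp add: distrib_left)
next
  case (coord d p i)
  from polyfun.coord[OF coord.IH, of i] show ?case by (simp add: mult.left_commute)
qed

lemma polyfun_diff: "polyfun d p \<Longrightarrow> polyfun d q \<Longrightarrow> polyfun d (\<lambda>x. p x - q x)"
  using polyfun.add[OF _ polyfun_cmult[where c = "-1"]] by fastforce

lemma polyfun_sum:
  "finite A \<Longrightarrow> (\<And>a. a \<in> A \<Longrightarrow> polyfun d (p a)) \<Longrightarrow> polyfun d (\<lambda>x. \<Sum>a\<in>A. p a x)"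
  by (induction A rule: finite_induct) (auto intro: polyfun.intros)

lemma polyfun_mult: "polyfun d p \<Longrightarrow> polyfun e q \<Longrightarrow> polyfun (d + e) (\<lambda>x. p x * q x)"
proof (induction rule: polyfun.induct)
  case (const d c)
  then show ?case by (intro polyfun_cmult polyfun_mono[OF const]) auto
next
  case (add d p q')
  from polyfun.add[OF add.IH(1)[OF add.prems] add.IH(2)[OF add.prems]]
  show ?case by (simp add: distrib_right)
next
  case (coord d p i)
  from polyfun.coord[OF coord.IH[OF coord.prems], of i] show ?case by (simp add: mult.assoc)
qed

lemma polyfun_affine:
  "polyfun d p \<Longrightarrow> polyfun d (\<lambda>x. p (a + c *\<^sub>R x))"
proof (induction rule: polyfun.induct)
  case (coord d p i)
  have "polyfun (Suc d) (\<lambda>x. a $ i * p (a + c *\<^sub>R x))"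
    by (intro polyfun_cmult polyfun_mono[OF coord.IH]) auto
  moreover have "polyfun (Suc d) (\<lambda>x. c * (x $ i * p (a + c *\<^sub>R x)))"
    by (intro polyfun_cmult polyfun.coord coord.IH)
  ultimately have "polyfun (Suc d) (\<lambda>x. a $ i * p (a + c *\<^sub>R x) + c * (x $ i * p (a + c *\<^sub>R x)))"
    by (rule polyfun.add)
  then show ?case by (simp add: algebra_simps)
qed (auto intro: polyfun.intros)

lemma finite_multiindices: "finite {\<alpha> :: 'n::finite \<Rightarrow> nat. (\<Sum>i\<in>UNIV. \<alpha> i) \<le> d}"
proof (rule finite_subset)
  show "{\<alpha> :: 'n \<Rightarrow> nat. (\<Sum>i\<in>UNIV. \<alpha> i) \<le> d} \<subseteq> PiE UNIV (\<lambda>_. {..d})"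
  proof safe
    fix \<alpha> :: "'n \<Rightarrow> nat" and i assume "(\<Sum>i\<in>UNIV. \<alpha> i) \<le> d"
    moreover have "\<alpha> i \<le> (\<Sum>i\<in>UNIV. \<alpha> i)" by (rule member_le_sum) auto
    ultimately show "\<alpha> i \<le> d" by simp
  qed auto
  show "finite (PiE (UNIV :: 'n set) (\<lambda>_. {..d}))" by (rule finite_PiE) auto
qed

lemma polyfun_monomial:
  "(\<Sum>i\<in>UNIV. \<alpha> i) \<le> d \<Longrightarrow> polyfun d (\<lambda>x :: real ^ 'n::finite. \<Prod>i\<in>UNIV. (x $ i) ^ \<alpha> i)"
proof -
  have pow: "polyfun m (\<lambda>x :: real ^ 'n. (x $ i) ^ m)" for m i
  proof (induction m)
    case (Suc m) from polyfun.coord[OF Suc, of i] show ?case by simp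
  qed (auto intro: polyfun.const)
  have "polyfun (\<Sum>i\<in>A. \<alpha> i) (\<lambda>x :: real ^ 'n. \<Prod>i\<in>A. (x $ i) ^ \<alpha> i)" if "finite A" for A
    using that by induction (auto intro: polyfun.const polyfun_mult pow)
  from polyfun_mono[OF this] show "(\<Sum>i\<in>UNIV. \<alpha> i) \<le> d \<Longrightarrow> ?thesis" by auto
qed

lemma monomial_in_polys:
  assumes "(\<Sum>i\<in>UNIV. \<alpha> i) \<le> d"
  shows "(\<lambda>x :: real ^ 'n::finite. c * (\<Prod>i\<in>UNIV. (x $ i) ^ \<alpha> i)) \<in> polys d"
  unfolding polys_def mem_Collect_eq
proof (intro exI[of _ "\<lambda>\<beta>. if \<beta> = \<alpha> then c else 0"] ext)
  fix x :: "real ^ 'n"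
  show "c * (\<Prod>i\<in>UNIV. (x $ i) ^ \<alpha> i) =
      (\<Sum>\<beta> | (\<Sum>i\<in>UNIV. \<beta> i) \<le> d. (if \<beta> = \<alpha> then c else 0) * (\<Prod>i\<in>UNIV. (x $ i) ^ \<beta> i))"
    using assms by (subst sum.remove[OF finite_multiindices, of \<alpha>]) (auto intro!: sum.neutral)
qed

lemma polys_add: "p \<in> polys d \<Longrightarrow> q \<in> polys d \<Longrightarrow> (\<lambda>x. p x + q x) \<in> polys d"
  unfolding polys_def mem_Collect_eq
proof (elim exE)
  fix c e :: "('a \<Rightarrow> nat) \<Rightarrow> real"
  assume "p = (\<lambda>x. \<Sum>\<alpha> | (\<Sum>i\<in>UNIV. \<alpha> i) \<le> d. c \<alpha> * (\<Prod>i\<in>UNIV. (x $ i) ^ \<alpha> i))"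
    "q = (\<lambda>x. \<Sum>\<alpha> | (\<Sum>i\<in>UNIV. \<alpha> i) \<le> d. e \<alpha> * (\<Prod>i\<in>UNIV. (x $ i) ^ \<alpha> i))"
  then show "\<exists>c. (\<lambda>x. p x + q x) = (\<lambda>x. \<Sum>\<alpha> | (\<Sum>i\<in>UNIV. \<alpha> i) \<le> d. c \<alpha> * (\<Prod>i\<in>UNIV. (x $ i) ^ \<alpha> i))"
    by (intro exI[of _ "\<lambda>\<alpha>. c \<alpha> + e \<alpha>"]) (simp add: sum.distrib distrib_right)
qed

lemma polys_sum:
  "finite A \<Longrightarrow> (\<And>a. a \<in> A \<Longrightarrow> p a \<in> polys d) \<Longrightarrow> (\<lambda>x. \<Sum>a\<in>A. p a x) \<in> polys d"
proof (induction A rule: finite_induct)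
  case empty
  show ?case using monomial_in_polys[of "\<lambda>_. 0" d 0] by simp
qed (auto intro: polys_add)

text \<open>The inductive description gives closure rules by rule induction, without handling
  coefficients. The coefficient form returns only where membership in \<open>polys\<close> or a
  finite spanning set is needed.\<close>

lemma polys_eq: "polys d = {p. polyfun d p}"
proof (intro set_eqI iffI; (unfold mem_Collect_eq)?)
  fix p :: "real ^ 'a \<Rightarrow> real" assume "p \<in> polys d"
  then show "polyfun d p"
    unfolding polys_def
    by (auto intro!: polyfun_sum finite_multiindices polyfun_cmult polyfun_monomial)
next
  fix p :: "real ^ 'a \<Rightarrow> real" assume "polyfun d p"
  then show "p \<in> polys d"
  proof (induction rule: polyfun.induct)
    case (const d c)
    show ?case using monomial_in_polys[of "\<lambda>_. 0" d c] by simp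
  next
    case (coord d p i)
    from coord.IH obtain c where p: "p = (\<lambda>x. \<Sum>\<alpha> | (\<Sum>i\<in>UNIV. \<alpha> i) \<le> d. c \<alpha> * (\<Prod>i\<in>UNIV. (x $ i) ^ \<alpha> i))"
      by (auto simp: polys_def)
    have "(\<lambda>x. \<Sum>\<alpha> | (\<Sum>i\<in>UNIV. \<alpha> i) \<le> d. c \<alpha> * (\<Prod>j\<in>UNIV. (x $ j) ^ (\<alpha>(i := Suc (\<alpha> i))) j)) \<in> polys (Suc d)"
    proof (intro polys_sum finite_multiindices monomial_in_polys)
      fix \<alpha> :: "'a \<Rightarrow> nat" assume \<alpha>: "\<alpha> \<in> {\<alpha>. (\<Sum>i\<in>UNIV. \<alpha> i) \<le> d}"
      have "(\<Sum>j\<in>UNIV. (\<alpha>(i := Suc (\<alpha> i))) j) = (\<Sum>j\<in>UNIV. \<alpha> j + (if j = i then 1 else 0))"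
        by (intro sum.cong) auto
      with \<alpha> show "(\<Sum>j\<in>UNIV. (\<alpha>(i := Suc (\<alpha> i))) j) \<le> Suc d" by (simp add: sum.distrib)
    qed
    moreover have "(\<Prod>j\<in>UNIV. (x $ j) ^ (\<alpha>(i := Suc (\<alpha> i))) j) = x $ i * (\<Prod>j\<in>UNIV. (x $ j) ^ \<alpha> j)"
      for x :: "real ^ 'a" and \<alpha>
      by (subst (1 2) prod.remove[of UNIV i]) (auto intro!: prod.cong)
    ultimately show ?case by (simp add: p sum_distrib_left mult.left_commute)
  qed (auto intro: polys_add)
qed

lemma polyfun_continuous: "polyfun d p \<Longrightarrow> continuous_on S p"
  by (induction rule: polyfun.induct) (auto intro!: continuous_intros)

text \<open>Multiplying by a coordinate multiplies the restriction to a line by the affine factor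
  \<open>x $ i + t * h $ i\<close>, so the new coefficients combine the old ones with a copy shifted
  by one index. Quantitative facts about several variables are reduced to one variable in this
  way.\<close>

lemma polyfun_line:
  "polyfun d p \<Longrightarrow> \<exists>a. \<forall>t. p (x + t *\<^sub>R h) = (\<Sum>l\<le>d. a l * t ^ l)"
proof (induction rule: polyfun.induct)
  case (const d c)
  show ?case by (rule exI[of _ "\<lambda>l. if l = 0 then c else 0"]) (simp add: if_distrib[of "\<lambda>z. z * _"] cong: if_cong)
next
  case (add d p q)
  then obtain a b where "\<forall>t. p (x + t *\<^sub>R h) = (\<Sum>l\<le>d. a l * t ^ l)"
    "\<forall>t. q (x + t *\<^sub>R h) = (\<Sum>l\<le>d. b l * t ^ l)" by blast
  then show ?case
    by (intro exI[of _ "\<lambda>l. a l + b l"]) (simp add: sum.distrib distrib_right)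
next
  case (coord d p i)
  then obtain a where a: "\<And>t. p (x + t *\<^sub>R h) = (\<Sum>l\<le>d. a l * t ^ l)" by blast
  define b where "b l = x $ i * (if l \<le> d then a l else 0) + h $ i * (if l = 0 then 0 else a (l - 1))" for l
  show ?case
  proof (intro exI[of _ b] allI)
    fix t
    have "(\<Sum>l\<le>Suc d. b l * t ^ l) =
        x $ i * (\<Sum>l\<le>Suc d. (if l \<le> d then a l else 0) * t ^ l)
        + h $ i * (\<Sum>l\<le>Suc d. (if l = 0 then 0 else a (l - 1)) * t ^ l)"
      by (simp add: b_def sum_distrib_left sum.distrib distrib_right distrib_left mult.assoc)
    also have "(\<Sum>l\<le>Suc d. (if l \<le> d then a l else 0) * t ^ l) = p (x + t *\<^sub>R h)"
      by (simp add: a)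
    also have "(\<Sum>l\<le>Suc d. (if l = 0 then 0 else a (l - 1)) * t ^ l) = t * p (x + t *\<^sub>R h)"
      by (subst sum.atMost_Suc_shift) (simp add: a sum_distrib_left mult_ac)
    finally show "(x + t *\<^sub>R h) $ i * p (x + t *\<^sub>R h) = (\<Sum>l\<le>Suc d. b l * t ^ l)"
      by (simp add: algebra_simps)
  qed
qed

lemma polyfun_has_derivative:
  "polyfun d (p :: real ^ 'n::finite \<Rightarrow> real) \<Longrightarrow> d = Suc e \<Longrightarrow> \<exists>g. (\<forall>i. polyfun e (g i)) \<and>
     (\<forall>z. (p has_derivative (\<lambda>u. \<Sum>i\<in>UNIV. u $ i * g i z)) (at z))"
proof (induction arbitrary: e rule: polyfun.induct)
  case (const d c)
  show ?case by (rule exI[of _ "\<lambda>_ _. 0"]) (auto intro: polyfun.const)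
next
  case (add d p q)
  from add.IH(1)[OF add.prems] obtain g where g: "\<And>i. polyfun e (g i)"
    "\<And>z. (p has_derivative (\<lambda>u. \<Sum>i\<in>UNIV. u $ i * g i z)) (at z)" by blast
  from add.IH(2)[OF add.prems] obtain g' where g': "\<And>i. polyfun e (g' i)"
    "\<And>z. (q has_derivative (\<lambda>u. \<Sum>i\<in>UNIV. u $ i * g' i z)) (at z)" by blast
  show ?case
  proof (intro exI[of _ "\<lambda>i x. g i x + g' i x"] conjI allI)
    show "polyfun e (\<lambda>x. g i x + g' i x)" for i by (intro polyfun.add g g')
    show "((\<lambda>x. p x + q x) has_derivative (\<lambda>u. \<Sum>i\<in>UNIV. u $ i * (g i z + g' i z))) (at z)" for z
      using has_derivative_add[OF g(2) g'(2), of z] by (simp add: distrib_left sum.distrib)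
  qed
next
  case (coord d p i)
  have d: "d = e" using coord.prems by simp
  \<comment> \<open>The induction hypothesis needs a predecessor of \<open>d\<close> and says
    nothing for \<open>d = 0\<close>, where the partial derivatives vanish. Asking only that
    \<open>x $ i * g j x\<close> have degree \<open>d\<close> covers both cases.\<close>
  obtain g where g: "\<And>j. polyfun d (\<lambda>x. x $ i * g j x)"
    "\<And>z. (p has_derivative (\<lambda>u. \<Sum>j\<in>UNIV. u $ j * g j z)) (at z)"
  proof (cases d)
    case 0
    have "\<exists>c. p = (\<lambda>_. c)" using coord.hyps 0 by (induction rule: polyfun.induct) auto
    then obtain c where "p = (\<lambda>_. c)" ..
    then show ?thesis using that[of "\<lambda>_ _. 0"] by (auto intro: polyfun.const)
  next
    case (Suc e')
    from coord.IH[OF this] obtain g where "\<And>j. polyfun e' (g j)"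
      "\<And>z. (p has_derivative (\<lambda>u. \<Sum>j\<in>UNIV. u $ j * g j z)) (at z)" by blast
    with Suc that[of g] show ?thesis by (auto intro: polyfun.coord)
  qed
  show ?case
  proof (intro exI[of _ "\<lambda>j x. x $ i * g j x + (if j = i then p x else 0)"] conjI allI)
    show "polyfun e (\<lambda>x. x $ i * g j x + (if j = i then p x else 0))" for j
      using polyfun.add[OF g(1)[of i] coord.hyps] g(1)[of j] by (cases "j = i") (auto simp: d[symmetric])
    fix z :: "real ^ 'n"
    have i: "((\<lambda>x. x $ i) has_derivative (\<lambda>u. u $ i)) (at z)"
      by (rule bounded_linear_imp_has_derivative) (rule bounded_linear_vec_nth)
    show "((\<lambda>x. x $ i * p x) has_derivative
        (\<lambda>u. \<Sum>j\<in>UNIV. u $ j * (z $ i * g j z + (if j = i then p z else 0)))) (at z)"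
      by (rule has_derivative_eq_rhs[OF has_derivative_mult[OF i g(2)]])
        (simp add: fun_eq_iff sum_distrib_left sum.distrib distrib_left mult_ac if_distrib[of "\<lambda>z. _ * z"] cong: if_cong)
  qed
qed

lemma polyfun_degree_0: "polyfun d p \<Longrightarrow> d = 0 \<Longrightarrow> \<exists>c. p = (\<lambda>_. c)"
  by (induction rule: polyfun.induct) auto

section \<open>Coefficient and growth bounds\<close>

text \<open>The combination \<open>q(t) - 2 ^ d * q(t / 2)\<close> removes the leading coefficient, which allows an
  induction on the degree.\<close>

lemma coeff_bound_unit:
  "\<exists>C\<ge>0. \<forall>a M. (\<forall>t\<in>{0..1}. \<bar>\<Sum>l\<le>d. a l * t ^ l\<bar> \<le> M) \<longrightarrow> (\<forall>l\<le>d. \<bar>a l\<bar> \<le> C * (M::real))"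
proof (induction d)
  case 0
  show ?case by (rule exI[of _ 1]) auto
next
  case (Suc d)
  then obtain C where C: "C \<ge> 0" "\<And>(a :: nat \<Rightarrow> real) M l. (\<forall>t\<in>{0..1}. \<bar>\<Sum>l\<le>d. a l * t ^ l\<bar> \<le> M) \<Longrightarrow> l \<le> d \<Longrightarrow> \<bar>a l\<bar> \<le> C * M"
    by blast
  define C' where "C' = 1 + real (Suc d) * (C * (1 + 2 ^ Suc d)) + C * (1 + 2 ^ Suc d)"
  have C'0: "C' \<ge> 0" using C(1) by (auto simp: C'_def)
  have "\<bar>a l\<bar> \<le> C' * M" if M: "\<forall>t\<in>{0..1}. \<bar>\<Sum>l\<le>Suc d. a l * t ^ l\<bar> \<le> M" and l: "l \<le> Suc d" for a M l
  proof -
    have M0: "M \<ge> 0" using M[rule_format, of 0] by auto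
    have low: "\<bar>a l\<bar> \<le> C * (1 + 2 ^ Suc d) * M" if l: "l \<le> d" for l
    proof -
      \<comment> \<open>Coefficients of q(t) - 2^(d+1) q(t/2) for the given polynomial q. For
        \<open>l \<le> d\<close> the factor \<open>1 - 2 ^ (Suc d - l)\<close> is at most -1, so
        bounds on \<open>b\<close> pass to \<open>a\<close>.\<close>
      define b where "b l = a l * (1 - 2 ^ (Suc d - l))" for l
      have "\<bar>\<Sum>l\<le>d. b l * t ^ l\<bar> \<le> (1 + 2 ^ Suc d) * M" if t: "t \<in> {0..1}" for t
      proof -
        have "(\<Sum>l\<le>Suc d. a l * t ^ l) - 2 ^ Suc d * (\<Sum>l\<le>Suc d. a l * (t / 2) ^ l)
            = (\<Sum>l\<le>Suc d. b l * t ^ l)"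
          unfolding sum_distrib_left sum_subtractf[symmetric]
        proof (intro sum.cong refl)
          fix l assume "l \<in> {..Suc d}"
          then have "(2::real) ^ Suc d = 2 ^ (Suc d - l) * 2 ^ l"
            by (simp flip: power_add)
          then show "a l * t ^ l - 2 ^ Suc d * (a l * (t / 2) ^ l) = b l * t ^ l"
            by (simp add: b_def power_divide field_simps)
        qed
        also have "\<dots> = (\<Sum>l\<le>d. b l * t ^ l)" by (simp add: b_def)
        finally have "\<bar>\<Sum>l\<le>d. b l * t ^ l\<bar> \<le>
            \<bar>\<Sum>l\<le>Suc d. a l * t ^ l\<bar> + 2 ^ Suc d * \<bar>\<Sum>l\<le>Suc d. a l * (t / 2) ^ l\<bar>"
          by (metis abs_mult abs_numeral abs_triangle_ineq4 power_abs)
        also have "\<dots> \<le> M + 2 ^ Suc d * M"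
          using M[rule_format, of t] M[rule_format, of "t / 2"] t
          by (intro add_mono mult_left_mono) (simp_all del: sum.atMost_Suc)
        finally show ?thesis by (simp add: algebra_simps)
      qed
      then have "\<bar>b l\<bar> \<le> C * ((1 + 2 ^ Suc d) * M)" using C(2) l by blast
      moreover have "\<bar>a l\<bar> \<le> \<bar>b l\<bar>"
      proof -
        have "(2::real) \<le> 2 ^ (Suc d - l)" using l by (simp add: Suc_diff_le)
        then have "1 \<le> \<bar>1 - (2::real) ^ (Suc d - l)\<bar>" by linarith
        then show ?thesis unfolding b_def abs_mult using mult_left_mono[of 1 _ "\<bar>a l\<bar>"] by fastforce
      qed
      ultimately show ?thesis by (simp add: mult.assoc)
    qed
    show ?thesis
    proof (cases "l \<le> d")
      case True
      have "C * (1 + 2 ^ Suc d) * M \<le> C' * M"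
        using M0 C(1) by (intro mult_right_mono) (auto simp: C'_def)
      then show ?thesis using low[OF True] by linarith
    next
      case False
      then have l: "l = Suc d" using l by simp
      \<comment> \<open>The leading coefficient is the value at 1 minus all the others, which are
        already bounded.\<close>
      have "\<bar>a (Suc d)\<bar> = \<bar>(\<Sum>l\<le>Suc d. a l * 1 ^ l) - (\<Sum>l\<le>d. a l)\<bar>" by simp
      also have "\<dots> \<le> M + (\<Sum>l\<le>d. \<bar>a l\<bar>)"
        using M[rule_format, of 1] sum_abs[of a "{..d}"] by (simp; linarith)
      also have "(\<Sum>l\<le>d. \<bar>a l\<bar>) \<le> real (Suc d) * (C * (1 + 2 ^ Suc d) * M)"
        using sum_bounded_above[of "{..d}" "\<lambda>l. \<bar>a l\<bar>"] low by auto
      also have "M + \<dots> \<le> C' * M"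
        using M0 C(1) by (simp add: C'_def algebra_simps)
      finally show ?thesis by (simp add: l)
    qed
  qed
  with C'0 show ?case by blast
qed

lemma coeff_bound:
  "\<exists>C\<ge>0. \<forall>a M T. T > 0 \<longrightarrow> (\<forall>t\<in>{0..T}. \<bar>\<Sum>l\<le>d. a l * t ^ l\<bar> \<le> M) \<longrightarrow>
     (\<forall>l\<le>d. \<bar>a l\<bar> \<le> C * (M::real) / T ^ l)"
proof -
  obtain C where C: "C \<ge> 0" "\<And>(a :: nat \<Rightarrow> real) M l. (\<forall>t\<in>{0..1}. \<bar>\<Sum>l\<le>d. a l * t ^ l\<bar> \<le> M) \<Longrightarrow> l \<le> d \<Longrightarrow> \<bar>a l\<bar> \<le> C * M"
    using coeff_bound_unit[of d] by blast
  have "\<bar>a l\<bar> \<le> C * M / T ^ l"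
    if T: "T > 0" and M: "\<forall>t\<in>{0..T}. \<bar>\<Sum>l\<le>d. a l * t ^ l\<bar> \<le> M" and l: "l \<le> d" for a M T l
  proof -
    have "\<bar>a l * T ^ l\<bar> \<le> C * M"
    proof (rule C(2)[OF ballI l])
      fix t :: real assume t: "t \<in> {0..1}"
      have "(\<Sum>l\<le>d. a l * T ^ l * t ^ l) = (\<Sum>l\<le>d. a l * (T * t) ^ l)"
        by (simp add: power_mult_distrib mult.assoc)
      then show "\<bar>\<Sum>l\<le>d. a l * T ^ l * t ^ l\<bar> \<le> M"
        using M t T by (auto simp: mult_le_one intro!: M[rule_format] mult_left_le)
    qed
    then show ?thesis using T by (simp add: abs_mult pos_le_divide_eq)
  qed
  with C(1) show ?thesis by blast
qed

lemma mem_cube: "y \<in> cube x r \<longleftrightarrow> (\<forall>i. \<bar>y $ i - x $ i\<bar> \<le> r)"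
  by (simp add: cube_def)

text \<open>The ray from \<open>z\<close> through \<open>w\<close> stays in the cube of radius
  \<open>R\<close> up to parameter \<open>1 / \<tau>\<close>, so \<open>coeff_bound\<close> applies
  with \<open>T = 1 / \<tau>\<close>. The factor \<open>\<tau> ^ l\<close> serves both ways: large
  \<open>\<tau>\<close> gives growth on bigger cubes, small \<open>\<tau>\<close> gives Lipschitz
  and Taylor estimates.\<close>

lemma polyfun_ray_coeffs:
  "\<exists>C\<ge>0. \<forall>p :: real ^ 'n::finite \<Rightarrow> real. polyfun d p \<longrightarrow> (\<forall>z R M \<tau> w. 0 < \<tau> \<longrightarrow>
     (\<forall>y\<in>cube z R. \<bar>p y\<bar> \<le> M) \<longrightarrow> w \<in> cube z (\<tau> * R) \<longrightarrow>
     (\<exists>a. (\<forall>t. p (z + t *\<^sub>R (w - z)) = (\<Sum>l\<le>d. a l * t ^ l)) \<and> (\<forall>l\<le>d. \<bar>a l\<bar> \<le> C * M * \<tau> ^ l)))"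
proof -
  obtain C where C: "C \<ge> 0" "\<And>(a :: nat \<Rightarrow> real) M T l. T > 0 \<Longrightarrow> (\<forall>t\<in>{0..T}. \<bar>\<Sum>l\<le>d. a l * t ^ l\<bar> \<le> M) \<Longrightarrow> l \<le> d \<Longrightarrow>
     \<bar>a l\<bar> \<le> C * M / T ^ l" using coeff_bound[of d] by blast
  show ?thesis
  proof (intro exI[of _ C] conjI allI impI C(1))
    fix p :: "real ^ 'n \<Rightarrow> real" and z R M \<tau> w
    assume p: "polyfun d p" and \<tau>: "0 < \<tau>" and M: "\<forall>y\<in>cube z R. \<bar>p y\<bar> \<le> M" and w: "w \<in> cube z (\<tau> * R)"
    obtain a where a: "\<And>t. p (z + t *\<^sub>R (w - z)) = (\<Sum>l\<le>d. a l * t ^ l)"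
      using polyfun_line[OF p] by blast
    have "\<forall>t\<in>{0..1/\<tau>}. \<bar>\<Sum>l\<le>d. a l * t ^ l\<bar> \<le> M"
    proof
      fix t assume t: "t \<in> {0..1/\<tau>}"
      have "z + t *\<^sub>R (w - z) \<in> cube z R"
        unfolding mem_cube
      proof
        fix i
        have "\<bar>t\<bar> * \<bar>w $ i - z $ i\<bar> \<le> (1 / \<tau>) * (\<tau> * R)"
          using t w \<tau> by (intro mult_mono) (auto simp: mem_cube)
        then show "\<bar>(z + t *\<^sub>R (w - z)) $ i - z $ i\<bar> \<le> R" using \<tau> by (simp add: abs_mult)
      qed
      then show "\<bar>\<Sum>l\<le>d. a l * t ^ l\<bar> \<le> M" using M a by metis
    qed
    then have "\<bar>a l\<bar> \<le> C * M * \<tau> ^ l" if "l \<le> d" for l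
      using C(2)[of "1 / \<tau>" a M l] that \<tau> by (simp add: power_divide)
    then show "\<exists>a. (\<forall>t. p (z + t *\<^sub>R (w - z)) = (\<Sum>l\<le>d. a l * t ^ l)) \<and> (\<forall>l\<le>d. \<bar>a l\<bar> \<le> C * M * \<tau> ^ l)"
      using a by blast
  qed
qed

lemma polyfun_growth:
  assumes "\<kappa> \<ge> 1"
  shows "\<exists>C\<ge>1. \<forall>p :: real ^ 'n::finite \<Rightarrow> real. polyfun d p \<longrightarrow> (\<forall>x r M. r > 0 \<longrightarrow> (\<forall>y\<in>cube x r. \<bar>p y\<bar> \<le> M) \<longrightarrow>
     (\<forall>y\<in>cube x (\<kappa> * r). \<bar>p y\<bar> \<le> C * M))"
proof -
  from polyfun_ray_coeffs[of d, where 'n = 'n] obtain C where C: "C \<ge> 0 \<and>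
    (\<forall>p :: real ^ 'n \<Rightarrow> real. polyfun d p \<longrightarrow> (\<forall>z R M \<tau> w. 0 < \<tau> \<longrightarrow>
     (\<forall>y\<in>cube z R. \<bar>p y\<bar> \<le> M) \<longrightarrow> w \<in> cube z (\<tau> * R) \<longrightarrow>
     (\<exists>a. (\<forall>t. p (z + t *\<^sub>R (w - z)) = (\<Sum>l\<le>d. a l * t ^ l)) \<and> (\<forall>l\<le>d. \<bar>a l\<bar> \<le> C * M * \<tau> ^ l))))" ..
  note coeffs = conjunct2[OF C, rule_format]
  have "\<bar>p y\<bar> \<le> (1 + (\<Sum>l\<le>d. C * \<kappa> ^ l)) * M" if p: "polyfun d p" and r: "r > 0"
    and M: "\<forall>y\<in>cube x r. \<bar>p y\<bar> \<le> M" and y: "y \<in> cube x (\<kappa> * r)" for p :: "real ^ 'n \<Rightarrow> real" and x r M y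
  proof -
    have M0: "M \<ge> 0" using M[rule_format, of x] r by (auto simp: mem_cube)
    obtain a where a: "\<forall>t. p (x + t *\<^sub>R (y - x)) = (\<Sum>l\<le>d. a l * t ^ l)" "\<forall>l\<le>d. \<bar>a l\<bar> \<le> C * M * \<kappa> ^ l"
      using coeffs[OF p _ bspec[OF M] y] assms by auto
    have "p y = (\<Sum>l\<le>d. a l)" using a(1)[rule_format, of 1] by simp
    then have "\<bar>p y\<bar> \<le> (\<Sum>l\<le>d. \<bar>a l\<bar>)" by simp
    also have "\<dots> \<le> (\<Sum>l\<le>d. C * M * \<kappa> ^ l)" using a(2) by (intro sum_mono) auto
    also have "\<dots> = (\<Sum>l\<le>d. C * \<kappa> ^ l) * M" unfolding sum_distrib_right by (simp add: mult_ac)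
    also have "\<dots> \<le> (1 + (\<Sum>l\<le>d. C * \<kappa> ^ l)) * M" using M0 by (simp add: distrib_right)
    finally show ?thesis .
  qed
  moreover have "(\<Sum>l\<le>d. C * \<kappa> ^ l) \<ge> 0" using C assms by (intro sum_nonneg) auto
  ultimately show ?thesis by (intro exI[of _ "1 + (\<Sum>l\<le>d. C * \<kappa> ^ l)"]) auto
qed

section \<open>Finite differences\<close>

lemma finite_diff_0 [simp]: "finite_diff 0 h f x = f x"
  by (simp add: finite_diff_def)

text \<open>The sign \<open>(-1) ^ (k + j)\<close> avoids truncated subtraction, and a range
  reaching past \<open>k\<close> only adds vanishing binomial coefficients; orders \<open>k\<close>
  and \<open>Suc k\<close> can then be compared termwise by Pascal's rule.\<close>

lemma finite_diff_eq_sum_atMost: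
  assumes "k \<le> N"
  shows "finite_diff k h f x = (\<Sum>j\<le>N. (-1) ^ (k + j) * real (k choose j) * f (x + real j *\<^sub>R h))"
proof -
  have "(-1) ^ (k - j) = ((-1) ^ (k + j) :: real)" if "j \<le> k" for j
    using that by (simp add: uminus_power_if even_diff_nat)
  then show ?thesis
    unfolding finite_diff_def using assms by (intro sum.mono_neutral_cong_left) auto
qed

lemma finite_diff_Suc:
  "finite_diff (Suc k) h f x = finite_diff k h f (x + h) - finite_diff k h f x"
proof -
  let ?b = "\<lambda>k j. real (k choose j)" and ?f = "\<lambda>j. f (x + real j *\<^sub>R h)"
  have "finite_diff (Suc k) h f x = (\<Sum>j\<le>Suc k. (-1) ^ (Suc k + j) * ?b (Suc k) j * ?f j)"
    by (rule finite_diff_eq_sum_atMost) simp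
  also have "\<dots> = (-1) ^ Suc k * ?f 0 + (\<Sum>j\<le>k. (-1) ^ (k + j) * ?b (Suc k) (Suc j) * ?f (Suc j))"
    by (subst sum.atMost_Suc_shift) simp
  also have "\<dots> = (\<Sum>j\<le>k. (-1) ^ (k + j) * ?b k j * ?f (Suc j))
      - ((-1) ^ k * ?f 0 + (\<Sum>j\<le>k. (-1) ^ (k + Suc j) * ?b k (Suc j) * ?f (Suc j)))"
    by (simp add: distrib_right distrib_left sum.distrib sum_negf)
  also have "(-1) ^ k * ?f 0 + (\<Sum>j\<le>k. (-1) ^ (k + Suc j) * ?b k (Suc j) * ?f (Suc j))
      = (\<Sum>j\<le>Suc k. (-1) ^ (k + j) * ?b k j * ?f j)"
    unfolding sum.atMost_Suc_shift[of _ k] by simp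
  also have "\<dots> = finite_diff k h f x"
    by (rule finite_diff_eq_sum_atMost[symmetric]) simp
  also have "(\<Sum>j\<le>k. (-1) ^ (k + j) * ?b k j * ?f (Suc j)) = finite_diff k h f (x + h)"
    by (subst finite_diff_eq_sum_atMost[OF order_refl]) (simp add: algebra_simps)
  finally show ?thesis .
qed

lemma finite_diff_Suc': "finite_diff (Suc k) h f x = finite_diff k h (\<lambda>x. f (x + h) - f x) x"
  by (induction k arbitrary: x) (simp_all add: finite_diff_Suc)

lemma finite_diff_diff: "finite_diff k h (\<lambda>x. f x - g x) x = finite_diff k h f x - finite_diff k h g x"
  by (simp add: finite_diff_def right_diff_distrib sum_subtractf)

lemma finite_diff_0_step: "k \<ge> 1 \<Longrightarrow> finite_diff k 0 f x = 0"
  by (cases k) (simp_all add: finite_diff_Suc)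

lemma finite_diff_affine:
  "finite_diff k h (\<lambda>y. f (a + c *\<^sub>R y)) x = finite_diff k (c *\<^sub>R h) f (a + c *\<^sub>R x)"
  by (simp add: finite_diff_def algebra_simps)

lemma finite_diff_bound:
  assumes "\<And>j. j \<le> k \<Longrightarrow> \<bar>f (x + real j *\<^sub>R h)\<bar> \<le> B"
  shows "\<bar>finite_diff k h f x\<bar> \<le> 2 ^ k * B"
  using assms
proof (induction k arbitrary: x)
  case (Suc k)
  have "\<bar>finite_diff k h f (x + h)\<bar> \<le> 2 ^ k * B"
  proof (rule Suc.IH)
    fix j assume "j \<le> k"
    then show "\<bar>f (x + h + real j *\<^sub>R h)\<bar> \<le> B"
      using Suc.prems[of "Suc j"] by (simp add: algebra_simps)
  qed
  moreover have "\<bar>finite_diff k h f x\<bar> \<le> 2 ^ k * B" using Suc.prems by (intro Suc.IH) auto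
  ultimately show ?case by (simp add: finite_diff_Suc)
qed (use assms[of 0] in auto)

lemma polyfun_difference:
  "polyfun d p \<Longrightarrow> (d = 0 \<longrightarrow> (\<forall>x. p (x + h) = p x)) \<and>
     (\<forall>e. d = Suc e \<longrightarrow> polyfun e (\<lambda>x. p (x + h) - p x))"
proof (induction rule: polyfun.induct)
  case (add d p q)
  have "polyfun e (\<lambda>x. (p (x + h) - p x) + (q (x + h) - q x))" if "d = Suc e" for e
    using add.IH that by (intro polyfun.add) auto
  then show ?case using add.IH by (auto simp: algebra_simps)
next
  case (coord d p i)
  have shift: "polyfun d (\<lambda>x. h $ i * p (x + h))"
    using polyfun_affine[OF coord.hyps, of h 1] by (intro polyfun_cmult) (simp add: add.commute)
  have "polyfun d (\<lambda>x. x $ i * (p (x + h) - p x))"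
  proof (cases d)
    case 0
    then show ?thesis using coord.IH by (simp add: polyfun.const)
  qed (use coord.IH in \<open>auto intro: polyfun.coord\<close>)
  from polyfun.add[OF this shift] show ?case by (auto simp: algebra_simps)
qed (auto intro: polyfun.const)

lemma finite_diff_polyfun:
  "polyfun d p \<Longrightarrow> d < k \<Longrightarrow> finite_diff k h p x = 0"
proof (induction k arbitrary: d p)
  case (Suc k)
  show ?case
  proof (cases d)
    case 0
    have "(\<lambda>x. p (x + h) - p x) = (\<lambda>x. 0)" using polyfun_difference[OF Suc.prems(1), of h] 0 by auto
    then show ?thesis by (simp only: finite_diff_Suc') (simp add: finite_diff_def)
  next
    case (Suc e)
    then have "polyfun e (\<lambda>x. p (x + h) - p x)"
      using polyfun_difference[OF Suc.prems(1), of h] by auto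
    then show ?thesis using Suc.prems(2) Suc by (simp only: finite_diff_Suc') (rule Suc.IH, auto)
  qed
qed simp

text \<open>\<open>smooth_seq k \<theta> M a\<close>: the differences of order \<open>i \<le> k\<close> of \<open>a\<close> that involve only
  \<open>a 0, \<dots>, a k\<close> are bounded by \<open>M * \<theta> ^ i\<close>. Smoothness of a function at scale \<open>D\<close> is measured by
  sampling it at the points \<open>y + l h\<close>, with \<open>\<theta>\<close> comparable to \<open>norm h / D\<close>.\<close>

fun smooth_seq :: "nat \<Rightarrow> real \<Rightarrow> real \<Rightarrow> (nat \<Rightarrow> real) \<Rightarrow> bool" where
  "smooth_seq 0 \<theta> M a \<longleftrightarrow> \<bar>a 0\<bar> \<le> M"
| "smooth_seq (Suc k) \<theta> M a \<longleftrightarrow> (\<forall>l\<le>Suc k. \<bar>a l\<bar> \<le> M) \<and> smooth_seq k \<theta> (M * \<theta>) (\<lambda>l. a (Suc l) - a l)"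

section \<open>Calculus of smooth sequences\<close>

lemma smooth_seq_bound: "smooth_seq k \<theta> M a \<Longrightarrow> l \<le> k \<Longrightarrow> \<bar>a l\<bar> \<le> M"
  by (cases k) auto

lemma smooth_seq_const_nonneg: "smooth_seq k \<theta> M a \<Longrightarrow> 0 \<le> M"
  using smooth_seq_bound[of k \<theta> M a 0] by (auto intro: order_trans[OF abs_ge_zero])

lemma smooth_seq_cong:
  "(\<And>l. l \<le> k \<Longrightarrow> a l = b l) \<Longrightarrow> smooth_seq k \<theta> M a = smooth_seq k \<theta> M b"
proof (induction k arbitrary: a b M)
  case (Suc k)
  have "smooth_seq k \<theta> (M * \<theta>) (\<lambda>l. a (Suc l) - a l) = smooth_seq k \<theta> (M * \<theta>) (\<lambda>l. b (Suc l) - b l)"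
    using Suc.prems by (intro Suc.IH) auto
  then show ?case using Suc.prems by auto
qed simp

lemma smooth_seq_mono:
  "smooth_seq k \<theta> M a \<Longrightarrow> M \<le> M' \<Longrightarrow> 0 \<le> \<theta> \<Longrightarrow> smooth_seq k \<theta> M' a"
proof (induction k arbitrary: a M M')
  case (Suc k)
  have "smooth_seq k \<theta> (M' * \<theta>) (\<lambda>l. a (Suc l) - a l)"
    by (rule Suc.IH[of "M * \<theta>"]) (use Suc.prems in \<open>auto intro: mult_right_mono\<close>)
  then show ?case using Suc.prems by force
qed auto

lemma smooth_seq_Suc_imp: "smooth_seq (Suc k) \<theta> M a \<Longrightarrow> smooth_seq k \<theta> M a"
proof (induction k arbitrary: a M)
  case (Suc k)
  have "smooth_seq k \<theta> (M * \<theta>) (\<lambda>l. a (Suc l) - a l)"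
    by (rule Suc.IH) (use Suc.prems in simp)
  then show ?case using Suc.prems by auto
qed auto

lemma smooth_seq_shift: "smooth_seq (Suc k) \<theta> M a \<Longrightarrow> smooth_seq k \<theta> M (\<lambda>l. a (Suc l))"
proof (induction k arbitrary: a M)
  case (Suc k)
  have "smooth_seq k \<theta> (M * \<theta>) (\<lambda>l. a (Suc (Suc l)) - a (Suc l))"
    using Suc.IH[of "M * \<theta>" "\<lambda>l. a (Suc l) - a l"] Suc.prems by simp
  then show ?case using Suc.prems by auto
qed auto

lemma smooth_seq_add:
  "smooth_seq k \<theta> M a \<Longrightarrow> smooth_seq k \<theta> N b \<Longrightarrow> smooth_seq k \<theta> (M + N) (\<lambda>l. a l + b l)"
proof (induction k arbitrary: a b M N)
  case (Suc k)
  have "smooth_seq k \<theta> (M * \<theta> + N * \<theta>) (\<lambda>l. (a (Suc l) - a l) + (b (Suc l) - b l))"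
    by (rule Suc.IH) (use Suc.prems in auto)
  moreover have "\<bar>a l + b l\<bar> \<le> M + N" if "l \<le> Suc k" for l
    using smooth_seq_bound[OF Suc.prems(1) that] smooth_seq_bound[OF Suc.prems(2) that] by linarith
  ultimately show ?case by (auto simp: algebra_simps)
qed auto

lemma smooth_seq_cmult:
  "smooth_seq k \<theta> M a \<Longrightarrow> smooth_seq k \<theta> (\<bar>c\<bar> * M) (\<lambda>l. c * a l)"
proof (induction k arbitrary: a M)
  case (Suc k)
  have "smooth_seq k \<theta> (\<bar>c\<bar> * (M * \<theta>)) (\<lambda>l. c * (a (Suc l) - a l))"
    by (rule Suc.IH) (use Suc.prems in auto)
  moreover have "\<bar>c * a l\<bar> \<le> \<bar>c\<bar> * M" if "l \<le> Suc k" for l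
    using smooth_seq_bound[OF Suc.prems(1) that] by (simp add: abs_mult mult_left_mono)
  ultimately show ?case by (simp add: algebra_simps)
qed (auto simp: abs_mult mult_left_mono)

text \<open>Discrete Leibniz rule: the first difference of the product is
  \<open>(a (Suc l) - a l) * b (Suc l) + a l * (b (Suc l) - b l)\<close>. In each summand one factor
  has gained \<open>\<theta>\<close>; the doubling at every order gives
  \<open>2 ^ k\<close>.\<close>

lemma smooth_seq_mult:
  "smooth_seq k \<theta> M a \<Longrightarrow> smooth_seq k \<theta> N b \<Longrightarrow> smooth_seq k \<theta> (2 ^ k * M * N) (\<lambda>l. a l * b l)"
proof (induction k arbitrary: a b M N)
  case 0
  then show ?case by (auto simp: abs_mult intro!: mult_mono intro: order_trans[OF abs_ge_zero])
next
  case (Suc k)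
  have "smooth_seq k \<theta> (2 ^ k * (M * \<theta>) * N) (\<lambda>l. (a (Suc l) - a l) * b (Suc l))"
    by (rule Suc.IH[OF _ smooth_seq_shift[OF Suc.prems(2)]]) (use Suc.prems in auto)
  moreover have "smooth_seq k \<theta> (2 ^ k * M * (N * \<theta>)) (\<lambda>l. a l * (b (Suc l) - b l))"
    by (rule Suc.IH[OF smooth_seq_Suc_imp[OF Suc.prems(1)]]) (use Suc.prems in auto)
  ultimately have "smooth_seq k \<theta> (2 ^ k * (M * \<theta>) * N + 2 ^ k * M * (N * \<theta>))
      (\<lambda>l. (a (Suc l) - a l) * b (Suc l) + a l * (b (Suc l) - b l))"
    by (rule smooth_seq_add)
  moreover have "\<bar>a l * b l\<bar> \<le> 2 ^ Suc k * M * N" if "l \<le> Suc k" for l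
  proof -
    have M: "M \<ge> 0" "N \<ge> 0" using Suc.prems by (auto intro: smooth_seq_const_nonneg)
    have "\<bar>a l * b l\<bar> \<le> 1 * (M * N)"
      unfolding abs_mult using that M
      by (auto intro!: mult_mono smooth_seq_bound[OF Suc.prems(1)] smooth_seq_bound[OF Suc.prems(2)])
    also have "\<dots> \<le> 2 ^ Suc k * (M * N)"
      using M by (intro mult_right_mono one_le_power) auto
    finally show ?thesis by (simp add: mult.assoc)
  qed
  ultimately show ?case by (simp add: algebra_simps)
qed

lemma smooth_seq_zero: "0 \<le> M \<Longrightarrow> 0 \<le> \<theta> \<Longrightarrow> smooth_seq k \<theta> M (\<lambda>_. 0)"
  by (induction k arbitrary: M) auto

lemma smooth_seq_one: "0 \<le> \<theta> \<Longrightarrow> smooth_seq k \<theta> 1 (\<lambda>_. 1)"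
  by (cases k) (auto intro: smooth_seq_zero)

lemma smooth_seq_sum:
  "finite A \<Longrightarrow> 0 \<le> \<theta> \<Longrightarrow> (\<And>x. x \<in> A \<Longrightarrow> smooth_seq k \<theta> M (a x)) \<Longrightarrow>
    smooth_seq k \<theta> (real (card A) * M) (\<lambda>l. \<Sum>x\<in>A. a x l)"
proof (induction A rule: finite_induct)
  case (insert x A)
  have "smooth_seq k \<theta> (M + real (card A) * M) (\<lambda>l. a x l + (\<Sum>x\<in>A. a x l))"
    by (intro smooth_seq_add insert.IH) (use insert.prems in auto)
  then show ?case using insert.hyps by (simp add: algebra_simps)
qed (auto intro: smooth_seq_zero)

lemma smooth_seq_prod:
  "finite A \<Longrightarrow> 0 \<le> \<theta> \<Longrightarrow> (\<And>x. x \<in> A \<Longrightarrow> smooth_seq k \<theta> M (a x)) \<Longrightarrow>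
    smooth_seq k \<theta> ((2 ^ k * M) ^ card A) (\<lambda>l. \<Prod>x\<in>A. a x l)"
proof (induction A rule: finite_induct)
  case (insert x A)
  have "smooth_seq k \<theta> (2 ^ k * M * (2 ^ k * M) ^ card A) (\<lambda>l. a x l * (\<Prod>x\<in>A. a x l))"
    by (intro smooth_seq_mult insert.IH) (use insert.prems in auto)
  then show ?case using insert.hyps by (simp add: algebra_simps)
qed (auto intro: smooth_seq_one)

lemma smooth_seq_linear:
  assumes "0 \<le> \<theta>" "\<theta> \<le> 1"
  shows "smooth_seq k \<theta> (real (Suc k)) (\<lambda>l. \<theta> * real l)"
proof (cases k)
  case (Suc m)
  have "smooth_seq m \<theta> (1 * \<theta>) (\<lambda>l. \<theta> * 1)"
    using smooth_seq_cmult[OF smooth_seq_one, of \<theta> m \<theta>] assms by simp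
  then have "smooth_seq m \<theta> (real (Suc k) * \<theta>) (\<lambda>l. \<theta> * 1)"
    by (rule smooth_seq_mono) (use assms mult_right_mono[of 1 "real (Suc k)" \<theta>] in auto)
  moreover have "\<theta> * real l \<le> real (Suc k)" if "l \<le> k" for l
    using assms that mult_mono[of \<theta> 1 "real l" "real (Suc k)"] by auto
  ultimately show ?thesis using Suc assms by (auto simp: algebra_simps abs_mult)
qed auto

lemma smooth_seq_power:
  assumes "0 \<le> \<theta>" "\<theta> \<le> 1"
  shows "smooth_seq k \<theta> ((2 ^ k * real (Suc k)) ^ m) (\<lambda>l. (\<theta> * real l) ^ m)"
  using smooth_seq_prod[OF finite_lessThan[of m] assms(1) smooth_seq_linear[OF assms]] by simp

lemma smooth_seq_finite_diff:
  "smooth_seq k \<theta> M (\<lambda>l. f (x + real l *\<^sub>R h)) \<Longrightarrow> \<bar>finite_diff k h f x\<bar> \<le> M * \<theta> ^ k"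
proof (induction k arbitrary: f M)
  case (Suc k)
  have "\<bar>finite_diff k h (\<lambda>x. f (x + h) - f x) x\<bar> \<le> (M * \<theta>) * \<theta> ^ k"
    by (rule Suc.IH) (use Suc.prems in \<open>simp add: algebra_simps\<close>)
  then show ?case by (simp add: finite_diff_Suc' mult_ac)
qed simp

lemma smooth_seq_if_finite_diff:
  assumes "\<And>i x. i \<le> k \<Longrightarrow> \<bar>finite_diff i h f x\<bar> \<le> M * \<theta> ^ i"
  shows "smooth_seq k \<theta> M (\<lambda>l. f (x + real l *\<^sub>R h))"
  using assms
proof (induction k arbitrary: f M)
  case 0
  from 0[of 0 x] show ?case by simp
next
  case (Suc k)
  have "smooth_seq k \<theta> (M * \<theta>) (\<lambda>l. (\<lambda>x. f (x + h) - f x) (x + real l *\<^sub>R h))"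
  proof (rule Suc.IH)
    fix i x assume "i \<le> k"
    then show "\<bar>finite_diff i h (\<lambda>x. f (x + h) - f x) x\<bar> \<le> M * \<theta> * \<theta> ^ i"
      using Suc.prems[of "Suc i" x] by (simp add: finite_diff_Suc' mult_ac)
  qed
  moreover have "\<bar>f (x + real l *\<^sub>R h)\<bar> \<le> M" for l
    using Suc.prems[of 0 "x + real l *\<^sub>R h"] by simp
  ultimately show ?case by (simp add: algebra_simps)
qed

text \<open>A bound on a segment of \<open>1 / \<theta>\<close> steps forces the coefficient of
  \<open>t ^ m\<close> along the line to be \<open>O(M * \<theta> ^ m)\<close>. Each monomial is
  then a bounded multiple of \<open>(\<theta> * real l) ^ m\<close>, a power of the sequence in
  \<open>smooth_seq_linear\<close>.\<close>

lemma polyfun_smooth_seq: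
  "\<exists>C\<ge>0. \<forall>p :: real ^ 'n::finite \<Rightarrow> real. polyfun d p \<longrightarrow> (\<forall>y h M \<theta>. 0 < \<theta> \<longrightarrow> \<theta> \<le> 1 \<longrightarrow>
     (\<forall>t\<in>{0..1/\<theta>}. \<bar>p (y + t *\<^sub>R h)\<bar> \<le> M) \<longrightarrow> smooth_seq k \<theta> (C * M) (\<lambda>l. p (y + real l *\<^sub>R h)))"
proof -
  obtain C where C: "C \<ge> 0" "\<And>(a :: nat \<Rightarrow> real) M T l. T > 0 \<Longrightarrow> (\<forall>t\<in>{0..T}. \<bar>\<Sum>l\<le>d. a l * t ^ l\<bar> \<le> M) \<Longrightarrow> l \<le> d \<Longrightarrow>
     \<bar>a l\<bar> \<le> C * M / T ^ l" using coeff_bound[of d] by blast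
  define B where "B = 2 ^ k * real (Suc k)"
  have B: "B \<ge> 1" unfolding B_def using mult_mono[of 1 "2 ^ k" 1 "real (Suc k)"] by simp
  have "smooth_seq k \<theta> (real (Suc d) * C * B ^ d * M) (\<lambda>l. p (y + real l *\<^sub>R h))"
    if p: "polyfun d p" and \<theta>: "0 < \<theta>" "\<theta> \<le> 1" and M: "\<forall>t\<in>{0..1/\<theta>}. \<bar>p (y + t *\<^sub>R h)\<bar> \<le> M"
    for p :: "real ^ 'n \<Rightarrow> real" and y h M \<theta>
  proof -
    have M0: "M \<ge> 0" using M[rule_format, of 0] \<theta> by auto
    obtain a where a: "\<And>t. p (y + t *\<^sub>R h) = (\<Sum>l\<le>d. a l * t ^ l)"
      using polyfun_line[OF p] by blast
    have al: "\<bar>a l\<bar> \<le> C * M * \<theta> ^ l" if "l \<le> d" for l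
      using C(2)[of "1/\<theta>" a M l] that \<theta> M a by (simp add: power_divide)
    have "smooth_seq k \<theta> (C * M * B ^ d) (\<lambda>l. a m * real l ^ m)" if m: "m \<in> {..d}" for m
    proof -
      have "smooth_seq k \<theta> (\<bar>a m / \<theta> ^ m\<bar> * B ^ m) (\<lambda>l. a m / \<theta> ^ m * (\<theta> * real l) ^ m)"
        unfolding B_def by (intro smooth_seq_cmult smooth_seq_power) (use \<theta> in auto)
      then show ?thesis
      proof (rule smooth_seq_mono[THEN smooth_seq_cong[THEN iffD1, rotated]])
        show "a m / \<theta> ^ m * (\<theta> * real l) ^ m = a m * real l ^ m" for l
          using \<theta> by (simp add: power_mult_distrib)
        show "\<bar>a m / \<theta> ^ m\<bar> * B ^ m \<le> C * M * B ^ d"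
          using al[of m] m \<theta> B C(1) M0
          by (intro mult_mono power_increasing) (auto simp: abs_div pos_divide_le_eq abs_mult)
      qed (use \<theta> in auto)
    qed
    from smooth_seq_sum[OF finite_atMost _ this] show ?thesis
      using \<theta> by (simp add: a mult_ac)
  qed
  moreover have "real (Suc d) * C * B ^ d \<ge> 0" using C(1) B by auto
  ultimately show ?thesis by blast
qed

section \<open>Mixed differences\<close>

text \<open>The product over \<open>j \<in> A\<close> of the operators identity minus translation by
  \<open>v j\<close>. This sign keeps \<open>mixed_diff_insert\<close> simple but differs from that
  of \<open>finite_diff\<close> by \<open>(-1) ^ card A\<close>, whence the factor
  \<open>(-1) ^ k\<close> in Kemperman's identity.\<close>

definition mixed_diff :: "nat set \<Rightarrow> (nat \<Rightarrow> 'a::real_vector) \<Rightarrow> ('a \<Rightarrow> real) \<Rightarrow> 'a \<Rightarrow> real" where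
  "mixed_diff A v g x = (\<Sum>e\<in>Pow A. (-1) ^ card e * g (x + (\<Sum>j\<in>e. v j)))"

lemma mixed_diff_empty [simp]: "mixed_diff {} v g x = g x"
  by (simp add: mixed_diff_def)

lemma sum_Pow_insert:
  assumes "finite A" "a \<notin> A"
  shows "(\<Sum>e\<in>Pow (insert a A). F e) = (\<Sum>e\<in>Pow A. F e + F (insert a e))"
proof -
  have "(\<Sum>e\<in>Pow (insert a A). F e) = (\<Sum>e\<in>Pow A. F e) + (\<Sum>e\<in>insert a ` Pow A. F e)"
    unfolding Pow_insert using assms by (intro sum.union_disjoint) auto
  also have "(\<Sum>e\<in>insert a ` Pow A. F e) = (\<Sum>e\<in>Pow A. F (insert a e))"
    using assms by (intro sum.reindex_cong[of "insert a"]) (auto simp: inj_on_def)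
  finally show ?thesis by (simp add: sum.distrib)
qed

lemma mixed_diff_insert:
  assumes "finite A" "a \<notin> A"
  shows "mixed_diff (insert a A) v g x = mixed_diff A v g x - mixed_diff A v g (x + v a)"
proof -
  have "mixed_diff (insert a A) v g x =
      (\<Sum>e\<in>Pow A. (-1) ^ card e * g (x + sum v e) + (-1) ^ card (insert a e) * g (x + sum v (insert a e)))"
    unfolding mixed_diff_def by (rule sum_Pow_insert) (use assms in auto)
  also have "\<dots> = (\<Sum>e\<in>Pow A. (-1) ^ card e * g (x + sum v e) - (-1) ^ card e * g (x + v a + sum v e))"
  proof (intro sum.cong refl)
    fix e assume e: "e \<in> Pow A"
    then have "finite e" "a \<notin> e" using assms finite_subset by auto
    then show "(-1) ^ card e * g (x + sum v e) + (-1) ^ card (insert a e) * g (x + sum v (insert a e)) =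
        (-1) ^ card e * g (x + sum v e) - (-1) ^ card e * g (x + v a + sum v e)"
      by (simp add: add.assoc)
  qed
  finally show ?thesis by (simp add: mixed_diff_def sum_subtractf)
qed

lemma mixed_diff_insert':
  assumes "finite A" "a \<notin> A"
  shows "mixed_diff (insert a A) v g x = mixed_diff A v (\<lambda>x. g x - g (x + v a)) x"
  unfolding mixed_diff_insert[OF assms]
  by (simp add: mixed_diff_def sum_subtractf right_diff_distrib algebra_simps)

lemma mixed_diff_cong: "(\<And>j. j \<in> A \<Longrightarrow> v j = w j) \<Longrightarrow> mixed_diff A v g x = mixed_diff A w g x"
  unfolding mixed_diff_def by (intro sum.cong refl arg_cong2[where f = "(*)"] arg_cong[where f = g]
    arg_cong2[where f = "(+)"]) auto

lemma mixed_diff_diff: "mixed_diff A v (\<lambda>x. f x - g x) x = mixed_diff A v f x - mixed_diff A v g x"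
  by (simp add: mixed_diff_def right_diff_distrib sum_subtractf)

lemma mixed_diff_zero_direction:
  assumes "finite A" "a \<in> A" "v a = 0"
  shows "mixed_diff A v g x = 0"
  using mixed_diff_insert[of "A - {a}" a v g x] assms by (simp add: insert_absorb)

lemma mixed_diff_bound:
  assumes "finite A" "\<And>e. e \<subseteq> A \<Longrightarrow> \<bar>g (x + (\<Sum>j\<in>e. v j))\<bar> \<le> B"
  shows "\<bar>mixed_diff A v g x\<bar> \<le> 2 ^ card A * B"
proof -
  have "\<bar>mixed_diff A v g x\<bar> \<le> (\<Sum>e\<in>Pow A. \<bar>(-1) ^ card e * g (x + (\<Sum>j\<in>e. v j))\<bar>)"
    unfolding mixed_diff_def by (rule sum_abs)
  also have "\<dots> \<le> (\<Sum>e\<in>Pow A. B)"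
    using assms by (intro sum_mono) (auto simp: abs_mult)
  finally show ?thesis using assms(1) by (simp add: card_Pow)
qed

text \<open>Kemperman's identity: in the expansion of the right-hand side, the terms with \<open>i \<ge> 1\<close> form
  a mixed difference whose \<open>i\<close>-th direction \<open>(1 - i / i) v\<^sub>i\<close> vanishes.\<close>

lemma mixed_diff_eq_finite_diffs:
  "(-1) ^ k * mixed_diff {1..k} v g x = (\<Sum>e\<in>Pow {1..k}. (-1) ^ card e *
     finite_diff k (- (\<Sum>j\<in>e. (1 / real j) *\<^sub>R v j)) g (x + (\<Sum>j\<in>e. v j)))"
proof -
  have inner: "x + (\<Sum>j\<in>e. v j) + real i *\<^sub>R (- (\<Sum>j\<in>e. (1 / real j) *\<^sub>R v j)) =
      x + (\<Sum>j\<in>e. (1 - real i / real j) *\<^sub>R v j)" for e i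
    by (simp add: scaleR_sum_right sum_subtractf scaleR_diff_left sum_negf algebra_simps)
  have "(\<Sum>e\<in>Pow {1..k}. (-1) ^ card e *
     finite_diff k (- (\<Sum>j\<in>e. (1 / real j) *\<^sub>R v j)) g (x + (\<Sum>j\<in>e. v j))) =
     (\<Sum>e\<in>Pow {1..k}. \<Sum>i\<le>k. (-1) ^ (k - i) * real (k choose i) *
        ((-1) ^ card e * g (x + (\<Sum>j\<in>e. (1 - real i / real j) *\<^sub>R v j))))"
    unfolding finite_diff_def atLeast0AtMost inner by (simp add: sum_distrib_left mult_ac)
  also have "\<dots> = (\<Sum>i\<le>k. (-1) ^ (k - i) * real (k choose i) *
      mixed_diff {1..k} (\<lambda>j. (1 - real i / real j) *\<^sub>R v j) g x)"
    by (subst sum.swap) (simp add: mixed_diff_def sum_distrib_left)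
  also have "\<dots> = (\<Sum>i\<le>k. if i = 0 then (-1) ^ k * mixed_diff {1..k} v g x else 0)"
  proof (intro sum.cong refl)
    fix i assume "i \<in> {..k}"
    then show "(-1) ^ (k - i) * real (k choose i) * mixed_diff {1..k} (\<lambda>j. (1 - real i / real j) *\<^sub>R v j) g x =
        (if i = 0 then (-1) ^ k * mixed_diff {1..k} v g x else 0)"
      by (auto intro!: mixed_diff_zero_direction[of _ i])
  qed
  finally show ?thesis by simp
qed

section \<open>Almost additive functions\<close>

lemma almost_additive_sum:
  fixes a :: "real ^ 'n::finite \<Rightarrow> real"
  assumes add: "\<And>h h'. h \<in> cube 0 1 \<Longrightarrow> h' \<in> cube 0 1 \<Longrightarrow> h + h' \<in> cube 0 1 \<Longrightarrow>
      \<bar>a (h + h') - a h - a h'\<bar> \<le> \<epsilon>"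
    and h: "h \<in> cube 0 1" and fin: "finite I"
  shows "\<bar>a (\<Sum>i\<in>I. axis i (h $ i))\<bar> \<le> (\<Sum>i\<in>I. \<bar>a (axis i (h $ i))\<bar>) + (real (card I) + 1) * \<epsilon>"
proof -
  have comp: "(\<Sum>i\<in>I. axis i (h $ i)) $ j = (if j \<in> I then h $ j else 0)" if "finite I" for I j
    using that by induction (auto simp: axis_def)
  have mem: "(\<Sum>i\<in>I. axis i (h $ i)) \<in> cube 0 1" if "finite I" for I
    using h comp[OF that] by (auto simp: mem_cube)
  have ax: "axis i (h $ i) \<in> cube 0 1" for i using mem[of "{i}"] by simp
  show ?thesis using fin
  proof induction
    case empty
    \<comment> \<open>With both arguments 0 the hypothesis reads
      \<open>\<bar>a 0\<bar> \<le> \<epsilon>\<close>; this is the extra 1 in the bound.\<close>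
    from add[of 0 0] show ?case by (auto simp: mem_cube)
  next
    case (insert i I)
    have "axis i (h $ i) + (\<Sum>i\<in>I. axis i (h $ i)) \<in> cube 0 1"
      using mem[of "insert i I"] insert.hyps by simp
    from add[OF ax mem[OF insert.hyps(1)] this] insert show ?case
      by (simp add: algebra_simps)
  qed
qed

text \<open>Halving an argument on an axis halves any bound, up to \<open>\<epsilon>\<close>;
  arguments beyond 1/2 are first moved by a unit step, whose value is small. A bound
  \<open>b\<close> on the axes improves to \<open>b / 2 + 9 / 2 * \<epsilon>\<close>, and iteration
  leaves the fixed point \<open>9 * \<epsilon>\<close>. The number \<open>B\<close> starts the
  iteration and disappears in the limit; its existence excludes discontinuous additive functions,
  for which the claim fails.\<close>

lemma almost_additive_bound:
  fixes a :: "real ^ 'n::finite \<Rightarrow> real"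
  assumes add: "\<And>h h'. h \<in> cube 0 1 \<Longrightarrow> h' \<in> cube 0 1 \<Longrightarrow> h + h' \<in> cube 0 1 \<Longrightarrow>
      \<bar>a (h + h') - a h - a h'\<bar> \<le> \<epsilon>"
    and unit: "\<And>i. \<bar>a (axis i 1)\<bar> \<le> \<epsilon>"
    and bdd: "\<And>h. h \<in> cube 0 1 \<Longrightarrow> \<bar>a h\<bar> \<le> B"
    and h: "h \<in> cube 0 1"
  shows "\<bar>a h\<bar> \<le> (10 * real CARD('n) + 1) * \<epsilon>"
proof -
  have ax: "axis i t \<in> cube 0 1" if "\<bar>t\<bar> \<le> 1" for i :: 'n and t :: real
    using that by (auto simp: mem_cube axis_def)
  have axis_add: "axis i (s + t) = axis i s + axis i t" for i :: 'n and s t :: real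
    by (simp add: axis_def vec_eq_iff)
  have \<epsilon>: "\<epsilon> \<ge> 0" using unit[of undefined] by (auto intro: order_trans[OF abs_ge_zero])
  have axis_0: "axis i 0 = 0" for i :: 'n
    by (simp add: axis_def vec_eq_iff)
  have a0: "\<bar>a 0\<bar> \<le> \<epsilon>" using add[of 0 0] by (auto simp: mem_cube)
  have neg: "\<bar>a (axis i (-1))\<bar> \<le> 3 * \<epsilon>" for i
    using add[of "axis i 1" "axis i (-1)"] ax[of 1 i] ax[of "-1" i] ax[of 0 i] unit[of i] a0
    by (auto simp: axis_0 simp flip: axis_add)
  have half: "\<bar>a (axis i t)\<bar> \<le> (b + \<epsilon>) / 2" if t: "\<bar>t\<bar> \<le> 1/2" and b: "\<And>t. \<bar>t\<bar> \<le> 1 \<Longrightarrow> \<bar>a (axis i t)\<bar> \<le> b" for i t b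
  proof -
    have tt: "\<bar>t + t\<bar> \<le> 1" "\<bar>t\<bar> \<le> 1" using t by linarith+
    have "\<bar>a (axis i (t + t)) - a (axis i t) - a (axis i t)\<bar> \<le> \<epsilon>"
      using add[of "axis i t" "axis i t"] ax[OF tt(1), of i] ax[OF tt(2), of i] by (simp only: axis_add)
    with b[OF tt(1)] show ?thesis by argo
  qed
  have step: "\<bar>a (axis i t)\<bar> \<le> b / 2 + 9 / 2 * \<epsilon>"
    if t: "\<bar>t\<bar> \<le> 1" and b: "\<And>t. \<bar>t\<bar> \<le> 1 \<Longrightarrow> \<bar>a (axis i t)\<bar> \<le> b" for i t b
  proof -
    consider "\<bar>t\<bar> \<le> 1/2" | "t > 1/2" | "t < -1/2" by linarith
    then show ?thesis
    proof cases
      case 1 then show ?thesis using half[OF _ b] \<epsilon> by fastforce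
    next
      case 2
      then have "\<bar>a (axis i (t - 1))\<bar> \<le> (b + \<epsilon>) / 2" using t b by (intro half) auto
      moreover have "\<bar>a (axis i t) - a (axis i (t - 1)) - a (axis i 1)\<bar> \<le> \<epsilon>"
        using add[of "axis i (t - 1)" "axis i 1"] ax[of "t-1" i] ax[of 1 i] ax[of t i] t 2
        by (auto simp flip: axis_add)
      ultimately show ?thesis using unit[of i] \<epsilon> by argo
    next
      case 3
      then have "\<bar>a (axis i (t + 1))\<bar> \<le> (b + \<epsilon>) / 2" using t b by (intro half) auto
      moreover have "\<bar>a (axis i t) - a (axis i (t + 1)) - a (axis i (-1))\<bar> \<le> \<epsilon>"
        using add[of "axis i (t + 1)" "axis i (-1)"] ax[of "t+1" i] ax[of "-1" i] ax[of t i] t 3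
        by (auto simp flip: axis_add)
      ultimately show ?thesis using neg[of i] \<epsilon> by argo
    qed
  qed
  have iter: "\<bar>a (axis i t)\<bar> \<le> B / 2 ^ m + 9 * \<epsilon>" if "\<bar>t\<bar> \<le> 1" for i t m
    using that
  proof (induction m arbitrary: t)
    case 0
    have "\<bar>a (axis i t)\<bar> \<le> B" using ax[OF 0] by (rule bdd)
    then show ?case using \<epsilon> by simp
  next
    case (Suc m)
    from step[OF Suc.prems Suc.IH] show ?case by (simp add: field_simps)
  qed
  have "\<bar>a (axis i t)\<bar> \<le> 9 * \<epsilon>" if "\<bar>t\<bar> \<le> 1" for i t
  proof (rule LIMSEQ_le_const)
    show "(\<lambda>m. B / 2 ^ m + 9 * \<epsilon>) \<longlonglongrightarrow> 9 * \<epsilon>"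
      using tendsto_add[OF LIMSEQ_divide_realpow_zero[of 2 B] tendsto_const[of "9 * \<epsilon>"]] by simp
  qed (use iter[OF that] in auto)
  moreover have "\<bar>h $ i\<bar> \<le> 1" for i using h by (simp add: mem_cube)
  ultimately have "(\<Sum>i\<in>UNIV. \<bar>a (axis i (h $ i))\<bar>) \<le> real CARD('n) * (9 * \<epsilon>)"
    by (intro sum_bounded_above[of "UNIV :: 'n set", simplified]) auto
  moreover have "(\<Sum>i\<in>UNIV. axis i (h $ i)) = h" by (simp add: vec_eq_iff axis_def)
  \<comment> \<open>The axis components contribute \<open>9 * n * \<epsilon>\<close>, and adding up
    \<open>n\<close> of them costs another \<open>(n + 1) * \<epsilon>\<close>.\<close>
  ultimately show ?thesis
    using almost_additive_sum[OF add h finite, of UNIV] by (simp add: algebra_simps)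
qed

section \<open>Newton interpolation\<close>

text \<open>The Newton basis in several variables, made of generalized binomial coefficients.
  Indexing by a multiset of directions matches the fact that mixed differences along coordinate
  vectors ignore their order.\<close>

definition newton :: "'n multiset \<Rightarrow> real ^ 'n::finite \<Rightarrow> real" where
  "newton M x = (\<Prod>i\<in>UNIV. (x $ i) gchoose count M i)"

lemma polyfun_newton: "polyfun (size M) (newton M :: real ^ 'n::finite \<Rightarrow> real)"
proof -
  have gb: "polyfun a (\<lambda>x :: real ^ 'n. (x $ i) gchoose a)" for a i
  proof (induction a)
    case (Suc a)
    have "polyfun (Suc a) (\<lambda>x :: real ^ 'n. x $ i * ((x $ i) gchoose a) - real a * ((x $ i) gchoose a))"
      by (intro polyfun_diff polyfun.coord polyfun_cmult polyfun_mono[OF Suc.IH] Suc.IH) auto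
    from polyfun_cmult[OF this, of "1 / real (Suc a)"] show ?case
      by (simp add: gbinomial_mult_1)
  qed (auto intro: polyfun.const)
  have "polyfun (\<Sum>i\<in>A. count M i) (\<lambda>x :: real ^ 'n. \<Prod>i\<in>A. (x $ i) gchoose count M i)" if "finite A" for A
    using that by induction (auto intro: polyfun.const polyfun_mult gb)
  from this[OF finite] show ?thesis
    unfolding newton_def size_multiset_overloaded_eq
    by (rule back_subst[where P = "\<lambda>m. polyfun m _"]) (auto intro!: sum.mono_neutral_right simp: not_in_iff)
qed

text \<open>Pascal's rule in the coordinate \<open>i\<close>: a unit step removes one copy of
  \<open>i\<close> from the multiset.\<close>

lemma newton_difference:
  "newton M x - newton M (x + axis i 1) = (if i \<in># M then - newton (M - {#i#}) x else 0)"
proof -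
  let ?R = "\<Prod>j\<in>UNIV - {i}. (x $ j) gchoose count M j"
  have split: "newton N y = ((y $ i) gchoose count N i) * (\<Prod>j\<in>UNIV - {i}. (y $ j) gchoose count N j)" for N y
    unfolding newton_def by (rule prod.remove) auto
  have "newton M (x + axis i 1) = ((x $ i + 1) gchoose count M i) * ?R"
    unfolding split by (auto intro!: prod.cong simp: axis_def)
  moreover have "newton (M - {#i#}) x = ((x $ i) gchoose (count M i - 1)) * ?R"
    unfolding split by (auto intro!: prod.cong)
  moreover have "newton M x = ((x $ i) gchoose count M i) * ?R" by (rule split)
  moreover have "count M i = 0 \<longleftrightarrow> i \<notin># M" by (simp add: not_in_iff)
  ultimately show ?thesis
    by (cases "count M i") (auto simp: gbinomial_Suc_Suc distrib_right)
qed

lemma newton_0: "newton M 0 = (if M = {#} then 1 else 0)"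
proof (cases "M = {#}")
  case False
  then obtain i where "count M i \<noteq> 0" by (metis count_eq_zero_iff multiset_nonemptyE)
  then have "((0::real) gchoose count M i) = 0" by (cases "count M i") auto
  then have "newton M 0 = 0" unfolding newton_def by (intro prod_zero) auto
  with False show ?thesis by simp
qed (simp add: newton_def)

text \<open>Duality between the Newton basis and unit differences at the origin: every direction of
  \<open>A\<close> takes its copy out of \<open>M\<close>, and at 0 only the empty multiset
  survives.\<close>

lemma mixed_diff_newton:
  assumes "finite A"
  shows "mixed_diff A (\<lambda>j. axis (w j) 1) (newton M) 0 =
    (if M = image_mset w (mset_set A) then (-1) ^ card A else 0)"
  using assms
proof (induction A arbitrary: M)
  case empty
  then show ?case by (simp add: newton_0)
next
  case (insert a A)
  have "mixed_diff (insert a A) (\<lambda>j. axis (w j) 1) (newton M) 0 =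
      mixed_diff A (\<lambda>j. axis (w j) 1) (\<lambda>x. if w a \<in># M then - newton (M - {#w a#}) x else 0) 0"
    unfolding mixed_diff_insert'[OF insert.hyps] newton_difference ..
  also have "\<dots> = (if w a \<in># M then - mixed_diff A (\<lambda>j. axis (w j) 1) (newton (M - {#w a#})) 0 else 0)"
    by (simp add: mixed_diff_def sum_negf)
  also have "\<dots> = (if M = image_mset w (mset_set (insert a A)) then (-1) ^ card (insert a A) else 0)"
  proof (cases "w a \<in># M")
    case True
    then obtain N where "M = add_mset (w a) N" by (metis multi_member_split)
    then show ?thesis using insert.hyps by (simp add: insert.IH)
  qed (use insert.hyps in auto)
  finally show ?case .
qed

text \<open>Along coordinate vectors, a mixed difference only depends on the multiset of directions.\<close>

definition axis_diff :: "'n multiset \<Rightarrow> (real ^ 'n::finite \<Rightarrow> real) \<Rightarrow> real ^ 'n \<Rightarrow> real" where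
  "axis_diff M g = fold_mset (\<lambda>i g x. g x - g (x + axis i 1)) g M"

lemma mixed_diff_axis:
  assumes "finite A"
  shows "mixed_diff A (\<lambda>j. axis (w j) 1) g x = axis_diff (image_mset w (mset_set A)) g x"
proof -
  interpret comp_fun_commute "\<lambda>i (g :: real ^ 'n \<Rightarrow> real) x. g x - g (x + axis i 1)"
    by standard (auto simp: fun_eq_iff algebra_simps)
  show ?thesis using assms
  proof (induction A arbitrary: g)
    case (insert a A)
    then show ?case
      by (simp add: mixed_diff_insert' axis_diff_def fold_mset_add_mset fold_mset_fun_left_comm)
  qed (simp add: axis_diff_def)
qed

text \<open>By duality the coefficient of \<open>newton M\<close> is the mixed difference of
  \<open>g\<close> along \<open>M\<close>, with the sign \<open>(-1) ^ size M\<close> cancelling the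
  one in \<open>mixed_diff_newton\<close>.\<close>

lemma newton_interpolation:
  fixes g :: "real ^ 'n::finite \<Rightarrow> real"
  assumes "1 \<le> k"
  shows "\<exists>p. polyfun (k - 1) p \<and> (\<forall>w m. m < k \<longrightarrow> mixed_diff {1..m} (\<lambda>j. axis (w j) 1) p 0 =
    mixed_diff {1..m} (\<lambda>j. axis (w j) 1) g 0)"
proof -
  \<comment> \<open>The multisets of size below \<open>k\<close>, written as images of lists because
    this gives finiteness at once.\<close>
  define I where "I = mset ` {xs :: 'n list. set xs \<subseteq> UNIV \<and> length xs \<le> k - 1}"
  have fin: "finite I" unfolding I_def by (intro finite_imageI finite_lists_length_le finite)
  have mem_I: "M \<in> I \<longleftrightarrow> size M < k" for M
  proof
    assume "size M < k"
    moreover obtain xs where "M = mset xs" using ex_mset by metis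
    ultimately show "M \<in> I" by (auto simp: I_def)
  qed (use assms in \<open>auto simp: I_def\<close>)
  define p where "p x = (\<Sum>M\<in>I. (-1) ^ size M * axis_diff M g 0 * newton M x)" for x
  have "polyfun (k - 1) p"
    unfolding p_def using fin
    by (intro polyfun_sum polyfun_cmult polyfun_mono[OF polyfun_newton]) (auto simp: mem_I)
  moreover have "mixed_diff {1..m} (\<lambda>j. axis (w j) 1) p 0 = mixed_diff {1..m} (\<lambda>j. axis (w j) 1) g 0"
    if "m < k" for w m
  proof -
    let ?M = "image_mset w (mset_set {1..m})"
    have "mixed_diff {1..m} (\<lambda>j. axis (w j) 1) p 0 = (\<Sum>M\<in>I. (-1) ^ size M * axis_diff M g 0 *
        mixed_diff {1..m} (\<lambda>j. axis (w j) 1) (newton M) 0)"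
      unfolding mixed_diff_def p_def sum_distrib_left by (subst sum.swap) (simp add: mult_ac)
    also have "\<dots> = (\<Sum>M\<in>I. if M = ?M then (-1) ^ m * axis_diff M g 0 * (-1) ^ m else 0)"
      by (intro sum.cong refl) (auto simp: mixed_diff_newton)
    also have "\<dots> = axis_diff ?M g 0"
      using fin that by (simp add: mem_I flip: power_add)
    also have "\<dots> = mixed_diff {1..m} (\<lambda>j. axis (w j) 1) g 0"
      by (simp add: mixed_diff_axis)
    finally show ?thesis .
  qed
  ultimately show ?thesis by blast
qed

section \<open>Whitney's theorem\<close>

lemma cube_mono: "r \<le> R \<Longrightarrow> cube x r \<subseteq> cube x R"
  unfolding subset_iff mem_cube using order_trans by blast

lemma compact_cube: "compact (cube x r)"
proof -
  have "cube x r = cbox (\<chi> i. x $ i - r) (\<chi> i. x $ i + r)"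
    unfolding set_eq_iff mem_cube mem_box_cart by (simp add: abs_diff_le_iff)
  then show ?thesis by simp
qed

text \<open>The additivity defect of a mixed difference of order \<open>m\<close> in one of its
  directions is, up to sign, a mixed difference of order \<open>Suc m\<close>, hence small. With
  coordinate vectors in all directions the difference vanishes by hypothesis; from there the
  directions are released one at a time, each at the cost of the constant in
  \<open>almost_additive_bound\<close>. The larger cube of radius \<open>k\<close> hosts the sums of
  up to \<open>k\<close> vectors of the unit cube that occur as arguments.\<close>

lemma whitney_unit_aux:
  assumes "1 \<le> k"
  shows "\<exists>C\<ge>0. \<forall>(u :: real ^ 'n::finite \<Rightarrow> real) \<epsilon> B.
    (\<forall>v. (\<forall>j. v j \<in> cube 0 1) \<longrightarrow> \<bar>mixed_diff {1..k} v u 0\<bar> \<le> \<epsilon>) \<longrightarrow>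
    (\<forall>w m. m < k \<longrightarrow> mixed_diff {1..m} (\<lambda>j. axis (w j) 1) u 0 = 0) \<longrightarrow>
    (\<forall>x\<in>cube 0 (real k). \<bar>u x\<bar> \<le> B) \<longrightarrow> (\<forall>x\<in>cube 0 1. \<bar>u x\<bar> \<le> C * \<epsilon>)"
  using assms
proof (induction k rule: nat_induct_at_least)
  case base
  have "\<bar>u x\<bar> \<le> \<epsilon>" if v: "\<forall>v. (\<forall>j. v j \<in> cube 0 1) \<longrightarrow> \<bar>mixed_diff {1..1} v u 0\<bar> \<le> \<epsilon>"
    and w: "\<forall>w m. m < 1 \<longrightarrow> mixed_diff {1..m} (\<lambda>j. axis (w j) 1) u 0 = 0"
    and x: "x \<in> cube 0 1" for u :: "real ^ 'n \<Rightarrow> real" and \<epsilon> x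
  proof -
    have "u 0 = 0" using w[rule_format, of 0] by simp
    then show ?thesis using v[rule_format, of "\<lambda>_. x"] x mixed_diff_insert[of "{}" 1 "\<lambda>_. x" u 0] by simp
  qed
  then show ?case by (intro exI[of _ 1]) auto
next
  case (Suc m)
  then obtain C where C: "C \<ge> 0" "\<And>(u :: real ^ 'n \<Rightarrow> real) \<epsilon> B x.
    (\<forall>v. (\<forall>j. v j \<in> cube 0 1) \<longrightarrow> \<bar>mixed_diff {1..m} v u 0\<bar> \<le> \<epsilon>) \<Longrightarrow>
    (\<forall>w i. i < m \<longrightarrow> mixed_diff {1..i} (\<lambda>j. axis (w j) 1) u 0 = 0) \<Longrightarrow>
    (\<forall>x\<in>cube 0 (real m). \<bar>u x\<bar> \<le> B) \<Longrightarrow> x\<in>cube 0 1 \<Longrightarrow> \<bar>u x\<bar> \<le> C * \<epsilon>" by metis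
  define E where "E = 10 * real CARD('n) + 1"
  have E: "E \<ge> 1" by (simp add: E_def)
  have "\<bar>u x\<bar> \<le> C * (E ^ m * \<epsilon>)"
    if v: "\<And>v. (\<And>j. v j \<in> cube 0 1) \<Longrightarrow> \<bar>mixed_diff {1..Suc m} v u 0\<bar> \<le> \<epsilon>"
    and w: "\<And>w i. i < Suc m \<Longrightarrow> mixed_diff {1..i} (\<lambda>j. axis (w j) 1) u 0 = 0"
    and B: "\<And>x. x\<in>cube 0 (real (Suc m)) \<Longrightarrow> \<bar>u x\<bar> \<le> B"
    and x: "x \<in> cube 0 1" for u :: "real ^ 'n \<Rightarrow> real" and \<epsilon> B x
  proof -
    have z: "0 \<in> cube (0 :: real ^ 'n) 1" by (simp add: mem_cube)
    have \<epsilon>: "\<epsilon> \<ge> 0" using v[of "\<lambda>_. 0"] z by (auto intro: order_trans[OF abs_ge_zero])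
    \<comment> \<open>The first \<open>t\<close> directions are arbitrary, the later ones still
      coordinate vectors; \<open>t = m\<close> is what the induction on the order needs.\<close>
    have claim: "\<bar>mixed_diff {1..m} v u 0\<bar> \<le> E ^ t * \<epsilon>"
      if "t \<le> m" "\<And>j. v j \<in> cube 0 1" "\<And>j. t < j \<Longrightarrow> j \<le> m \<Longrightarrow> \<exists>i. v j = axis i 1" for t v
      using that
    proof (induction t arbitrary: v)
      case 0
      then have "\<forall>j\<in>{1..m}. \<exists>i. v j = axis i 1" by auto
      then obtain w' where "\<forall>j\<in>{1..m}. v j = axis (w' j) 1" by metis
      then have "mixed_diff {1..m} v u 0 = mixed_diff {1..m} (\<lambda>j. axis (w' j) 1) u 0"
        by (intro mixed_diff_cong) auto
      then show ?case using w[of m w'] \<epsilon> by simp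
    next
      case (Suc t)
      define A where "A = {1..m} - {Suc t}"
      have A: "finite A" "Suc t \<notin> A" "insert (Suc t) A = {1..m}" using Suc.prems(1) by (auto simp: A_def)
      define G where "G x = mixed_diff A v u x" for x
      define a where "a h = mixed_diff {1..m} (v(Suc t := h)) u 0" for h
      have G: "mixed_diff A (v(Suc t := h)) u x = G x" for h x
        unfolding G_def using A by (intro mixed_diff_cong) auto
      have aG: "mixed_diff {1..m} (v(Suc t := h)) u x = G x - G (x + h)" for h x
        using mixed_diff_insert[OF A(1,2), of "v(Suc t := h)" u x] A(3) G by simp
      have "\<bar>a (v (Suc t))\<bar> \<le> (10 * real CARD('n) + 1) * (E ^ t * \<epsilon>)"
      proof (rule almost_additive_bound)
        fix h h' :: "real ^ 'n" assume h: "h \<in> cube 0 1" "h' \<in> cube 0 1"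
        \<comment> \<open>The defect is realised by taking \<open>h'\<close> as an additional
          direction, with index \<open>Suc m\<close>.\<close>
        define v' where "v' = v(Suc t := h, Suc m := h')"
        have cong: "mixed_diff {1..m} v' u x = mixed_diff {1..m} (v(Suc t := h)) u x" for x
          unfolding v'_def by (intro mixed_diff_cong) auto
        have "mixed_diff {1..Suc m} v' u 0 = mixed_diff {1..m} v' u 0 - mixed_diff {1..m} v' u (0 + v' (Suc m))"
          using mixed_diff_insert[of "{1..m}" "Suc m" v' u 0] by (simp add: atLeastAtMostSuc_conv)
        also have "\<dots> = - (a (h + h') - a h - a h')"
          unfolding cong unfolding a_def aG by (simp add: v'_def add.commute)
        finally have "\<bar>a (h + h') - a h - a h'\<bar> = \<bar>mixed_diff {1..Suc m} v' u 0\<bar>" by simp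
        also have "\<dots> \<le> \<epsilon>" using Suc.prems(2) h by (intro v) (auto simp: v'_def)
        also have "\<dots> \<le> E ^ t * \<epsilon>" using E \<epsilon> mult_right_mono[of 1 "E ^ t" \<epsilon>] by simp
        finally show "\<bar>a (h + h') - a h - a h'\<bar> \<le> E ^ t * \<epsilon>" .
      next
        fix i :: 'n
        have "axis i 1 \<in> cube 0 1" by (auto simp: mem_cube axis_def)
        then show "\<bar>a (axis i 1)\<bar> \<le> E ^ t * \<epsilon>"
          unfolding a_def using Suc.prems by (intro Suc.IH) auto
      next
        fix h :: "real ^ 'n" assume h: "h \<in> cube 0 1"
        show "\<bar>a h\<bar> \<le> 2 ^ card {1..m} * B"
          unfolding a_def
        proof (rule mixed_diff_bound)
          fix e assume e: "e \<subseteq> {1..m}"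
          have "0 + (\<Sum>j\<in>e. (v(Suc t := h)) j) \<in> cube 0 (real (Suc m))"
            unfolding mem_cube
          proof
            fix i
            have "\<bar>\<Sum>j\<in>e. (v(Suc t := h)) j $ i\<bar> \<le> (\<Sum>j\<in>e. 1)"
              using Suc.prems(2) h by (intro order_trans[OF sum_abs] sum_mono) (auto simp: mem_cube)
            also have "\<dots> \<le> real (Suc m)" using card_mono[OF _ e] by simp
            finally show "\<bar>(0 + (\<Sum>j\<in>e. (v(Suc t := h)) j)) $ i - 0 $ i\<bar> \<le> real (Suc m)" by simp
          qed
          then show "\<bar>u (0 + (\<Sum>j\<in>e. (v(Suc t := h)) j))\<bar> \<le> B" by (rule B)
        qed auto
      next
        show "v (Suc t) \<in> cube 0 1" by (rule Suc.prems)
      qed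
      then show ?case by (simp add: a_def E_def)
    qed
    show ?thesis
    proof (rule C(2)[OF _ _ _ x])
      show "\<forall>v. (\<forall>j. v j \<in> cube 0 1) \<longrightarrow> \<bar>mixed_diff {1..m} v u 0\<bar> \<le> E ^ m * \<epsilon>"
        using claim[of m] by auto
      show "\<forall>w i. i < m \<longrightarrow> mixed_diff {1..i} (\<lambda>j. axis (w j) 1) u 0 = 0" using w by auto
      have "cube 0 (real m) \<subseteq> cube (0 :: real ^ 'n) (real (Suc m))" by (rule cube_mono) simp
      then show "\<forall>x\<in>cube 0 (real m). \<bar>u x\<bar> \<le> B" using B by blast
    qed
  qed
  then have "\<bar>u x\<bar> \<le> (C * E ^ m) * \<epsilon>"
    if "\<forall>v. (\<forall>j. v j \<in> cube 0 1) \<longrightarrow> \<bar>mixed_diff {1..Suc m} v u 0\<bar> \<le> \<epsilon>"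
    "\<forall>w i. i < Suc m \<longrightarrow> mixed_diff {1..i} (\<lambda>j. axis (w j) 1) u 0 = 0"
    "\<forall>x\<in>cube 0 (real (Suc m)). \<bar>u x\<bar> \<le> B" "x \<in> cube 0 1" for u :: "real ^ 'n \<Rightarrow> real" and \<epsilon> B x
    using that unfolding mult.assoc by blast
  moreover have "C * E ^ m \<ge> 0" using C(1) E by simp
  ultimately show ?case by blast
qed

text \<open>Subtracting the Newton interpolant changes no difference of order \<open>k\<close> and
  makes the lower mixed differences along coordinate vectors vanish at 0. Kemperman's identity has
  \<open>2 ^ k\<close> terms, whose steps are sums of at most \<open>k\<close> vectors of the unit
  cube; this fixes the range of \<open>h\<close>.\<close>

lemma whitney_unit:
  assumes "1 \<le> k"
  shows "\<exists>C\<ge>0. \<forall>(g :: real ^ 'n::finite \<Rightarrow> real) \<epsilon> B.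
    (\<forall>x h. h \<in> cube 0 (real k) \<longrightarrow> \<bar>finite_diff k h g x\<bar> \<le> \<epsilon>) \<longrightarrow>
    (\<forall>x\<in>cube 0 (real k). \<bar>g x\<bar> \<le> B) \<longrightarrow> (\<exists>p. polyfun (k - 1) p \<and> (\<forall>x\<in>cube 0 1. \<bar>g x - p x\<bar> \<le> C * \<epsilon>))"
proof -
  obtain C where C: "C \<ge> 0" "\<And>(u :: real ^ 'n \<Rightarrow> real) \<epsilon> B x.
    (\<forall>v. (\<forall>j. v j \<in> cube 0 1) \<longrightarrow> \<bar>mixed_diff {1..k} v u 0\<bar> \<le> \<epsilon>) \<Longrightarrow>
    (\<forall>w i. i < k \<longrightarrow> mixed_diff {1..i} (\<lambda>j. axis (w j) 1) u 0 = 0) \<Longrightarrow>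
    (\<forall>x\<in>cube 0 (real k). \<bar>u x\<bar> \<le> B) \<Longrightarrow> x\<in>cube 0 1 \<Longrightarrow> \<bar>u x\<bar> \<le> C * \<epsilon>"
    using whitney_unit_aux[OF assms, where 'n = 'n] by metis
  have "\<exists>p. polyfun (k - 1) p \<and> (\<forall>x\<in>cube 0 1. \<bar>g x - p x\<bar> \<le> C * (2 ^ k * \<epsilon>))"
    if g: "\<And>x h. h \<in> cube 0 (real k) \<Longrightarrow> \<bar>finite_diff k h g x\<bar> \<le> \<epsilon>"
    and B: "\<And>x. x\<in>cube 0 (real k) \<Longrightarrow> \<bar>g x\<bar> \<le> B" for g :: "real ^ 'n \<Rightarrow> real" and \<epsilon> B
  proof -
    obtain p where p: "polyfun (k - 1) p" "\<And>w m. m < k \<Longrightarrow> mixed_diff {1..m} (\<lambda>j. axis (w j) 1) p 0 =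
      mixed_diff {1..m} (\<lambda>j. axis (w j) 1) g 0" using newton_interpolation[OF assms, of g] by blast
    define u where "u x = g x - p x" for x
    have fd: "finite_diff k h u x = finite_diff k h g x" for h x
      unfolding u_def finite_diff_diff using finite_diff_polyfun[OF p(1)] assms by simp
    have bounded: "\<exists>B'. \<forall>x\<in>cube 0 (real k). \<bar>u x\<bar> \<le> B'"
    proof -
      have "bounded (p ` cube 0 (real k))"
        by (intro compact_imp_bounded compact_continuous_image polyfun_continuous[OF p(1)] compact_cube)
      then obtain B' where "\<And>x. x\<in>cube 0 (real k) \<Longrightarrow> \<bar>p x\<bar> \<le> B'" by (auto simp: bounded_iff)
      then have "\<bar>u x\<bar> \<le> B + B'" if "x\<in>cube 0 (real k)" for x
        unfolding u_def using B[OF that] that by (smt (verit))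
      then show ?thesis by blast
    qed
    have "\<bar>mixed_diff {1..k} v u 0\<bar> \<le> 2 ^ k * \<epsilon>" if v: "\<forall>j. v j \<in> cube 0 1" for v
    proof -
      have "\<bar>mixed_diff {1..k} v u 0\<bar> = \<bar>(-1) ^ k * mixed_diff {1..k} v u 0\<bar>" by (simp add: abs_mult)
      also have "\<dots> \<le> (\<Sum>e\<in>Pow {1..k}. \<bar>(-1) ^ card e *
        finite_diff k (- (\<Sum>j\<in>e. (1 / real j) *\<^sub>R v j)) u (0 + (\<Sum>j\<in>e. v j))\<bar>)"
        unfolding mixed_diff_eq_finite_diffs by (rule sum_abs)
      also have "\<dots> \<le> (\<Sum>e\<in>Pow {1..k}. \<epsilon>)"
      proof (rule sum_mono)
        fix e assume e: "e \<in> Pow {1..k}"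
        have "- (\<Sum>j\<in>e. (1 / real j) *\<^sub>R v j) \<in> cube 0 (real k)"
          unfolding mem_cube
        proof
          fix i
          have "\<bar>\<Sum>j\<in>e. (1 / real j) * v j $ i\<bar> \<le> (\<Sum>j\<in>e. 1)"
          proof (intro order_trans[OF sum_abs] sum_mono)
            fix j assume "j \<in> e"
            then have "real j \<ge> 1" "\<bar>v j $ i\<bar> \<le> 1" using e v by (auto simp: mem_cube)
            then show "\<bar>1 / real j * v j $ i\<bar> \<le> 1" by (simp add: abs_mult divide_le_eq)
          qed
          also have "\<dots> \<le> real k" using card_mono[of "{1..k}" e] e by simp
          finally show "\<bar>(- (\<Sum>j\<in>e. (1 / real j) *\<^sub>R v j)) $ i - 0 $ i\<bar> \<le> real k" by simp
        qed
        from g[OF this] show "\<bar>(-1) ^ card e *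
          finite_diff k (- (\<Sum>j\<in>e. (1 / real j) *\<^sub>R v j)) u (0 + (\<Sum>j\<in>e. v j))\<bar> \<le> \<epsilon>"
          by (simp add: abs_mult fd)
      qed
      finally show ?thesis by (simp add: card_Pow)
    qed
    moreover have "mixed_diff {1..m} (\<lambda>j. axis (w j) 1) u 0 = 0" if "m < k" for w m
      unfolding u_def mixed_diff_diff using p(2)[OF that] by simp
    ultimately have "\<bar>u x\<bar> \<le> C * (2 ^ k * \<epsilon>)" if "x \<in> cube 0 1" for x
      using C(2) bounded that by blast
    with p(1) show ?thesis by (auto simp: u_def)
  qed
  then have "\<exists>p. polyfun (k - 1) p \<and> (\<forall>x\<in>cube 0 1. \<bar>g x - p x\<bar> \<le> (C * 2 ^ k) * \<epsilon>)"
    if "\<forall>x h. h \<in> cube 0 (real k) \<longrightarrow> \<bar>finite_diff k h g x\<bar> \<le> \<epsilon>"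
      "\<forall>x\<in>cube 0 (real k). \<bar>g x\<bar> \<le> B" for g :: "real ^ 'n \<Rightarrow> real" and \<epsilon> B
    using that unfolding mult.assoc by blast
  moreover have "C * 2 ^ k \<ge> 0" using C(1) by simp
  ultimately show ?thesis by blast
qed

lemma whitney:
  assumes "1 \<le> k"
  shows "\<exists>C\<ge>0. \<forall>(g :: real ^ 'n::finite \<Rightarrow> real) \<epsilon> B x0 r. r > 0 \<longrightarrow>
    (\<forall>x h. h \<in> cube 0 (real k * r) \<longrightarrow> \<bar>finite_diff k h g x\<bar> \<le> \<epsilon>) \<longrightarrow>
    (\<forall>x\<in>cube x0 (real k * r). \<bar>g x\<bar> \<le> B) \<longrightarrow>
    (\<exists>p. polyfun (k - 1) p \<and> (\<forall>x\<in>cube x0 r. \<bar>g x - p x\<bar> \<le> C * \<epsilon>))"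
proof -
  obtain C where C: "C \<ge> 0" "\<And>(g :: real ^ 'n \<Rightarrow> real) \<epsilon> B.
    (\<forall>x h. h \<in> cube 0 (real k) \<longrightarrow> \<bar>finite_diff k h g x\<bar> \<le> \<epsilon>) \<Longrightarrow>
    (\<forall>x\<in>cube 0 (real k). \<bar>g x\<bar> \<le> B) \<Longrightarrow> (\<exists>p. polyfun (k - 1) p \<and> (\<forall>x\<in>cube 0 1. \<bar>g x - p x\<bar> \<le> C * \<epsilon>))"
    using whitney_unit[OF assms, where 'n = 'n] by metis
  have "\<exists>p. polyfun (k - 1) p \<and> (\<forall>x\<in>cube x0 r. \<bar>g x - p x\<bar> \<le> C * \<epsilon>)"
    if r: "r > 0" and g: "\<forall>x h. h \<in> cube 0 (real k * r) \<longrightarrow> \<bar>finite_diff k h g x\<bar> \<le> \<epsilon>"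
    and B: "\<forall>x\<in>cube x0 (real k * r). \<bar>g x\<bar> \<le> B" for g :: "real ^ 'n \<Rightarrow> real" and \<epsilon> B x0 r
  proof -
    have scale: "x0 + r *\<^sub>R y \<in> cube x0 (R * r) \<longleftrightarrow> y \<in> cube 0 R"
      "r *\<^sub>R y \<in> cube 0 (R * r) \<longleftrightarrow> y \<in> cube 0 R" for y R
      using r by (auto simp: mem_cube abs_mult mult.commute)
    have "\<exists>p. polyfun (k - 1) p \<and> (\<forall>y\<in>cube 0 1. \<bar>g (x0 + r *\<^sub>R y) - p y\<bar> \<le> C * \<epsilon>)"
      by (rule C(2)[of _ _ B]) (use g B scale in \<open>auto simp: finite_diff_affine\<close>)
    then obtain p where p: "polyfun (k - 1) p" "\<And>y. y \<in> cube 0 1 \<Longrightarrow> \<bar>g (x0 + r *\<^sub>R y) - p y\<bar> \<le> C * \<epsilon>"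
      by blast
    show ?thesis
    proof (intro exI[of _ "\<lambda>x. p (- ((1 / r) *\<^sub>R x0) + (1 / r) *\<^sub>R x)"] conjI ballI)
      show "polyfun (k - 1) (\<lambda>x. p (- ((1 / r) *\<^sub>R x0) + (1 / r) *\<^sub>R x))"
        by (rule polyfun_affine[OF p(1)])
      fix x assume x: "x \<in> cube x0 r"
      define y where "y = - ((1 / r) *\<^sub>R x0) + (1 / r) *\<^sub>R x"
      have eq: "x0 + r *\<^sub>R y = x" using r by (simp add: y_def algebra_simps)
      have "y \<in> cube 0 1" using scale(1)[of y 1] x by (simp add: eq)
      from p(2)[OF this] show "\<bar>g x - p (- ((1 / r) *\<^sub>R x0) + (1 / r) *\<^sub>R x)\<bar> \<le> C * \<epsilon>"
        by (simp only: eq flip: y_def)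
    qed
  qed
  with C(1) show ?thesis by blast
qed

section \<open>Quasipower majorants and Lipschitz spaces\<close>

lemma quasipower_majorantD:
  assumes "quasipower_majorant k \<omega>"
  shows "t > 0 \<Longrightarrow> \<omega> t > 0"
    and "0 < t \<Longrightarrow> t \<le> u \<Longrightarrow> \<omega> t \<le> \<omega> u"
    and "0 < t \<Longrightarrow> t \<le> u \<Longrightarrow> \<omega> u / u ^ k \<le> \<omega> t / t ^ k"
    and "(\<omega> \<longlongrightarrow> 0) (at_right 0)"
  using assms by (auto simp: quasipower_majorant_def monotone_on_def)

lemma quasipower_majorant_scale:
  assumes "quasipower_majorant k \<omega>" "t > 0" "c \<ge> 1"
  shows "\<omega> (c * t) \<le> c ^ k * \<omega> t"
  using quasipower_majorantD(3)[OF assms(1,2), of "c * t"] assms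
  by (simp add: field_simps power_mult_distrib)

lemma norm_le_cube: "h \<in> cube 0 r \<Longrightarrow> norm (h :: real ^ 'n::finite) \<le> real CARD('n) * r"
  using norm_le_l1_cart[of h] sum_bounded_above[of UNIV "\<lambda>i. \<bar>h $ i\<bar>" r]
  by (auto simp: mem_cube)

lemma locally_bounded_imp_bounded_on_compact:
  fixes g :: "'a::metric_space \<Rightarrow> 'b::metric_space"
  assumes "compact S" "\<And>x. \<exists>r>0. bounded (g ` ball x r)"
  shows "bounded (g ` S)"
proof -
  obtain r where r: "\<And>x. r x > 0" "\<And>x. bounded (g ` ball x (r x))" using assms(2) by metis
  obtain D where D: "D \<subseteq> S" "finite D" "S \<subseteq> (\<Union>x\<in>D. ball x (r x))"
    by (rule compactE_image[OF assms(1), of S "\<lambda>x. ball x (r x)"]) (use r(1) in auto)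
  then have "bounded (\<Union>x\<in>D. g ` ball x (r x))" using r(2) by auto
  then show ?thesis by (rule bounded_subset) (use D(3) in blast)
qed

lemma lipschitz_seminormD:
  assumes "g \<in> lipschitz_space k \<omega>" "quasipower_majorant k \<omega>" "h \<noteq> 0"
  shows "\<bar>finite_diff k h g x\<bar> \<le> enn2real (lipschitz_seminorm k \<omega> g) * \<omega> (norm h)"
proof -
  have fin: "lipschitz_seminorm k \<omega> g < \<infinity>" using assms(1) by (simp add: lipschitz_space_def)
  have "ennreal (\<bar>finite_diff k h g x\<bar> / \<omega> (norm h)) \<le> lipschitz_seminorm k \<omega> g"
    unfolding lipschitz_seminorm_def using assms(3) by (intro SUP_upper2[of "(x, h)"]) auto
  then have "\<bar>finite_diff k h g x\<bar> / \<omega> (norm h) \<le> enn2real (lipschitz_seminorm k \<omega> g)"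
    using enn2real_mono[OF _ fin[unfolded infinity_ennreal_def]] quasipower_majorantD(1)[OF assms(2), of "norm h"] assms(3)
    by fastforce
  then show ?thesis
    using quasipower_majorantD(1)[OF assms(2), of "norm h"] assms(3) by (simp add: pos_divide_le_eq)
qed

text \<open>Steps in the cube of radius \<open>k * r\<close> have norm at most \<open>N * r\<close>,
  and \<open>\<omega> (N * r) \<le> N ^ k * \<omega> r\<close>. The step 0, about which the seminorm
  is silent, gives difference 0 because \<open>k \<ge> 1\<close>.\<close>

lemma lipschitz_space_polyfun_approx:
  assumes "1 \<le> k" "quasipower_majorant k \<omega>"
  shows "\<exists>C\<ge>0. \<forall>(g :: real ^ 'n::finite \<Rightarrow> real) \<in> lipschitz_space k \<omega>. \<forall>x r. r > 0 \<longrightarrow>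
    (\<exists>p. polyfun (k - 1) p \<and> (\<forall>y\<in>cube x r. \<bar>g y - p y\<bar> \<le> C * enn2real (lipschitz_seminorm k \<omega> g) * \<omega> r))"
proof -
  obtain C where C: "C \<ge> 0" "\<And>(g :: real ^ 'n \<Rightarrow> real) \<epsilon> B x0 r. r > 0 \<Longrightarrow>
    (\<forall>x h. h \<in> cube 0 (real k * r) \<longrightarrow> \<bar>finite_diff k h g x\<bar> \<le> \<epsilon>) \<Longrightarrow>
    (\<forall>x\<in>cube x0 (real k * r). \<bar>g x\<bar> \<le> B) \<Longrightarrow>
    (\<exists>p. polyfun (k - 1) p \<and> (\<forall>x\<in>cube x0 r. \<bar>g x - p x\<bar> \<le> C * \<epsilon>))"
    using whitney[OF assms(1), where 'n = 'n] by metis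
  define N where "N = real CARD('n) * real k"
  have N: "N \<ge> 1" using assms(1) mult_mono[of 1 "real CARD('n)" 1 "real k"] by (simp add: N_def Suc_le_eq)
  have "\<exists>p. polyfun (k - 1) p \<and> (\<forall>y\<in>cube x r. \<bar>g y - p y\<bar> \<le> C * N ^ k * enn2real (lipschitz_seminorm k \<omega> g) * \<omega> r)"
    if g: "g \<in> lipschitz_space k \<omega>" and r: "r > 0" for g :: "real ^ 'n \<Rightarrow> real" and x r
  proof -
    let ?K = "enn2real (lipschitz_seminorm k \<omega> g)"
    have "\<bar>finite_diff k h g x\<bar> \<le> N ^ k * ?K * \<omega> r" if h: "h \<in> cube 0 (real k * r)" for h x
    proof (cases "h = 0")
      case True
      then show ?thesis
        using assms(1) N quasipower_majorantD(1)[OF assms(2) r] by (simp add: finite_diff_0_step)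
    next
      case False
      have "\<omega> (norm h) \<le> \<omega> (N * r)"
        using norm_le_cube[OF h] False by (intro quasipower_majorantD(2)[OF assms(2)]) (auto simp: N_def mult.assoc)
      also have "\<dots> \<le> N ^ k * \<omega> r" by (rule quasipower_majorant_scale[OF assms(2) r N])
      finally have "?K * \<omega> (norm h) \<le> ?K * (N ^ k * \<omega> r)" by (intro mult_left_mono) auto
      with lipschitz_seminormD[OF g assms(2) False, of x] show ?thesis by (simp add: mult_ac)
    qed
    moreover have "bounded (g ` cube x (real k * r))"
      using g by (intro locally_bounded_imp_bounded_on_compact compact_cube) (auto simp: lipschitz_space_def)
    then obtain B where "\<forall>y\<in>cube x (real k * r). \<bar>g y\<bar> \<le> B" by (auto simp: bounded_iff)
    ultimately have "\<exists>p. polyfun (k - 1) p \<and> (\<forall>y\<in>cube x r. \<bar>g y - p y\<bar> \<le> C * (N ^ k * ?K * \<omega> r))"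
      by (intro C(2)[OF r, of g _ x B]) auto
    then show ?thesis by (simp add: mult.assoc)
  qed
  moreover have "C * N ^ k \<ge> 0" using C(1) N by simp
  ultimately show ?thesis by blast
qed

lemma ball_subset_cube: "ball x r \<subseteq> cube x r"
proof
  fix y assume "y \<in> ball x r"
  then have "norm (y - x) < r" by (simp add: dist_norm norm_minus_commute)
  then have "\<bar>(y - x) $ i\<bar> \<le> r" for i using component_le_norm_cart[of "y - x" i] by linarith
  then show "y \<in> cube x r" by (simp add: mem_cube)
qed

text \<open>The space asks only for local boundedness. Continuity follows because \<open>g\<close>
  stays within a multiple of \<open>\<omega> r\<close> of a polynomial on the cube of radius
  \<open>r\<close> and \<open>\<omega>\<close> tends to 0. It later yields measurability and
  upgrades equality almost everywhere to equality on \<open>X\<close>.\<close>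

lemma lipschitz_space_continuous:
  assumes "1 \<le> k" "quasipower_majorant k \<omega>" "(g :: real ^ 'n::finite \<Rightarrow> real) \<in> lipschitz_space k \<omega>"
  shows "continuous_on S g"
proof (rule continuous_at_imp_continuous_on, rule ballI)
  fix x :: "real ^ 'n"
  obtain C where C: "C \<ge> 0" "\<And>x r. r > 0 \<Longrightarrow> \<exists>p. polyfun (k - 1) p \<and>
      (\<forall>y\<in>cube x r. \<bar>g y - p y\<bar> \<le> C * enn2real (lipschitz_seminorm k \<omega> g) * \<omega> r)"
    using lipschitz_space_polyfun_approx[OF assms(1,2), where 'n = 'n] assms(3) by blast
  show "isCont g x"
    unfolding continuous_at_eps_delta
  proof (intro allI impI)
    fix e :: real assume e: "e > 0"
    let ?K = "C * enn2real (lipschitz_seminorm k \<omega> g)"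
    have "((\<lambda>r. ?K * \<omega> r) \<longlongrightarrow> ?K * 0) (at_right 0)"
      by (intro tendsto_mult_left quasipower_majorantD(4)[OF assms(2)])
    then have "eventually (\<lambda>r. ?K * \<omega> r < e / 3 \<and> r > 0) (at_right 0)"
      using e by (intro eventually_conj order_tendstoD(2)[where a = "e/3"] eventually_at_right_less) auto
    then obtain r where r: "?K * \<omega> r < e / 3" "r > 0"
      using eventually_happens'[OF trivial_limit_at_right_real] by blast
    obtain p where p: "polyfun (k - 1) p" "\<And>y. y \<in> cube x r \<Longrightarrow> \<bar>g y - p y\<bar> \<le> ?K * \<omega> r"
      using C(2)[OF r(2)] by blast
    have "isCont p x"
      using polyfun_continuous[OF p(1), of UNIV] by (simp add: continuous_on_eq_continuous_at)
    then obtain d where d: "d > 0" "\<And>y. dist y x < d \<Longrightarrow> dist (p y) (p x) < e / 3"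
      unfolding continuous_at_eps_delta using e by (metis divide_pos_pos zero_less_numeral)
    show "\<exists>d>0. \<forall>y. dist y x < d \<longrightarrow> dist (g y) (g x) < e"
    proof (intro exI[of _ "min d r"] conjI allI impI)
      fix y assume y: "dist y x < min d r"
      then have mem: "y \<in> cube x r" "x \<in> cube x r"
        using ball_subset_cube[of x r] r(2) by (auto simp: dist_commute mem_cube)
      have "\<bar>p y - p x\<bar> < e / 3" using d(2)[of y] y by (simp add: dist_real_def)
      with p(2)[OF mem(1)] p(2)[OF mem(2)] r(1) show "dist (g y) (g x) < e"
        unfolding dist_real_def by linarith
    qed (use d r in auto)
  qed
qed

text \<open>The disjoint intervals from \<open>r / 2 ^ l\<close> to twice that, for
  \<open>l \<ge> 1\<close>, lie below \<open>r\<close>. On each the integrand is at least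
  \<open>\<omega> (a l) / (2 * a l)\<close>, so it contributes at least half of
  \<open>\<omega> (a l)\<close>. The term \<open>l = 0\<close> is \<open>\<omega> r\<close>
  itself.\<close>

lemma quasipower_majorant_sum:
  assumes "quasipower_majorant k \<omega>"
  shows "\<exists>C\<ge>0. \<forall>r>0. \<forall>N. (\<Sum>l<N. \<omega> (r / 2 ^ l)) \<le> C * \<omega> r"
proof -
  define S where "S = (SUP t\<in>{0<..}. (\<integral>\<^sup>+u\<in>{0<..<t}. ennreal (\<omega> u / u) \<partial>lborel) / ennreal (\<omega> t))"
  have S: "S < \<infinity>" using assms by (simp add: quasipower_majorant_def S_def)
  have "(\<Sum>l<N. \<omega> (r / 2 ^ l)) \<le> (1 + 2 * enn2real S) * \<omega> r" if r: "r > 0" for r N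
  proof -
    define a where "a l = r / 2 ^ l" for l :: nat
    have a: "a l > 0" for l using r by (simp add: a_def)
    have \<omega>a: "\<omega> (a l) > 0" for l by (rule quasipower_majorantD(1)[OF assms a])
    define J where "J l = {a l<..<2 * a l}" for l
    have J_lt: "J l \<inter> J l' = {}" if "l < l'" for l l'
    proof -
      have "2 * a l' \<le> a l" using that r power_increasing[of "Suc l" l' "2::real"]
        by (simp add: a_def field_simps)
      then show ?thesis by (auto simp: J_def)
    qed
    then have J_disj: "J l \<inter> J l' = {}" if "l \<noteq> l'" for l l'
      using that J_lt[of l l'] J_lt[of l' l] by (metis Int_commute linorder_neqE_nat)
    have "ennreal (\<Sum>l\<in>{1..<N}. \<omega> (a l) / 2) = (\<Sum>l\<in>{1..<N}. ennreal (\<omega> (a l) / (2 * a l)) * emeasure lborel (J l))"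
    proof -
      have "ennreal (\<omega> (a l) / 2) = ennreal (\<omega> (a l) / (2 * a l)) * emeasure lborel (J l)" for l
        using a[of l] \<omega>a[of l] by (simp add: J_def less_imp_le flip: ennreal_mult)
      then show ?thesis using \<omega>a by (simp add: less_imp_le flip: sum_ennreal)
    qed
    also have "\<dots> = (\<integral>\<^sup>+u. (\<Sum>l\<in>{1..<N}. ennreal (\<omega> (a l) / (2 * a l)) * indicator (J l) u) \<partial>lborel)"
      by (subst nn_integral_sum) (auto simp: nn_integral_cmult_indicator J_def)
    also have "\<dots> \<le> (\<integral>\<^sup>+u\<in>{0<..<r}. ennreal (\<omega> u / u) \<partial>lborel)"
    proof (rule nn_integral_mono)
      fix u
      show "(\<Sum>l\<in>{1..<N}. ennreal (\<omega> (a l) / (2 * a l)) * indicator (J l) u) \<le>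
          ennreal (\<omega> u / u) * indicator {0<..<r} u"
      proof (cases "\<exists>l0\<in>{1..<N}. u \<in> J l0")
        case True
        then obtain l0 where l0: "l0 \<in> {1..<N}" "u \<in> J l0" by blast
        have "(\<Sum>l\<in>{1..<N}. ennreal (\<omega> (a l) / (2 * a l)) * indicator (J l) u) =
            (\<Sum>l\<in>{l0}. ennreal (\<omega> (a l) / (2 * a l)) * indicator (J l) u)"
          using l0 J_disj by (intro sum.mono_neutral_right) (auto simp: indicator_def disjoint_iff)
        also have "\<dots> = ennreal (\<omega> (a l0) / (2 * a l0))" using l0 by simp
        also have "\<dots> \<le> ennreal (\<omega> u / u)"
        proof (intro ennreal_leI frac_le)
          show "\<omega> (a l0) \<le> \<omega> u"
            using l0 by (intro quasipower_majorantD(2)[OF assms a]) (auto simp: J_def)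
        qed (use l0 a[of l0] \<omega>a[of l0] quasipower_majorantD(1)[OF assms, of u] in \<open>auto simp: J_def\<close>)
        finally have le: "(\<Sum>l\<in>{1..<N}. ennreal (\<omega> (a l) / (2 * a l)) * indicator (J l) u) \<le> ennreal (\<omega> u / u)" .
        have "2 * a l0 \<le> r" using l0 r power_increasing[of 1 l0 "2::real"]
          by (simp add: a_def field_simps)
        then have "u \<in> {0<..<r}" using l0 a[of l0] by (auto simp: J_def)
        with le show ?thesis by simp
      qed (simp add: sum.neutral)
    qed
    also have "\<dots> \<le> S * ennreal (\<omega> r)"
    proof -
      have "(\<integral>\<^sup>+u\<in>{0<..<r}. ennreal (\<omega> u / u) \<partial>lborel) / ennreal (\<omega> r) \<le> S"
        unfolding S_def using r by (intro SUP_upper) auto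
      then have "(\<integral>\<^sup>+u\<in>{0<..<r}. ennreal (\<omega> u / u) \<partial>lborel) / ennreal (\<omega> r) * ennreal (\<omega> r) \<le> S * ennreal (\<omega> r)"
        by (rule mult_right_mono) simp
      then show ?thesis
        using quasipower_majorantD(1)[OF assms r] by (simp add: ennreal_divide_times ennreal_divide_self)
    qed
    also have "\<dots> = ennreal (enn2real S * \<omega> r)"
      using S quasipower_majorantD(1)[OF assms r] by (simp add: ennreal_mult)
    finally have "(\<Sum>l\<in>{1..<N}. \<omega> (a l) / 2) \<le> enn2real S * \<omega> r"
      using quasipower_majorantD(1)[OF assms r] by (subst (asm) ennreal_le_iff) auto
    then have "(\<Sum>l\<in>{1..<N}. \<omega> (a l)) \<le> 2 * enn2real S * \<omega> r"
      by (simp flip: sum_divide_distrib)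
    moreover have "(\<Sum>l<N. \<omega> (a l)) \<le> \<omega> (a 0) + (\<Sum>l\<in>{1..<N}. \<omega> (a l))"
    proof (cases N)
      case (Suc M)
      then show ?thesis by (simp add: lessThan_atLeast0 sum.atLeast_Suc_lessThan)
    qed (use \<omega>a[of 0] in auto)
    ultimately show ?thesis by (simp add: a_def algebra_simps)
  qed
  moreover have "1 + 2 * enn2real S \<ge> 0" by (simp add: add_nonneg_nonneg)
  ultimately show ?thesis by blast
qed

section \<open>A partition of unity\<close>

lemma antiderivative_ex:
  fixes \<sigma> :: "real \<Rightarrow> real"
  assumes "continuous_on UNIV \<sigma>" "\<And>t. t \<le> 0 \<Longrightarrow> \<sigma> t = 0"
  shows "\<exists>\<Phi>. \<forall>t. (\<Phi> has_real_derivative \<sigma> t) (at t)"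
\<comment> \<open>Starting the integral at -1 puts every \<open>t \<ge> 0\<close> in the interior of
  the interval of integration; for negative \<open>t\<close> the integral vanishes identically, as
  does \<open>\<sigma>\<close>.\<close>
proof (intro exI[of _ "\<lambda>t. integral {-1..t} \<sigma>"] allI)
  fix t :: real
  show "((\<lambda>t. integral {-1..t} \<sigma>) has_real_derivative \<sigma> t) (at t)"
  proof (cases "t < 0")
    case True
    have zero: "0 = integral {-1..u} \<sigma>" if "u \<in> {..<0}" for u
    proof -
      have "integral {-1..u} \<sigma> = integral {-1..u} (\<lambda>_. 0)"
        by (rule Henstock_Kurzweil_Integration.integral_cong) (use that assms(2) in auto)
      then show ?thesis by simp
    qed
    have "((\<lambda>t. integral {-1..t} \<sigma>) has_real_derivative 0) (at t)"
      by (rule has_field_derivative_transform_within_open[OF DERIV_const open_lessThan _ zero])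
        (use True in auto)
    then show ?thesis using assms(2)[of t] True by simp
  next
    case False
    have "((\<lambda>t. integral {-1..t} \<sigma>) has_real_derivative \<sigma> t) (at t within {-1..t+1})"
      using False by (intro integral_has_real_derivative continuous_on_subset[OF assms(1)]) auto
    moreover have "at t within {-1..t+1} = at t"
      using False by (intro at_within_interior) auto
    ultimately show ?thesis by simp
  qed
qed

text \<open>The difference of order \<open>i\<close> of \<open>\<Phi>\<close> has that of
  \<open>\<sigma>\<close> as derivative, so the mean value inequality trades one more difference for
  a factor \<open>\<bar>\<eta>\<bar>\<close>.\<close>

lemma finite_diff_antiderivative:
  fixes \<sigma> \<Phi> :: "real \<Rightarrow> real"
  assumes "\<And>t. (\<Phi> has_real_derivative \<sigma> t) (at t)" "\<And>t. \<bar>finite_diff i \<eta> \<sigma> t\<bar> \<le> M"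
  shows "\<bar>finite_diff (Suc i) \<eta> \<Phi> t\<bar> \<le> \<bar>\<eta>\<bar> * M"
proof -
  have "(finite_diff i \<eta> \<Phi> has_real_derivative finite_diff i \<eta> \<sigma> t) (at t)" for t
  proof -
    have "((\<lambda>t. \<Phi> (t + real j *\<^sub>R \<eta>)) has_real_derivative \<sigma> (t + real j *\<^sub>R \<eta>)) (at t)" for j
      using DERIV_shift[of \<Phi> "\<sigma> (t + real j *\<^sub>R \<eta>)" t "real j *\<^sub>R \<eta>"] assms(1) by blast
    then show ?thesis
      unfolding finite_diff_def by (intro DERIV_sum DERIV_cmult) auto
  qed
  then have "norm (finite_diff i \<eta> \<Phi> (t + \<eta>) - finite_diff i \<eta> \<Phi> t) \<le> M * norm (t + \<eta> - t)"
    by (intro field_differentiable_bound[of UNIV]) (use assms(2) in auto)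
  then show ?thesis by (simp add: finite_diff_Suc mult.commute)
qed

text \<open>Each step replaces \<open>\<sigma>\<close> by \<open>\<tau>\<close>, whose value at
  \<open>t\<close> is the average of \<open>\<sigma>\<close> between \<open>2 * t - 1\<close> and
  \<open>2 * t\<close>. Averaging gains one order of difference bounds, and the factor 2 compresses
  the widened transition back to the unit interval.\<close>

lemma smoothstep_ex:
  "\<exists>\<sigma> :: real \<Rightarrow> real. \<exists>C. continuous_on UNIV \<sigma> \<and> (\<forall>t\<le>0. \<sigma> t = 0) \<and> (\<forall>t\<ge>1. \<sigma> t = 1) \<and>
    (\<forall>t. 0 \<le> \<sigma> t \<and> \<sigma> t \<le> 1) \<and> (\<forall>i\<le>k. \<forall>\<eta> t. \<bar>finite_diff i \<eta> \<sigma> t\<bar> \<le> C * \<bar>\<eta>\<bar> ^ i)"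
proof (induction k)
  case 0
  show ?case
    by (intro exI[of _ "\<lambda>t. max 0 (min 1 t)"] exI[of _ 1]) (auto intro!: continuous_intros)
next
  case (Suc k)
  then obtain \<sigma> :: "real \<Rightarrow> real" and C where \<sigma>: "continuous_on UNIV \<sigma>" "\<And>t. t \<le> 0 \<Longrightarrow> \<sigma> t = 0"
    "\<And>t. t \<ge> 1 \<Longrightarrow> \<sigma> t = 1" "\<And>t. 0 \<le> \<sigma> t" "\<And>t. \<sigma> t \<le> 1"
    "\<And>i \<eta> t. i \<le> k \<Longrightarrow> \<bar>finite_diff i \<eta> \<sigma> t\<bar> \<le> C * \<bar>\<eta>\<bar> ^ i" by blast
  obtain \<Phi> where \<Phi>: "\<And>t. (\<Phi> has_real_derivative \<sigma> t) (at t)"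
    using antiderivative_ex[OF \<sigma>(1,2)] by blast
  define \<tau> where "\<tau> t = \<Phi> (2 * t) - \<Phi> (2 * t - 1)" for t
  have mvt: "\<exists>z. 2 * t - 1 < z \<and> z < 2 * t \<and> \<tau> t = \<sigma> z" for t
    using MVT2[of "2 * t - 1" "2 * t" \<Phi> \<sigma>] \<Phi> by (auto simp: \<tau>_def)
  have bounds: "0 \<le> \<tau> t" "\<tau> t \<le> 1" for t using mvt[of t] \<sigma>(4,5) by auto
  have C: "C \<ge> 0" using \<sigma>(6)[of 0 0 0] by (auto intro: order_trans[OF abs_ge_zero])
  define C' where "C' = 1 + 4 * 2 ^ k * C"
  have \<Phi>_cont: "continuous_on UNIV \<Phi>"
    using \<Phi> by (intro continuous_at_imp_continuous_on ballI DERIV_isCont)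
  have "continuous_on UNIV \<tau>"
    unfolding \<tau>_def by (intro continuous_intros continuous_on_compose2[OF \<Phi>_cont]) auto
  moreover have "\<tau> t = 0" if "t \<le> 0" for t using mvt[of t] that \<sigma>(2) by auto
  moreover have "\<tau> t = 1" if "t \<ge> 1" for t using mvt[of t] that \<sigma>(3) by auto
  moreover have "\<bar>finite_diff i \<eta> \<tau> t\<bar> \<le> C' * \<bar>\<eta>\<bar> ^ i" if "i \<le> Suc k" for i \<eta> t
  proof (cases i)
    case 0
    have "1 \<le> C'" using C by (simp add: C'_def)
    then show ?thesis using 0 bounds[of t] by simp
  next
    case (Suc m)
    have le: "\<bar>finite_diff i (2 * \<eta>) \<Phi> u\<bar> \<le> \<bar>2 * \<eta>\<bar> * (C * \<bar>2 * \<eta>\<bar> ^ m)" for u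
      unfolding Suc by (rule finite_diff_antiderivative[OF \<Phi>]) (use \<sigma>(6) that Suc in auto)
    have "finite_diff i \<eta> \<tau> t = finite_diff i (2 * \<eta>) \<Phi> (2 * t) - finite_diff i (2 * \<eta>) \<Phi> (2 * t - 1)"
      unfolding \<tau>_def finite_diff_diff
      using finite_diff_affine[of i \<eta> \<Phi> 0 2 t] finite_diff_affine[of i \<eta> \<Phi> "-1" 2 t] by simp
    then have "\<bar>finite_diff i \<eta> \<tau> t\<bar> \<le> 2 * (\<bar>2 * \<eta>\<bar> * (C * \<bar>2 * \<eta>\<bar> ^ m))"
      using le[of "2 * t"] le[of "2 * t - 1"] by linarith
    also have "\<dots> = (4 * 2 ^ m * C) * \<bar>\<eta>\<bar> ^ i"
      by (simp add: Suc abs_mult power_mult_distrib)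
    also have "\<dots> \<le> C' * \<bar>\<eta>\<bar> ^ i"
      using that Suc C by (intro mult_right_mono) (auto simp: C'_def intro!: add_increasing mult_right_mono)
    finally show ?thesis .
  qed
  ultimately show ?case using bounds by blast
qed

text \<open>The translates of \<open>\<sigma>(t + 1) - \<sigma>(t)\<close> by integers form a telescoping sum.\<close>

locale bump =
  fixes \<beta> :: "real \<Rightarrow> real" and k :: nat and B :: real
  assumes nonneg: "0 \<le> \<beta> t"
    and support: "1 \<le> \<bar>t\<bar> \<Longrightarrow> \<beta> t = 0"
    and partition: "\<beta> (t - of_int \<lfloor>t\<rfloor>) + \<beta> (t - of_int (\<lfloor>t\<rfloor> + 1)) = 1"
    and smooth: "\<bar>\<eta>\<bar> \<le> \<theta> \<Longrightarrow> smooth_seq k \<theta> B (\<lambda>l. \<beta> (t + real l * \<eta>))"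

lemma bump_ex: "\<exists>\<beta> B. bump \<beta> k B"
proof -
  obtain \<sigma> :: "real \<Rightarrow> real" and C where \<sigma>: "\<And>t. t \<le> 0 \<Longrightarrow> \<sigma> t = 0"
    "\<And>t. t \<ge> 1 \<Longrightarrow> \<sigma> t = 1" "\<And>t. 0 \<le> \<sigma> t" "\<And>t. \<sigma> t \<le> 1"
    "\<And>i \<eta> t. i \<le> k \<Longrightarrow> \<bar>finite_diff i \<eta> \<sigma> t\<bar> \<le> C * \<bar>\<eta>\<bar> ^ i" using smoothstep_ex[of k] by blast
  have C: "C \<ge> 0" using \<sigma>(5)[of 0 0 0] by (auto intro: order_trans[OF abs_ge_zero])
  have smooth: "smooth_seq k \<theta> C (\<lambda>l. \<sigma> (t + real l * \<eta>))" if "\<bar>\<eta>\<bar> \<le> \<theta>" for t \<eta> \<theta>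
  proof -
    have "smooth_seq k \<theta> C (\<lambda>l. \<sigma> (t + real l *\<^sub>R \<eta>))"
    proof (rule smooth_seq_if_finite_diff)
      fix i x assume "i \<le> k"
      moreover have "C * \<bar>\<eta>\<bar> ^ i \<le> C * \<theta> ^ i"
        using that C by (intro mult_left_mono power_mono) auto
      ultimately show "\<bar>finite_diff i \<eta> \<sigma> x\<bar> \<le> C * \<theta> ^ i" using \<sigma>(5) order_trans by blast
    qed
    then show ?thesis by simp
  qed
  have "bump (\<lambda>t. \<sigma> (t + 1) - \<sigma> t) k (C + \<bar>-1\<bar> * C)"
  proof
    fix t :: real
    show "0 \<le> \<sigma> (t + 1) - \<sigma> t"
      using \<sigma>(1)[of t] \<sigma>(2)[of "t + 1"] \<sigma>(3)[of "t + 1"] \<sigma>(4)[of t] by (cases "t \<le> 0") auto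
    show "\<sigma> (t + 1) - \<sigma> t = 0" if "1 \<le> \<bar>t\<bar>"
      using that \<sigma>(1)[of t] \<sigma>(2)[of "t + 1"] \<sigma>(1)[of "t + 1"] \<sigma>(2)[of t] by (cases "t \<le> 0") auto
    have "\<sigma> (t - of_int \<lfloor>t\<rfloor> + 1) = 1" "\<sigma> (t - of_int (\<lfloor>t\<rfloor> + 1)) = 0"
      by (intro \<sigma>(1,2); linarith)+
    then show "\<sigma> (t - of_int \<lfloor>t\<rfloor> + 1) - \<sigma> (t - of_int \<lfloor>t\<rfloor>) +
        (\<sigma> (t - of_int (\<lfloor>t\<rfloor> + 1) + 1) - \<sigma> (t - of_int (\<lfloor>t\<rfloor> + 1))) = 1" by simp
    fix \<eta> \<theta> :: real assume "\<bar>\<eta>\<bar> \<le> \<theta>"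
    from smooth_seq_add[OF smooth[OF this, of "t + 1"] smooth_seq_cmult[OF smooth[OF this, of t], of "-1"]]
    show "smooth_seq k \<theta> (C + \<bar>-1\<bar> * C) (\<lambda>l. \<sigma> (t + real l * \<eta> + 1) - \<sigma> (t + real l * \<eta>))"
      by (simp add: algebra_simps)
  qed
  then show ?thesis by blast
qed

text \<open>The corners of the lattice box of mesh \<open>\<delta>\<close> containing
  \<open>y\<close>; because of the support of \<open>\<beta>\<close> no other lattice point carries
  weight at \<open>y\<close>.\<close>

definition cells :: "real \<Rightarrow> real ^ 'n::finite \<Rightarrow> ('n \<Rightarrow> int) set" where
  "cells \<delta> y = {m. \<forall>i. m i \<in> {\<lfloor>y $ i / \<delta>\<rfloor>, \<lfloor>y $ i / \<delta>\<rfloor> + 1}}"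

definition lattice_point :: "real \<Rightarrow> ('n::finite \<Rightarrow> int) \<Rightarrow> real ^ 'n" where
  "lattice_point \<delta> m = (\<chi> i. \<delta> * of_int (m i))"

definition tensor_bump :: "(real \<Rightarrow> real) \<Rightarrow> real \<Rightarrow> ('n::finite \<Rightarrow> int) \<Rightarrow> real ^ 'n \<Rightarrow> real" where
  "tensor_bump \<beta> \<delta> m y = (\<Prod>i\<in>UNIV. \<beta> (y $ i / \<delta> - of_int (m i)))"

lemma cells_eq_PiE: "cells \<delta> y = PiE UNIV (\<lambda>i. {\<lfloor>y $ i / \<delta>\<rfloor>, \<lfloor>y $ i / \<delta>\<rfloor> + 1})"
  by (auto simp: cells_def PiE_def Pi_def)

lemma cells_dist:
  assumes "m \<in> cells \<delta> y"
  shows "\<bar>y $ i / \<delta> - of_int (m i)\<bar> \<le> 1"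
proof -
  have "m i = \<lfloor>y $ i / \<delta>\<rfloor> \<or> m i = \<lfloor>y $ i / \<delta>\<rfloor> + 1" using assms by (auto simp: cells_def)
  then show ?thesis by linarith
qed

lemma lattice_point_mem_cube:
  assumes "\<delta> > 0"
  shows "y \<in> cube (lattice_point \<delta> m) (c * \<delta>) \<longleftrightarrow> (\<forall>i. \<bar>y $ i / \<delta> - of_int (m i)\<bar> \<le> c)"
proof -
  have "\<bar>y $ i - \<delta> * of_int (m i)\<bar> \<le> c * \<delta> \<longleftrightarrow> \<bar>y $ i / \<delta> - of_int (m i)\<bar> \<le> c" for i
  proof -
    have "\<bar>y $ i - \<delta> * of_int (m i)\<bar> = \<delta> * \<bar>y $ i / \<delta> - of_int (m i)\<bar>"
      using assms by (simp add: abs_mult_pos' right_diff_distrib)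
    then show ?thesis using assms by (simp add: mult.commute)
  qed
  then show ?thesis by (simp add: mem_cube lattice_point_def)
qed

context bump
begin

lemma tensor_bump_nonneg: "0 \<le> tensor_bump \<beta> \<delta> m y"
  unfolding tensor_bump_def by (intro prod_nonneg) (auto simp: nonneg)

lemma tensor_bump_outside: "m \<notin> cells \<delta> y \<Longrightarrow> tensor_bump \<beta> \<delta> m y = 0"
proof -
  assume "m \<notin> cells \<delta> y"
  then obtain i where i: "m i \<noteq> \<lfloor>y $ i / \<delta>\<rfloor>" "m i \<noteq> \<lfloor>y $ i / \<delta>\<rfloor> + 1" by (auto simp: cells_def)
  have "1 \<le> \<bar>y $ i / \<delta> - of_int (m i)\<bar>" using i by linarith
  then show ?thesis unfolding tensor_bump_def using support by (intro prod_zero) auto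
qed

lemma tensor_bump_sum: "(\<Sum>m\<in>cells \<delta> y. tensor_bump \<beta> \<delta> m y) = 1"
proof -
  have "(\<Prod>i\<in>UNIV. \<Sum>j\<in>{\<lfloor>y $ i / \<delta>\<rfloor>, \<lfloor>y $ i / \<delta>\<rfloor> + 1}. \<beta> (y $ i / \<delta> - of_int j)) =
    (\<Sum>m\<in>cells \<delta> y. tensor_bump \<beta> \<delta> m y)"
    unfolding cells_eq_PiE tensor_bump_def by (rule prod_sum_PiE) auto
  moreover have "(\<Sum>j\<in>{\<lfloor>t\<rfloor>, \<lfloor>t\<rfloor> + 1}. \<beta> (t - of_int j)) = 1" for t using partition[of t] by simp
  ultimately show ?thesis by simp
qed

lemma tensor_bump_average:
  assumes "\<And>m. m \<in> cells \<delta> y \<Longrightarrow> \<bar>a m - c\<bar> \<le> e"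
  shows "\<bar>(\<Sum>m\<in>cells \<delta> y. tensor_bump \<beta> \<delta> m y * a m) - c\<bar> \<le> e"
proof -
  have "(\<Sum>m\<in>cells \<delta> y. tensor_bump \<beta> \<delta> m y * a m) - c =
      (\<Sum>m\<in>cells \<delta> y. tensor_bump \<beta> \<delta> m y * (a m - c))"
    using tensor_bump_sum[of \<delta> y] by (simp add: right_diff_distrib sum_subtractf flip: sum_distrib_right)
  also have "\<bar>\<dots>\<bar> \<le> (\<Sum>m\<in>cells \<delta> y. tensor_bump \<beta> \<delta> m y * e)"
    using assms
    by (intro order_trans[OF sum_abs] sum_mono)
      (auto simp: abs_mult abs_of_nonneg[OF tensor_bump_nonneg] intro!: mult_left_mono tensor_bump_nonneg)
  also have "\<dots> = e" using tensor_bump_sum[of \<delta> y] by (simp flip: sum_distrib_right)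
  finally show ?thesis .
qed

lemma tensor_bump_smooth:
  assumes "\<delta> > 0" "norm h / \<delta> \<le> \<theta>"
  shows "smooth_seq k \<theta> ((2 ^ k * B) ^ CARD('n)) (\<lambda>l. tensor_bump \<beta> \<delta> m (y + real l *\<^sub>R (h :: real ^ 'n::finite)))"
  unfolding tensor_bump_def
proof (rule smooth_seq_prod)
  show "0 \<le> \<theta>" using assms by (auto intro: order_trans[rotated])
  fix i :: 'n
  have "\<bar>h $ i / \<delta>\<bar> \<le> norm h / \<delta>" using assms component_le_norm_cart[of h i] by (simp add: divide_right_mono)
  then have "\<bar>h $ i / \<delta>\<bar> \<le> \<theta>" using assms by linarith
  from smooth[OF this, of "y $ i / \<delta> - of_int (m i)"]
  show "smooth_seq k \<theta> B (\<lambda>l. \<beta> ((y + real l *\<^sub>R h) $ i / \<delta> - of_int (m i)))"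
    by (simp add: add_divide_distrib algebra_simps)
qed auto

end

section \<open>Gluing local polynomials\<close>

text \<open>With radius \<open>2 * \<delta>\<close>, a point of \<open>X\<close> within sup-norm
  distance \<open>\<delta>\<close> of \<open>y\<close> makes all cells at \<open>y\<close> near,
  while a near cell at \<open>y\<close> provides a point of \<open>X\<close> within
  \<open>3 * \<delta>\<close> of \<open>y\<close>.\<close>

definition near :: "(real ^ 'n::finite) set \<Rightarrow> real \<Rightarrow> ('n \<Rightarrow> int) \<Rightarrow> bool" where
  "near X \<delta> m \<longleftrightarrow> X \<inter> cube (lattice_point \<delta> m) (2 * \<delta>) \<noteq> {}"

definition near_point :: "(real ^ 'n::finite) set \<Rightarrow> real \<Rightarrow> ('n \<Rightarrow> int) \<Rightarrow> real ^ 'n" where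
  "near_point X \<delta> m = (SOME z. z \<in> X \<inter> cube (lattice_point \<delta> m) (2 * \<delta>))"

text \<open>At a lattice point near \<open>X\<close> the local polynomial of scale \<open>\<delta>\<close> is used; elsewhere the function is
  inherited from the next coarser scale \<open>2 \<delta>\<close>. After \<open>N\<close> scales the recursion ends with \<open>g\<close>.\<close>

fun glue :: "(real \<Rightarrow> real) \<Rightarrow> (real ^ 'n::finite) set \<Rightarrow> (real ^ 'n \<Rightarrow> real \<Rightarrow> real ^ 'n \<Rightarrow> real) \<Rightarrow>
    (real ^ 'n \<Rightarrow> real) \<Rightarrow> nat \<Rightarrow> real \<Rightarrow> real ^ 'n \<Rightarrow> real" where
  "glue \<beta> X P g 0 \<delta> y = g y"
| "glue \<beta> X P g (Suc N) \<delta> y = (\<Sum>m\<in>cells \<delta> y. tensor_bump \<beta> \<delta> m y *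
     (if near X \<delta> m then P (near_point X \<delta> m) \<delta> y else glue \<beta> X P g N (2 * \<delta>) y))"

text \<open>Stage \<open>N\<close> runs through the scales from \<open>2 ^ (-N)\<close> to
  \<open>2 ^ (N - 1)\<close>, so that in the limit both ends recede. By
  \<open>glue_base_irrelevant\<close> the base function 0 loses its influence at large
  stages.\<close>

definition glued :: "(real \<Rightarrow> real) \<Rightarrow> (real ^ 'n::finite) set \<Rightarrow> (real ^ 'n \<Rightarrow> real \<Rightarrow> real ^ 'n \<Rightarrow> real) \<Rightarrow>
    real ^ 'n \<Rightarrow> real" where
  "glued \<beta> X P y = lim (\<lambda>N. glue \<beta> X P (\<lambda>_. 0) (2 * N) ((1 / 2) ^ N) y)"

lemma near_point: "near X \<delta> m \<Longrightarrow> near_point X \<delta> m \<in> X \<and> near_point X \<delta> m \<in> cube (lattice_point \<delta> m) (2 * \<delta>)"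
  unfolding near_def near_point_def by (metis (no_types, lifting) IntD1 IntD2 ex_in_conv someI_ex)

section \<open>Geometry of cubes and lattice cells\<close>

lemma cube_sym: "x \<in> cube y r \<longleftrightarrow> y \<in> cube x r"
  by (simp add: mem_cube abs_minus_commute)

lemma cube_trans:
  assumes "x \<in> cube y r" "y \<in> cube z r'" "r + r' \<le> R"
  shows "x \<in> cube z R"
  unfolding mem_cube
proof
  fix i
  have "\<bar>x $ i - z $ i\<bar> \<le> \<bar>x $ i - y $ i\<bar> + \<bar>y $ i - z $ i\<bar>" by linarith
  also have "\<dots> \<le> r + r'" using assms(1,2) by (intro add_mono) (auto simp: mem_cube)
  finally show "\<bar>x $ i - z $ i\<bar> \<le> R" using assms(3) by linarith
qed

lemma cells_lattice_point: "\<delta> > 0 \<Longrightarrow> m \<in> cells \<delta> y \<Longrightarrow> y \<in> cube (lattice_point \<delta> m) \<delta>"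
  using lattice_point_mem_cube[of \<delta> y m 1] cells_dist[of m \<delta> y] by simp

lemma near_point_cells:
  assumes "\<delta> > 0" "m \<in> cells \<delta> y" "near X \<delta> m"
  shows "near_point X \<delta> m \<in> X" "y \<in> cube (near_point X \<delta> m) (3 * \<delta>)"
proof -
  show "y \<in> cube (near_point X \<delta> m) (3 * \<delta>)"
    using cube_trans[OF cells_lattice_point[OF assms(1,2)], of "near_point X \<delta> m" "2 * \<delta>"]
      near_point[OF assms(3)] assms(1) by (simp add: cube_sym)
qed (use near_point[OF assms(3)] in auto)

lemma glue_linear:
  "glue \<beta> X (\<lambda>x r y. a * P x r y + b * Q x r y) (\<lambda>_. 0) N \<delta> y =
   a * glue \<beta> X P (\<lambda>_. 0) N \<delta> y + b * glue \<beta> X Q (\<lambda>_. 0) N \<delta> y"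
proof (induction N arbitrary: \<delta>)
  case (Suc N)
  show ?case
    unfolding glue.simps Suc.IH sum_distrib_left sum.distrib[symmetric]
    by (intro sum.cong refl) (simp add: algebra_simps)
qed simp

lemma dyadic_between:
  fixes \<delta> r :: real
  assumes "0 < \<delta>" "\<delta> \<le> 2 * r"
  shows "\<exists>a. r \<le> 2 ^ a * \<delta> \<and> 2 ^ a * \<delta> \<le> 2 * r"
proof -
  obtain a0 where a0: "r / \<delta> < 2 ^ a0" using real_arch_pow[of 2 "r / \<delta>"] by auto
  define a where "a = (LEAST a. r \<le> 2 ^ a * \<delta>)"
  have "r \<le> 2 ^ a0 * \<delta>" using a0 assms by (simp add: pos_divide_less_eq)
  then have a: "r \<le> 2 ^ a * \<delta>" unfolding a_def by (rule LeastI)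
  have "2 ^ a * \<delta> \<le> 2 * r"
  proof (cases a)
    case (Suc b)
    then have "\<not> r \<le> 2 ^ b * \<delta>" unfolding a_def using not_less_Least[of b] by (metis lessI)
    then show ?thesis using Suc by simp
  qed (use assms in simp)
  with a show ?thesis by blast
qed

text \<open>\<open>K\<close> stands for the seminorm of the function to be extended.
  \<open>CS\<close>, \<open>Cg\<close> and \<open>Cp\<close> will be constants depending only on
  \<open>k\<close>, \<open>\<omega>\<close> and the dimension, which makes the result uniform in
  \<open>X\<close> and \<open>P\<close>. The factor 3 in \<open>coherent\<close> is the one
  delivered by \<open>near_point_cells\<close>.\<close>

locale gluing = bump \<beta> k B for \<beta> k B +
  fixes X :: "(real ^ 'n::finite) set" and P :: "real ^ 'n \<Rightarrow> real \<Rightarrow> real ^ 'n \<Rightarrow> real"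
    and \<omega> :: "real \<Rightarrow> real" and K CS Cg Cp :: real
  assumes X: "X \<noteq> {}" and k: "1 \<le> k" and \<omega>: "quasipower_majorant k \<omega>"
    and CS: "CS \<ge> 0" "\<And>r N. r > 0 \<Longrightarrow> (\<Sum>l<N. \<omega> (r / 2 ^ l)) \<le> CS * \<omega> r"
    and K: "K \<ge> 0"
    and poly: "x \<in> X \<Longrightarrow> r > 0 \<Longrightarrow> polyfun (k - 1) (P x r)"
    and coherent: "x \<in> X \<Longrightarrow> x' \<in> X \<Longrightarrow> 0 < r \<Longrightarrow> r \<le> r' \<Longrightarrow> r' \<le> 2 * r \<Longrightarrow>
      y \<in> cube x (3 * r) \<Longrightarrow> y \<in> cube x' (3 * r') \<Longrightarrow> \<bar>P x r y - P x' r' y\<bar> \<le> K * \<omega> r'"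
    and Cg: "Cg \<ge> 0" "\<And>(p :: real ^ 'n \<Rightarrow> real) x r M y. polyfun (k - 1) p \<Longrightarrow> r > 0 \<Longrightarrow>
      (\<forall>y\<in>cube x r. \<bar>p y\<bar> \<le> M) \<Longrightarrow> y \<in> cube x (10 * r) \<Longrightarrow> \<bar>p y\<bar> \<le> Cg * M"
    and Cp: "Cp \<ge> 0" "\<And>(p :: real ^ 'n \<Rightarrow> real) y h M \<theta>. polyfun (k - 1) p \<Longrightarrow> 0 < \<theta> \<Longrightarrow> \<theta> \<le> 1 \<Longrightarrow>
      (\<forall>t\<in>{0..1/\<theta>}. \<bar>p (y + t *\<^sub>R h)\<bar> \<le> M) \<Longrightarrow> smooth_seq k \<theta> (Cp * M) (\<lambda>l. p (y + real l *\<^sub>R h))"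
begin

abbreviation G where "G \<equiv> glue \<beta> X P"
abbreviation F where "F \<equiv> glued \<beta> X P"

definition C1 where "C1 = (CS + 1) * 2 ^ k"

lemma C1_nonneg: "C1 \<ge> 0" using CS by (simp add: C1_def)

lemma \<omega>_pos: "t > 0 \<Longrightarrow> \<omega> t > 0" using quasipower_majorantD(1)[OF \<omega>] .

text \<open>A ladder of doublings at the centre \<open>z\<close> leads from \<open>\<delta>\<close>
  to a scale \<open>\<rho>\<close> comparable to \<open>r\<close>, with errors summing to at most
  \<open>CS\<close> times \<open>K * \<omega> \<rho>\<close>; one more comparison changes the
  centre. This explains \<open>CS + 1\<close> in \<open>C1\<close>, while \<open>2 ^ k\<close> comes
  from \<open>\<rho> \<le> 2 * r\<close>.\<close>

lemma multiscale:
  assumes xz: "x \<in> X" "z \<in> X" and \<delta>: "0 < \<delta>" "\<delta> \<le> 2 * r"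
    and y: "y \<in> cube x (3 * r)" "y \<in> cube z (3 * \<delta>)"
  shows "\<bar>P z \<delta> y - P x r y\<bar> \<le> C1 * K * \<omega> r"
proof -
  obtain a where a: "r \<le> 2 ^ a * \<delta>" "2 ^ a * \<delta> \<le> 2 * r" using dyadic_between[OF \<delta>] by blast
  define \<rho> where "\<rho> = 2 ^ a * \<delta>"
  have r: "r > 0" "\<rho> > 0" using \<delta> by (auto simp: \<rho>_def)
  have mem: "y \<in> cube z (3 * (2 ^ l * \<delta>))" for l
  proof -
    have "1 * \<delta> \<le> 2 ^ l * \<delta>" using \<delta> by (intro mult_right_mono) auto
    then show ?thesis using cube_mono[of "3 * \<delta>" "3 * (2 ^ l * \<delta>)" z] y(2) by auto
  qed
  have "\<bar>P z \<delta> y - P z (2 ^ b * \<delta>) y\<bar> \<le> K * (\<Sum>l<b. \<omega> (2 ^ Suc l * \<delta>))" for b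
  proof (induction b)
    case (Suc b)
    have "\<bar>P z (2 ^ b * \<delta>) y - P z (2 ^ Suc b * \<delta>) y\<bar> \<le> K * \<omega> (2 ^ Suc b * \<delta>)"
      using \<delta> mem[of b] mem[of "Suc b"] by (intro coherent xz(2)) auto
    with Suc show ?case by (simp add: distrib_left)
  qed simp
  from this[of a] have "\<bar>P z \<delta> y - P z \<rho> y\<bar> \<le> K * (\<Sum>l<a. \<omega> (2 ^ Suc l * \<delta>))" by (simp add: \<rho>_def)
  also have "(\<Sum>l<a. \<omega> (2 ^ Suc l * \<delta>)) = (\<Sum>l<a. \<omega> (\<rho> / 2 ^ l))"
    by (subst sum.nat_diff_reindex[symmetric], intro sum.cong refl)
      (simp add: \<rho>_def power_diff Suc_diff_Suc flip: power_Suc)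
  also have "K * \<dots> \<le> K * (CS * \<omega> \<rho>)" by (intro mult_left_mono CS(2) K r)
  finally have 1: "\<bar>P z \<delta> y - P z \<rho> y\<bar> \<le> K * CS * \<omega> \<rho>" by simp
  have "\<bar>P x r y - P z \<rho> y\<bar> \<le> K * \<omega> \<rho>"
    using a r mem[of a] y by (intro coherent xz) (auto simp: \<rho>_def)
  with 1 have "\<bar>P z \<delta> y - P x r y\<bar> \<le> (CS + 1) * K * \<omega> \<rho>" by (simp add: algebra_simps)
  also have "\<omega> \<rho> \<le> 2 ^ k * \<omega> r"
    using quasipower_majorantD(2)[OF \<omega> r(2), of "2 * r"] quasipower_majorant_scale[OF \<omega> r(1), of 2] a
    by (simp add: \<rho>_def)
  then have "(CS + 1) * K * \<omega> \<rho> \<le> (CS + 1) * K * (2 ^ k * \<omega> r)"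
    using CS K by (intro mult_left_mono) auto
  finally show ?thesis by (simp add: C1_def mult_ac)
qed

section \<open>Which scales influence the glued function at a point\<close>

lemma glue_inactive:
  assumes "\<delta> > 0" "X \<inter> cube y (3 * \<delta>) = {}"
  shows "G g (Suc N) \<delta> y = G g N (2 * \<delta>) y"
proof -
  have "\<not> near X \<delta> m" if "m \<in> cells \<delta> y" for m
    using near_point_cells[OF assms(1) that, of X] assms(2) by (auto simp: cube_sym)
  then have "G g (Suc N) \<delta> y = (\<Sum>m\<in>cells \<delta> y. tensor_bump \<beta> \<delta> m y * G g N (2 * \<delta>) y)" by simp
  then show ?thesis using tensor_bump_sum[of \<delta> y] by (simp flip: sum_distrib_right)
qed

lemma glue_inactive_iter:
  assumes "\<delta> > 0" "X \<inter> cube y (3 * (2 ^ a * \<delta>)) = {}"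
  shows "G g (N + a) \<delta> y = G g N (2 ^ a * \<delta>) y"
  using assms
proof (induction a arbitrary: \<delta>)
  case (Suc a)
  have "X \<inter> cube y (3 * \<delta>) = {}"
  proof -
    have "1 * \<delta> \<le> 2 ^ Suc a * \<delta>" using Suc.prems by (intro mult_right_mono one_le_power) auto
    then have "cube y (3 * \<delta>) \<subseteq> cube y (3 * (2 ^ Suc a * \<delta>))" by (intro cube_mono) linarith
    then show ?thesis using Suc.prems(2) by blast
  qed
  then have "G g (Suc (N + a)) \<delta> y = G g (N + a) (2 * \<delta>) y" using Suc.prems by (intro glue_inactive)
  also have "\<dots> = G g N (2 ^ a * (2 * \<delta>)) y" using Suc.prems by (intro Suc.IH) (auto simp: mult_ac)
  finally show ?case by (simp add: mult_ac)
qed simp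

text \<open>At the scale \<open>2 ^ a * \<delta>\<close> a point of \<open>X\<close> is so close to
  \<open>y\<close> that every cell is near, and the recursion ends there whatever would come
  after.\<close>

lemma glue_base_irrelevant:
  assumes "\<delta> > 0" "X \<inter> cube y (2 ^ a * \<delta>) \<noteq> {}" "a < N" "a < N'"
  shows "G g N \<delta> y = G g' N' \<delta> y"
  using assms
proof (induction a arbitrary: \<delta> N N')
  case 0
  obtain M M' where N: "N = Suc M" "N' = Suc M'" using 0 by (metis gr0_implies_Suc)
  have "near X \<delta> m" if "m \<in> cells \<delta> y" for m
  proof -
    obtain z where "z \<in> X" "z \<in> cube y \<delta>" using 0 by auto
    then show ?thesis
      using cube_trans[of z y \<delta> "lattice_point \<delta> m" \<delta> "2 * \<delta>"] cells_lattice_point[OF 0(1) that]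
      by (auto simp: near_def)
  qed
  then show ?case by (simp add: N)
next
  case (Suc a)
  obtain M M' where N: "N = Suc M" "N' = Suc M'" using Suc.prems by (metis Suc_lessE)
  have "G g M (2 * \<delta>) y = G g' M' (2 * \<delta>) y"
    using Suc.prems N by (intro Suc.IH) (auto simp: mult_ac)
  then show ?case by (simp add: N cong: if_cong)
qed

lemma glue_bound:
  assumes "\<delta> > 0" "\<bar>g y - c\<bar> \<le> e"
    "\<And>a m. a < N \<Longrightarrow> m \<in> cells (2 ^ a * \<delta>) y \<Longrightarrow> near X (2 ^ a * \<delta>) m \<Longrightarrow>
      \<bar>P (near_point X (2 ^ a * \<delta>) m) (2 ^ a * \<delta>) y - c\<bar> \<le> e"
  shows "\<bar>G g N \<delta> y - c\<bar> \<le> e"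
  using assms
proof (induction N arbitrary: \<delta>)
  case (Suc N)
  have IH: "\<bar>G g N (2 * \<delta>) y - c\<bar> \<le> e"
  proof (rule Suc.IH)
    fix a m assume "a < N" "m \<in> cells (2 ^ a * (2 * \<delta>)) y" "near X (2 ^ a * (2 * \<delta>)) m"
    then show "\<bar>P (near_point X (2 ^ a * (2 * \<delta>)) m) (2 ^ a * (2 * \<delta>)) y - c\<bar> \<le> e"
      using Suc.prems(3)[of "Suc a" m] by (simp add: mult_ac)
  qed (use Suc.prems in auto)
  show ?case
    unfolding glue.simps
    by (rule tensor_bump_average) (use IH Suc.prems(3)[of 0] in auto)
qed simp

text \<open>By \<open>glue_base_irrelevant\<close> the recursion may be cut after a scale comparable
  to \<open>r\<close> and its base replaced by \<open>P x r\<close>. What remains is an iterated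
  convex combination of local polynomials of scales at most \<open>2 * r\<close>, each compared with
  \<open>P x r\<close> by \<open>multiscale\<close>.\<close>

lemma glue_near_bound:
  assumes "x \<in> X" "r > 0" "y \<in> cube x r"
  shows "eventually (\<lambda>N. \<bar>G (\<lambda>_. 0) (2 * N) ((1 / 2) ^ N) y - P x r y\<bar> \<le> C1 * K * \<omega> r) sequentially"
proof -
  obtain N0 where N0: "2 * r < 2 ^ N0" using real_arch_pow[of 2 "2 * r"] by auto
  have "(\<lambda>N. (1 / 2) ^ N) \<longlonglongrightarrow> (0::real)" by (rule LIMSEQ_realpow_zero) auto
  then have "eventually (\<lambda>N. (1 / 2) ^ N < 2 * r) sequentially"
    using assms(2) by (intro order_tendstoD(2)) auto
  then have "eventually (\<lambda>N. (1 / 2) ^ N < 2 * r \<and> N \<ge> N0) sequentially"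
    by (intro eventually_conj eventually_ge_at_top)
  then show ?thesis
  proof eventually_elim
    case (elim N)
    define \<delta> :: real where "\<delta> = (1 / 2) ^ N"
    have \<delta>: "\<delta> > 0" "\<delta> \<le> 2 * r" using elim by (auto simp: \<delta>_def)
    obtain a where a: "r \<le> 2 ^ a * \<delta>" "2 ^ a * \<delta> \<le> 2 * r" using dyadic_between[OF \<delta>] by blast
    \<comment> \<open>The \<open>2 * N\<close> scales starting at \<open>2 ^ (-N)\<close> reach past
      \<open>2 * r\<close> by the choice of \<open>N0\<close>.\<close>
    have "a < 2 * N"
    proof (rule ccontr)
      assume "\<not> a < 2 * N"
      then have "(2::real) ^ (2 * N) * \<delta> \<le> 2 ^ a * \<delta>"
        using \<delta> by (intro mult_right_mono power_increasing) auto
      also have "(2::real) ^ (2 * N) * \<delta> = 2 ^ N"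
        by (simp add: \<delta>_def mult_2 power_add power_divide)
      finally have "2 ^ N \<le> 2 * r" using a by linarith
      moreover have "(2::real) ^ N0 \<le> 2 ^ N" using elim by (intro power_increasing) auto
      ultimately show False using N0 by linarith
    qed
    moreover have "x \<in> cube y (2 ^ a * \<delta>)"
      using assms(3) cube_mono[OF a(1)] by (auto simp: cube_sym)
    ultimately have "G (\<lambda>_. 0) (2 * N) \<delta> y = G (P x r) (Suc a) \<delta> y"
      using assms(1) \<delta> by (intro glue_base_irrelevant[of _ _ a]) auto
    moreover have "\<bar>G (P x r) (Suc a) \<delta> y - P x r y\<bar> \<le> C1 * K * \<omega> r"
    proof (rule glue_bound[OF \<delta>(1)])
      show "\<bar>P x r y - P x r y\<bar> \<le> C1 * K * \<omega> r" using C1_nonneg K \<omega>_pos[OF assms(2)] by simp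
      fix b m assume b: "b < Suc a" "m \<in> cells (2 ^ b * \<delta>) y" "near X (2 ^ b * \<delta>) m"
      have "2 ^ b * \<delta> \<le> 2 ^ a * \<delta>" using b \<delta> by (intro mult_right_mono power_increasing) auto
      with a have "2 ^ b * \<delta> \<le> 2 * r" by linarith
      moreover have "y \<in> cube x (3 * r)" using cube_mono[of r "3 * r" x] assms by auto
      ultimately show "\<bar>P (near_point X (2 ^ b * \<delta>) m) (2 ^ b * \<delta>) y - P x r y\<bar> \<le> C1 * K * \<omega> r"
        using near_point_cells[OF _ b(2,3)] \<delta> assms(1) by (intro multiscale) auto
    qed
    ultimately show ?case by (simp add: \<delta>_def)
  qed
qed

lemma near_X_scale: "r > 0 \<Longrightarrow> \<exists>a. X \<inter> cube y (2 ^ a * r) \<noteq> {}"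
proof -
  assume r: "r > 0"
  obtain x where x: "x \<in> X" using X by auto
  obtain a where a: "norm (x - y) / r < 2 ^ a" using real_arch_pow[of 2 "norm (x - y) / r"] by auto
  have "x \<in> cube y (2 ^ a * r)"
    unfolding mem_cube
  proof
    fix i
    have "\<bar>(x - y) $ i\<bar> \<le> norm (x - y)" by (rule component_le_norm_cart)
    also have "\<dots> \<le> 2 ^ a * r" using a r by (simp add: pos_divide_less_eq)
    finally show "\<bar>x $ i - y $ i\<bar> \<le> 2 ^ a * r" by simp
  qed
  with x show ?thesis by blast
qed

text \<open>Passing from stage \<open>N\<close> to \<open>M\<close> adds \<open>M - N\<close> fine
  scales, which are inactive at this distance from \<open>X\<close>, and \<open>M - N\<close> coarse
  ones, which come after the recursion has ended.\<close>

lemma glue_far_stable: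
  assumes "X \<inter> cube y (3 * (1 / 2) ^ N) = {}" "X \<inter> cube y (2 ^ a * (1 / 2) ^ N) \<noteq> {}" "a < 2 * N" "N \<le> M"
  shows "G (\<lambda>_. 0) (2 * M) ((1 / 2) ^ M) y = G (\<lambda>_. 0) (2 * N) ((1 / 2) ^ N) y"
proof -
  define b where "b = M - N"
  have eq: "2 ^ b * (1 / 2) ^ M = ((1 / 2) ^ N :: real)"
    using assms(4) by (simp add: b_def power_divide power_diff)
  have e2: "2 * M - b + b = 2 * M" by (simp add: b_def)
  have "G (\<lambda>_. 0) (2 * M) ((1 / 2) ^ M) y = G (\<lambda>_. 0) (2 * M - b) (2 ^ b * (1 / 2) ^ M) y"
    using glue_inactive_iter[of "(1 / 2) ^ M" y b "\<lambda>_. 0" "2 * M - b"] assms(1) unfolding e2 eq by simp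
  also have "\<dots> = G (\<lambda>_. 0) (2 * N) ((1 / 2) ^ N) y"
    unfolding eq by (rule glue_base_irrelevant[OF _ assms(2)]) (use assms(3,4) in \<open>auto simp: b_def\<close>)
  finally show ?thesis .
qed

lemma glued_far:
  assumes "X \<inter> cube y (3 * (1 / 2) ^ N) = {}" "X \<inter> cube y (2 ^ a * (1 / 2) ^ N) \<noteq> {}" "a < 2 * N"
  shows "(\<lambda>M. G (\<lambda>_. 0) (2 * M) ((1 / 2) ^ M) y) \<longlonglongrightarrow> G (\<lambda>_. 0) (2 * N) ((1 / 2) ^ N) y"
proof (rule tendsto_eventually)
  show "\<forall>\<^sub>F M in sequentially. G (\<lambda>_. 0) (2 * M) ((1 / 2) ^ M) y = G (\<lambda>_. 0) (2 * N) ((1 / 2) ^ N) y"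
    unfolding eventually_sequentially using glue_far_stable[OF assms] by blast
qed

text \<open>If \<open>y\<close> lies in the closure of \<open>X\<close>, the sequence is Cauchy by
  \<open>glue_near_bound\<close>, as \<open>\<omega>\<close> tends to 0; otherwise it is eventually
  constant.\<close>

lemma glue_convergent: "convergent (\<lambda>N. G (\<lambda>_. 0) (2 * N) ((1 / 2) ^ N) y)"
proof (cases "\<forall>\<rho>>0. X \<inter> cube y \<rho> \<noteq> {}")
  case True
  have "Cauchy (\<lambda>N. G (\<lambda>_. 0) (2 * N) ((1 / 2) ^ N) y)"
  proof (rule metric_CauchyI)
    fix e :: real assume e: "e > 0"
    have "((\<lambda>r. C1 * K * \<omega> r) \<longlongrightarrow> C1 * K * 0) (at_right 0)"
      by (intro tendsto_mult_left quasipower_majorantD(4)[OF \<omega>])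
    then have "eventually (\<lambda>r. C1 * K * \<omega> r < e / 2 \<and> r > 0) (at_right 0)"
      using e by (intro eventually_conj order_tendstoD(2)[where a = "e/2"] eventually_at_right_less) auto
    then obtain r where r: "C1 * K * \<omega> r < e / 2" "r > 0"
      using eventually_happens'[OF trivial_limit_at_right_real] by blast
    obtain x where x: "x \<in> X" "x \<in> cube y r" using True r(2) by blast
    obtain N0 where N0: "\<And>N. N \<ge> N0 \<Longrightarrow>
        \<bar>G (\<lambda>_. 0) (2 * N) ((1 / 2) ^ N) y - P x r y\<bar> \<le> C1 * K * \<omega> r"
      using glue_near_bound[OF x(1) r(2) x(2)[unfolded cube_sym[of x]]]
      unfolding eventually_sequentially by blast
    show "\<exists>N0. \<forall>m\<ge>N0. \<forall>n\<ge>N0.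
        dist (G (\<lambda>_. 0) (2 * m) ((1 / 2) ^ m) y) (G (\<lambda>_. 0) (2 * n) ((1 / 2) ^ n) y) < e"
    proof (intro exI[of _ N0] allI impI)
      fix m n assume "m \<ge> N0" "n \<ge> N0"
      from N0[OF this(1)] N0[OF this(2)] r(1)
      show "dist (G (\<lambda>_. 0) (2 * m) ((1 / 2) ^ m) y) (G (\<lambda>_. 0) (2 * n) ((1 / 2) ^ n) y) < e"
        unfolding dist_real_def by linarith
    qed
  qed
  then show ?thesis by (rule real_Cauchy_convergent)
next
  case False
  then obtain \<rho> where \<rho>: "\<rho> > 0" "X \<inter> cube y \<rho> = {}" by blast
  obtain b where b: "X \<inter> cube y (2 ^ b * 1) \<noteq> {}" using near_X_scale[of 1 y] by auto
  have lim: "(\<lambda>N. 3 * (1 / 2) ^ N) \<longlonglongrightarrow> 3 * (0::real)"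
    by (intro tendsto_mult_left LIMSEQ_realpow_zero) auto
  have "eventually (\<lambda>N. 3 * (1 / 2) ^ N < \<rho>) sequentially"
    by (rule order_tendstoD(2)[OF lim]) (use \<rho>(1) in simp)
  then have "eventually (\<lambda>N. 3 * (1 / 2) ^ N < \<rho> \<and> N \<ge> b + 1) sequentially"
    by (intro eventually_conj eventually_ge_at_top)
  then obtain N where N: "3 * (1 / 2) ^ N < \<rho>" "N \<ge> b + 1"
    using eventually_happens'[OF sequentially_bot] by blast
  have "X \<inter> cube y (3 * (1 / 2) ^ N) = {}" using cube_mono[of "3 * (1 / 2) ^ N" \<rho> y] N(1) \<rho>(2) by auto
  moreover have "X \<inter> cube y (2 ^ (b + N) * (1 / 2) ^ N) \<noteq> {}"
    using b by (simp add: power_add power_divide)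
  ultimately have "(\<lambda>M. G (\<lambda>_. 0) (2 * M) ((1 / 2) ^ M) y) \<longlonglongrightarrow> G (\<lambda>_. 0) (2 * N) ((1 / 2) ^ N) y"
    by (rule glued_far) (use N in auto)
  then show ?thesis by (rule convergentI)
qed

lemma glued_near:
  assumes "x \<in> X" "r > 0" "y \<in> cube x r"
  shows "\<bar>F y - P x r y\<bar> \<le> C1 * K * \<omega> r"
proof -
  have "(\<lambda>N. \<bar>G (\<lambda>_. 0) (2 * N) ((1 / 2) ^ N) y - P x r y\<bar>) \<longlonglongrightarrow> \<bar>F y - P x r y\<bar>"
    unfolding glued_def
    by (intro tendsto_rabs tendsto_diff tendsto_const) (use glue_convergent in \<open>simp add: convergent_LIMSEQ_iff\<close>)
  then show ?thesis
    by (rule tendsto_upperbound) (use glue_near_bound[OF assms] in auto)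
qed

text \<open>Since \<open>3 * \<delta> \<le> D / 2\<close>, scales below \<open>\<delta>\<close> see
  nothing of \<open>X\<close> from the half cube; since
  \<open>2 ^ 5 * \<delta> \<ge> 5 / 2 * D\<close>, at level 5 every cell is near. Hence six levels
  matter, and the base \<open>q\<close> may be chosen at will.\<close>

lemma glued_eq_few_scales:
  assumes D: "D > 0" "X \<inter> cube y0 D = {}" "X \<inter> cube y0 (2 * D) \<noteq> {}"
  shows "\<exists>\<delta>. D / 12 \<le> \<delta> \<and> \<delta> \<le> D / 6 \<and> (\<forall>y\<in>cube y0 (D / 2). F y = G q 6 \<delta> y)"
proof -
  have lim: "(\<lambda>N. 3 * (1 / 2) ^ N) \<longlonglongrightarrow> 3 * (0::real)"
    by (intro tendsto_mult_left LIMSEQ_realpow_zero) auto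
  have "eventually (\<lambda>N. 3 * (1 / 2) ^ N < D / 2) sequentially"
    by (rule order_tendstoD(2)[OF lim]) (use D(1) in simp)
  moreover obtain N0 where N0: "12 * D < 2 ^ N0" using real_arch_pow[of 2 "12 * D"] by auto
  ultimately have "eventually (\<lambda>N. 3 * (1 / 2) ^ N < D / 2 \<and> N \<ge> N0) sequentially"
    by (intro eventually_conj eventually_ge_at_top)
  then obtain N where N: "3 * (1 / 2) ^ N < D / 2" "N \<ge> N0"
    using eventually_happens'[OF sequentially_bot] by blast
  define \<epsilon> :: real where "\<epsilon> = (1 / 2) ^ N"
  have \<epsilon>: "\<epsilon> > 0" "\<epsilon> \<le> 2 * (D / 12)" using N(1) by (auto simp: \<epsilon>_def)
  obtain b where b: "D / 12 \<le> 2 ^ b * \<epsilon>" "2 ^ b * \<epsilon> \<le> 2 * (D / 12)" using dyadic_between[OF \<epsilon>] by blast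
  define \<delta> where "\<delta> = 2 ^ b * \<epsilon>"
  have \<delta>: "D / 12 \<le> \<delta>" "\<delta> \<le> D / 6" using b by (auto simp: \<delta>_def)
  have far: "X \<inter> cube y \<rho> = {}" if "y \<in> cube y0 (D / 2)" "\<rho> \<le> D / 2" for y \<rho>
    using cube_trans[of _ y \<rho> y0 "D / 2" D] that D(2) by fastforce
  have close: "X \<inter> cube y \<rho> \<noteq> {}" if y: "y \<in> cube y0 (D / 2)" and \<rho>: "5 / 2 * D \<le> \<rho>" for y \<rho>
  proof -
    obtain z where "z \<in> X" "z \<in> cube y0 (2 * D)" using D(3) by auto
    then show ?thesis using cube_trans[of z y0 "2 * D" y "D / 2" \<rho>] y \<rho> by (auto simp: cube_sym)
  qed
  have b5: "b + 5 < 2 * N"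
  proof (rule ccontr)
    assume "\<not> b + 5 < 2 * N"
    then have "(2::real) ^ (2 * N) * \<epsilon> \<le> 2 ^ (b + 5) * \<epsilon>"
      using \<epsilon> by (intro mult_right_mono power_increasing) auto
    also have "(2::real) ^ (2 * N) * \<epsilon> = 2 ^ N"
      by (simp add: \<epsilon>_def mult_2 power_add power_divide)
    also have "2 ^ (b + 5) * \<epsilon> = 32 * \<delta>" by (simp add: \<delta>_def power_add)
    finally have "2 ^ N \<le> 12 * D" using \<delta> D(1) by linarith
    moreover have "(2::real) ^ N0 \<le> 2 ^ N" using N(2) by (intro power_increasing) auto
    ultimately show False using N0 by linarith
  qed
  have "F y = G q 6 \<delta> y" if y: "y \<in> cube y0 (D / 2)" for y
  proof -
    have big: "5 / 2 * D \<le> 2 ^ 5 * \<delta>" using \<delta> D(1) by simp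
    have "(\<lambda>M. G (\<lambda>_. 0) (2 * M) ((1 / 2) ^ M) y) \<longlonglongrightarrow> G (\<lambda>_. 0) (2 * N) ((1 / 2) ^ N) y"
    proof (rule glued_far[of _ _ "b + 5"])
      show "X \<inter> cube y (3 * (1 / 2) ^ N) = {}" using N(1) by (intro far y) auto
      show "X \<inter> cube y (2 ^ (b + 5) * (1 / 2) ^ N) \<noteq> {}"
        using big by (intro close y) (simp add: \<delta>_def \<epsilon>_def power_add)
    qed (rule b5)
    then have "F y = G (\<lambda>_. 0) ((2 * N - b) + b) \<epsilon> y"
      unfolding glued_def \<epsilon>_def using b5 by (simp add: limI)
    also have "\<dots> = G (\<lambda>_. 0) (2 * N - b) \<delta> y"
      unfolding \<delta>_def
      by (rule glue_inactive_iter[OF \<epsilon>(1)]) (intro far y, use \<delta> in \<open>simp add: \<delta>_def\<close>)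
    also have "\<dots> = G q 6 \<delta> y"
      by (rule glue_base_irrelevant[of _ _ 5]) (use close[OF y big] \<delta> D(1) b5 in auto)
    finally show ?thesis .
  qed
  with \<delta> show ?thesis by blast
qed

section \<open>Differences of the glued function, away from X and near X\<close>

definition E where "E = max 1 (15 ^ CARD('n) * (2 ^ k * (2 ^ k * B) ^ CARD('n)))"

text \<open>\<open>E\<close> is the cost of one level of the recursion: number of lattice points,
  Leibniz constant, smoothness of a tensor bump. Six levels are multiplied here, followed by
  sampling, growth and comparison of scales; \<open>20 ^ k\<close> comes from
  \<open>\<omega> (20 * D)\<close> and \<open>12 ^ k\<close> from
  \<open>\<theta> = 12 * norm h / D\<close>.\<close>

definition C2 where "C2 = E ^ 6 * (Cp * (Cg * (C1 * (20 ^ k)))) * 12 ^ k"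

lemma B_nonneg: "B \<ge> 0"
  using smooth[of 0 0 0] by (auto intro: smooth_seq_const_nonneg)

lemma E_ge_1: "E \<ge> 1" by (simp add: E_def)

lemma C2_nonneg: "C2 \<ge> 0"
  unfolding C2_def using E_ge_1 C1_nonneg Cg(1) Cp(1) by (intro mult_nonneg_nonneg) auto

text \<open>Sample points stray at most six mesh widths from the centre and cells add one; hence the
  radius 7, with at most 15 integers per coordinate.\<close>

lemma card_lattice_box:
  "finite {m :: 'n \<Rightarrow> int. \<forall>i. \<bar>t i - of_int (m i)\<bar> \<le> (7::real)}"
  "card {m :: 'n \<Rightarrow> int. \<forall>i. \<bar>t i - of_int (m i)\<bar> \<le> (7::real)} \<le> 15 ^ CARD('n)"
proof -
  let ?J = "\<lambda>i. {\<lceil>t i - 7\<rceil>..\<lfloor>t i + 7\<rfloor>}"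
  have "\<bar>t i - of_int j\<bar> \<le> 7 \<longleftrightarrow> j \<in> ?J i" for i j
    unfolding atLeastAtMost_iff ceiling_le_iff le_floor_iff abs_le_iff by (auto simp: algebra_simps)
  then have eq: "{m :: 'n \<Rightarrow> int. \<forall>i. \<bar>t i - of_int (m i)\<bar> \<le> 7} = PiE UNIV ?J"
    by (auto simp: PiE_def Pi_def)
  show "finite {m :: 'n \<Rightarrow> int. \<forall>i. \<bar>t i - of_int (m i)\<bar> \<le> (7::real)}"
    unfolding eq by (rule finite_PiE) auto
  have "card (?J i) \<le> 15" for i
  proof -
    have "\<lfloor>t i + 7\<rfloor> - \<lceil>t i - 7\<rceil> \<le> 14" by linarith
    then have "nat (\<lfloor>t i + 7\<rfloor> + 1 - \<lceil>t i - 7\<rceil>) \<le> 15" by linarith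
    then show ?thesis by (simp only: card_atLeastAtMost_int)
  qed
  then have "(\<Prod>i\<in>UNIV. card (?J i)) \<le> (\<Prod>i\<in>(UNIV :: 'n set). 15)" by (intro prod_mono) auto
  then show "card {m :: 'n \<Rightarrow> int. \<forall>i. \<bar>t i - of_int (m i)\<bar> \<le> (7::real)} \<le> 15 ^ CARD('n)"
    unfolding eq by (subst card_PiE) auto
qed

text \<open>Near \<open>y0\<close> the function combines boundedly many local polynomials with
  weights smooth at scale \<open>D\<close>. Subtracting a single polynomial \<open>q\<close>,
  invisible to differences of order \<open>k\<close>, leaves small polynomial differences, smooth by
  \<open>polyfun_smooth_seq\<close>; the Leibniz rule is applied once per level.\<close>

lemma finite_diff_far:
  assumes D: "D > 0" "X \<inter> cube y0 D = {}" "X \<inter> cube y0 (2 * D) \<noteq> {}"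
    and h: "h \<noteq> 0" "norm h \<le> D / 12" "real k * norm h \<le> D / 2"
  shows "\<bar>finite_diff k h F y0\<bar> \<le> C2 * K * \<omega> D * (norm h / D) ^ k"
proof -
  obtain x where x: "x \<in> X" "x \<in> cube y0 (2 * D)" using D(3) by blast
  \<comment> \<open>The scale \<open>20 * D\<close> suits \<open>multiscale\<close>: the points
    \<open>w\<close> below lie within \<open>10 * \<epsilon> + 2 * D\<close> of \<open>x\<close>,
    and \<open>\<epsilon> \<le> 32 / 6 * D\<close> keeps this below
    \<open>3 * (20 * D)\<close>.\<close>
  define q where "q = P x (20 * D)"
  have q: "polyfun (k - 1) q" unfolding q_def using x D by (intro poly) auto
  obtain \<delta> where \<delta>: "D / 12 \<le> \<delta>" "\<delta> \<le> D / 6" "\<And>y. y \<in> cube y0 (D / 2) \<Longrightarrow> F y = G q 6 \<delta> y"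
    using glued_eq_few_scales[OF D, of q] by blast
  define \<theta> where "\<theta> = 12 * norm h / D"
  have \<theta>: "0 < \<theta>" "\<theta> \<le> 1" using h D by (auto simp: \<theta>_def)
  define M0 where "M0 = Cp * (Cg * (C1 * K * \<omega> (20 * D)))"
  have M0: "M0 \<ge> 0"
    unfolding M0_def using Cp(1) Cg(1) C1_nonneg K \<omega>_pos[of "20 * D"] D(1) by (intro mult_nonneg_nonneg) auto
  have comp: "\<bar>(y0 + t *\<^sub>R h) $ i - y0 $ i\<bar> \<le> t * norm h" if "t \<ge> 0" for t i
    using that component_le_norm_cart[of h i] by (simp add: abs_mult mult_left_mono)
  have lev: "D / 12 \<le> 2 ^ a * \<delta>" "2 ^ a * \<delta> \<le> 32 / 6 * D" if "a < 6" for a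
  proof -
    have "1 * \<delta> \<le> 2 ^ a * \<delta>" using \<delta> D by (intro mult_right_mono) auto
    then show "D / 12 \<le> 2 ^ a * \<delta>" using \<delta> by simp
    have "2 ^ a * \<delta> \<le> 2 ^ 5 * (D / 6)"
      using that \<delta> D by (intro mult_mono power_increasing) auto
    then show "2 ^ a * \<delta> \<le> 32 / 6 * D" by simp
  qed
  have piece: "smooth_seq k \<theta> M0 (\<lambda>l. P (near_point X \<epsilon> m) \<epsilon> (y0 + real l *\<^sub>R h) - q (y0 + real l *\<^sub>R h))"
    if \<epsilon>: "D / 12 \<le> \<epsilon>" "\<epsilon> \<le> 32 / 6 * D" and m: "\<forall>i. \<bar>y0 $ i / \<epsilon> - of_int (m i)\<bar> \<le> 7" "near X \<epsilon> m" for \<epsilon> m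
  proof -
    have \<epsilon>0: "\<epsilon> > 0" using \<epsilon> D by linarith
    define z where "z = near_point X \<epsilon> m"
    have z: "z \<in> X" "z \<in> cube (lattice_point \<epsilon> m) (2 * \<epsilon>)" using near_point[OF m(2)] by (auto simp: z_def)
    have "y0 \<in> cube (lattice_point \<epsilon> m) (7 * \<epsilon>)" using m(1) lattice_point_mem_cube[OF \<epsilon>0] by blast
    with z(2) have zy: "z \<in> cube y0 (9 * \<epsilon>)"
      using cube_trans[of z _ "2 * \<epsilon>" y0 "7 * \<epsilon>"] by (simp add: cube_sym[of y0])
    have pz: "polyfun (k - 1) (\<lambda>w. P z \<epsilon> w - q w)" using z \<epsilon>0 q by (intro polyfun_diff poly) auto
    have "\<bar>P z \<epsilon> w - q w\<bar> \<le> C1 * K * \<omega> (20 * D)" if w: "w \<in> cube z \<epsilon>" for w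
      unfolding q_def
    proof (rule multiscale)
      show "w \<in> cube x (3 * (20 * D))"
        using cube_trans[OF cube_trans[OF w zy order_refl], of x "2 * D"] x(2) \<epsilon> D by (auto simp: cube_sym[of y0])
      show "w \<in> cube z (3 * \<epsilon>)" using w cube_mono[of \<epsilon> "3 * \<epsilon>" z] \<epsilon>0 by auto
    qed (use x z \<epsilon>0 \<epsilon> D in auto)
    then have g: "\<bar>P z \<epsilon> w - q w\<bar> \<le> Cg * (C1 * K * \<omega> (20 * D))" if "w \<in> cube z (10 * \<epsilon>)" for w
      using Cg(2)[OF pz \<epsilon>0 _ that] by blast
    show ?thesis
      unfolding M0_def z_def[symmetric]
    proof (rule Cp(2)[OF pz \<theta>], intro ballI g)
      \<comment> \<open>The segment of \<open>1 / \<theta>\<close> steps has length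
        \<open>D / 12 \<le> \<epsilon>\<close>, so it stays within \<open>10 * \<epsilon>\<close> of
        \<open>z\<close>; this is the factor 10 in \<open>Cg\<close>.\<close>
      fix t assume t: "t \<in> {0..1 / \<theta>}"
      have "t * norm h \<le> 1 / \<theta> * norm h" using t by (intro mult_right_mono) auto
      also have "\<dots> = D / 12" using h by (simp add: \<theta>_def)
      finally have "y0 + t *\<^sub>R h \<in> cube y0 \<epsilon>"
        using comp[of t] t \<epsilon> unfolding mem_cube by (meson atLeastAtMost_iff order_trans)
      then show "y0 + t *\<^sub>R h \<in> cube z (10 * \<epsilon>)"
        using cube_trans[of _ y0 \<epsilon> z "9 * \<epsilon>"] zy by (auto simp: cube_sym[of z])
    qed
  qed
  \<comment> \<open>Because \<open>q\<close> is also the base of the recursion, the induction starts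
    from the error 0.\<close>
  have main: "smooth_seq k \<theta> (E ^ N * M0) (\<lambda>l. G q N (2 ^ a * \<delta>) (y0 + real l *\<^sub>R h) - q (y0 + real l *\<^sub>R h))"
    if "a + N \<le> 6" for N a
    using that
  proof (induction N arbitrary: a)
    case 0
    then show ?case using M0 \<theta> by (auto intro: smooth_seq_zero)
  next
    case (Suc N)
    define \<epsilon> where "\<epsilon> = 2 ^ a * \<delta>"
    have \<epsilon>: "D / 12 \<le> \<epsilon>" "\<epsilon> \<le> 32 / 6 * D" "\<epsilon> > 0" using lev[of a] Suc.prems D by (auto simp: \<epsilon>_def)
    \<comment> \<open>The cells change along the sample points, so the sum is taken over one fixed
      set containing them all; the additional weights vanish.\<close>
    define I where "I = {m. \<forall>i. \<bar>y0 $ i / \<epsilon> - of_int (m i)\<bar> \<le> 7}"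
    have I: "finite I" "card I \<le> 15 ^ CARD('n)"
      unfolding I_def by (rule card_lattice_box)+
    define e where "e m l = (if near X \<epsilon> m then P (near_point X \<epsilon> m) \<epsilon> (y0 + real l *\<^sub>R h) - q (y0 + real l *\<^sub>R h)
        else G q N (2 * \<epsilon>) (y0 + real l *\<^sub>R h) - q (y0 + real l *\<^sub>R h))" for m l
    have EN: "M0 \<le> E ^ N * M0" using mult_right_mono[of 1 "E ^ N" M0] E_ge_1 M0 by simp
    have "smooth_seq k \<theta> (E ^ N * M0) (e m)" if "m \<in> I" for m
    proof (cases "near X \<epsilon> m")
      case True
      then have "e m = (\<lambda>l. P (near_point X \<epsilon> m) \<epsilon> (y0 + real l *\<^sub>R h) - q (y0 + real l *\<^sub>R h))"
        by (simp add: e_def fun_eq_iff)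
      with smooth_seq_mono[OF piece[OF \<epsilon>(1,2) _ True] EN] that \<theta> show ?thesis by (simp add: I_def)
    next
      case False
      have "2 * \<epsilon> = 2 ^ Suc a * \<delta>" by (simp add: \<epsilon>_def)
      moreover have "e m = (\<lambda>l. G q N (2 * \<epsilon>) (y0 + real l *\<^sub>R h) - q (y0 + real l *\<^sub>R h))"
        using False by (simp add: e_def fun_eq_iff)
      ultimately show ?thesis using Suc.IH[of "Suc a"] Suc.prems by (simp add: mult.assoc)
    qed
    moreover have "smooth_seq k \<theta> ((2 ^ k * B) ^ CARD('n)) (\<lambda>l. tensor_bump \<beta> \<epsilon> m (y0 + real l *\<^sub>R h))" for m
    proof (rule tensor_bump_smooth[OF \<epsilon>(3)])
      have "norm h / \<epsilon> \<le> norm h / (D / 12)" using \<epsilon> D by (intro divide_left_mono) auto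
      then show "norm h / \<epsilon> \<le> \<theta>" by (simp add: \<theta>_def mult.commute)
    qed
    ultimately have "smooth_seq k \<theta> (real (card I) * (2 ^ k * (2 ^ k * B) ^ CARD('n) * (E ^ N * M0)))
        (\<lambda>l. \<Sum>m\<in>I. tensor_bump \<beta> \<epsilon> m (y0 + real l *\<^sub>R h) * e m l)"
      using \<theta> by (intro smooth_seq_sum I smooth_seq_mult) auto
    moreover have "real (card I) * (2 ^ k * (2 ^ k * B) ^ CARD('n) * (E ^ N * M0)) \<le> E ^ Suc N * M0"
    proof -
      have "real (card I) \<le> 15 ^ CARD('n)" using I(2) by (metis of_nat_le_iff of_nat_numeral of_nat_power)
      then have "real (card I) * (2 ^ k * (2 ^ k * B) ^ CARD('n)) \<le> 15 ^ CARD('n) * (2 ^ k * (2 ^ k * B) ^ CARD('n))"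
        using B_nonneg by (intro mult_right_mono) auto
      also have "\<dots> \<le> E" by (simp add: E_def)
      finally have "real (card I) * (2 ^ k * (2 ^ k * B) ^ CARD('n)) * (E ^ N * M0) \<le> E * (E ^ N * M0)"
        using E_ge_1 M0 by (intro mult_right_mono) auto
      then show ?thesis by (simp add: mult.assoc)
    qed
    ultimately have "smooth_seq k \<theta> (E ^ Suc N * M0) (\<lambda>l. \<Sum>m\<in>I. tensor_bump \<beta> \<epsilon> m (y0 + real l *\<^sub>R h) * e m l)"
      using \<theta> by (intro smooth_seq_mono[of k \<theta> _ _ "E ^ Suc N * M0"]) auto
    then show ?case
    proof (rule smooth_seq_cong[THEN iffD1, rotated])
      fix l assume l: "l \<le> k"
      let ?y = "y0 + real l *\<^sub>R h"
      have sub: "cells \<epsilon> ?y \<subseteq> I"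
      proof
        fix m assume m: "m \<in> cells \<epsilon> ?y"
        show "m \<in> I" unfolding I_def mem_Collect_eq
        proof
          fix i
          have "\<bar>?y $ i - y0 $ i\<bar> \<le> real l * norm h" by (rule comp) simp
          also have "\<dots> \<le> real k * norm h" using l by (intro mult_right_mono) auto
          also have "\<dots> \<le> 6 * \<epsilon>" using h \<epsilon> by linarith
          finally have "\<bar>?y $ i - y0 $ i\<bar> / \<epsilon> \<le> 6" using \<epsilon>(3) by (simp add: pos_divide_le_eq)
          then have "\<bar>?y $ i / \<epsilon> - y0 $ i / \<epsilon>\<bar> \<le> 6" using \<epsilon>(3) by (simp add: diff_divide_distrib[symmetric])
          with cells_dist[OF m, of i] show "\<bar>y0 $ i / \<epsilon> - of_int (m i)\<bar> \<le> 7" by linarith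
        qed
      qed
      have "(\<Sum>m\<in>I. tensor_bump \<beta> \<epsilon> m ?y * e m l) = (\<Sum>m\<in>cells \<epsilon> ?y. tensor_bump \<beta> \<epsilon> m ?y * e m l)"
        using sub I(1) by (intro sum.mono_neutral_right) (auto simp: tensor_bump_outside)
      also have "\<dots> = (\<Sum>m\<in>cells \<epsilon> ?y. tensor_bump \<beta> \<epsilon> m ?y *
          (if near X \<epsilon> m then P (near_point X \<epsilon> m) \<epsilon> ?y else G q N (2 * \<epsilon>) ?y) - tensor_bump \<beta> \<epsilon> m ?y * q ?y)"
        by (intro sum.cong refl) (auto simp: e_def right_diff_distrib)
      also have "\<dots> = G q (Suc N) \<epsilon> ?y - q ?y"
        using tensor_bump_sum[of \<epsilon> ?y] by (simp add: sum_subtractf flip: sum_distrib_right)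
      finally show "(\<Sum>m\<in>I. tensor_bump \<beta> \<epsilon> m ?y * e m l) = G q (Suc N) (2 ^ a * \<delta>) ?y - q ?y"
        by (simp only: \<epsilon>_def)
    qed
  qed
  have "smooth_seq k \<theta> (E ^ 6 * M0) (\<lambda>l. F (y0 + real l *\<^sub>R h) - q (y0 + real l *\<^sub>R h))"
  proof (rule smooth_seq_cong[THEN iffD1, OF _ main[of 0 6]])
    fix l assume l: "l \<le> k"
    have "\<bar>(y0 + real l *\<^sub>R h) $ i - y0 $ i\<bar> \<le> D / 2" for i
    proof -
      have "\<bar>(y0 + real l *\<^sub>R h) $ i - y0 $ i\<bar> \<le> real l * norm h" by (rule comp) simp
      also have "\<dots> \<le> real k * norm h" using l by (intro mult_right_mono) auto
      finally show ?thesis using h by linarith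
    qed
    then have "y0 + real l *\<^sub>R h \<in> cube y0 (D / 2)" by (simp only: mem_cube simp_thms)
    from \<delta>(3)[OF this] show "G q 6 (2 ^ 0 * \<delta>) (y0 + real l *\<^sub>R h) - q (y0 + real l *\<^sub>R h) =
      F (y0 + real l *\<^sub>R h) - q (y0 + real l *\<^sub>R h)" by simp
  qed simp
  then have "\<bar>finite_diff k h (\<lambda>y. F y - q y) y0\<bar> \<le> E ^ 6 * M0 * \<theta> ^ k"
    by (rule smooth_seq_finite_diff)
  then have "\<bar>finite_diff k h F y0\<bar> \<le> E ^ 6 * M0 * \<theta> ^ k"
    using finite_diff_polyfun[OF q, of k h y0] k by (simp add: finite_diff_diff)
  also have "\<dots> \<le> E ^ 6 * (Cp * (Cg * (C1 * K * (20 ^ k * \<omega> D)))) * \<theta> ^ k"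
    unfolding M0_def using quasipower_majorant_scale[OF \<omega> D(1), of 20] E_ge_1 Cp(1) Cg(1) C1_nonneg K \<theta>
    by (intro mult_right_mono mult_left_mono) auto
  also have "\<dots> = C2 * K * \<omega> D * (norm h / D) ^ k"
    by (simp add: C2_def \<theta>_def power_mult_distrib power_divide mult_ac)
  finally show ?thesis .
qed

text \<open>The multiple of \<open>norm h\<close> up to which \<open>X\<close> counts as near. Its
  two entries give \<open>norm h \<le> \<rho> / 12\<close> and
  \<open>real k * norm h \<le> \<rho> / 2\<close>, as \<open>finite_diff_far\<close>
  requires.\<close>

definition A where "A = max 12 (2 * real k)"

definition C3 where "C3 = max C2 (2 ^ k * (C1 * (2 * A) ^ k))"

lemma C3_bounds: "C3 \<ge> 0" "C1 \<le> C3"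
proof -
  show "C3 \<ge> 0" using C2_nonneg by (simp add: C3_def)
  have "1 * (C1 * 1) \<le> 2 ^ k * (C1 * (2 * A) ^ k)"
    using C1_nonneg by (intro mult_mono one_le_power) (auto simp: A_def)
  then show "C1 \<le> C3" by (simp add: C3_def)
qed

lemma glued_near':
  assumes "x \<in> X" "r > 0" "y \<in> cube x r"
  shows "\<bar>F y - P x r y\<bar> \<le> C3 * K * \<omega> r"
proof -
  have "C1 * (K * \<omega> r) \<le> C3 * (K * \<omega> r)"
    using C3_bounds K \<omega>_pos[OF assms(2)] by (intro mult_right_mono) auto
  with glued_near[OF assms] show ?thesis by (simp add: mult.assoc)
qed

text \<open>If \<open>X\<close> meets the cube of radius \<open>\<rho>\<close>, all sample values
  are close to one local polynomial and can be estimated separately. Otherwise \<open>D\<close> is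
  the distance to \<open>X\<close> up to a factor 2 and \<open>finite_diff_far\<close>
  applies.\<close>

lemma finite_diff_glued:
  assumes h: "h \<noteq> 0"
  shows "\<bar>finite_diff k h F y0\<bar> \<le> C3 * K * \<omega> (norm h)"
proof -
  define \<rho> where "\<rho> = A * norm h"
  have A: "A \<ge> 12" "A \<ge> 2 * real k" by (auto simp: A_def)
  have \<rho>: "\<rho> > 0" "norm h \<le> \<rho> / 12" "real k * norm h \<le> \<rho> / 2"
    using h A mult_right_mono[OF A(1), of "norm h"] mult_right_mono[OF A(2), of "norm h"]
    by (auto simp: \<rho>_def)
  show ?thesis
  proof (cases "X \<inter> cube y0 \<rho> = {}")
    case False
    then obtain x where x: "x \<in> X" "x \<in> cube y0 \<rho>" by blast
    have "\<bar>finite_diff k h (\<lambda>y. F y - P x (2 * \<rho>) y) y0\<bar> \<le> 2 ^ k * (C1 * K * \<omega> (2 * \<rho>))"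
    proof (rule finite_diff_bound)
      fix j assume j: "j \<le> k"
      have "\<bar>(y0 + real j *\<^sub>R h) $ i - y0 $ i\<bar> \<le> \<rho>" for i
      proof -
        have "\<bar>(y0 + real j *\<^sub>R h) $ i - y0 $ i\<bar> \<le> real j * norm h"
          using component_le_norm_cart[of h i] by (simp add: abs_mult mult_left_mono)
        also have "\<dots> \<le> real k * norm h" using j by (intro mult_right_mono) auto
        finally show ?thesis using \<rho> by linarith
      qed
      then have "y0 + real j *\<^sub>R h \<in> cube y0 \<rho>" by (simp only: mem_cube simp_thms)
      from cube_trans[OF this, of x \<rho> "2 * \<rho>"] x(2)
      show "\<bar>F (y0 + real j *\<^sub>R h) - P x (2 * \<rho>) (y0 + real j *\<^sub>R h)\<bar> \<le> C1 * K * \<omega> (2 * \<rho>)"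
        using \<rho>(1) x(1) by (intro glued_near) (auto simp: cube_sym[of y0])
    qed
    moreover have "finite_diff k h (P x (2 * \<rho>)) y0 = 0"
      using x \<rho> k by (intro finite_diff_polyfun[OF poly]) auto
    ultimately have "\<bar>finite_diff k h F y0\<bar> \<le> 2 ^ k * (C1 * K * \<omega> (2 * \<rho>))"
      by (simp add: finite_diff_diff)
    also have "\<dots> \<le> 2 ^ k * (C1 * K * ((2 * A) ^ k * \<omega> (norm h)))"
      using quasipower_majorant_scale[OF \<omega>, of "norm h" "2 * A"] h A C1_nonneg K
      by (intro mult_left_mono) (auto simp: \<rho>_def mult.assoc)
    also have "\<dots> = (2 ^ k * (C1 * (2 * A) ^ k)) * K * \<omega> (norm h)" by (simp add: mult_ac)
    also have "\<dots> \<le> C3 * K * \<omega> (norm h)"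
      using K \<omega>_pos[of "norm h"] h by (intro mult_right_mono) (auto simp: C3_def)
    finally show ?thesis .
  next
    case True
    define a where "a = (LEAST a. X \<inter> cube y0 (2 ^ a * \<rho>) \<noteq> {})"
    obtain a' where "X \<inter> cube y0 (2 ^ a' * \<rho>) \<noteq> {}" using near_X_scale[OF \<rho>(1)] by blast
    then have a: "X \<inter> cube y0 (2 ^ a * \<rho>) \<noteq> {}"
      unfolding a_def by (rule LeastI[of "\<lambda>a. X \<inter> cube y0 (2 ^ a * \<rho>) \<noteq> {}"])
    obtain b where b: "a = Suc b" using a True by (cases a) auto
    have b': "X \<inter> cube y0 (2 ^ b * \<rho>) = {}"
      using not_less_Least[of b "\<lambda>a. X \<inter> cube y0 (2 ^ a * \<rho>) \<noteq> {}"] b by (auto simp: a_def)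
    define D where "D = 2 ^ b * \<rho>"
    have "1 * \<rho> \<le> 2 ^ b * \<rho>" using \<rho>(1) by (intro mult_right_mono) auto
    then have D: "\<rho> \<le> D" by (simp add: D_def)
    have "\<bar>finite_diff k h F y0\<bar> \<le> C2 * K * \<omega> D * (norm h / D) ^ k"
    proof (rule finite_diff_far)
      show "X \<inter> cube y0 D = {}" using b' by (simp add: D_def)
      show "X \<inter> cube y0 (2 * D) \<noteq> {}" using a by (simp add: D_def b mult.assoc)
    qed (use D \<rho> h in auto)
    also have "\<omega> D * (norm h / D) ^ k \<le> \<omega> (norm h)"
      using quasipower_majorantD(3)[OF \<omega>, of "norm h" D] h D \<rho> by (simp add: power_divide field_simps)
    then have "C2 * K * \<omega> D * (norm h / D) ^ k \<le> C2 * K * \<omega> (norm h)"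
      using C2_nonneg K unfolding mult.assoc by (intro mult_left_mono) auto
    also have "\<dots> \<le> C3 * K * \<omega> (norm h)"
      using K \<omega>_pos[of "norm h"] h by (intro mult_right_mono) (auto simp: C3_def)
    finally show ?thesis .
  qed
qed

end

text \<open>\<open>\<beta>\<close> and \<open>C\<close> are chosen before \<open>X\<close>,
  \<open>P\<close> and \<open>K\<close>: one fixed \<open>\<beta>\<close> lets \<open>glued\<close>
  depend linearly on \<open>P\<close>, and a constant independent of \<open>K\<close> turns the
  estimates into boundedness of an operator.\<close>

theorem gluing_theorem:
  fixes \<omega> :: "real \<Rightarrow> real"
  assumes k: "1 \<le> k" and \<omega>: "quasipower_majorant k \<omega>"
  shows "\<exists>\<beta> C. C \<ge> 0 \<and> (\<forall>(X :: (real ^ 'n::finite) set) P K. X \<noteq> {} \<longrightarrow> K \<ge> 0 \<longrightarrow>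
    (\<forall>x\<in>X. \<forall>r>0. polyfun (k - 1) (P x r)) \<longrightarrow>
    (\<forall>x\<in>X. \<forall>x'\<in>X. \<forall>r r' y. 0 < r \<longrightarrow> r \<le> r' \<longrightarrow> r' \<le> 2 * r \<longrightarrow> y \<in> cube x (3 * r) \<longrightarrow> y \<in> cube x' (3 * r') \<longrightarrow>
       \<bar>P x r y - P x' r' y\<bar> \<le> K * \<omega> r') \<longrightarrow>
    (\<forall>x\<in>X. \<forall>r>0. \<forall>y\<in>cube x r. \<bar>glued \<beta> X P y - P x r y\<bar> \<le> C * K * \<omega> r) \<and>
    (\<forall>h y. h \<noteq> 0 \<longrightarrow> \<bar>finite_diff k h (glued \<beta> X P) y\<bar> \<le> C * K * \<omega> (norm h)) \<and>
    (\<forall>y. convergent (\<lambda>N. glue \<beta> X P (\<lambda>_. 0) (2 * N) ((1 / 2) ^ N) y)))"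
proof -
  obtain \<beta> B where \<beta>: "bump \<beta> k B" using bump_ex by blast
  obtain CS where CS: "CS \<ge> 0" "\<And>r N. r > 0 \<Longrightarrow> (\<Sum>l<N. \<omega> (r / 2 ^ l)) \<le> CS * \<omega> r"
    using quasipower_majorant_sum[OF \<omega>] by blast
  obtain Cg where Cg: "Cg \<ge> 1" "\<And>(p :: real ^ 'n \<Rightarrow> real) x r M y. polyfun (k - 1) p \<Longrightarrow> r > 0 \<Longrightarrow>
      (\<forall>y\<in>cube x r. \<bar>p y\<bar> \<le> M) \<Longrightarrow> y \<in> cube x (10 * r) \<Longrightarrow> \<bar>p y\<bar> \<le> Cg * M"
    using polyfun_growth[of 10 "k - 1", where 'n = 'n] by auto
  obtain Cp where Cp: "Cp \<ge> 0" "\<And>(p :: real ^ 'n \<Rightarrow> real) y h M \<theta>. polyfun (k - 1) p \<Longrightarrow> 0 < \<theta> \<Longrightarrow> \<theta> \<le> 1 \<Longrightarrow>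
      (\<forall>t\<in>{0..1/\<theta>}. \<bar>p (y + t *\<^sub>R h)\<bar> \<le> M) \<Longrightarrow> smooth_seq k \<theta> (Cp * M) (\<lambda>l. p (y + real l *\<^sub>R h))"
    using polyfun_smooth_seq[of "k - 1" k, where 'n = 'n] by blast
  have gluing: "gluing \<beta> k B X P \<omega> K CS Cg Cp" if "X \<noteq> {}" "K \<ge> 0" "\<forall>x\<in>X. \<forall>r>0. polyfun (k - 1) (P x r)"
    "\<forall>x\<in>X. \<forall>x'\<in>X. \<forall>r r' y. 0 < r \<longrightarrow> r \<le> r' \<longrightarrow> r' \<le> 2 * r \<longrightarrow> y \<in> cube x (3 * r) \<longrightarrow> y \<in> cube x' (3 * r') \<longrightarrow>
       \<bar>P x r y - P x' r' y\<bar> \<le> K * \<omega> r'" for X :: "(real ^ 'n) set" and P K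
    using that \<beta> k \<omega> CS Cg Cp by (intro gluing.intro gluing_axioms.intro) auto
  show ?thesis
  proof (intro exI[of _ \<beta>] exI[of _ "gluing.C3 TYPE('n) k B CS Cg Cp"] conjI allI impI)
    \<comment> \<open>\<open>C3\<close> involves neither the set nor the polynomials, so a trivial
      instance shows its sign.\<close>
    have "gluing \<beta> k B (UNIV :: (real ^ 'n) set) (\<lambda>_ _ _. 0) \<omega> 0 CS Cg Cp"
      by (rule gluing) (auto intro: polyfun.const)
    then show "0 \<le> gluing.C3 TYPE('n) k B CS Cg Cp" by (rule gluing.C3_bounds)
  qed (use gluing.finite_diff_glued[OF gluing] gluing.glue_convergent[OF gluing]
        gluing.glued_near'[OF gluing] in auto)
qed

section \<open>Borel sets are Hausdorff measurable\<close>

lemma hausdorff_pre_antimono: "\<delta> \<le> \<delta>' \<Longrightarrow> hausdorff_pre s \<delta>' A \<le> hausdorff_pre s \<delta> A"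
  unfolding hausdorff_pre_def by (rule INF_superset_mono) (auto intro: order_trans)

text \<open>A set of diameter at most \<open>\<delta> < \<eta>\<close> cannot meet both
  \<open>A\<close> and \<open>B\<close>, so every cover splits in two. Members that miss the set in
  question are replaced by the empty set, which costs 0.\<close>

lemma hausdorff_pre_separated:
  assumes "\<delta> < \<eta>" "\<And>x y. x \<in> A \<Longrightarrow> y \<in> B \<Longrightarrow> \<eta> \<le> dist x y"
  shows "hausdorff_pre s \<delta> A + hausdorff_pre s \<delta> B \<le> hausdorff_pre s \<delta> (A \<union> B)"
  unfolding hausdorff_pre_def[of s \<delta> "A \<union> B"]
proof (rule INF_greatest)
  fix U assume "U \<in> {U :: nat \<Rightarrow> 'a set. A \<union> B \<subseteq> (\<Union>i. U i) \<and> (\<forall>i. bounded (U i) \<and> diameter (U i) \<le> \<delta>)}"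
  then have U: "A \<union> B \<subseteq> (\<Union>i. U i)" "\<And>i. bounded (U i)" "\<And>i. diameter (U i) \<le> \<delta>" by auto
  define V where "V C i = (if U i \<inter> C \<noteq> {} then U i else {})" for C i
  have le: "hausdorff_pre s \<delta> C \<le> (\<Sum>i. ennreal (diameter (V C i) powr s))" if "C = A \<or> C = B" for C
  proof -
    have "0 \<le> \<delta>" using U(3)[of undefined] diameter_ge_0[OF U(2)] order_trans by blast
    moreover have "C \<subseteq> (\<Union>i. V C i)"
    proof
      fix x assume x: "x \<in> C"
      then have "x \<in> (\<Union>i. U i)" using U(1) that by auto
      then obtain i where "x \<in> U i" by blast
      with x show "x \<in> (\<Union>i. V C i)" by (auto simp: V_def intro!: exI[of _ i])
    qed
    ultimately show ?thesis
      unfolding hausdorff_pre_def using U(2,3) by (intro INF_lower) (auto simp: V_def)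
  qed
  have "hausdorff_pre s \<delta> A + hausdorff_pre s \<delta> B \<le>
      (\<Sum>i. ennreal (diameter (V A i) powr s)) + (\<Sum>i. ennreal (diameter (V B i) powr s))"
    by (intro add_mono le) auto
  also have "\<dots> = (\<Sum>i. ennreal (diameter (V A i) powr s) + ennreal (diameter (V B i) powr s))"
    by (rule suminf_add) auto
  also have "\<dots> \<le> (\<Sum>i. ennreal (diameter (U i) powr s))"
  proof (intro suminf_le)
    fix i
    have "U i \<inter> A = {} \<or> U i \<inter> B = {}"
    proof (rule ccontr)
      assume "\<not> ?thesis"
      then obtain x y where xy: "x \<in> U i" "x \<in> A" "y \<in> U i" "y \<in> B" by auto
      have "dist x y \<le> diameter (U i)" by (rule diameter_bounded_bound[OF U(2) xy(1,3)])
      with U(3)[of i] assms(1) assms(2)[OF xy(2,4)] show False by linarith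
    qed
    then show "ennreal (diameter (V A i) powr s) + ennreal (diameter (V B i) powr s) \<le> ennreal (diameter (U i) powr s)"
      by (auto simp: V_def)
  qed auto
  finally show "hausdorff_pre s \<delta> A + hausdorff_pre s \<delta> B \<le> (\<Sum>i. ennreal (diameter (U i) powr s))" .
qed

lemma hausdorff_outer_separated:
  assumes "\<eta> > 0" "\<And>x y. x \<in> A \<Longrightarrow> y \<in> B \<Longrightarrow> \<eta> \<le> dist x y"
  shows "hausdorff_outer s A + hausdorff_outer s B \<le> hausdorff_outer s (A \<union> B)"
proof -
  have "hausdorff_outer s A + hausdorff_outer s B =
      (SUP \<delta>\<in>{0<..}. hausdorff_pre s \<delta> A + hausdorff_pre s \<delta> B)"
    unfolding hausdorff_outer_def
  proof (rule SUP_add_directed_ennreal[symmetric])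
    fix \<delta> \<delta>' :: real assume "\<delta> \<in> {0<..}" "\<delta>' \<in> {0<..}"
    then show "\<exists>k\<in>{0<..}. hausdorff_pre s \<delta> A + hausdorff_pre s \<delta>' B \<le> hausdorff_pre s k A + hausdorff_pre s k B"
      by (intro bexI[of _ "min \<delta> \<delta>'"] add_mono hausdorff_pre_antimono) auto
  qed
  also have "\<dots> \<le> hausdorff_outer s (A \<union> B)"
  proof (rule SUP_least)
    fix \<delta> :: real assume \<delta>: "\<delta> \<in> {0<..}"
    define \<delta>' where "\<delta>' = min \<delta> (\<eta> / 2)"
    have "hausdorff_pre s \<delta> A + hausdorff_pre s \<delta> B \<le> hausdorff_pre s \<delta>' A + hausdorff_pre s \<delta>' B"
      by (intro add_mono hausdorff_pre_antimono) (auto simp: \<delta>'_def)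
    also have "\<dots> \<le> hausdorff_pre s \<delta>' (A \<union> B)"
      by (rule hausdorff_pre_separated[OF _ assms(2)]) (use assms(1) in \<open>auto simp: \<delta>'_def\<close>)
    also have "\<dots> \<le> hausdorff_outer s (A \<union> B)"
      unfolding hausdorff_outer_def by (rule SUP_upper) (use \<delta> assms(1) in \<open>auto simp: \<delta>'_def\<close>)
    finally show "hausdorff_pre s \<delta> A + hausdorff_pre s \<delta> B \<le> hausdorff_outer s (A \<union> B)" .
  qed
  finally show ?thesis .
qed

lemma hausdorff_outer_UN:
  fixes A :: "nat \<Rightarrow> 'a::metric_space set"
  shows "hausdorff_outer s (\<Union>i. A i) \<le> (\<Sum>i. hausdorff_outer s (A i))"
  unfolding hausdorff_outer_def[of s "\<Union>i. A i"]
proof (rule SUP_least)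
  fix \<delta> :: real assume "\<delta> \<in> {0<..}"
  then have "hausdorff_pre s \<delta> (A i) \<le> hausdorff_outer s (A i)" for i
    unfolding hausdorff_outer_def by (rule SUP_upper)
  then have "(\<Sum>i. hausdorff_pre s \<delta> (A i)) \<le> (\<Sum>i. hausdorff_outer s (A i))"
    by (intro suminf_le) auto
  with hausdorff_pre_UN[of s \<delta> A] show "hausdorff_pre s \<delta> (\<Union>i. A i) \<le> (\<Sum>i. hausdorff_outer s (A i))"
    by (rule order_trans)
qed

lemma hausdorff_outer_Un: "hausdorff_outer s (A \<union> B) \<le> hausdorff_outer s A + hausdorff_outer s B"
proof -
  have "hausdorff_outer s (A \<union> B) = hausdorff_outer s (\<Union>i. binaryset A B i)"
    by (simp add: UN_binaryset_eq)
  also have "\<dots> \<le> (\<Sum>i. hausdorff_outer s (binaryset A B i))" by (rule hausdorff_outer_UN)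
  also have "\<dots> = hausdorff_outer s A + hausdorff_outer s B"
    by (rule suminf_binaryset_eq) (rule hausdorff_outer_empty)
  finally show ?thesis .
qed

lemma hausdorff_outer_finite_UN:
  "finite I \<Longrightarrow> hausdorff_outer s (\<Union>i\<in>I. A i) \<le> (\<Sum>i\<in>I. hausdorff_outer s (A i))"
proof (induction I rule: finite_induct)
  case (insert i I)
  have "hausdorff_outer s (\<Union>i\<in>insert i I. A i) \<le> hausdorff_outer s (A i) + hausdorff_outer s (\<Union>i\<in>I. A i)"
    by (simp add: hausdorff_outer_Un)
  also have "\<dots> \<le> hausdorff_outer s (A i) + (\<Sum>i\<in>I. hausdorff_outer s (A i))"
    by (intro add_left_mono insert.IH)
  finally show ?case using insert.hyps by simp
qed (simp add: hausdorff_outer_empty)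

text \<open>Caratheodory's ring argument. The rings \<open>R j\<close>, at distance about
  \<open>1 / j\<close> from \<open>F\<close>, are separated from each other within one parity class,
  so their measures form a convergent series. Its tails bound what \<open>T j\<close>, a set at
  positive distance from \<open>F\<close>, misses of \<open>S - F\<close>.\<close>

lemma hausdorff_outer_closed_split:
  assumes F: "closed F" "F \<noteq> {}"
  shows "hausdorff_outer s (S \<inter> F) + hausdorff_outer s (S - F) \<le> hausdorff_outer s S"
proof (cases "hausdorff_outer s S = \<infinity>")
  case False
  define R where "R j = {x \<in> S. 1 / (real j + 2) \<le> infdist x F \<and> infdist x F < 1 / (real j + 1)}" for j :: nat
  define T where "T j = {x \<in> S. 1 / (real j + 1) \<le> infdist x F}" for j :: nat
  have R_sum: "(\<Sum>i<N. hausdorff_outer s (R (2 * i + c))) \<le> hausdorff_outer s (\<Union>i<N. R (2 * i + c))" for N c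
  proof (induction N)
    case (Suc N)
    define t where "t = real (2 * N + c)"
    have "hausdorff_outer s (R (2 * N + c)) + hausdorff_outer s (\<Union>i<N. R (2 * i + c)) \<le>
        hausdorff_outer s (R (2 * N + c) \<union> (\<Union>i<N. R (2 * i + c)))"
    \<comment> \<open>For \<open>N = 0\<close> the union is empty; otherwise
      \<open>t \<ge> 2\<close>, so \<open>1 / t - 1 / (t + 1)\<close> is a genuine gap between the
      rings.\<close>
    proof (cases "N = 0")
      case False
      have t: "t \<ge> 2" using False by (simp add: t_def)
      show ?thesis
      proof (rule hausdorff_outer_separated)
        show "0 < 1 / t - 1 / (t + 1)" using t by (simp add: field_simps add_pos_pos)
        fix x y assume x: "x \<in> R (2 * N + c)" and "y \<in> (\<Union>i<N. R (2 * i + c))"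
        then obtain i where i: "i < N" "y \<in> R (2 * i + c)" by auto
        have "1 / t \<le> 1 / (real (2 * i + c) + 2)" using i by (intro divide_left_mono) (auto simp: t_def)
        also have "\<dots> \<le> infdist y F" using i by (simp add: R_def)
        also have "\<dots> \<le> infdist x F + dist y x" by (rule infdist_triangle)
        also have "infdist x F \<le> 1 / (t + 1)" using x by (auto simp: R_def t_def)
        finally show "1 / t - 1 / (t + 1) \<le> dist x y" by (simp add: dist_commute)
      qed
    qed (simp add: hausdorff_outer_empty)
    moreover have "R (2 * N + c) \<union> (\<Union>i<N. R (2 * i + c)) = (\<Union>i<Suc N. R (2 * i + c))"
      by (auto simp: lessThan_Suc)
    ultimately have step: "hausdorff_outer s (R (2 * N + c)) + hausdorff_outer s (\<Union>i<N. R (2 * i + c)) \<le>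
        hausdorff_outer s (\<Union>i<Suc N. R (2 * i + c))" by simp
    have "(\<Sum>i<Suc N. hausdorff_outer s (R (2 * i + c))) =
        hausdorff_outer s (R (2 * N + c)) + (\<Sum>i<N. hausdorff_outer s (R (2 * i + c)))"
      by (simp add: add.commute)
    also have "\<dots> \<le> hausdorff_outer s (R (2 * N + c)) + hausdorff_outer s (\<Union>i<N. R (2 * i + c))"
      by (intro add_left_mono Suc.IH)
    finally show ?case using step by (rule order_trans)
  qed simp
  have fin: "hausdorff_outer s (R j) \<noteq> \<infinity>" for j
    using hausdorff_outer_mono[of "R j" S s] False by (auto simp: R_def top_unique)
  define \<rho> where "\<rho> j = enn2real (hausdorff_outer s (R j))" for j
  have \<rho>: "hausdorff_outer s (R j) = ennreal (\<rho> j)" for j using fin[of j] by (simp add: \<rho>_def less_top)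
  have \<rho>0: "\<rho> j \<ge> 0" for j by (simp add: \<rho>_def)
  have bound: "(\<Sum>i<N. \<rho> (2 * i + c)) \<le> enn2real (hausdorff_outer s S)" for N c
  proof -
    have "ennreal (\<Sum>i<N. \<rho> (2 * i + c)) = (\<Sum>i<N. hausdorff_outer s (R (2 * i + c)))"
      by (simp add: \<rho> \<rho>0 sum_ennreal)
    also have "\<dots> \<le> hausdorff_outer s (\<Union>i<N. R (2 * i + c))" by (rule R_sum)
    also have "\<dots> \<le> hausdorff_outer s S" by (rule hausdorff_outer_mono) (auto simp: R_def)
    also have "\<dots> = ennreal (enn2real (hausdorff_outer s S))" using False by (simp add: less_top)
    finally show ?thesis by (subst (asm) ennreal_le_iff) auto
  qed
  have summable: "summable \<rho>"
  proof (rule summableI_nonneg_bounded[OF \<rho>0])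
    fix N
    have "(\<Sum>i<N. \<rho> i) \<le> (\<Sum>i<2 * N. \<rho> i)" using \<rho>0 by (intro sum_mono2) auto
    also have "\<dots> = (\<Sum>i<N. \<rho> (2 * i + 0)) + (\<Sum>i<N. \<rho> (2 * i + 1))"
      by (induction N) auto
    also have "\<dots> \<le> enn2real (hausdorff_outer s S) + enn2real (hausdorff_outer s S)"
      by (intro add_mono bound)
    finally show "(\<Sum>i<N. \<rho> i) \<le> enn2real (hausdorff_outer s S) + enn2real (hausdorff_outer s S)" .
  qed
  show ?thesis
  proof (rule ennreal_le_epsilon)
    fix e :: real assume e: "e > 0"
    obtain j where j: "norm (\<Sum>i. \<rho> (i + j)) < e" using suminf_exist_split[OF e summable] by blast
    have "S - F \<subseteq> T j \<union> (\<Union>i. R (i + j))"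
    proof
      fix x assume x: "x \<in> S - F"
      have d: "infdist x F > 0"
        using x F by (simp add: infdist_pos_not_in_closed)
      show "x \<in> T j \<union> (\<Union>i. R (i + j))"
      proof (cases "1 / (real j + 1) \<le> infdist x F")
        case False
        \<comment> \<open>The ring of \<open>x\<close>: the index with
          \<open>J + 1 < 1 / infdist x F \<le> J + 2\<close>.\<close>
        define J where "J = nat \<lceil>1 / infdist x F\<rceil> - 2"
        have "real j + 1 < 1 / infdist x F" using False d by (simp add: field_simps)
        then have J: "int J = \<lceil>1 / infdist x F\<rceil> - 2" "j \<le> J" unfolding J_def by linarith+
        have "real J + 1 < 1 / infdist x F" "1 / infdist x F \<le> real J + 2" using J(1) by linarith+
        then have "x \<in> R J" using x d by (simp add: R_def field_simps)
        moreover have "J = (J - j) + j" using J(2) by simp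
        ultimately have "x \<in> (\<Union>i. R (i + j))" by (metis UNIV_I UN_iff)
        then show ?thesis ..
      qed (use x in \<open>auto simp: T_def\<close>)
    qed
    then have "hausdorff_outer s (S - F) \<le> hausdorff_outer s (T j) + hausdorff_outer s (\<Union>i. R (i + j))"
      using hausdorff_outer_mono hausdorff_outer_Un order_trans by meson
    also have "hausdorff_outer s (\<Union>i. R (i + j)) \<le> (\<Sum>i. hausdorff_outer s (R (i + j)))"
      by (rule hausdorff_outer_UN)
    also have "\<dots> = ennreal (\<Sum>i. \<rho> (i + j))"
      unfolding \<rho> using \<rho>0 summable by (intro suminf_ennreal2) (auto simp: summable_iff_shift)
    also have "\<dots> \<le> ennreal e" using j by (intro ennreal_leI) auto
    finally have "hausdorff_outer s (S - F) \<le> hausdorff_outer s (T j) + ennreal e"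
      by (simp add: add_left_mono)
    then have "hausdorff_outer s (S \<inter> F) + hausdorff_outer s (S - F) \<le>
        (hausdorff_outer s (S \<inter> F) + hausdorff_outer s (T j)) + ennreal e"
      by (simp add: add.assoc add_left_mono)
    also have "hausdorff_outer s (S \<inter> F) + hausdorff_outer s (T j) \<le> hausdorff_outer s (S \<inter> F \<union> T j)"
    proof (rule hausdorff_outer_separated)
      show "0 < 1 / (real j + 1)" by simp
      fix x y assume "x \<in> S \<inter> F" "y \<in> T j"
      then show "1 / (real j + 1) \<le> dist x y"
        using infdist_le[of x F y] by (auto simp: T_def dist_commute)
    qed
    also have "\<dots> \<le> hausdorff_outer s S" by (rule hausdorff_outer_mono) (auto simp: T_def)
    finally show "hausdorff_outer s (S \<inter> F) + hausdorff_outer s (S - F) \<le> hausdorff_outer s S + ennreal e"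
      by (simp add: add_right_mono)
  qed
qed simp

lemma closed_in_sets_hausdorff_on:
  assumes "closed F"
  shows "F \<inter> A \<in> sets (hausdorff_on s A)"
proof (cases "F = {}")
  case False
  have "hausdorff_outer s (F \<inter> A \<inter> S) + hausdorff_outer s ((A - F \<inter> A) \<inter> S) = hausdorff_outer s S"
    if "S \<subseteq> A" for S
  proof (rule antisym)
    have eq: "F \<inter> A \<inter> S = S \<inter> F" "(A - F \<inter> A) \<inter> S = S - F" using that by auto
    show "hausdorff_outer s (F \<inter> A \<inter> S) + hausdorff_outer s ((A - F \<inter> A) \<inter> S) \<le> hausdorff_outer s S"
      unfolding eq by (rule hausdorff_outer_closed_split[OF assms False])
    have "(S \<inter> F) \<union> (S - F) = S" by auto
    then show "hausdorff_outer s S \<le> hausdorff_outer s (F \<inter> A \<inter> S) + hausdorff_outer s ((A - F \<inter> A) \<inter> S)"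
      unfolding eq using hausdorff_outer_Un[of s "S \<inter> F" "S - F"] by simp
  qed
  then show ?thesis by (auto simp: sets_hausdorff_on lambda_system_def)
qed simp

section \<open>Borel sets and restrictions of the measure\<close>

lemma measurable_id_hausdorff_on: "(\<lambda>x. x) \<in> borel_measurable (hausdorff_on s A)"
proof (rule borel_measurableI)
  fix S :: "'a set" assume "open S"
  then have "A - (- S \<inter> A) \<in> sets (hausdorff_on s A)"
    using sets.compl_sets[OF closed_in_sets_hausdorff_on[of "- S" A s]] \<open>open S\<close>
    by (simp add: open_closed)
  then show "(\<lambda>x. x) -` S \<inter> space (hausdorff_on s A) \<in> sets (hausdorff_on s A)"
    by (simp add: Diff_Int_distrib2 Int_commute Diff_Int Diff_Compl)
qed

lemma borel_in_sets_hausdorff_on: "B \<in> sets borel \<Longrightarrow> B \<inter> A \<in> sets (hausdorff_on s A)"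
  using measurable_sets[OF measurable_id_hausdorff_on, of B s A] by simp

lemma continuous_measurable_hausdorff_on:
  "continuous_on UNIV f \<Longrightarrow> f \<in> borel_measurable (hausdorff_on s A)"
  using measurable_compose[OF measurable_id_hausdorff_on borel_measurable_continuous_onI] by simp

text \<open>For a measurable \<open>B\<close>, Caratheodory's condition relative to \<open>B\<close>
  and relative to \<open>A\<close> agree: a test set is first cut by \<open>B\<close> and then,
  inside \<open>B\<close>, by \<open>E\<close>. This makes the measures on
  \<open>cube x r \<inter> X\<close> restrictions of the measure on \<open>X\<close>.\<close>

lemma lambda_system_subspace:
  assumes B: "B \<in> lambda_system A (Pow A) (hausdorff_outer s)"
  shows "lambda_system B (Pow B) (hausdorff_outer s) = {E \<in> lambda_system A (Pow A) (hausdorff_outer s). E \<subseteq> B}"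
    (is "?L = ?R")
proof (intro set_eqI iffI)
  have BA: "B \<subseteq> A" and Bsplit: "\<And>S. S \<subseteq> A \<Longrightarrow>
      hausdorff_outer s (B \<inter> S) + hausdorff_outer s ((A - B) \<inter> S) = hausdorff_outer s S"
    using B by (auto simp: lambda_system_def)
  fix E
  {
    assume E: "E \<in> ?L"
    have EB: "E \<subseteq> B" and Esplit: "\<And>S. S \<subseteq> B \<Longrightarrow>
        hausdorff_outer s (E \<inter> S) + hausdorff_outer s ((B - E) \<inter> S) = hausdorff_outer s S"
      using E by (auto simp: lambda_system_def)
    have "hausdorff_outer s (E \<inter> S) + hausdorff_outer s ((A - E) \<inter> S) = hausdorff_outer s S" if S: "S \<subseteq> A" for S
    proof -
      have sets: "B \<inter> ((A - E) \<inter> S) = (B - E) \<inter> (B \<inter> S)" "(A - B) \<inter> ((A - E) \<inter> S) = (A - B) \<inter> S"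
        "E \<inter> (B \<inter> S) = E \<inter> S" using BA EB by auto
      have "hausdorff_outer s (E \<inter> S) + hausdorff_outer s ((A - E) \<inter> S) =
          (hausdorff_outer s (E \<inter> S) + hausdorff_outer s ((B - E) \<inter> (B \<inter> S))) + hausdorff_outer s ((A - B) \<inter> S)"
      proof -
        have "(A - E) \<inter> S \<subseteq> A" using S by blast
        from Bsplit[OF this] show ?thesis unfolding sets by (simp add: add.assoc)
      qed
      also have "hausdorff_outer s (E \<inter> S) + hausdorff_outer s ((B - E) \<inter> (B \<inter> S)) = hausdorff_outer s (B \<inter> S)"
        using Esplit[of "B \<inter> S"] unfolding sets by simp
      finally show ?thesis using Bsplit[OF S] by simp
    qed
    then show "E \<in> ?R" using EB BA by (auto simp: lambda_system_def)
  next
    assume E: "E \<in> ?R"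
    have "hausdorff_outer s (E \<inter> S) + hausdorff_outer s ((B - E) \<inter> S) = hausdorff_outer s S" if S: "S \<subseteq> B" for S
    proof -
      have "(A - E) \<inter> S = (B - E) \<inter> S" "S \<in> Pow A" using S BA by auto
      moreover have "hausdorff_outer s (E \<inter> S) + hausdorff_outer s ((A - E) \<inter> S) = hausdorff_outer s S"
        using E \<open>S \<in> Pow A\<close> unfolding lambda_system_def by blast
      ultimately show ?thesis by simp
    qed
    then show "E \<in> ?L" using E by (auto simp: lambda_system_def)
  }
qed

lemma hausdorff_on_restrict:
  assumes "B \<in> sets (hausdorff_on s A)"
  shows "hausdorff_on s B = restrict_space (hausdorff_on s A) B"
proof (rule measure_eqI)
  have BA: "B \<inter> space (hausdorff_on s A) = B" using sets.sets_into_space[OF assms] by auto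
  have sub: "sets (hausdorff_on s B) = {E \<in> sets (hausdorff_on s A). E \<subseteq> B}"
    using lambda_system_subspace assms unfolding sets_hausdorff_on by blast
  show "sets (hausdorff_on s B) = sets (restrict_space (hausdorff_on s A) B)"
    unfolding sub sets_restrict_space using assms by (auto intro!: image_eqI)
  fix E assume E: "E \<in> sets (hausdorff_on s B)"
  then have "E \<in> sets (hausdorff_on s A)" "E \<subseteq> B" unfolding sub by auto
  then show "emeasure (hausdorff_on s B) E = emeasure (restrict_space (hausdorff_on s A) B) E"
    using E assms BA by (subst emeasure_restrict_space) (auto simp: emeasure_hausdorff_on)
qed


lemma hausdorff_on_closed_restrict:
  assumes "closed F"
  shows "hausdorff_on s (F \<inter> A) = restrict_space (hausdorff_on s A) (F \<inter> A)"
  by (rule hausdorff_on_restrict) (rule closed_in_sets_hausdorff_on[OF assms])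

lemma emeasure_hausdorff_on_space: "emeasure (hausdorff_on s A) A = hausdorff_outer s A"
  using emeasure_hausdorff_on[of A s A] sets.top[of "hausdorff_on s A"] by simp

lemma closed_cube: "closed (cube x r)"
  using compact_cube compact_imp_closed by blast

section \<open>Polynomials near a point\<close>

text \<open>The constant term of the ray expansion cancels, and \<open>\<tau> \<le> 1\<close> bounds
  the remaining powers by \<open>\<tau>\<close>.\<close>

lemma polyfun_local_lipschitz:
  "\<exists>L\<ge>0. \<forall>p :: real ^ 'n::finite \<Rightarrow> real. polyfun d p \<longrightarrow> (\<forall>z R M \<tau> w. 0 < \<tau> \<longrightarrow> \<tau> \<le> 1 \<longrightarrow>
     (\<forall>y\<in>cube z R. \<bar>p y\<bar> \<le> M) \<longrightarrow> w \<in> cube z (\<tau> * R) \<longrightarrow> \<bar>p w - p z\<bar> \<le> L * \<tau> * M)"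
proof -
  from polyfun_ray_coeffs[of d, where 'n = 'n] obtain C where C: "C \<ge> 0 \<and>
    (\<forall>p :: real ^ 'n \<Rightarrow> real. polyfun d p \<longrightarrow> (\<forall>z R M \<tau> w. 0 < \<tau> \<longrightarrow>
     (\<forall>y\<in>cube z R. \<bar>p y\<bar> \<le> M) \<longrightarrow> w \<in> cube z (\<tau> * R) \<longrightarrow>
     (\<exists>a. (\<forall>t. p (z + t *\<^sub>R (w - z)) = (\<Sum>l\<le>d. a l * t ^ l)) \<and> (\<forall>l\<le>d. \<bar>a l\<bar> \<le> C * M * \<tau> ^ l))))" ..
  note coeffs = conjunct2[OF C, rule_format]
  have "\<bar>p w - p z\<bar> \<le> (real d * C) * \<tau> * M"
    if p: "polyfun d p" and \<tau>: "0 < \<tau>" "\<tau> \<le> 1" and M: "\<forall>y\<in>cube z R. \<bar>p y\<bar> \<le> M"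
      and w: "w \<in> cube z (\<tau> * R)" for p :: "real ^ 'n \<Rightarrow> real" and z R M \<tau> w
  proof -
    obtain a where a: "\<forall>t. p (z + t *\<^sub>R (w - z)) = (\<Sum>l\<le>d. a l * t ^ l)" "\<forall>l\<le>d. \<bar>a l\<bar> \<le> C * M * \<tau> ^ l"
      using coeffs[OF p \<tau>(1) bspec[OF M] w] by blast
    have M0: "C * M \<ge> 0" using a(2)[rule_format, of 0] by (auto intro: order_trans[OF abs_ge_zero])
    have al: "\<bar>a l\<bar> \<le> C * \<tau> * M" if l: "l \<in> {1..d}" for l
    proof -
      have "\<bar>a l\<bar> \<le> C * M * \<tau> ^ l" using a(2) l by simp
      also have "\<dots> \<le> C * M * \<tau> ^ 1"
        using l \<tau> M0 by (intro mult_left_mono power_decreasing) auto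
      finally show ?thesis by (simp add: mult_ac)
    qed
    have "p w - p z = (\<Sum>l\<le>d. a l * 1 ^ l) - (\<Sum>l\<le>d. a l * 0 ^ l)"
      using a(1)[rule_format, of 1] a(1)[rule_format, of 0] by simp
    also have "\<dots> = (\<Sum>l\<in>{1..d}. a l)"
      by (simp add: atMost_atLeast0 sum.atLeast_Suc_atMost power_0_left if_distrib cong: if_cong)
    finally have "\<bar>p w - p z\<bar> \<le> (\<Sum>l\<in>{1..d}. \<bar>a l\<bar>)" by simp
    also have "\<dots> \<le> (\<Sum>l\<in>{1..d}. C * \<tau> * M)" by (intro sum_mono al)
    finally show ?thesis by simp
  qed
  with C show ?thesis by (intro exI[of _ "real d * C"]) auto
qed

lemma polyfun_line_derivative:
  fixes p :: "real ^ 'n::finite \<Rightarrow> real"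
  assumes "\<And>z. (p has_derivative (\<lambda>u. \<Sum>i\<in>UNIV. u $ i * g i z)) (at z)"
  shows "((\<lambda>t. p (z + t *\<^sub>R u)) has_real_derivative (\<Sum>i\<in>UNIV. u $ i * g i (z + t *\<^sub>R u))) (at t)"
proof -
  have "((\<lambda>t. z + t *\<^sub>R u) has_derivative (\<lambda>t. t *\<^sub>R u)) (at t)"
    by (auto intro!: derivative_eq_intros)
  from diff_chain_at[OF this assms]
  have "((\<lambda>t. p (z + t *\<^sub>R u)) has_derivative (\<lambda>h. \<Sum>i\<in>UNIV. (h *\<^sub>R u) $ i * g i (z + t *\<^sub>R u))) (at t)"
    by (simp add: o_def)
  then show ?thesis
    unfolding has_field_derivative_def
    by (rule has_derivative_eq_rhs) (simp add: fun_eq_iff sum_distrib_left mult_ac)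
qed

text \<open>The ray expansion without its constant and linear terms; the linear coefficient is the
  directional derivative by uniqueness of derivatives.\<close>

lemma polyfun_taylor:
  "\<exists>L\<ge>0. \<forall>(p :: real ^ 'n::finite \<Rightarrow> real) g. polyfun d p \<longrightarrow>
     (\<forall>z. (p has_derivative (\<lambda>u. \<Sum>i\<in>UNIV. u $ i * g i z)) (at z)) \<longrightarrow> (\<forall>z R M \<tau> w. 0 < \<tau> \<longrightarrow> \<tau> \<le> 1 \<longrightarrow>
     (\<forall>y\<in>cube z R. \<bar>p y\<bar> \<le> M) \<longrightarrow> w \<in> cube z (\<tau> * R) \<longrightarrow>
     \<bar>p w - p z - (\<Sum>i\<in>UNIV. (w - z) $ i * g i z)\<bar> \<le> L * \<tau>\<^sup>2 * M)"
proof -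
  from polyfun_ray_coeffs[of d, where 'n = 'n] obtain C where C: "C \<ge> 0 \<and>
    (\<forall>p :: real ^ 'n \<Rightarrow> real. polyfun d p \<longrightarrow> (\<forall>z R M \<tau> w. 0 < \<tau> \<longrightarrow>
     (\<forall>y\<in>cube z R. \<bar>p y\<bar> \<le> M) \<longrightarrow> w \<in> cube z (\<tau> * R) \<longrightarrow>
     (\<exists>a. (\<forall>t. p (z + t *\<^sub>R (w - z)) = (\<Sum>l\<le>d. a l * t ^ l)) \<and> (\<forall>l\<le>d. \<bar>a l\<bar> \<le> C * M * \<tau> ^ l))))" ..
  note coeffs = conjunct2[OF C, rule_format]
  have "\<bar>p w - p z - (\<Sum>i\<in>UNIV. (w - z) $ i * g i z)\<bar> \<le> (real d * C) * \<tau>\<^sup>2 * M"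
    if p: "polyfun d p" and g: "\<forall>z. (p has_derivative (\<lambda>u. \<Sum>i\<in>UNIV. u $ i * g i z)) (at z)"
      and \<tau>: "0 < \<tau>" "\<tau> \<le> 1" and M: "\<forall>y\<in>cube z R. \<bar>p y\<bar> \<le> M"
      and w: "w \<in> cube z (\<tau> * R)" for p :: "real ^ 'n \<Rightarrow> real" and g z R M \<tau> w
  proof -
    define D where "D = (\<Sum>i\<in>UNIV. (w - z) $ i * g i z)"
    obtain a where a: "\<forall>t. p (z + t *\<^sub>R (w - z)) = (\<Sum>l\<le>d. a l * t ^ l)" "\<forall>l\<le>d. \<bar>a l\<bar> \<le> C * M * \<tau> ^ l"
      using coeffs[OF p \<tau>(1) bspec[OF M] w] by blast
    have M0: "C * M \<ge> 0" using a(2)[rule_format, of 0] by (auto intro: order_trans[OF abs_ge_zero])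
    \<comment> \<open>Padding with a zero makes the coefficient of index 1 available also for
      \<open>d = 0\<close>.\<close>
    define b where "b l = (if l \<le> d then a l else 0)" for l
    have ab: "p (z + t *\<^sub>R (w - z)) = (\<Sum>l\<le>Suc d. b l * t ^ l)" for t using a(1) by (simp add: b_def)
    have "((\<lambda>t. p (z + t *\<^sub>R (w - z))) has_real_derivative D) (at 0)"
      using polyfun_line_derivative[of p g z "w - z" 0] g by (simp add: D_def)
    moreover have "((\<lambda>t. p (z + t *\<^sub>R (w - z))) has_real_derivative b 1) (at 0)"
    proof -
      have "((\<lambda>t. \<Sum>l\<le>Suc d. b l * t ^ l) has_real_derivative (\<Sum>l\<le>Suc d. b l * (real l * 0 ^ (l - 1)))) (at 0)"
        by (intro DERIV_sum DERIV_cmult) (auto intro!: derivative_eq_intros)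
      moreover have "(\<Sum>l\<le>Suc d. b l * (real l * 0 ^ (l - 1))) = (\<Sum>l\<in>{1}. b l * (real l * 0 ^ (l - 1)))"
        by (intro sum.mono_neutral_right) (auto simp: power_0_left)
      ultimately show ?thesis unfolding ab by simp
    qed
    ultimately have D: "D = b 1" by (rule DERIV_unique)
    have al: "\<bar>b l\<bar> \<le> C * \<tau>\<^sup>2 * M" if l: "l \<in> {2..d}" for l
    proof -
      have "\<bar>b l\<bar> \<le> C * M * \<tau> ^ l"
        using a(2) l by (simp add: b_def)
      also have "\<dots> \<le> C * M * \<tau>\<^sup>2"
        using l \<tau> M0 by (intro mult_left_mono power_decreasing) auto
      finally show ?thesis by (simp add: mult_ac)
    qed
    have "p w - p z - D = (\<Sum>l\<le>Suc d. b l * 1 ^ l) - (\<Sum>l\<le>Suc d. b l * 0 ^ l) - b 1"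
      unfolding D ab[symmetric] by simp
    also have "(\<Sum>l\<le>Suc d. b l * 0 ^ l) = (\<Sum>l\<in>{0}. b l * 0 ^ l)"
      by (intro sum.mono_neutral_right) (auto simp: power_0_left)
    also have "(\<Sum>l\<le>Suc d. b l * 1 ^ l) - (\<Sum>l\<in>{0}. b l * 0 ^ l) - b 1 = (\<Sum>l\<in>{2..Suc d}. b l)"
      by (simp add: atMost_atLeast0 sum.atLeast_Suc_atMost numeral_2_eq_2 del: sum.cl_ivl_Suc)
    also have "\<dots> = (\<Sum>l\<in>{2..d}. b l)"
      by (intro sum.mono_neutral_right) (auto simp: b_def)
    finally have "\<bar>p w - p z - D\<bar> \<le> (\<Sum>l\<in>{2..d}. \<bar>b l\<bar>)" by simp
    also have "\<dots> \<le> (\<Sum>l\<in>{2..d}. C * \<tau>\<^sup>2 * M)" by (intro sum_mono al)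
    also have "\<dots> = real (card {2..d}) * (C * \<tau>\<^sup>2 * M)" by simp
    also have "\<dots> \<le> real d * (C * \<tau>\<^sup>2 * M)"
      using mult_nonneg_nonneg[OF M0, of "\<tau>\<^sup>2"] by (intro mult_right_mono) (auto simp: mult_ac)
    finally show ?thesis by (simp add: D_def mult.assoc)
  qed
  with C show ?thesis by (intro exI[of _ "real d * C"]) auto
qed

section \<open>Sets of dimension greater than \<open>n - 1\<close>\<close>

locale ahlfors_set =
  fixes s :: real and X :: "(real ^ 'n::finite) set" and a b :: real
  assumes a: "a > 0" and b: "b > 0"
    and lower: "x \<in> X \<Longrightarrow> 0 < r \<Longrightarrow> ennreal r \<le> ediam X \<Longrightarrow>
      ennreal (b * r powr s) \<le> hausdorff_outer s (ball x r \<inter> X)"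
    and upper: "x \<in> X \<Longrightarrow> 0 < r \<Longrightarrow> ennreal r \<le> ediam X \<Longrightarrow>
      hausdorff_outer s (ball x r \<inter> X) \<le> ennreal (a * r powr s)"
    and dim: "real CARD('n) - 1 < s"
    and diam: "ediam X > 0"
begin

lemma card_ge_1: "real CARD('n) \<ge> 1" by (simp add: Suc_le_eq)

lemma s_pos: "s > 0" using dim card_ge_1 by linarith

lemma X_nonempty: "X \<noteq> {}"
  using diam by (auto simp: ediam_def bot_ennreal)

section \<open>Covering estimates and Remez inequalities\<close>

lemma dist_le_sum: "dist y y' \<le> (\<Sum>i\<in>UNIV. \<bar>y $ i - y' $ i\<bar>)" for y y' :: "real ^ 'n"
  using norm_le_l1_cart[of "y - y'"] by (simp add: dist_norm)

text \<open>Each class of \<open>\<kappa>\<close> lies in a ball of radius \<open>\<rho>\<close>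
  about one of its own points, hence about a point of \<open>X\<close>, where the upper bound of an
  s-set applies.\<close>

lemma covering:
  assumes "finite I" "\<kappa> ` S \<subseteq> I" "S \<subseteq> X" "\<rho> > 0" "ennreal \<rho> \<le> ediam X"
    and close: "\<And>y y'. y \<in> S \<Longrightarrow> y' \<in> S \<Longrightarrow> \<kappa> y = \<kappa> y' \<Longrightarrow> dist y y' < \<rho>"
  shows "hausdorff_outer s S \<le> ennreal (real (card I) * (a * \<rho> powr s))"
proof -
  have piece: "hausdorff_outer s {y \<in> S. \<kappa> y = i} \<le> ennreal (a * \<rho> powr s)" for i
  proof (cases "{y \<in> S. \<kappa> y = i} = {}")
    case False
    then obtain y where y: "y \<in> S" "\<kappa> y = i" by blast
    have "{y \<in> S. \<kappa> y = i} \<subseteq> ball y \<rho> \<inter> X" using close y assms(3) by auto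
    then have "hausdorff_outer s {y \<in> S. \<kappa> y = i} \<le> hausdorff_outer s (ball y \<rho> \<inter> X)"
      by (rule hausdorff_outer_mono)
    also have "\<dots> \<le> ennreal (a * \<rho> powr s)" using y assms by (intro upper) auto
    finally show ?thesis .
  qed (simp only: hausdorff_outer_empty zero_le)
  have "hausdorff_outer s S \<le> hausdorff_outer s (\<Union>i\<in>I. {y \<in> S. \<kappa> y = i})"
    using assms(2) by (intro hausdorff_outer_mono) auto
  also have "\<dots> \<le> (\<Sum>i\<in>I. hausdorff_outer s {y \<in> S. \<kappa> y = i})"
    by (rule hausdorff_outer_finite_UN[OF assms(1)])
  also have "\<dots> \<le> (\<Sum>i\<in>I. ennreal (a * \<rho> powr s))" by (intro sum_mono piece)
  also have "\<dots> = ennreal (real (card I) * (a * \<rho> powr s))"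
    using a by (simp add: ennreal_mult ennreal_of_nat_eq_real_of_nat)
  finally show ?thesis .
qed

lemma floor_scaled_close:
  fixes t t' c :: real
  assumes "c > 0" "\<lfloor>t / c\<rfloor> = \<lfloor>t' / c\<rfloor>"
  shows "\<bar>t - t'\<bar> < c"
proof -
  have "\<bar>t / c - t' / c\<bar> < 1" using assms(2) by linarith
  moreover have "\<bar>t / c - t' / c\<bar> = \<bar>t - t'\<bar> / c" using assms(1) by (simp flip: diff_divide_distrib)
  ultimately show ?thesis using assms(1) by (simp add: pos_divide_less_eq)
qed

lemma quarter_le_ediam: "ennreal r \<le> 4 * ediam X \<Longrightarrow> 0 < r \<Longrightarrow> ennreal (r / 4) \<le> ediam X"
proof -
  assume r: "ennreal r \<le> 4 * ediam X" "0 < r"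
  have "ennreal r = 4 * ennreal (r / 4)"
    using r(2) by (simp flip: ennreal_numeral ennreal_mult)
  with r(1) have "4 * ennreal (r / 4) \<le> 4 * ediam X" by simp
  then show ?thesis by (subst (asm) ennreal_mult_le_mult_iff) auto
qed

lemma le_ediam_mono: "ennreal r \<le> ediam X \<Longrightarrow> r' \<le> r \<Longrightarrow> ennreal r' \<le> ediam X"
  using ennreal_leI order_trans by blast

text \<open>Balls are controlled up to radius \<open>ediam X\<close>, whereas cubes reach four times
  that. Boxes of side \<open>r / (4 * n)\<close> have diameter below \<open>r / 4\<close>, and
  \<open>8 * n + 1\<close> of them per coordinate suffice.\<close>

lemma cube_upper:
  assumes "r > 0" "ennreal r \<le> 4 * ediam X"
  shows "hausdorff_outer s (cube x r \<inter> X) \<le> ennreal ((8 * real CARD('n) + 1) ^ CARD('n) * a * r powr s)"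
proof -
  define c where "c = r / (4 * real CARD('n))"
  have c: "c > 0" using assms(1) card_ge_1 by (simp add: c_def)
  define I where "I = PiE (UNIV :: 'n set) (\<lambda>_. {- int (4 * CARD('n))..int (4 * CARD('n))})"
  define \<kappa> where "\<kappa> y = (\<lambda>i. \<lfloor>(y $ i - x $ i) / c\<rfloor>)" for y
  have r4: "ennreal (r / 4) \<le> ediam X" by (rule quarter_le_ediam[OF assms(2,1)])
  have "hausdorff_outer s (cube x r \<inter> X) \<le> ennreal (real (card I) * (a * (r / 4) powr s))"
  proof (rule covering)
    show "finite I" unfolding I_def by (rule finite_PiE) auto
    show "\<kappa> ` (cube x r \<inter> X) \<subseteq> I"
    proof safe
      fix y assume y: "y \<in> cube x r"
      have "\<lfloor>(y $ i - x $ i) / c\<rfloor> \<in> {- int (4 * CARD('n))..int (4 * CARD('n))}" for i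
      proof -
        have "\<bar>(y $ i - x $ i) / c\<bar> \<le> r / c" using y c by (simp add: mem_cube divide_right_mono)
        also have "r / c = 4 * real CARD('n)" using assms(1) card_ge_1 by (simp add: c_def)
        finally have *: "\<bar>(y $ i - x $ i) / c\<bar> \<le> real (4 * CARD('n))" by simp
        show ?thesis using * unfolding atLeastAtMost_iff by linarith
      qed
      then show "\<kappa> y \<in> I" by (auto simp: I_def \<kappa>_def PiE_def)
    qed
    fix y y' assume eq: "\<kappa> y = \<kappa> y'"
    have "\<bar>y $ i - y' $ i\<bar> < c" for i
      using floor_scaled_close[OF c, of "y $ i - x $ i" "y' $ i - x $ i"] eq by (simp add: \<kappa>_def fun_eq_iff)
    then have "(\<Sum>i\<in>UNIV. \<bar>y $ i - y' $ i\<bar>) < (\<Sum>i\<in>(UNIV :: 'n set). c)" by (intro sum_strict_mono) auto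
    also have "\<dots> = r / 4" using card_ge_1 by (simp add: c_def)
    finally show "dist y y' < r / 4" using dist_le_sum[of y y'] by linarith
  qed (use assms(1) r4 in auto)
  also have "\<dots> \<le> ennreal ((8 * real CARD('n) + 1) ^ CARD('n) * a * r powr s)"
  proof (rule ennreal_leI)
    have "real (card I) = (8 * real CARD('n) + 1) ^ CARD('n)"
      unfolding I_def by (subst card_PiE) (auto simp: algebra_simps)
    moreover have "(r / 4) powr s \<le> r powr s" using assms(1) s_pos by (intro powr_mono2) auto
    ultimately show "real (card I) * (a * (r / 4) powr s) \<le> (8 * real CARD('n) + 1) ^ CARD('n) * a * r powr s"
      using a card_ge_1 by (simp add: mult.assoc)
  qed
  finally show ?thesis .
qed

text \<open>If \<open>X\<close> stayed in a slab of width comparable to \<open>\<rho> / m\<close>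
  around \<open>z\<close>, about \<open>m ^ (n - 1)\<close> balls of radius comparable to
  \<open>\<rho> / m\<close> would cover it, of total measure
  \<open>O(m powr (n - 1 - s) * \<rho> powr s)\<close>. As \<open>s > n - 1\<close>, this
  contradicts the lower bound for large \<open>m\<close>.\<close>

lemma slab_escape:
  "\<exists>c>0. \<forall>z\<in>X. \<forall>\<rho>>0. ennreal \<rho> \<le> ediam X \<longrightarrow> (\<forall>v i0. (\<forall>i. \<bar>v i\<bar> \<le> \<bar>v i0\<bar>) \<longrightarrow>
     (\<exists>z1\<in>X \<inter> ball z \<rho>. c * \<rho> * \<bar>v i0\<bar> \<le> \<bar>\<Sum>i\<in>UNIV. v i * (z1 - z) $ i\<bar>))"
proof -
  define D where "D = a * 3 ^ (CARD('n) - 1) * (3 * real CARD('n)) powr s"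
  define e where "e = s - (real CARD('n) - 1)"
  have e: "e > 0" using dim by (simp add: e_def)
  have "((\<lambda>m. D * real m powr (- e)) \<longlongrightarrow> D * 0) sequentially"
    using e by (intro tendsto_mult_left tendsto_neg_powr filterlim_real_sequentially) auto
  then have "eventually (\<lambda>m. D * real m powr (- e) < b) sequentially"
    using b by (intro order_tendstoD(2)) auto
  then have "eventually (\<lambda>m. D * real m powr (- e) < b \<and> m \<ge> 3 * CARD('n)) sequentially"
    by (intro eventually_conj eventually_ge_at_top)
  then obtain m where m: "D * real m powr (- e) < b" "m \<ge> 3 * CARD('n)"
    using eventually_happens'[OF sequentially_bot] by blast
  have "real (3 * CARD('n)) \<le> real m" using m(2) by (rule of_nat_mono)
  then have m3: "real m \<ge> 3 * real CARD('n)" "real m \<ge> 1" using card_ge_1 by linarith+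
  have "\<exists>z1\<in>X \<inter> ball z \<rho>. (1 / real m) * \<rho> * \<bar>v i0\<bar> \<le> \<bar>\<Sum>i\<in>UNIV. v i * (z1 - z) $ i\<bar>"
    if z: "z \<in> X" and \<rho>: "\<rho> > 0" "ennreal \<rho> \<le> ediam X" and v: "\<forall>i. \<bar>v i\<bar> \<le> \<bar>v i0\<bar>" for z \<rho> v i0
  proof (rule ccontr)
    assume "\<not> ?thesis"
    then have slab: "\<And>z1. z1 \<in> ball z \<rho> \<inter> X \<Longrightarrow> \<bar>\<Sum>i\<in>UNIV. v i * (z1 - z) $ i\<bar> < \<rho> / m * \<bar>v i0\<bar>"
      by (fastforce simp: not_le)
    have "z \<in> ball z \<rho> \<inter> X" using z \<rho> by simp
    from slab[OF this] have vi0: "v i0 \<noteq> 0" by auto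
    define c where "c = \<rho> / m"
    have c: "c > 0" using \<rho> m3 by (simp add: c_def)
    define J where "J i = (if i = i0 then {0} else {- int m..int m})" for i
    \<comment> \<open>The dominant coordinate \<open>i0\<close> of \<open>v\<close> is left out:
      within the slab the other coordinates determine it up to \<open>(n + 1) * c\<close>.\<close>
    define \<kappa> where "\<kappa> y = (\<lambda>i. if i = i0 then 0 else \<lfloor>(y $ i - z $ i) / c\<rfloor>)" for y
    have "hausdorff_outer s (ball z \<rho> \<inter> X) \<le> ennreal (real (card (PiE UNIV J)) * (a * (3 * real CARD('n) * c) powr s))"
    proof (rule covering)
      show "finite (PiE UNIV J)" by (rule finite_PiE) (auto simp: J_def)
      show "\<kappa> ` (ball z \<rho> \<inter> X) \<subseteq> PiE UNIV J"
      proof (rule image_subsetI)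
        fix y assume y: "y \<in> ball z \<rho> \<inter> X"
        have "\<kappa> y i \<in> J i" for i
        proof -
          have "\<bar>y $ i - z $ i\<bar> \<le> \<rho>" using ball_subset_cube[of z \<rho>] y by (auto simp: mem_cube)
          then have "\<bar>(y $ i - z $ i) / c\<bar> \<le> \<rho> / c" using c by (simp add: divide_right_mono)
          also have "\<rho> / c = real m" using \<rho> m3 by (simp add: c_def)
          finally have *: "\<bar>(y $ i - z $ i) / c\<bar> \<le> real m" .
          have "- int m \<le> \<lfloor>(y $ i - z $ i) / c\<rfloor>" "\<lfloor>(y $ i - z $ i) / c\<rfloor> \<le> int m"
            using * by linarith+
          then show ?thesis by (simp add: J_def \<kappa>_def)
        qed
        then show "\<kappa> y \<in> PiE UNIV J" by (auto simp: PiE_def)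
      qed
      show "0 < 3 * real CARD('n) * c" using c card_ge_1 by simp
      have "3 * real CARD('n) * c \<le> \<rho>" using \<rho> m3 by (simp add: c_def field_simps)
      then show "ennreal (3 * real CARD('n) * c) \<le> ediam X" by (rule le_ediam_mono[OF \<rho>(2)])
      fix y y' assume y: "y \<in> ball z \<rho> \<inter> X" "y' \<in> ball z \<rho> \<inter> X" "\<kappa> y = \<kappa> y'"
      have other: "\<bar>y $ i - y' $ i\<bar> < c" if "i \<noteq> i0" for i
        using floor_scaled_close[OF c, of "y $ i - z $ i" "y' $ i - z $ i"] fun_cong[OF y(3), of i] that
        by (simp add: \<kappa>_def)
      have card': "real (card (UNIV - {i0})) = real CARD('n) - 1"
        using card_ge_1 by (simp add: card_Diff_singleton of_nat_diff Suc_le_eq)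
      have others: "(\<Sum>i\<in>UNIV - {i0}. \<bar>y $ i - y' $ i\<bar>) \<le> (real CARD('n) - 1) * c"
        using sum_bounded_above[of "UNIV - {i0}" "\<lambda>i. \<bar>y $ i - y' $ i\<bar>" c] other
        unfolding card' by (auto intro: less_imp_le)
      have "v i0 * (y $ i0 - y' $ i0) = (\<Sum>i\<in>UNIV. v i * (y - z) $ i) - (\<Sum>i\<in>UNIV. v i * (y' - z) $ i)
          - (\<Sum>i\<in>UNIV - {i0}. v i * (y $ i - y' $ i))"
      proof -
        have "(\<Sum>i\<in>UNIV. v i * (y - z) $ i) - (\<Sum>i\<in>UNIV. v i * (y' - z) $ i) = (\<Sum>i\<in>UNIV. v i * (y $ i - y' $ i))"
          by (simp add: algebra_simps flip: sum_subtractf)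
        also have "\<dots> = v i0 * (y $ i0 - y' $ i0) + (\<Sum>i\<in>UNIV - {i0}. v i * (y $ i - y' $ i))"
          by (rule sum.remove) auto
        finally show ?thesis by simp
      qed
      moreover have "\<bar>\<Sum>i\<in>UNIV - {i0}. v i * (y $ i - y' $ i)\<bar> \<le> \<bar>v i0\<bar> * ((real CARD('n) - 1) * c)"
      proof -
        have "\<bar>\<Sum>i\<in>UNIV - {i0}. v i * (y $ i - y' $ i)\<bar> \<le> (\<Sum>i\<in>UNIV - {i0}. \<bar>v i0\<bar> * \<bar>y $ i - y' $ i\<bar>)"
          using v by (intro order_trans[OF sum_abs] sum_mono) (auto simp: abs_mult intro!: mult_right_mono)
        also have "\<dots> \<le> \<bar>v i0\<bar> * ((real CARD('n) - 1) * c)"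
          using others by (simp add: mult_left_mono flip: sum_distrib_left)
        finally show ?thesis .
      qed
      ultimately have "\<bar>v i0 * (y $ i0 - y' $ i0)\<bar> \<le> c * \<bar>v i0\<bar> + c * \<bar>v i0\<bar> + \<bar>v i0\<bar> * ((real CARD('n) - 1) * c)"
        using slab[OF y(1)] slab[OF y(2)] unfolding c_def[symmetric] by linarith
      then have "\<bar>v i0\<bar> * \<bar>y $ i0 - y' $ i0\<bar> \<le> \<bar>v i0\<bar> * ((real CARD('n) + 1) * c)"
        unfolding abs_mult by (simp add: algebra_simps)
      then have "\<bar>y $ i0 - y' $ i0\<bar> \<le> (real CARD('n) + 1) * c" using vi0 by simp
      moreover have "(\<Sum>i\<in>UNIV. \<bar>y $ i - y' $ i\<bar>) = \<bar>y $ i0 - y' $ i0\<bar> + (\<Sum>i\<in>UNIV - {i0}. \<bar>y $ i - y' $ i\<bar>)"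
        by (rule sum.remove) auto
      ultimately have "dist y y' \<le> 2 * real CARD('n) * c"
        using others dist_le_sum[of y y'] by (simp add: algebra_simps)
      also have "\<dots> < 3 * real CARD('n) * c" using c card_ge_1 by simp
      finally show "dist y y' < 3 * real CARD('n) * c" .
    qed auto
    moreover have "ennreal (b * \<rho> powr s) \<le> hausdorff_outer s (ball z \<rho> \<inter> X)"
      by (rule lower[OF z \<rho>])
    ultimately have "ennreal (b * \<rho> powr s) \<le> ennreal (real (card (PiE UNIV J)) * (a * (3 * real CARD('n) * c) powr s))"
      by (rule order_trans[rotated])
    then have "b * \<rho> powr s \<le> real (card (PiE UNIV J)) * (a * (3 * real CARD('n) * c) powr s)"
      using a by (subst (asm) ennreal_le_iff) auto
    also have "real (card (PiE UNIV J)) \<le> (3 * real m) ^ (CARD('n) - 1)"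
    proof -
      have "card (PiE UNIV J) = (\<Prod>i\<in>UNIV. card (J i))" by (rule card_PiE) auto
      also have "\<dots> = card (J i0) * (\<Prod>i\<in>UNIV - {i0}. card (J i))" by (rule prod.remove) auto
      also have "\<dots> = (2 * m + 1) ^ (CARD('n) - 1)"
        by (simp add: J_def card_Diff_singleton nat_add_distrib nat_mult_distrib)
      finally have "real (card (PiE UNIV J)) = (2 * real m + 1) ^ (CARD('n) - 1)"
        by (simp add: add.commute)
      also have "\<dots> \<le> (3 * real m) ^ (CARD('n) - 1)" using m3 by (intro power_mono) auto
      finally show ?thesis .
    qed
    then have "real (card (PiE UNIV J)) * (a * (3 * real CARD('n) * c) powr s) \<le>
        (3 * real m) ^ (CARD('n) - 1) * (a * (3 * real CARD('n) * c) powr s)"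
      using a by (intro mult_right_mono) auto
    also have "\<dots> = D * real m powr (- e) * \<rho> powr s"
    proof -
      have "(3 * real CARD('n) * c) powr s = (3 * real CARD('n)) powr s * \<rho> powr s * real m powr (- s)"
        using \<rho> m3 card_ge_1 by (simp add: c_def powr_mult powr_divide powr_minus_divide)
      moreover have "real m ^ (CARD('n) - 1) = real m powr (real CARD('n) - 1)"
      proof -
        have "real (CARD('n) - 1) = real CARD('n) - 1" by (simp add: of_nat_diff Suc_le_eq)
        then show ?thesis using powr_realpow[of "real m" "CARD('n) - 1"] m3 by simp
      qed
      moreover have "real m powr (real CARD('n) - 1) * real m powr (- s) = real m powr (- e)"
        by (simp add: e_def flip: powr_add)
      ultimately show ?thesis by (simp add: D_def power_mult_distrib mult_ac)
    qed
    finally show False using m(1) \<rho> by simp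
  qed
  moreover have "1 / real m > 0" using m3 by simp
  ultimately show ?thesis by blast
qed

text \<open>A Remez inequality for the supremum norm, by induction on the degree. If the gradient of \<open>p\<close>
  is small then \<open>p\<close> is almost constant. Otherwise the induction hypothesis gives a point \<open>z\<close> of \<open>X\<close>
  at which the gradient is large, and near \<open>z\<close> the set \<open>X\<close> is not contained in a thin slab
  orthogonal to the gradient.\<close>

lemma remez_sup:
  "\<exists>c>0. \<forall>x\<in>X. \<forall>r>0. ennreal r \<le> ediam X \<longrightarrow> (\<forall>p. polyfun d p \<longrightarrow>
     (\<exists>z\<in>X \<inter> cube x r. \<forall>y\<in>cube x r. c * \<bar>p y\<bar> \<le> \<bar>p z\<bar>))"
proof (induction d)
  case 0
  have "\<exists>z\<in>X \<inter> cube x r. \<forall>y\<in>cube x r. 1 * \<bar>p y\<bar> \<le> \<bar>p z\<bar>"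
    if x: "x \<in> X" and r: "r > 0" and p: "polyfun 0 p" for x r and p :: "real ^ 'n \<Rightarrow> real"
  proof (rule bexI[of _ x])
    obtain c where "p = (\<lambda>_. c)" using polyfun_degree_0[OF p refl] by blast
    then show "\<forall>y\<in>cube x r. 1 * \<bar>p y\<bar> \<le> \<bar>p x\<bar>" by simp
  qed (use x r in \<open>auto simp: mem_cube\<close>)
  then show ?case by (intro exI[of _ 1]) auto
next
  case (Suc d)
  then obtain cd where cd: "cd > 0" "\<And>x r p. x \<in> X \<Longrightarrow> r > 0 \<Longrightarrow> ennreal r \<le> ediam X \<Longrightarrow> polyfun d p \<Longrightarrow>
     \<exists>z\<in>X \<inter> cube x r. \<forall>y\<in>cube x r. cd * \<bar>p y\<bar> \<le> \<bar>p z\<bar>" by blast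
  obtain cf where cf: "cf > 0" "\<And>z \<rho> v i0. z \<in> X \<Longrightarrow> \<rho> > 0 \<Longrightarrow> ennreal \<rho> \<le> ediam X \<Longrightarrow>
     (\<forall>i. \<bar>v i\<bar> \<le> \<bar>v i0\<bar>) \<Longrightarrow> \<exists>z1\<in>X \<inter> ball z \<rho>. cf * \<rho> * \<bar>v i0\<bar> \<le> \<bar>\<Sum>i\<in>UNIV. v i * (z1 - z) $ i\<bar>"
    using slab_escape by blast
  obtain Cg where Cg: "Cg \<ge> 1" "\<And>(p :: real ^ 'n \<Rightarrow> real) x r M y. polyfun (Suc d) p \<Longrightarrow> r > 0 \<Longrightarrow>
      (\<forall>y\<in>cube x r. \<bar>p y\<bar> \<le> M) \<Longrightarrow> y \<in> cube x (2 * r) \<Longrightarrow> \<bar>p y\<bar> \<le> Cg * M"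
    using polyfun_growth[of 2 "Suc d", where 'n = 'n] by auto
  obtain L where L: "L \<ge> 0" "\<And>(p :: real ^ 'n \<Rightarrow> real) g z R M \<tau> w. polyfun (Suc d) p \<Longrightarrow>
     (\<forall>z. (p has_derivative (\<lambda>u. \<Sum>i\<in>UNIV. u $ i * g i z)) (at z)) \<Longrightarrow> 0 < \<tau> \<Longrightarrow> \<tau> \<le> 1 \<Longrightarrow>
     (\<forall>y\<in>cube z R. \<bar>p y\<bar> \<le> M) \<Longrightarrow> w \<in> cube z (\<tau> * R) \<Longrightarrow>
     \<bar>p w - p z - (\<Sum>i\<in>UNIV. (w - z) $ i * g i z)\<bar> \<le> L * \<tau>\<^sup>2 * M"
    using polyfun_taylor[of "Suc d", where 'n = 'n] by blast
  \<comment> \<open>\<open>c3 * \<tau> * M\<close> will bound the linear term from below at the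
    point that escapes the slab, and \<open>\<tau>\<close> is so small that the Taylor remainder
    \<open>L * \<tau>\<^sup>2 * M\<close> takes away at most half of it.\<close>
  define c3 where "c3 = cf * cd / (2 * Cg * real CARD('n))"
  have c3: "c3 > 0" using cf cd Cg card_ge_1 by (simp add: c3_def)
  define \<tau> where "\<tau> = min 1 (c3 / (2 * (L + 1)))"
  have \<tau>: "0 < \<tau>" "\<tau> \<le> 1" using c3 L by (auto simp: \<tau>_def)
  have L\<tau>: "L * \<tau>\<^sup>2 \<le> c3 * \<tau> / 2"
  proof -
    have "\<tau> \<le> c3 / (2 * (L + 1))" by (simp add: \<tau>_def)
    then have "(L + 1) * \<tau> \<le> c3 / 2" using L(1) by (simp add: field_simps)
    then have "L * \<tau> \<le> c3 / 2" using \<tau> by (simp add: algebra_simps)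
    then have "L * \<tau> * \<tau> \<le> c3 / 2 * \<tau>" using \<tau> by (intro mult_right_mono) auto
    then show ?thesis by (simp add: power2_eq_square mult.assoc)
  qed
  define c where "c = min (1 / (2 * Cg)) (c3 * \<tau> / 4)"
  have c: "c > 0" using c3 \<tau> Cg by (simp add: c_def)
  have "\<exists>z\<in>X \<inter> cube x r. \<forall>y\<in>cube x r. c * \<bar>p y\<bar> \<le> \<bar>p z\<bar>"
    if x: "x \<in> X" and r: "r > 0" "ennreal r \<le> ediam X" and p: "polyfun (Suc d) p"
    for x r and p :: "real ^ 'n \<Rightarrow> real"
  proof -
    have contp: "continuous_on (cube x \<rho>) (\<lambda>y. \<bar>p y\<bar>)" for \<rho>
      using polyfun_continuous[OF p] by (intro continuous_on_rabs)
    have ne: "cube x \<rho> \<noteq> {}" if "\<rho> > 0" for \<rho> using that mem_cube[of x x \<rho>] by auto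
    obtain yM where yM: "yM \<in> cube x r" "\<And>y. y \<in> cube x r \<Longrightarrow> \<bar>p y\<bar> \<le> \<bar>p yM\<bar>"
      using continuous_attains_sup[OF compact_cube ne[OF r(1)] contp] by blast
    obtain yh where yh: "yh \<in> cube x (r / 2)" "\<And>y. y \<in> cube x (r / 2) \<Longrightarrow> \<bar>p y\<bar> \<le> \<bar>p yh\<bar>"
      using continuous_attains_sup[OF compact_cube ne contp, of "r / 2"] r by auto
    define M where "M = \<bar>p yM\<bar>"
    have M: "M \<ge> 0" "M \<le> Cg * \<bar>p yh\<bar>"
      using Cg(2)[OF p, of "r / 2" x "\<bar>p yh\<bar>" yM] yh(2) yM(1) r(1) by (auto simp: M_def)
    have half: "cube x (r / 2) \<subseteq> cube x r" using r by (intro cube_mono) auto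
    have goal: ?thesis if z: "z \<in> X" "z \<in> cube x r" "c * M \<le> \<bar>p z\<bar>" for z
    proof (intro bexI[of _ z] ballI)
      fix y assume "y \<in> cube x r"
      then have "c * \<bar>p y\<bar> \<le> c * M" using yM(2) c by (simp add: M_def)
      with z(3) show "c * \<bar>p y\<bar> \<le> \<bar>p z\<bar>" by linarith
    qed (use z in auto)
    obtain g where g: "\<And>i. polyfun d (g i)"
      "\<And>z. (p has_derivative (\<lambda>u. \<Sum>i\<in>UNIV. u $ i * g i z)) (at z)"
      using polyfun_has_derivative[OF p refl] by blast
    show ?thesis
    \<comment> \<open>Below this threshold the gradient changes \<open>p\<close> on the half cube by
      at most \<open>M / (2 * Cg)\<close>, half of the guaranteed size \<open>M / Cg\<close> of
      \<open>p yh\<close>. The half cube leaves room for the escaping point and for the Taylor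
      estimate.\<close>
    proof (cases "\<forall>i. \<forall>w\<in>cube x (r / 2). \<bar>g i w\<bar> \<le> M / (Cg * real CARD('n) * r)")
      case True
      define u where "u = yh - x"
      have u: "\<bar>u $ i\<bar> \<le> r / 2" for i using yh(1) by (simp add: u_def mem_cube)
      obtain t where t: "0 < t" "t < 1" "p (x + 1 *\<^sub>R u) - p (x + 0 *\<^sub>R u) = (1 - 0) * (\<Sum>i\<in>UNIV. u $ i * g i (x + t *\<^sub>R u))"
        using MVT2[of 0 1 "\<lambda>t. p (x + t *\<^sub>R u)" "\<lambda>t. \<Sum>i\<in>UNIV. u $ i * g i (x + t *\<^sub>R u)"]
          polyfun_line_derivative[OF g(2)] by auto
      have xt: "x + t *\<^sub>R u \<in> cube x (r / 2)"
        unfolding mem_cube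
      proof
        fix i
        have "\<bar>t\<bar> * \<bar>u $ i\<bar> \<le> 1 * (r / 2)" using t u by (intro mult_mono) auto
        then show "\<bar>(x + t *\<^sub>R u) $ i - x $ i\<bar> \<le> r / 2" by (simp add: abs_mult)
      qed
      have "\<bar>p yh - p x\<bar> = \<bar>\<Sum>i\<in>UNIV. u $ i * g i (x + t *\<^sub>R u)\<bar>" using t(3) by (simp add: u_def)
      also have "\<dots> \<le> (\<Sum>i\<in>(UNIV :: 'n set). r / 2 * (M / (Cg * real CARD('n) * r)))"
        using True xt u r
        by (intro order_trans[OF sum_abs] sum_mono) (simp only: abs_mult, intro mult_mono, auto)
      also have "\<dots> = M / (2 * Cg)" using r card_ge_1 Cg by (simp add: field_simps)
      finally have "\<bar>p yh\<bar> - M / (2 * Cg) \<le> \<bar>p x\<bar>" by linarith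
      moreover have "M / Cg \<le> \<bar>p yh\<bar>" using M(2) Cg(1) by (simp add: divide_le_eq mult.commute)
      ultimately have "1 / (2 * Cg) * M \<le> \<bar>p x\<bar>" using Cg(1) by (simp add: field_simps)
      moreover have "c * M \<le> 1 / (2 * Cg) * M" using M(1) by (intro mult_right_mono) (auto simp: c_def)
      ultimately show ?thesis using x r by (intro goal[of x]) (auto simp: mem_cube)
    next
      case False
      then obtain i w where iw: "w \<in> cube x (r / 2)" "\<bar>g i w\<bar> > M / (Cg * real CARD('n) * r)"
        unfolding not_all by (auto simp: not_le)
      have r2: "r / 2 > 0" "ennreal (r / 2) \<le> ediam X" using r le_ediam_mono[OF r(2), of "r / 2"] by auto
      obtain z where z: "z \<in> X" "z \<in> cube x (r / 2)" "cd * \<bar>g i w\<bar> \<le> \<bar>g i z\<bar>"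
        using cd(2)[OF x r2 g(1)[of i]] iw(1) by blast
      obtain i0 where i0: "\<And>j. \<bar>g j z\<bar> \<le> \<bar>g i0 z\<bar>"
      proof -
        have "finite (range (\<lambda>j. \<bar>g j z\<bar>))" "range (\<lambda>j. \<bar>g j z\<bar>) \<noteq> {}" by auto
        then have "Max (range (\<lambda>j. \<bar>g j z\<bar>)) \<in> range (\<lambda>j. \<bar>g j z\<bar>)" by (rule Max_in)
        then obtain i0 where "Max (range (\<lambda>j. \<bar>g j z\<bar>)) = \<bar>g i0 z\<bar>" by blast
        moreover have "\<bar>g j z\<bar> \<le> Max (range (\<lambda>j. \<bar>g j z\<bar>))" for j by (intro Max_ge) auto
        ultimately show ?thesis using that by metis
      qed
      define \<rho> where "\<rho> = \<tau> * (r / 2)"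
      have \<rho>: "\<rho> > 0" "\<rho> \<le> r / 2" using \<tau> r by (auto simp: \<rho>_def mult_left_le_one_le)
      obtain z1 where z1: "z1 \<in> X" "z1 \<in> ball z \<rho>" "cf * \<rho> * \<bar>g i0 z\<bar> \<le> \<bar>\<Sum>j\<in>UNIV. g j z * (z1 - z) $ j\<bar>"
        using cf(2)[OF z(1) \<rho>(1) le_ediam_mono[OF r2(2) \<rho>(2)], of "\<lambda>j. g j z" i0] i0 by blast
      have z1c: "z1 \<in> cube z (\<tau> * (r / 2))" using ball_subset_cube[of z \<rho>] z1(2) by (auto simp: \<rho>_def)
      have "cd * (M / (Cg * real CARD('n) * r)) \<le> \<bar>g i0 z\<bar>"
        using iw(2) z(3) i0[of i] mult_left_mono[of "M / (Cg * real CARD('n) * r)" "\<bar>g i w\<bar>" cd] cd(1) by linarith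
      then have "cf * \<rho> * (cd * (M / (Cg * real CARD('n) * r))) \<le> cf * \<rho> * \<bar>g i0 z\<bar>"
        using cf(1) \<rho>(1) by (intro mult_left_mono) auto
      moreover have "cf * \<rho> * (cd * (M / (Cg * real CARD('n) * r))) = c3 * \<tau> * M"
        using r by (simp add: c3_def \<rho>_def mult_ac)
      ultimately have grad: "c3 * \<tau> * M \<le> \<bar>\<Sum>j\<in>UNIV. (z1 - z) $ j * g j z\<bar>"
        using z1(3) by (simp add: mult.commute)
      have "\<bar>p z1 - p z - (\<Sum>j\<in>UNIV. (z1 - z) $ j * g j z)\<bar> \<le> L * \<tau>\<^sup>2 * M"
      proof (rule L(2)[OF p _ \<tau> _ z1c])
        show "\<forall>y\<in>cube z (r / 2). \<bar>p y\<bar> \<le> M"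
          using cube_trans[OF _ z(2), of _ "r / 2" r] yM(2) by (auto simp: M_def)
      qed (use g in auto)
      also have "\<dots> \<le> c3 * \<tau> / 2 * M" using L\<tau> M(1) by (intro mult_right_mono)
      \<comment> \<open>An increment of \<open>c3 * \<tau> / 2 * M\<close> between \<open>z\<close>
        and \<open>z1\<close> forces one of the two values to be at least half of it.\<close>
      finally have "c3 * \<tau> * M - c3 * \<tau> / 2 * M \<le> \<bar>p z1\<bar> + \<bar>p z\<bar>" using grad by linarith
      moreover have "c3 * \<tau> * M - c3 * \<tau> / 2 * M = 2 * (c3 * \<tau> / 4 * M)" by simp
      ultimately have "2 * (c3 * \<tau> / 4 * M) \<le> \<bar>p z1\<bar> + \<bar>p z\<bar>" by simp
      then have "c3 * \<tau> / 4 * M \<le> \<bar>p z1\<bar> \<or> c3 * \<tau> / 4 * M \<le> \<bar>p z\<bar>" by linarith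
      moreover have "c * M \<le> c3 * \<tau> / 4 * M" using M(1) by (intro mult_right_mono) (auto simp: c_def)
      ultimately have "c * M \<le> \<bar>p z1\<bar> \<or> c * M \<le> \<bar>p z\<bar>" by linarith
      moreover have "z1 \<in> cube x r"
        using cube_trans[OF z1c z(2), of r] \<rho> by (simp add: \<rho>_def)
      ultimately show ?thesis using goal z z1 half by blast
    qed
  qed
  with c show ?case by blast
qed

text \<open>At the point of \<open>X\<close> given by \<open>remez_sup\<close>, the polynomial keeps
  half of its size on a ball of radius comparable to \<open>r\<close>, by the local Lipschitz bound,
  and this ball has measure comparable to \<open>r powr s\<close>. The radius \<open>r / 4\<close>
  respects the range of the s-set bounds; \<open>Cg\<close> compensates for it.\<close>

lemma remez_integral:
  "\<exists>C>0. \<forall>x\<in>X. \<forall>r>0. ennreal r \<le> 4 * ediam X \<longrightarrow> (\<forall>p. polyfun d p \<longrightarrow> (\<forall>y\<in>cube x r.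
     ennreal (\<bar>p y\<bar> * r powr s) \<le> ennreal C * (\<integral>\<^sup>+w. ennreal \<bar>p w\<bar> \<partial>hausdorff_on s (cube x r \<inter> X))))"
proof -
  obtain c where c: "c > 0" "\<And>x r p. x \<in> X \<Longrightarrow> r > 0 \<Longrightarrow> ennreal r \<le> ediam X \<Longrightarrow> polyfun d p \<Longrightarrow>
     \<exists>z\<in>X \<inter> cube x r. \<forall>y\<in>cube x r. c * \<bar>p y\<bar> \<le> \<bar>p z\<bar>" using remez_sup[of d] by blast
  obtain Cg where Cg: "Cg \<ge> 1" "\<And>(p :: real ^ 'n \<Rightarrow> real) x r M y. polyfun d p \<Longrightarrow> r > 0 \<Longrightarrow>
      (\<forall>y\<in>cube x r. \<bar>p y\<bar> \<le> M) \<Longrightarrow> y \<in> cube x (4 * r) \<Longrightarrow> \<bar>p y\<bar> \<le> Cg * M"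
    using polyfun_growth[of 4 d, where 'n = 'n] by auto
  obtain L where L: "L \<ge> 0" "\<And>(p :: real ^ 'n \<Rightarrow> real) z R M \<tau> w. polyfun d p \<Longrightarrow> 0 < \<tau> \<Longrightarrow> \<tau> \<le> 1 \<Longrightarrow>
     (\<forall>y\<in>cube z R. \<bar>p y\<bar> \<le> M) \<Longrightarrow> w \<in> cube z (\<tau> * R) \<Longrightarrow> \<bar>p w - p z\<bar> \<le> L * \<tau> * M"
    using polyfun_local_lipschitz[of d, where 'n = 'n] by blast
  define \<tau> where "\<tau> = min (1 / 2) (c / (2 * Cg * (L + 1)))"
  have \<tau>: "0 < \<tau>" "\<tau> \<le> 1 / 2"
  proof -
    show "0 < \<tau>" using c(1) Cg(1) L(1) by (simp add: \<tau>_def)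
    show "\<tau> \<le> 1 / 2" unfolding \<tau>_def by (rule min.cobounded1)
  qed
  have L\<tau>: "L * \<tau> * Cg \<le> c / 2"
  proof -
    have "\<tau> \<le> c / (2 * Cg * (L + 1))" by (simp add: \<tau>_def)
    then have "\<tau> * (2 * Cg * (L + 1)) \<le> c" using L(1) Cg(1) by (subst (asm) pos_le_divide_eq) auto
    moreover have "\<tau> * (2 * Cg * L) \<le> \<tau> * (2 * Cg * (L + 1))"
      using \<tau> Cg(1) L(1) by (intro mult_left_mono) auto
    ultimately show ?thesis by (simp add: mult_ac)
  qed
  define C where "C = 2 * Cg / (c * b * (\<tau> / 2) powr s)"
  have C: "C > 0" using c(1) Cg(1) b \<tau> by (simp add: C_def)
  have "ennreal (\<bar>p y\<bar> * r powr s) \<le> ennreal C * (\<integral>\<^sup>+w. ennreal \<bar>p w\<bar> \<partial>hausdorff_on s (cube x r \<inter> X))"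
    if x: "x \<in> X" and r: "r > 0" "ennreal r \<le> 4 * ediam X" and p: "polyfun d p" and y: "y \<in> cube x r"
    for x r y and p :: "real ^ 'n \<Rightarrow> real"
  proof -
    have r4: "r / 4 > 0" "ennreal (r / 4) \<le> ediam X" using r quarter_le_ediam by auto
    obtain z where z: "z \<in> X" "z \<in> cube x (r / 4)" "\<And>y. y \<in> cube x (r / 4) \<Longrightarrow> c * \<bar>p y\<bar> \<le> \<bar>p z\<bar>"
      using c(2)[OF x r4 p] by blast
    define m where "m = \<bar>p z\<bar>"
    have m0: "m \<ge> 0" by (simp add: m_def)
    have M: "\<bar>p y\<bar> \<le> Cg * (m / c)" if "y \<in> cube x r" for y
    proof (rule Cg(2)[OF p r4(1)])
      show "\<forall>y\<in>cube x (r / 4). \<bar>p y\<bar> \<le> m / c" using z(3) c(1) by (simp add: m_def pos_le_divide_eq mult.commute)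
    qed (use that in simp)
    define R where "R = r / 2"
    define T where "T = ball z (\<tau> * R) \<inter> X"
    have sub: "cube z R \<subseteq> cube x r"
      using cube_trans[OF _ z(2), of _ R r] r by (auto simp: R_def)
    have \<tau>R: "0 < \<tau> * R" "\<tau> * R \<le> r / 4"
      using \<tau> r mult_right_mono[of \<tau> "1 / 2" R] by (auto simp: R_def)
    have ball: "ball z (\<tau> * R) \<subseteq> cube x r"
      using ball_subset_cube[of z "\<tau> * R"] cube_mono[of "\<tau> * R" R z] sub \<tau>R r by (auto simp: R_def)
    have big: "m / 2 \<le> \<bar>p w\<bar>" if "w \<in> T" for w
    proof -
      have "w \<in> cube z (\<tau> * R)" using that ball_subset_cube[of z "\<tau> * R"] by (auto simp: T_def)
      then have "\<bar>p w - p z\<bar> \<le> L * \<tau> * (Cg * (m / c))"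
        using \<tau> sub M by (intro L(2)[OF p, of \<tau> z R]) auto
      also have "\<dots> = (L * \<tau> * Cg) * (m / c)" by simp
      also have "\<dots> \<le> c / 2 * (m / c)" using L\<tau> m0 c(1) by (intro mult_right_mono) auto
      also have "\<dots> = m / 2" using c(1) by simp
      finally show ?thesis unfolding m_def by linarith
    qed
    have T_sets: "T \<in> sets (hausdorff_on s (cube x r \<inter> X))"
    proof -
      have "T = ball z (\<tau> * R) \<inter> (cube x r \<inter> X)" using ball by (auto simp: T_def)
      then show ?thesis using borel_in_sets_hausdorff_on[of "ball z (\<tau> * R)" "cube x r \<inter> X" s] by simp
    qed
    have "ennreal (m / 2 * (b * (\<tau> * R) powr s)) \<le> ennreal (m / 2) * hausdorff_outer s T"
      unfolding T_def using m0 b le_ediam_mono[OF r4(2) \<tau>R(2)] \<tau>R(1) z(1)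
      by (subst ennreal_mult) (auto intro!: mult_left_mono lower)
    also have "\<dots> = (\<integral>\<^sup>+w. ennreal (m / 2) * indicator T w \<partial>hausdorff_on s (cube x r \<inter> X))"
      using T_sets by (simp add: nn_integral_cmult_indicator emeasure_hausdorff_on)
    also have "\<dots> \<le> (\<integral>\<^sup>+w. ennreal \<bar>p w\<bar> \<partial>hausdorff_on s (cube x r \<inter> X))"
      using big by (intro nn_integral_mono) (auto simp: indicator_def intro!: ennreal_leI)
    finally have int: "ennreal (m / 2 * (b * (\<tau> * R) powr s)) \<le> (\<integral>\<^sup>+w. ennreal \<bar>p w\<bar> \<partial>hausdorff_on s (cube x r \<inter> X))" .
    have "\<bar>p y\<bar> * r powr s \<le> Cg * (m / c) * r powr s" using M[OF y] by (intro mult_right_mono) auto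
    also have "\<dots> = C * (m / 2 * (b * (\<tau> * R) powr s))"
    proof -
      have "(\<tau> * R) powr s = (\<tau> / 2) powr s * r powr s"
        using \<tau> r by (simp add: R_def flip: powr_mult)
      then show ?thesis using c(1) b \<tau> by (simp add: C_def)
    qed
    finally have "ennreal (\<bar>p y\<bar> * r powr s) \<le> ennreal (C * (m / 2 * (b * (\<tau> * R) powr s)))" by (rule ennreal_leI)
    also have "\<dots> = ennreal C * ennreal (m / 2 * (b * (\<tau> * R) powr s))"
      using C m0 b by (intro ennreal_mult) auto
    also have "\<dots> \<le> ennreal C * (\<integral>\<^sup>+w. ennreal \<bar>p w\<bar> \<partial>hausdorff_on s (cube x r \<inter> X))"
      by (intro mult_left_mono int) auto
    finally show ?thesis .
  qed
  with C show ?thesis by blast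
qed

end

section \<open>Orthonormal bases\<close>

text \<open>The bilinear form may be degenerate, since distinct functions can agree almost
  everywhere. A residual of norm 0 is dropped, so \<open>N\<close> may be smaller than
  \<open>card E\<close>, and expansions hold only almost everywhere.\<close>

lemma gram_schmidt:
  fixes M :: "'a measure" and W :: "('a \<Rightarrow> real) set"
  assumes "finite E" "E \<subseteq> W"
    and zero: "(\<lambda>_. 0) \<in> W"
    and add: "\<And>f g c. f \<in> W \<Longrightarrow> g \<in> W \<Longrightarrow> (\<lambda>x. f x + c * g x) \<in> W"
    and int: "\<And>f g. f \<in> W \<Longrightarrow> g \<in> W \<Longrightarrow> integrable M (\<lambda>x. f x * g x)"
  shows "\<exists>N u. N \<le> card E \<and> (\<forall>i<N. u i \<in> W) \<and>
    (\<forall>i<N. \<forall>j<N. (LINT x|M. u i x * u j x) = (if i = j then 1 else 0)) \<and>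
    (\<forall>e\<in>E. AE x in M. e x = (\<Sum>i<N. (LINT y|M. e y * u i y) * u i x))"
  using assms(1,2)
proof (induction E rule: finite_induct)
  case empty
  show ?case by (rule exI[of _ 0]) auto
next
  case (insert e E)
  have sumW: "finite I \<Longrightarrow> (\<And>i. i \<in> I \<Longrightarrow> g i \<in> W) \<Longrightarrow> f \<in> W \<Longrightarrow> (\<lambda>x. f x + (\<Sum>i\<in>I. c i * g i x)) \<in> W"
    for I :: "nat set" and f g c
  proof (induction I rule: finite_induct)
    case (insert i I)
    have "(\<lambda>x. (f x + (\<Sum>i\<in>I. c i * g i x)) + c i * g i x) \<in> W"
      by (intro add insert.IH insert.prems) (use insert.prems in auto)
    then show ?case using insert.hyps by (simp add: algebra_simps)
  qed simp
  have "E \<subseteq> W" using insert.prems by blast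
  from insert.IH[OF this] obtain N u where u': "N \<le> card E" "\<forall>i<N. u i \<in> W"
    "\<forall>i<N. \<forall>j<N. (LINT x|M. u i x * u j x) = (if i = j then 1 else 0)"
    "\<forall>e\<in>E. AE x in M. e x = (\<Sum>i<N. (LINT y|M. e y * u i y) * u i x)" by (elim exE conjE)
  note u = u'(1) u'(2)[rule_format] u'(3)[rule_format] u'(4)[rule_format]
  have eW: "e \<in> W" using insert.prems by auto
  define e' where "e' = (\<lambda>x. e x - (\<Sum>i<N. (LINT y|M. e y * u i y) * u i x))"
  have e'W: "e' \<in> W"
    using sumW[of "{..<N}" u e "\<lambda>i. - (LINT y|M. e y * u i y)"] u(2) eW by (simp add: e'_def sum_negf)
  have intsum: "(LINT x|M. (\<Sum>i<N. c i * u i x) * g x) = (\<Sum>i<N. c i * (LINT x|M. u i x * g x))"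
    if "g \<in> W" for c g
    using that u(2) int by (simp add: sum_distrib_right mult.assoc)
  have intsum': "integrable M (\<lambda>x. (\<Sum>i<N. c i * u i x) * g x)" if "g \<in> W" for c g
    unfolding sum_distrib_right mult.assoc
    using that u(2) by (intro Bochner_Integration.integrable_sum integrable_mult_right int) auto
  have orth: "(LINT x|M. e' x * u j x) = 0" if j: "j < N" for j
  proof -
    have "(LINT x|M. e' x * u j x) = (LINT x|M. e x * u j x) -
        (LINT x|M. (\<Sum>i<N. (LINT y|M. e y * u i y) * u i x) * u j x)"
      unfolding e'_def left_diff_distrib
      using int[OF eW u(2)[OF j]] intsum'[OF u(2)[OF j]] by (rule Bochner_Integration.integral_diff)
    also have "(LINT x|M. (\<Sum>i<N. (LINT y|M. e y * u i y) * u i x) * u j x) = (LINT x|M. e x * u j x)"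
      using j u(3) by (simp add: intsum[OF u(2)[OF j]] if_distrib[of "\<lambda>z. _ * z"] cong: if_cong)
    finally show ?thesis by simp
  qed
  define c where "c = (LINT x|M. e' x * e' x)"
  have card: "card (insert e E) = Suc (card E)" using insert.hyps by simp
  show ?case
  proof (cases "c = 0")
    case True
    have "AE x in M. e' x * e' x = 0"
      using True integral_nonneg_eq_0_iff_AE[OF int[OF e'W e'W]] by (simp add: c_def)
    then have "AE x in M. e x = (\<Sum>i<N. (LINT y|M. e y * u i y) * u i x)" by (simp add: e'_def)
    then show ?thesis using u card by (intro exI[of _ N] exI[of _ u]) auto
  next
    case False
    moreover have "c \<ge> 0" unfolding c_def by (rule integral_nonneg_AE) auto
    ultimately have c: "c > 0" by simp
    define v where "v = u(N := (\<lambda>x. (1 / sqrt c) * e' x))"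
    have vN: "v N = (\<lambda>x. (1 / sqrt c) * e' x)" and vi: "\<And>i. i < N \<Longrightarrow> v i = u i" by (auto simp: v_def)
    have vNW: "v N \<in> W" using add[OF zero e'W, of "1 / sqrt c"] by (simp add: vN)
    have uN: "(LINT x|M. u i x * v N x) = 0" if "i < N" for i
      using orth[OF that] by (simp add: vN mult.commute[of "u i _"] mult.assoc)
    have NN: "(LINT x|M. v N x * v N x) = 1"
    proof -
      have "(LINT x|M. v N x * v N x) = (LINT x|M. (1 / c) * (e' x * e' x))"
        using c by (intro Bochner_Integration.integral_cong) (auto simp: vN field_simps)
      then show ?thesis using c by (simp add: c_def[symmetric])
    qed
    have "AE x in M. f x = (\<Sum>i<Suc N. (LINT y|M. f y * v i y) * v i x)" if f: "f \<in> insert e E" for f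
    proof (cases "f = e")
      case True
      have "(LINT y|M. e y * v N y) = (LINT y|M. e' y * v N y + (\<Sum>i<N. (LINT y|M. e y * u i y) * u i y) * v N y)"
        by (intro Bochner_Integration.integral_cong) (simp_all add: e'_def left_diff_distrib)
      also have "\<dots> = (LINT y|M. e' y * v N y) + (LINT y|M. (\<Sum>i<N. (LINT y|M. e y * u i y) * u i y) * v N y)"
        using int[OF e'W vNW] intsum'[OF vNW] by (rule Bochner_Integration.integral_add)
      also have "(LINT y|M. (\<Sum>i<N. (LINT y|M. e y * u i y) * u i y) * v N y) = 0"
        by (simp add: intsum[OF vNW] uN)
      also have "(LINT y|M. e' y * v N y) = sqrt c"
      proof -
        have "(LINT y|M. e' y * v N y) = (LINT x|M. (1 / sqrt c) * (e' x * e' x))"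
          by (intro Bochner_Integration.integral_cong) (auto simp: vN)
        then show ?thesis using c by (simp add: c_def[symmetric] real_div_sqrt)
      qed
      finally have "(LINT y|M. e y * v N y) * v N x = e' x" for x using c by (simp add: vN)
      then show ?thesis using True by (simp add: vi e'_def)
    next
      case False
      then have f: "f \<in> E" "f \<in> W" using f insert.prems by auto
      have "(LINT y|M. f y * v N y) = (LINT y|M. (\<Sum>i<N. (LINT y|M. f y * u i y) * u i y) * v N y)"
        by (rule integral_cong_AE)
          (use u(4)[OF f(1)] int[OF f(2) vNW] intsum'[OF vNW] in \<open>auto dest: borel_measurable_integrable\<close>)
      also have "\<dots> = 0" by (simp add: intsum[OF vNW] uN)
      finally show ?thesis using u(4)[OF f(1)] by (simp add: vi)
    qed
    moreover have "v i \<in> W" if "i < Suc N" for i using that vNW u(2) vi by (cases "i = N") auto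
    moreover have "(LINT x|M. v i x * v j x) = (if i = j then 1 else 0)" if ij: "i < Suc N" "j < Suc N" for i j
    proof -
      consider "i < N" "j < N" | "i < N" "j = N" | "i = N" "j < N" | "i = N" "j = N"
        using ij unfolding less_Suc_eq by blast
      then show ?thesis
      proof cases
        case 3
        then show ?thesis using uN[of j] vi[of j] by (subst mult.commute) simp
      qed (use u(3) uN NN vi in simp_all)
    qed
    ultimately show ?thesis using u(1) card by (intro exI[of _ "Suc N"] exI[of _ v]) auto
  qed
qed

text \<open>The bound on \<open>N\<close> is recorded because the norm of the projection has to be
  uniform over all cubes.\<close>

definition poly_basis :: "nat \<Rightarrow> (real ^ 'n::finite) measure \<Rightarrow> nat \<times> (nat \<Rightarrow> real ^ 'n \<Rightarrow> real) \<Rightarrow> bool" where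
  "poly_basis d M = (\<lambda>(N, u). N \<le> card {\<alpha> :: 'n \<Rightarrow> nat. (\<Sum>i\<in>UNIV. \<alpha> i) \<le> d} \<and> (\<forall>i<N. polyfun d (u i)) \<and>
    (\<forall>i<N. \<forall>j<N. (LINT x|M. u i x * u j x) = (if i = j then 1 else 0)) \<and>
    (\<forall>p. polyfun d p \<longrightarrow> (AE x in M. p x = (\<Sum>i<N. (LINT y|M. p y * u i y) * u i x))))"

lemma poly_basis_ex:
  fixes M :: "(real ^ 'n::finite) measure"
  assumes int: "\<And>p. polyfun (d + d) p \<Longrightarrow> integrable M p"
  shows "\<exists>b. poly_basis d M b"
proof -
  let ?A = "{\<alpha> :: 'n \<Rightarrow> nat. (\<Sum>i\<in>UNIV. \<alpha> i) \<le> d}"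
  define e where "e \<alpha> = (\<lambda>x :: real ^ 'n. \<Prod>i\<in>UNIV. (x $ i) ^ \<alpha> i)" for \<alpha>
  have "\<exists>N u. N \<le> card (e ` ?A) \<and> (\<forall>i<N. u i \<in> Collect (polyfun d)) \<and>
    (\<forall>i<N. \<forall>j<N. (LINT x|M. u i x * u j x) = (if i = j then 1 else 0)) \<and>
    (\<forall>e\<in>e ` ?A. AE x in M. e x = (\<Sum>i<N. (LINT y|M. e y * u i y) * u i x))"
  proof (rule gram_schmidt)
    show "e ` ?A \<subseteq> Collect (polyfun d)" by (auto simp: e_def intro!: polyfun_monomial)
  qed (use int in \<open>auto intro: finite_multiindices polyfun.intros polyfun_cmult polyfun_mult\<close>)
  then obtain N u where u': "N \<le> card (e ` ?A)" "\<forall>i<N. u i \<in> Collect (polyfun d)"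
    "\<forall>i<N. \<forall>j<N. (LINT x|M. u i x * u j x) = (if i = j then 1 else 0)"
    "\<forall>e\<in>e ` ?A. AE x in M. e x = (\<Sum>i<N. (LINT y|M. e y * u i y) * u i x)" by (elim exE conjE)
  note u = u'(1) u'(2)[rule_format, unfolded mem_Collect_eq] u'(3) u'(4)[rule_format, OF imageI]
  have "AE x in M. p x = (\<Sum>i<N. (LINT y|M. p y * u i y) * u i x)" if p: "polyfun d p" for p
  proof -
    obtain c where c: "p = (\<lambda>x. \<Sum>\<alpha>\<in>?A. c \<alpha> * e \<alpha> x)"
      using p polys_eq[of d] by (auto simp: polys_def e_def)
    have coef: "(LINT y|M. p y * u i y) = (\<Sum>\<alpha>\<in>?A. c \<alpha> * (LINT y|M. e \<alpha> y * u i y))" if "i < N" for i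
    proof -
      have "integrable M (\<lambda>y. e \<alpha> y * u i y)" if "\<alpha> \<in> ?A" for \<alpha>
        using that u(2)[OF \<open>i < N\<close>] by (intro int polyfun_mult) (auto simp: e_def intro!: polyfun_monomial)
      then show ?thesis unfolding c by (simp add: sum_distrib_right mult.assoc)
    qed
    have "AE x in M. \<forall>\<alpha>\<in>?A. e \<alpha> x = (\<Sum>i<N. (LINT y|M. e \<alpha> y * u i y) * u i x)"
      by (intro AE_finite_allI finite_multiindices u(4))
    then show ?thesis
    proof eventually_elim
      case (elim x)
      have "p x = (\<Sum>\<alpha>\<in>?A. c \<alpha> * (\<Sum>i<N. (LINT y|M. e \<alpha> y * u i y) * u i x))"
        unfolding c using elim by (intro sum.cong) auto
      also have "\<dots> = (\<Sum>i<N. (\<Sum>\<alpha>\<in>?A. c \<alpha> * (LINT y|M. e \<alpha> y * u i y)) * u i x)"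
        unfolding sum_distrib_left sum_distrib_right by (subst sum.swap) (simp add: mult.assoc)
      also have "\<dots> = (\<Sum>i<N. (LINT y|M. p y * u i y) * u i x)"
        using coef by (intro sum.cong) auto
      finally show ?case .
    qed
  qed
  moreover have "N \<le> card ?A" using u(1) card_image_le[OF finite_multiindices, of e d] by linarith
  ultimately show ?thesis using u(2,3) by (intro exI[of _ "(N, u)"]) (auto simp: poly_basis_def)
qed

text \<open>The orthogonal projection onto polynomials in \<open>L\<^sub>2\<close>; it extends to \<open>L\<^sub>1\<close> because polynomials are
  bounded.\<close>

definition poly_proj :: "nat \<Rightarrow> (real ^ 'n::finite) measure \<Rightarrow> (real ^ 'n \<Rightarrow> real) \<Rightarrow> real ^ 'n \<Rightarrow> real" where
  "poly_proj d M f y = (let (N, u) = (SOME b. poly_basis d M b) in \<Sum>i<N. (LINT w|M. f w * u i w) * u i y)"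

section \<open>Integral means\<close>

lemma in_Lq_integrable:
  assumes "finite_measure M" "1 \<le> q" "in_Lq q M f"
  shows "integrable M f"
proof -
  interpret finite_measure M by fact
  have meas: "f \<in> borel_measurable M" using assms(3) by (simp add: in_Lq_def)
  show ?thesis
  proof (cases "q = \<infinity>")
    case True
    then have fin: "esssup M (\<lambda>y. ennreal \<bar>f y\<bar>) < \<infinity>" using assms(3) by (simp add: in_Lq_def)
    have "AE x in M. norm (f x) \<le> enn2real (esssup M (\<lambda>y. ennreal \<bar>f y\<bar>))"
      using esssup_AE[of "\<lambda>y. ennreal \<bar>f y\<bar>" M]
    proof eventually_elim
      case (elim x)
      then have "enn2real (ennreal \<bar>f x\<bar>) \<le> enn2real (esssup M (\<lambda>y. ennreal \<bar>f y\<bar>))"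
        using fin by (intro enn2real_mono) auto
      then show ?case by simp
    qed
    then show ?thesis by (rule integrable_const_bound[OF _ meas])
  next
    case False
    define q' where "q' = enn2real q"
    have q': "q' \<ge> 1" using assms(2) False enn2real_mono[of 1 q] by (simp add: q'_def less_top)
    have "integrable M (\<lambda>y. 1 + \<bar>f y\<bar> powr q')"
      using assms(3) False by (auto simp: in_Lq_def q'_def)
    then show ?thesis
    proof (rule Bochner_Integration.integrable_bound[OF _ meas], intro AE_I2)
      fix x
      show "norm (f x) \<le> norm (1 + \<bar>f x\<bar> powr q')"
        using powr_mono[of 1 q' "\<bar>f x\<bar>"] q' by (cases "\<bar>f x\<bar> \<le> 1") (auto intro: add_increasing2 add_increasing)
    qed
  qed
qed

text \<open>Rests on the pointwise bound
  \<open>\<bar>f x\<bar> \<le> c + c * (\<bar>f x\<bar> / c) powr q'\<close>, trivial where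
  \<open>\<bar>f x\<bar> \<le> c\<close> and due to \<open>q' \<ge> 1\<close> elsewhere. Both
  summands integrate to at most the measure times \<open>c\<close>; hence the factor 2, and the
  positivity of \<open>c\<close>.\<close>

lemma integral_abs_le_mean_Lq:
  assumes "finite_measure M" "1 \<le> q" "in_Lq q M f" "mean_Lq q M f \<le> c" "c > 0"
  shows "(LINT x|M. \<bar>f x\<bar>) \<le> 2 * measure M (space M) * c"
proof -
  interpret finite_measure M by fact
  have int: "integrable M f" by (rule in_Lq_integrable[OF assms(1-3)])
  show ?thesis
  proof (cases "q = \<infinity>")
    case True
    then have fin: "esssup M (\<lambda>y. ennreal \<bar>f y\<bar>) < \<infinity>" using assms(3) by (simp add: in_Lq_def)
    have le: "enn2real (esssup M (\<lambda>y. ennreal \<bar>f y\<bar>)) \<le> c" using assms(4) True by (simp add: mean_Lq_def)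
    have "AE x in M. \<bar>f x\<bar> \<le> c"
      using esssup_AE[of "\<lambda>y. ennreal \<bar>f y\<bar>" M]
    proof eventually_elim
      case (elim x)
      then have "enn2real (ennreal \<bar>f x\<bar>) \<le> enn2real (esssup M (\<lambda>y. ennreal \<bar>f y\<bar>))"
        using fin by (intro enn2real_mono) auto
      then show ?case using le by simp
    qed
    then have "(LINT x|M. \<bar>f x\<bar>) \<le> (LINT x|M. c)" using int by (intro integral_mono_AE) auto
    also have "\<dots> = measure M (space M) * c" by simp
    also have "\<dots> \<le> 2 * measure M (space M) * c" using assms(5) by (simp add: mult_right_mono)
    finally show ?thesis .
  next
    case False
    define q' where "q' = enn2real q"
    have q': "q' \<ge> 1" using assms(2) False enn2real_mono[of 1 q] by (simp add: q'_def less_top)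
    have intq: "integrable M (\<lambda>y. \<bar>f y\<bar> powr q')" using assms(3) False by (auto simp: in_Lq_def q'_def)
    define I where "I = (LINT y|M. \<bar>f y\<bar> powr q')"
    have I0: "I \<ge> 0" unfolding I_def by (intro integral_nonneg_AE) auto
    have "I \<le> measure M (space M) * c powr q'"
    proof (cases "measure M (space M) = 0")
      case True
      then have "space M \<in> null_sets M" by (auto intro: null_setsI simp: emeasure_eq_measure)
      then have "AE x in M. \<bar>f x\<bar> powr q' = 0" using AE_space by (auto dest: AE_not_in elim: AE_mp)
      then have "I = 0" unfolding I_def by (rule integral_eq_zero_AE)
      then show ?thesis by simp
    next
      case False
      then have H: "measure M (space M) > 0" using measure_nonneg[of M "space M"] by linarith
      have "(1 / measure M (space M) * I) powr (1 / q') \<le> c"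
        using assms(4) \<open>q \<noteq> \<infinity>\<close> by (simp add: mean_Lq_def I_def q'_def)
      then have "((1 / measure M (space M) * I) powr (1 / q')) powr q' \<le> c powr q'"
        using q' by (intro powr_mono2) auto
      then show ?thesis using q' I0 H by (simp add: powr_powr field_simps)
    qed
    moreover have "(LINT x|M. \<bar>f x\<bar>) \<le> (LINT x|M. c + c / c powr q' * \<bar>f x\<bar> powr q')"
    proof (rule integral_mono)
      fix x
      show "\<bar>f x\<bar> \<le> c + c / c powr q' * \<bar>f x\<bar> powr q'"
      proof (cases "\<bar>f x\<bar> \<le> c")
        case True
        then show ?thesis using assms(5) by (simp add: add_increasing2)
      next
        case False
        then have "(\<bar>f x\<bar> / c) powr 1 \<le> (\<bar>f x\<bar> / c) powr q'"
          using q' assms(5) by (intro powr_mono) auto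
        then have "\<bar>f x\<bar> \<le> c * ((\<bar>f x\<bar> / c) powr q')" using assms(5) by (simp add: field_simps)
        also have "\<dots> = c / c powr q' * \<bar>f x\<bar> powr q'" using assms(5) by (simp add: powr_divide)
        finally show ?thesis using assms(5) by simp
      qed
    qed (use int intq in auto)
    moreover have "(LINT x|M. c + c / c powr q' * \<bar>f x\<bar> powr q') = measure M (space M) * c + c / c powr q' * I"
      using intq by (simp add: I_def)
    moreover have "c / c powr q' * I \<le> c / c powr q' * (measure M (space M) * c powr q')"
      using calculation(1) assms(5) by (intro mult_left_mono) auto
    ultimately have "(LINT x|M. \<bar>f x\<bar>) \<le>
        measure M (space M) * c + c / c powr q' * (measure M (space M) * c powr q')" by linarith
    then show ?thesis using assms(5) by (simp add: mult_ac)
  qed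
qed

lemma in_Lq_bounded:
  assumes "finite_measure M" "f \<in> borel_measurable M" "AE x in M. \<bar>f x\<bar> \<le> B" "B \<ge> 0"
  shows "in_Lq q M f"
proof -
  interpret finite_measure M by fact
  have "esssup M (\<lambda>y. ennreal \<bar>f y\<bar>) \<le> ennreal B"
    using assms(2,3) by (intro esssup_I) (auto elim!: eventually_mono intro: ennreal_leI)
  then have "esssup M (\<lambda>y. ennreal \<bar>f y\<bar>) < \<infinity>" using le_less_trans ennreal_less_top by fastforce
  moreover have "integrable M (\<lambda>y. \<bar>f y\<bar> powr enn2real q)"
    by (rule integrable_const_bound[where B = "B powr enn2real q"])
      (use assms(2,3) in \<open>auto elim!: eventually_mono intro: powr_mono2\<close>)
  ultimately show ?thesis using assms(2) by (simp add: in_Lq_def)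
qed

lemma mean_Lq_bounded:
  assumes "finite_measure M" "1 \<le> q" "f \<in> borel_measurable M" "AE x in M. \<bar>f x\<bar> \<le> B" "B \<ge> 0"
  shows "mean_Lq q M f \<le> B"
proof -
  interpret finite_measure M by fact
  show ?thesis
  proof (cases "q = \<infinity>")
    case True
    have "esssup M (\<lambda>y. ennreal \<bar>f y\<bar>) \<le> ennreal B"
      using assms(3,4) by (intro esssup_I) (auto elim!: eventually_mono intro: ennreal_leI)
    then have "enn2real (esssup M (\<lambda>y. ennreal \<bar>f y\<bar>)) \<le> enn2real (ennreal B)"
      by (intro enn2real_mono) auto
    then show ?thesis using True assms(5) by (simp add: mean_Lq_def)
  next
    case False
    define q' where "q' = enn2real q"
    have q': "q' \<ge> 1" using assms(2) False enn2real_mono[of 1 q] by (simp add: q'_def less_top)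
    define I where "I = (LINT y|M. \<bar>f y\<bar> powr q')"
    have I0: "I \<ge> 0" unfolding I_def by (intro integral_nonneg_AE) auto
    have "I \<le> (LINT y|M. B powr q')"
      unfolding I_def
    proof (rule integral_mono_AE)
      show "AE x in M. \<bar>f x\<bar> powr q' \<le> B powr q'"
        using assms(4) q' by (auto elim!: eventually_mono intro: powr_mono2)
      then show "integrable M (\<lambda>x. \<bar>f x\<bar> powr q')"
        using assms(3) by (intro integrable_const_bound[where B = "B powr q'"]) auto
    qed auto
    then have "I \<le> measure M (space M) * B powr q'" by simp
    then have "1 / measure M (space M) * I \<le> B powr q'"
      using zero_less_measure_iff[of M "space M"]
      by (cases "measure M (space M) = 0") (auto simp: pos_divide_le_eq mult.commute)
    then have "(1 / measure M (space M) * I) powr (1 / q') \<le> (B powr q') powr (1 / q')"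
      using I0 q' by (intro powr_mono2) auto
    also have "\<dots> = B" using q' assms(5) by (simp add: powr_powr)
    finally show ?thesis using False by (simp add: mean_Lq_def I_def q'_def)
  qed
qed

lemma in_Lq_diff_bounded:
  assumes "finite_measure M" "1 \<le> q" "in_Lq q M f" "g \<in> borel_measurable M" "AE x in M. \<bar>g x\<bar> \<le> B" "B \<ge> 0"
  shows "in_Lq q M (\<lambda>x. f x - g x)"
proof -
  interpret finite_measure M by fact
  have meas: "f \<in> borel_measurable M" using assms(3) by (simp add: in_Lq_def)
  show ?thesis
  proof (cases "q = \<infinity>")
    case True
    then have fin: "esssup M (\<lambda>y. ennreal \<bar>f y\<bar>) < \<infinity>" using assms(3) by (simp add: in_Lq_def)
    have "esssup M (\<lambda>y. ennreal \<bar>f y - g y\<bar>) \<le> esssup M (\<lambda>y. ennreal \<bar>f y\<bar>) + ennreal B"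
    proof (rule esssup_I)
      show "AE x in M. ennreal \<bar>f x - g x\<bar> \<le> esssup M (\<lambda>y. ennreal \<bar>f y\<bar>) + ennreal B"
        using esssup_AE[of "\<lambda>y. ennreal \<bar>f y\<bar>" M] assms(5)
      proof eventually_elim
        case (elim x)
        have "ennreal \<bar>f x - g x\<bar> \<le> ennreal (\<bar>f x\<bar> + B)" using elim by (intro ennreal_leI) linarith
        also have "\<dots> = ennreal \<bar>f x\<bar> + ennreal B" using assms(6) by simp
        also have "\<dots> \<le> esssup M (\<lambda>y. ennreal \<bar>f y\<bar>) + ennreal B" using elim by (intro add_right_mono)
        finally show ?case .
      qed
    qed (use meas assms(4) in auto)
    also have "\<dots> < \<infinity>" using fin by simp
    finally show ?thesis using True meas assms(4) by (simp add: in_Lq_def)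
  next
    case False
    define q' where "q' = enn2real q"
    have q': "q' \<ge> 1" using assms(2) False enn2real_mono[of 1 q] by (simp add: q'_def less_top)
    have "integrable M (\<lambda>y. 2 powr q' * (\<bar>f y\<bar> powr q' + B powr q'))"
      using assms(3) False by (auto simp: in_Lq_def q'_def)
    then have "integrable M (\<lambda>y. \<bar>f y - g y\<bar> powr q')"
    proof (rule Bochner_Integration.integrable_bound)
      show "AE x in M. norm (\<bar>f x - g x\<bar> powr q') \<le> norm (2 powr q' * (\<bar>f x\<bar> powr q' + B powr q'))"
        using assms(5)
      proof eventually_elim
        case (elim x)
        have "\<bar>f x - g x\<bar> powr q' \<le> (2 * max \<bar>f x\<bar> B) powr q'"
          using elim q' by (intro powr_mono2) auto
        also have "\<dots> = 2 powr q' * (max \<bar>f x\<bar> B) powr q'" using assms(6) by (simp add: powr_mult)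
        also have "\<dots> \<le> 2 powr q' * (\<bar>f x\<bar> powr q' + B powr q')"
          by (intro mult_left_mono) (auto simp: max_def)
        finally show ?case by simp
      qed
    qed (use meas assms(4) in auto)
    then show ?thesis using False meas assms(4) by (simp add: in_Lq_def q'_def)
  qed
qed

section \<open>Local polynomial approximation of Morrey--Campanato functions\<close>

locale campanato_set = ahlfors_set s X a b for s and X :: "(real ^ 'n::finite) set" and a b +
  fixes q :: ennreal and k :: nat and \<omega> :: "real \<Rightarrow> real"
  assumes q: "1 \<le> q" and k: "1 \<le> k" and \<omega>: "quasipower_majorant k \<omega>"
begin

abbreviation H where "H x r \<equiv> hausdorff_on s (cube x r \<inter> X)"
abbreviation proj where "proj x r f \<equiv> poly_proj (k - 1) (H x r) f"
abbreviation Nf where "Nf f \<equiv> enn2real (campanato_seminorm s q k \<omega> X f)"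

definition A1 where "A1 = (8 * real CARD('n) + 1) ^ CARD('n) * a"

lemma A1_pos: "A1 > 0" using a by (simp add: A1_def add_pos_pos)

lemma emeasure_H: "r > 0 \<Longrightarrow> ennreal r \<le> 4 * ediam X \<Longrightarrow> emeasure (H x r) (cube x r \<inter> X) \<le> ennreal (A1 * r powr s)"
  unfolding emeasure_hausdorff_on_space A1_def by (rule cube_upper)

lemma finite_H: "r > 0 \<Longrightarrow> ennreal r \<le> 4 * ediam X \<Longrightarrow> finite_measure (H x r)"
  using le_less_trans[OF emeasure_H ennreal_less_top] by (intro finite_measureI) (auto simp: less_top)

lemma measure_H: "r > 0 \<Longrightarrow> ennreal r \<le> 4 * ediam X \<Longrightarrow> measure (H x r) (cube x r \<inter> X) \<le> A1 * r powr s"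
  using emeasure_H[of r x] A1_pos unfolding measure_def by (intro enn2real_leI) auto

lemma polyfun_bounded: "polyfun d p \<Longrightarrow> \<exists>B\<ge>0. \<forall>y\<in>cube x r. \<bar>p y\<bar> \<le> B"
proof -
  assume p: "polyfun d p"
  have "bounded (p ` cube x r)"
    by (intro compact_imp_bounded compact_continuous_image polyfun_continuous[OF p] compact_cube)
  then obtain B where "\<And>y. y \<in> cube x r \<Longrightarrow> \<bar>p y\<bar> \<le> B" by (auto simp: bounded_iff)
  then show ?thesis by (intro exI[of _ "max 0 B"]) (auto simp: le_max_iff_disj)
qed

lemma polyfun_measurable: "polyfun d p \<Longrightarrow> p \<in> borel_measurable (H x r)"
  by (intro continuous_measurable_hausdorff_on polyfun_continuous)

lemma polyfun_integrable: "polyfun d p \<Longrightarrow> r > 0 \<Longrightarrow> ennreal r \<le> 4 * ediam X \<Longrightarrow> integrable (H x r) p"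
proof -
  assume p: "polyfun d p" and r: "r > 0" "ennreal r \<le> 4 * ediam X"
  interpret finite_measure "H x r" by (rule finite_H[OF r])
  obtain B where "\<forall>y\<in>cube x r. \<bar>p y\<bar> \<le> B" using polyfun_bounded[OF p] by blast
  then show ?thesis by (intro integrable_const_bound[of _ B] polyfun_measurable[OF p] AE_I2) auto
qed

lemma polyfun_mult_integrable:
  assumes p: "polyfun d p" and r: "r > 0" "ennreal r \<le> 4 * ediam X" and f: "integrable (H x r) f"
  shows "integrable (H x r) (\<lambda>w. f w * p w)"
proof -
  obtain B where B: "B \<ge> 0" "\<forall>y\<in>cube x r. \<bar>p y\<bar> \<le> B" using polyfun_bounded[OF p] by blast
  have "integrable (H x r) (\<lambda>w. B * f w)" using f by simp
  then show ?thesis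
  proof (rule Bochner_Integration.integrable_bound)
    show "AE w in H x r. norm (f w * p w) \<le> norm (B * f w)"
      using B by (intro AE_I2) (auto simp: abs_mult mult.commute[of B] intro!: mult_left_mono)
  qed (use f polyfun_measurable[OF p] in auto)
qed

section \<open>Projection onto polynomials on a cube\<close>

definition basis where "basis x r = (SOME b. poly_basis (k - 1) (H x r) b)"

lemma proj_eq: "proj x r f y = (\<Sum>i<fst (basis x r). (LINT w|H x r. f w * snd (basis x r) i w) * snd (basis x r) i y)"
  by (simp add: poly_proj_def basis_def case_prod_unfold Let_def)

lemma basis:
  assumes "r > 0" "ennreal r \<le> 4 * ediam X"
  shows "poly_basis (k - 1) (H x r) (basis x r)"
  unfolding basis_def by (rule someI_ex[OF poly_basis_ex]) (use assms in \<open>auto intro: polyfun_integrable\<close>)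

lemma polyfun_basis:
  assumes "r > 0" "ennreal r \<le> 4 * ediam X" "i < fst (basis x r)"
  shows "polyfun (k - 1) (snd (basis x r) i)"
  using basis[OF assms(1,2), of x] assms(3) by (auto simp: poly_basis_def case_prod_unfold)

lemma polyfun_proj: "r > 0 \<Longrightarrow> ennreal r \<le> 4 * ediam X \<Longrightarrow> polyfun (k - 1) (proj x r f)"
  unfolding proj_eq[abs_def] by (intro polyfun_sum polyfun_cmult polyfun_basis) auto

lemma remez_real:
  "\<exists>C>0. \<forall>x\<in>X. \<forall>r>0. ennreal r \<le> 4 * ediam X \<longrightarrow> (\<forall>p. polyfun (k - 1) p \<longrightarrow> (\<forall>y\<in>cube x r.
     \<bar>p y\<bar> * r powr s \<le> C * (LINT w|H x r. \<bar>p w\<bar>)))"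
proof -
  obtain C where C: "C > 0" "\<And>x r p y. x \<in> X \<Longrightarrow> r > 0 \<Longrightarrow> ennreal r \<le> 4 * ediam X \<Longrightarrow> polyfun (k - 1) p \<Longrightarrow>
     y \<in> cube x r \<Longrightarrow> ennreal (\<bar>p y\<bar> * r powr s) \<le> ennreal C * (\<integral>\<^sup>+w. ennreal \<bar>p w\<bar> \<partial>H x r)"
    using remez_integral[of "k - 1"] by blast
  have "\<bar>p y\<bar> * r powr s \<le> C * (LINT w|H x r. \<bar>p w\<bar>)"
    if "x \<in> X" "r > 0" "ennreal r \<le> 4 * ediam X" "polyfun (k - 1) p" "y \<in> cube x r" for x r p y
  proof -
    have "ennreal C * (\<integral>\<^sup>+w. ennreal \<bar>p w\<bar> \<partial>H x r) = ennreal (C * (LINT w|H x r. \<bar>p w\<bar>))"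
      using C(1) polyfun_integrable[OF that(4,2,3)]
      by (subst nn_integral_eq_integral) (auto simp: ennreal_mult)
    with C(2)[OF that] have "ennreal (\<bar>p y\<bar> * r powr s) \<le> ennreal (C * (LINT w|H x r. \<bar>p w\<bar>))" by simp
    then show ?thesis using C(1) by (subst (asm) ennreal_le_iff) (auto intro!: mult_nonneg_nonneg integral_nonneg_AE)
  qed
  with C(1) show ?thesis by blast
qed

text \<open>An orthonormal basis function is at most \<open>B / sqrt V\<close>: the inequality
  \<open>2 * \<bar>u\<bar> \<le> 1 / sqrt V + sqrt V * u\<^sup>2\<close> bounds its L_1 norm by a
  multiple of \<open>sqrt V\<close>, and the Remez inequality turns this into a supremum. It occurs
  twice in the projection, once under the integral, so the projection maps L_1 to bounded functions
  with a norm of order \<open>1 / V\<close>.\<close>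

lemma proj_bound:
  "\<exists>C\<ge>0. \<forall>x\<in>X. \<forall>r>0. ennreal r \<le> 4 * ediam X \<longrightarrow> (\<forall>h. integrable (H x r) h \<longrightarrow> (\<forall>y\<in>cube x r.
     \<bar>proj x r h y\<bar> * r powr s \<le> C * (LINT w|H x r. \<bar>h w\<bar>)))"
proof -
  obtain CR where CR: "CR > 0" "\<And>x r p y. x \<in> X \<Longrightarrow> r > 0 \<Longrightarrow> ennreal r \<le> 4 * ediam X \<Longrightarrow> polyfun (k - 1) p \<Longrightarrow>
     y \<in> cube x r \<Longrightarrow> \<bar>p y\<bar> * r powr s \<le> CR * (LINT w|H x r. \<bar>p w\<bar>)"
    using remez_real by blast
  define D where "D = real (card {\<alpha> :: 'n \<Rightarrow> nat. (\<Sum>i\<in>UNIV. \<alpha> i) \<le> k - 1})"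
  define B where "B = CR * (A1 + 1) / 2"
  have B: "B \<ge> 0" using CR A1_pos by (simp add: B_def)
  have "\<bar>proj x r h y\<bar> * r powr s \<le> (D * B\<^sup>2) * (LINT w|H x r. \<bar>h w\<bar>)"
    if x: "x \<in> X" and r: "r > 0" "ennreal r \<le> 4 * ediam X" and h: "integrable (H x r) h" and y: "y \<in> cube x r" for x r h y
  proof -
    interpret finite_measure "H x r" by (rule finite_H[OF r])
    define V where "V = r powr s"
    have V: "V > 0" using r by (simp add: V_def)
    define N where "N = fst (basis x r)"
    define u where "u = snd (basis x r)"
    have u: "polyfun (k - 1) (u i)" "(LINT w|H x r. u i w * u i w) = 1" if "i < N" for i
      using basis[OF r, of x] that by (auto simp: poly_basis_def case_prod_unfold N_def u_def)
    have N: "real N \<le> D" using basis[OF r, of x] by (auto simp: poly_basis_def case_prod_unfold N_def D_def)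
    have ub: "\<bar>u i w\<bar> \<le> B / sqrt V" if i: "i < N" and w: "w \<in> cube x r" for i w
    proof -
      have "(LINT w|H x r. \<bar>u i w\<bar>) \<le> (LINT w|H x r. (1 / sqrt V + sqrt V * (u i w * u i w)) / 2)"
      proof (rule integral_mono)
        fix w
        define t where "t = sqrt V"
        have t: "t > 0" using V by (simp add: t_def)
        have "0 \<le> (1 - t * \<bar>u i w\<bar>)\<^sup>2" by simp
        also have "\<dots> = 1 + t * (t * (u i w * u i w)) - t * (2 * \<bar>u i w\<bar>)"
          by (simp add: power2_eq_square algebra_simps)
        finally have "t * (2 * \<bar>u i w\<bar>) \<le> t * (1 / t + t * (u i w * u i w))"
          using t by (simp add: distrib_left)
        then have "2 * \<bar>u i w\<bar> \<le> 1 / t + t * (u i w * u i w)" using t by simp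
        then show "\<bar>u i w\<bar> \<le> (1 / sqrt V + sqrt V * (u i w * u i w)) / 2" by (simp add: t_def)
      qed (use polyfun_integrable[OF polyfun_mult[OF u(1)[OF i] u(1)[OF i]] r] polyfun_integrable[OF u(1)[OF i] r] in auto)
      also have "\<dots> = (measure (H x r) (cube x r \<inter> X) * (1 / sqrt V) + sqrt V) / 2"
        using polyfun_integrable[OF polyfun_mult[OF u(1)[OF i] u(1)[OF i]] r] u(2)[OF i] by simp
      also have "\<dots> \<le> (A1 * V * (1 / sqrt V) + sqrt V) / 2"
        using measure_H[OF r, of x] V by (intro divide_right_mono add_right_mono mult_right_mono) (auto simp: V_def)
      also have "\<dots> = (A1 + 1) / 2 * sqrt V"
      proof -
        have e: "V / sqrt V = sqrt V" using V by (intro real_div_sqrt) simp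
        have "A1 * V * (1 / sqrt V) = A1 * (V / sqrt V)" by simp
        then show ?thesis unfolding e by (simp add: algebra_simps)
      qed
      finally have "CR * (LINT w|H x r. \<bar>u i w\<bar>) \<le> CR * ((A1 + 1) / 2 * sqrt V)" using CR(1) by (intro mult_left_mono) auto
      with CR(2)[OF x r u(1)[OF i] w] have "\<bar>u i w\<bar> * V \<le> B * sqrt V" by (simp add: V_def B_def)
      then have "\<bar>u i w\<bar> * (sqrt V * sqrt V) \<le> B * sqrt V" using V by simp
      then have "\<bar>u i w\<bar> * sqrt V \<le> B" using V by (simp add: mult.assoc[symmetric] del: real_sqrt_mult_self)
      then show ?thesis using V by (simp add: pos_le_divide_eq)
    qed
    have "\<bar>(LINT w|H x r. h w * u i w) * u i y\<bar> \<le> B\<^sup>2 / V * (LINT w|H x r. \<bar>h w\<bar>)" if i: "i < N" for i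
    proof -
      have "\<bar>LINT w|H x r. h w * u i w\<bar> \<le> (LINT w|H x r. \<bar>h w * u i w\<bar>)" by (rule integral_abs_bound)
      also have "\<dots> \<le> (LINT w|H x r. B / sqrt V * \<bar>h w\<bar>)"
      proof (rule integral_mono)
        fix w assume "w \<in> space (H x r)"
        then have "\<bar>u i w\<bar> \<le> B / sqrt V" using ub[OF i] by simp
        then show "\<bar>h w * u i w\<bar> \<le> B / sqrt V * \<bar>h w\<bar>"
          unfolding abs_mult by (subst mult.commute) (intro mult_right_mono, auto)
      qed (use h polyfun_mult_integrable[OF u(1)[OF i] r h] in auto)
      finally have "\<bar>LINT w|H x r. h w * u i w\<bar> \<le> B / sqrt V * (LINT w|H x r. \<bar>h w\<bar>)" by simp
      then have "\<bar>(LINT w|H x r. h w * u i w) * u i y\<bar> \<le> B / sqrt V * (LINT w|H x r. \<bar>h w\<bar>) * (B / sqrt V)"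
        unfolding abs_mult using ub[OF i y] by (intro mult_mono) (auto intro: order_trans[OF abs_ge_zero])
      also have "\<dots> = B\<^sup>2 / V * (LINT w|H x r. \<bar>h w\<bar>)" using V by (simp add: power2_eq_square field_simps)
      finally show ?thesis .
    qed
    then have "\<bar>proj x r h y\<bar> \<le> (\<Sum>i<N. B\<^sup>2 / V * (LINT w|H x r. \<bar>h w\<bar>))"
      unfolding proj_eq N_def[symmetric] u_def[symmetric]
      by (intro order_trans[OF sum_abs] sum_mono) auto
    also have "\<dots> = real N * (B\<^sup>2 / V * (LINT w|H x r. \<bar>h w\<bar>))" by simp
    also have "\<dots> \<le> D * (B\<^sup>2 / V * (LINT w|H x r. \<bar>h w\<bar>))"
      using N V by (intro mult_right_mono) auto
    finally show ?thesis using V by (simp add: V_def[symmetric] field_simps)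
  qed
  then show ?thesis by (intro exI[of _ "D * B\<^sup>2"]) (auto simp: D_def)
qed

text \<open>The basis reproduces polynomials almost everywhere; the Remez inequality, applied to the
  difference, makes this pointwise on the cube.\<close>

lemma proj_polyfun:
  assumes x: "x \<in> X" and r: "r > 0" "ennreal r \<le> 4 * ediam X" and p: "polyfun (k - 1) p" and y: "y \<in> cube x r"
  shows "proj x r p y = p y"
proof -
  have "AE w in H x r. p w = proj x r p w"
    using basis[OF r, of x] p unfolding proj_eq by (auto simp: poly_basis_def case_prod_unfold)
  then have "AE w in H x r. \<bar>p w - proj x r p w\<bar> = 0" by eventually_elim simp
  then have "(LINT w|H x r. \<bar>p w - proj x r p w\<bar>) = 0" by (rule integral_eq_zero_AE)
  moreover have "polyfun (k - 1) (\<lambda>w. p w - proj x r p w)" by (intro polyfun_diff p polyfun_proj r)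
  ultimately have "\<bar>p y - proj x r p y\<bar> * r powr s \<le> 0"
    using remez_real x r y by fastforce
  then show ?thesis using r by (simp add: mult_le_0_iff)
qed

lemma proj_diff:
  assumes r: "r > 0" "ennreal r \<le> 4 * ediam X" and "integrable (H x r) f" "integrable (H x r) g"
  shows "proj x r (\<lambda>w. f w - g w) y = proj x r f y - proj x r g y"
proof -
  have "(LINT w|H x r. (f w - g w) * snd (basis x r) i w) =
      (LINT w|H x r. f w * snd (basis x r) i w) - (LINT w|H x r. g w * snd (basis x r) i w)"
    if "i < fst (basis x r)" for i
    unfolding left_diff_distrib using assms polyfun_basis[OF r that]
    by (intro Bochner_Integration.integral_diff polyfun_mult_integrable) auto
  then show ?thesis unfolding proj_eq by (simp add: left_diff_distrib flip: sum_subtractf)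
qed

lemma proj_lincomb:
  assumes r: "r > 0" "ennreal r \<le> 4 * ediam X" and "integrable (H x r) f" "integrable (H x r) g"
  shows "proj x r (\<lambda>w. c * f w + e * g w) y = c * proj x r f y + e * proj x r g y"
proof -
  have "(LINT w|H x r. (c * f w + e * g w) * snd (basis x r) i w) =
      c * (LINT w|H x r. f w * snd (basis x r) i w) + e * (LINT w|H x r. g w * snd (basis x r) i w)"
    if "i < fst (basis x r)" for i
    unfolding distrib_right mult.assoc using assms polyfun_basis[OF r that]
    by (subst Bochner_Integration.integral_add) (auto intro!: polyfun_mult_integrable integrable_mult_right)
  then show ?thesis unfolding proj_eq by (simp add: distrib_right sum.distrib sum_distrib_left mult.assoc)
qed

lemma campanatoD:
  assumes "f \<in> campanato s q k \<omega> X" "x \<in> X" "r > 0" "ennreal r \<le> 4 * ediam X"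
  shows "in_Lq q (H x r) f" "integrable (H x r) f" "best_approx s q k X f x r \<le> Nf f * \<omega> r"
proof -
  have cubes: "(x, r) \<in> cubes X" using assms by (simp add: cubes_def)
  show Lq: "in_Lq q (H x r) f" using assms(1) cubes by (auto simp: campanato_def)
  show "integrable (H x r) f" by (rule in_Lq_integrable[OF finite_H[OF assms(3,4)] q Lq])
  have "ennreal (best_approx s q k X f x r / \<omega> r) \<le> campanato_seminorm s q k \<omega> X f"
    unfolding campanato_seminorm_def using cubes by (intro SUP_upper2[of "(x, r)"]) auto
  moreover have fin: "campanato_seminorm s q k \<omega> X f < \<infinity>" using assms(1) by (simp add: campanato_def)
  ultimately have "enn2real (ennreal (best_approx s q k X f x r / \<omega> r)) \<le> Nf f"
    by (intro enn2real_mono) auto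
  then have "best_approx s q k X f x r / \<omega> r \<le> Nf f"
    by (cases "best_approx s q k X f x r / \<omega> r \<ge> 0") (auto intro: order_trans[OF _ enn2real_nonneg])
  then show "best_approx s q k X f x r \<le> Nf f * \<omega> r"
    using quasipower_majorantD(1)[OF \<omega> assms(3)] by (simp add: pos_divide_le_eq)
qed

text \<open>For any competitor \<open>p\<close>, the error of the projection equals
  \<open>h - proj x r h\<close> on the cube, where \<open>h = f - p\<close>. So a linear choice is
  as good as the best approximation, up to a constant.\<close>

lemma proj_approx:
  "\<exists>C\<ge>0. \<forall>f\<in>campanato s q k \<omega> X. \<forall>x\<in>X. \<forall>r>0. ennreal r \<le> 4 * ediam X \<longrightarrow>
     (LINT w|H x r. \<bar>f w - proj x r f w\<bar>) \<le> C * Nf f * \<omega> r * r powr s"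
proof -
  obtain CP where CP: "CP \<ge> 0" "\<And>x r h y. x \<in> X \<Longrightarrow> r > 0 \<Longrightarrow> ennreal r \<le> 4 * ediam X \<Longrightarrow> integrable (H x r) h \<Longrightarrow>
     y \<in> cube x r \<Longrightarrow> \<bar>proj x r h y\<bar> * r powr s \<le> CP * (LINT w|H x r. \<bar>h w\<bar>)"
    using proj_bound by blast
  define C where "C = 2 * A1 * (1 + A1 * CP)"
  have C: "C \<ge> 0" using A1_pos CP(1) by (simp add: C_def)
  have "(LINT w|H x r. \<bar>f w - proj x r f w\<bar>) \<le> C * Nf f * \<omega> r * r powr s"
    if f: "f \<in> campanato s q k \<omega> X" and x: "x \<in> X" and r: "r > 0" "ennreal r \<le> 4 * ediam X" for f x r
  proof (rule field_le_epsilon)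
    fix e :: real assume e: "e > 0"
    interpret finite_measure "H x r" by (rule finite_H[OF r])
    define V where "V = r powr s"
    have V: "V > 0" using r by (simp add: V_def)
    note fD = campanatoD[OF f x r]
    have \<omega>r: "\<omega> r > 0" by (rule quasipower_majorantD(1)[OF \<omega> r(1)])
    \<comment> \<open>The infimum need not be attained. The excess is scaled to contribute
      \<open>C / (C + 1) * e \<le> e\<close> in the end; it also keeps \<open>c\<close> positive
      when the seminorm vanishes.\<close>
    define c where "c = Nf f * \<omega> r + e / ((C + 1) * V)"
    have c: "c > Nf f * \<omega> r" using e C V by (simp add: c_def)
    then have c0: "c > 0" using \<omega>r by (smt (verit) enn2real_nonneg mult_nonneg_nonneg)
    have "(INF p\<in>polys (k - 1). mean_Lq q (H x r) (\<lambda>y. f y - p y)) < c"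
      using fD(3) c unfolding best_approx_def by linarith
    moreover have "polys (k - 1) \<noteq> ({} :: (real ^ 'n \<Rightarrow> real) set)"
      using polyfun.const[of "k - 1" 0] by (auto simp: polys_eq)
    ultimately obtain p where p: "polyfun (k - 1) p" "mean_Lq q (H x r) (\<lambda>y. f y - p y) < c"
      using cInf_lessD[of "(\<lambda>p. mean_Lq q (H x r) (\<lambda>y. f y - p y)) ` polys (k - 1)" c] by (auto simp: polys_eq)
    define h where "h w = f w - p w" for w
    have pint: "integrable (H x r) p" by (rule polyfun_integrable[OF p(1) r])
    have hint: "integrable (H x r) h" unfolding h_def using fD(2) pint by simp
    obtain B where B: "B \<ge> 0" "\<forall>y\<in>cube x r. \<bar>p y\<bar> \<le> B" using polyfun_bounded[OF p(1)] by blast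
    have "in_Lq q (H x r) h"
      unfolding h_def using B
      by (intro in_Lq_diff_bounded[OF _ q fD(1) polyfun_measurable[OF p(1)], of B] finite_H r AE_I2) auto
    then have "(LINT w|H x r. \<bar>h w\<bar>) \<le> 2 * measure (H x r) (space (H x r)) * c"
      using p(2) c0 unfolding h_def by (intro integral_abs_le_mean_Lq[OF _ q] finite_H r) auto
    also have "\<dots> \<le> 2 * (A1 * V) * c"
      using measure_H[OF r, of x] c0 by (intro mult_right_mono mult_left_mono) (auto simp: V_def)
    finally have hb: "(LINT w|H x r. \<bar>h w\<bar>) \<le> 2 * (A1 * V) * c" .
    have proj_h: "f w - proj x r f w = h w - proj x r h w" if "w \<in> cube x r" for w
      unfolding h_def proj_diff[OF r fD(2) pint] proj_polyfun[OF x r p(1) that] by simp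
    have ph: "\<bar>proj x r h w\<bar> \<le> CP * (2 * A1 * c)" if "w \<in> cube x r" for w
    proof -
      have "\<bar>proj x r h w\<bar> * V \<le> CP * (LINT w|H x r. \<bar>h w\<bar>)"
        unfolding V_def by (rule CP(2)[OF x r hint that])
      also have "\<dots> \<le> CP * (2 * (A1 * V) * c)" by (intro mult_left_mono hb CP(1))
      finally have "\<bar>proj x r h w\<bar> * V \<le> (CP * (2 * A1 * c)) * V" by (simp add: mult_ac)
      then show ?thesis using V by simp
    qed
    have "(LINT w|H x r. \<bar>f w - proj x r f w\<bar>) \<le> (LINT w|H x r. \<bar>h w\<bar> + CP * (2 * A1 * c))"
    proof (rule integral_mono)
      show "integrable (H x r) (\<lambda>w. \<bar>f w - proj x r f w\<bar>)"
        using fD(2) polyfun_integrable[OF polyfun_proj[OF r] r] by simp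
      fix w assume "w \<in> space (H x r)"
      then have w: "w \<in> cube x r" by simp
      show "\<bar>f w - proj x r f w\<bar> \<le> \<bar>h w\<bar> + CP * (2 * A1 * c)"
        using ph[OF w] unfolding proj_h[OF w] by linarith
    qed (use hint in auto)
    also have "\<dots> = (LINT w|H x r. \<bar>h w\<bar>) + measure (H x r) (cube x r \<inter> X) * (CP * (2 * A1 * c))"
      using hint by simp
    also have "\<dots> \<le> 2 * (A1 * V) * c + (A1 * V) * (CP * (2 * A1 * c))"
      using hb measure_H[OF r, of x] CP(1) A1_pos c0
      by (intro add_mono mult_right_mono) (auto simp: V_def)
    also have "\<dots> = C * V * c" by (simp add: C_def algebra_simps)
    also have "\<dots> = C * Nf f * \<omega> r * V + C / (C + 1) * e"
    proof -
      have "C * V * (e / ((C + 1) * V)) = C / (C + 1) * e" using V by simp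
      then show ?thesis by (simp add: c_def distrib_left mult_ac)
    qed
    also have "C / (C + 1) * e \<le> e" using C e by (simp add: divide_le_eq)
    finally show "(LINT w|H x r. \<bar>f w - proj x r f w\<bar>) \<le> C * Nf f * \<omega> r * r powr s + e"
      by (simp add: V_def)
  qed
  with C show ?thesis by blast
qed

section \<open>Radii beyond the diameter\<close>

lemma ediam_le_imp_subset: "x \<in> X \<Longrightarrow> ediam X \<le> ennreal r \<Longrightarrow> 0 \<le> r \<Longrightarrow> X \<subseteq> cube x r"
proof
  fix y assume x: "x \<in> X" and r: "ediam X \<le> ennreal r" "0 \<le> r" and y: "y \<in> X"
  have "ennreal (dist y x) \<le> ediam X" unfolding ediam_def using x y by (intro SUP_upper2[of "(y, x)"]) auto
  then have "ennreal (dist y x) \<le> ennreal r" using r(1) by (rule order_trans)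
  then have "norm (y - x) \<le> r" using r(2) by (simp add: dist_norm)
  then show "y \<in> cube x r"
    unfolding mem_cube using component_le_norm_cart[of "y - x"] by (auto intro: order_trans)
qed

lemma ediam_cases:
  obtains (infinite) "\<And>r. ennreal r \<le> 4 * ediam X" | (finite) E where "ediam X = ennreal E" "E > 0"
proof (cases "ediam X")
  case (real E)
  then show ?thesis using diam finite by (cases "E = 0") auto
next
  case top
  then show ?thesis using infinite by (auto simp: ennreal_mult_top)
qed

lemma ennreal_le_4_ediam: "E \<ge> 0 \<Longrightarrow> ediam X = ennreal E \<Longrightarrow> ennreal r \<le> 4 * ediam X \<longleftrightarrow> r \<le> 4 * E"
  by (simp flip: ennreal_numeral ennreal_mult)

text \<open>A cube centred in \<open>X\<close> whose radius is at least the diameter contains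
  \<open>X\<close>, so larger radii give the same local measure. This provides projections for every
  \<open>r > 0\<close>, as the gluing requires, although radii in \<open>cubes\<close> are
  bounded.\<close>

lemma normalize_radius:
  assumes "x \<in> X" "r > 0"
  shows "\<exists>r'>0. ennreal r' \<le> 4 * ediam X \<and> r' \<le> r \<and> cube x r \<inter> X = cube x r' \<inter> X"
proof (cases "ennreal r \<le> 4 * ediam X")
  case False
  then obtain E where E: "ediam X = ennreal E" "E > 0" by (cases rule: ediam_cases) auto
  have r: "r > 4 * E" using False E ennreal_le_4_ediam[of E r] by simp
  have "X \<subseteq> cube x r" "X \<subseteq> cube x (4 * E)"
    by (rule ediam_le_imp_subset[OF assms(1)]; use E r in \<open>auto intro: ennreal_leI\<close>)+
  then show ?thesis using E r ennreal_le_4_ediam[of E "4 * E"] by (intro exI[of _ "4 * E"]) auto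
qed (use assms in auto)

lemma polyfun_proj': "x \<in> X \<Longrightarrow> r > 0 \<Longrightarrow> polyfun (k - 1) (proj x r f)"
  using normalize_radius[of x r] polyfun_proj by metis

lemma proj_lincomb':
  assumes "x \<in> X" "r > 0" "f \<in> campanato s q k \<omega> X" "g \<in> campanato s q k \<omega> X"
  shows "proj x r (\<lambda>w. c * f w + e * g w) y = c * proj x r f y + e * proj x r g y"
proof -
  obtain r' where r': "r' > 0" "ennreal r' \<le> 4 * ediam X" "cube x r \<inter> X = cube x r' \<inter> X"
    using normalize_radius[OF assms(1,2)] by blast
  show ?thesis unfolding r'(3)
    by (rule proj_lincomb) (use r' assms in \<open>auto intro: campanatoD(2)\<close>)
qed

lemma proj_cong: "(\<And>w. w \<in> X \<Longrightarrow> f w = g w) \<Longrightarrow> proj x r f = proj x r g"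
proof -
  assume eq: "\<And>w. w \<in> X \<Longrightarrow> f w = g w"
  have "(LINT w|H x r. f w * u w) = (LINT w|H x r. g w * u w)" for u
    by (rule Bochner_Integration.integral_cong) (use eq in auto)
  then show ?thesis unfolding proj_eq[abs_def] by simp
qed

lemma H_restrict: "cube x r \<inter> X \<subseteq> S \<Longrightarrow> S \<subseteq> X \<Longrightarrow> H x r = restrict_space (hausdorff_on s S) (cube x r \<inter> X)"
proof -
  assume "cube x r \<inter> X \<subseteq> S" "S \<subseteq> X"
  then have "cube x r \<inter> S = cube x r \<inter> X" by blast
  then show ?thesis using hausdorff_on_closed_restrict[OF closed_cube, of s x r S] by simp
qed

lemma cube_sets: "cube x r \<inter> X \<subseteq> S \<Longrightarrow> S \<subseteq> X \<Longrightarrow> cube x r \<inter> X \<in> sets (hausdorff_on s S)"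
proof -
  assume "cube x r \<inter> X \<subseteq> S" "S \<subseteq> X"
  then have "cube x r \<inter> S = cube x r \<inter> X" by blast
  then show ?thesis using closed_in_sets_hausdorff_on[OF closed_cube, of x r S s] by simp
qed

lemma integral_H_mono:
  fixes h :: "real ^ 'n \<Rightarrow> real"
  assumes "cube x r \<inter> X \<subseteq> cube x' R \<inter> X" "integrable (H x' R) h"
  shows "integrable (H x r) h" "(LINT w|H x r. \<bar>h w\<bar>) \<le> (LINT w|H x' R. \<bar>h w\<bar>)"
proof -
  have sets: "cube x r \<inter> X \<inter> space (H x' R) \<in> sets (H x' R)"
    using cube_sets[OF assms(1) Int_lower2] assms(1) by (simp add: Int_absorb2)
  have set_int: "set_integrable (H x' R) (cube x r \<inter> X) h"
    unfolding set_integrable_def using cube_sets[OF assms(1) Int_lower2] assms(2)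
    by (intro integrable_mult_indicator) auto
  show "integrable (H x r) h"
    unfolding H_restrict[OF assms(1) Int_lower2] integrable_restrict_space[OF sets]
    using set_int by (simp add: set_integrable_def)
  have "(LINT w|H x r. \<bar>h w\<bar>) = (LINT w|H x' R. indicator (cube x r \<inter> X) w *\<^sub>R \<bar>h w\<bar>)"
    unfolding H_restrict[OF assms(1) Int_lower2] by (rule integral_restrict_space[OF sets])
  also have "\<dots> \<le> (LINT w|H x' R. \<bar>h w\<bar>)"
  proof (rule integral_mono)
    show "integrable (H x' R) (\<lambda>w. indicator (cube x r \<inter> X) w *\<^sub>R \<bar>h w\<bar>)"
      using cube_sets[OF assms(1) Int_lower2] assms(2) by (intro integrable_mult_indicator) auto
  qed (use assms(2) in \<open>auto simp: indicator_def\<close>)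
  finally show "(LINT w|H x r. \<bar>h w\<bar>) \<le> (LINT w|H x' R. \<bar>h w\<bar>)" .
qed

text \<open>On the smaller cube both polynomials are close to \<open>f\<close> in mean, hence to
  each other in mean, then in supremum by the Remez inequality, and on the tripled cube by growth.
  The bound \<open>R \<le> 10 * r\<close> keeps \<open>R powr s\<close> comparable to
  \<open>r powr s\<close>.\<close>

lemma proj_compare:
  "\<exists>C\<ge>0. \<forall>f\<in>campanato s q k \<omega> X. \<forall>x\<in>X. \<forall>x'\<in>X. \<forall>r R. 0 < r \<longrightarrow> r \<le> R \<longrightarrow> R \<le> 10 * r \<longrightarrow>
     ennreal R \<le> 4 * ediam X \<longrightarrow> cube x r \<inter> X \<subseteq> cube x' R \<inter> X \<longrightarrow>
     (\<forall>y\<in>cube x (3 * r). \<bar>proj x r f y - proj x' R f y\<bar> \<le> C * Nf f * \<omega> R)"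
proof -
  obtain CR where CR: "CR > 0" "\<And>x r p y. x \<in> X \<Longrightarrow> r > 0 \<Longrightarrow> ennreal r \<le> 4 * ediam X \<Longrightarrow> polyfun (k - 1) p \<Longrightarrow>
     y \<in> cube x r \<Longrightarrow> \<bar>p y\<bar> * r powr s \<le> CR * (LINT w|H x r. \<bar>p w\<bar>)"
    using remez_real by blast
  obtain CA where CA: "CA \<ge> 0" "\<And>f x r. f \<in> campanato s q k \<omega> X \<Longrightarrow> x \<in> X \<Longrightarrow> r > 0 \<Longrightarrow> ennreal r \<le> 4 * ediam X \<Longrightarrow>
     (LINT w|H x r. \<bar>f w - proj x r f w\<bar>) \<le> CA * Nf f * \<omega> r * r powr s"
    using proj_approx by blast
  obtain Cg where Cg: "Cg \<ge> 1" "\<And>(p :: real ^ 'n \<Rightarrow> real) x r M y. polyfun (k - 1) p \<Longrightarrow> r > 0 \<Longrightarrow>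
      (\<forall>y\<in>cube x r. \<bar>p y\<bar> \<le> M) \<Longrightarrow> y \<in> cube x (3 * r) \<Longrightarrow> \<bar>p y\<bar> \<le> Cg * M"
    using polyfun_growth[of 3 "k - 1", where 'n = 'n] by auto
  define C where "C = Cg * (CR * CA * (1 + 10 powr s))"
  have C: "C \<ge> 0" using Cg CR CA by (simp add: C_def)
  have "\<bar>proj x r f y - proj x' R f y\<bar> \<le> C * Nf f * \<omega> R"
    if f: "f \<in> campanato s q k \<omega> X" and x: "x \<in> X" "x' \<in> X" and r: "0 < r" "r \<le> R" "R \<le> 10 * r" "ennreal R \<le> 4 * ediam X"
      and sub: "cube x r \<inter> X \<subseteq> cube x' R \<inter> X" and y: "y \<in> cube x (3 * r)" for f x x' r R y
  proof -
    have R: "R > 0" "ennreal r \<le> 4 * ediam X"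
      using r ennreal_leI[OF r(2)] order_trans by (auto, blast)
    define p where "p = (\<lambda>w. proj x r f w - proj x' R f w)"
    have p: "polyfun (k - 1) p" unfolding p_def by (intro polyfun_diff polyfun_proj r R)
    define h where "h = (\<lambda>w. f w - proj x' R f w)"
    have h: "integrable (H x' R) h"
      unfolding h_def by (intro Bochner_Integration.integrable_diff campanatoD(2)[OF f x(2) R(1) r(4)]
          polyfun_integrable[OF polyfun_proj[OF R(1) r(4)] R(1) r(4)])
    define g where "g = (\<lambda>w. f w - proj x r f w)"
    have g: "integrable (H x r) g"
      unfolding g_def by (intro Bochner_Integration.integrable_diff campanatoD(2)[OF f x(1) r(1) R(2)]
          polyfun_integrable[OF polyfun_proj[OF r(1) R(2)] r(1) R(2)])
    have "(LINT w|H x r. \<bar>p w\<bar>) \<le> (LINT w|H x r. \<bar>h w\<bar> + \<bar>g w\<bar>)"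
      by (rule integral_mono) (use polyfun_integrable[OF p r(1) R(2)] integral_H_mono(1)[OF sub h] g in
          \<open>auto simp: p_def h_def g_def\<close>)
    also have "\<dots> = (LINT w|H x r. \<bar>h w\<bar>) + (LINT w|H x r. \<bar>g w\<bar>)"
      using integral_H_mono(1)[OF sub h] g by simp
    also have "\<dots> \<le> CA * Nf f * \<omega> R * R powr s + CA * Nf f * \<omega> r * r powr s"
      using integral_H_mono(2)[OF sub h] CA(2)[OF f x(2) R(1) r(4)] CA(2)[OF f x(1) r(1) R(2)]
      unfolding h_def g_def by linarith
    also have "\<dots> \<le> CA * Nf f * \<omega> R * (10 powr s * r powr s) + CA * Nf f * \<omega> R * r powr s"
    proof (intro add_mono mult_left_mono mult_right_mono)
      have "R powr s \<le> (10 * r) powr s" using r s_pos by (intro powr_mono2) auto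
      then show "R powr s \<le> 10 powr s * r powr s" using r by (simp add: powr_mult)
      show "\<omega> r \<le> \<omega> R" using quasipower_majorantD(2)[OF \<omega> r(1,2)] .
    qed (use CA(1) quasipower_majorantD(1)[OF \<omega> R(1)] in auto)
    finally have int: "(LINT w|H x r. \<bar>p w\<bar>) \<le> CA * (1 + 10 powr s) * Nf f * \<omega> R * r powr s"
      by (simp add: algebra_simps)
    have "\<bar>p w\<bar> \<le> CR * CA * (1 + 10 powr s) * Nf f * \<omega> R" if "w \<in> cube x r" for w
    proof -
      have "\<bar>p w\<bar> * r powr s \<le> CR * (CA * (1 + 10 powr s) * Nf f * \<omega> R * r powr s)"
        using CR(2)[OF x(1) r(1) R(2) p that] mult_left_mono[OF int, of CR] CR(1) by linarith
      then have "\<bar>p w\<bar> * r powr s \<le> (CR * CA * (1 + 10 powr s) * Nf f * \<omega> R) * r powr s"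
        by (simp add: mult_ac)
      then show ?thesis using r(1) by simp
    qed
    then have "\<bar>p y\<bar> \<le> Cg * (CR * CA * (1 + 10 powr s) * Nf f * \<omega> R)" using Cg(2)[OF p r(1) _ y] by blast
    then show ?thesis by (simp add: C_def p_def mult_ac)
  qed
  with C show ?thesis by blast
qed

text \<open>Both polynomials are compared with that of a common larger cube at \<open>x'\<close>.
  Its radius is \<open>10 * r\<close>, as \<open>x\<close> lies within
  \<open>3 * r + 3 * r' \<le> 9 * r\<close> of \<open>x'\<close>, or four diameters if that is less.
  Once \<open>r\<close> reaches the diameter the two local measures coincide.\<close>

lemma proj_coherent:
  "\<exists>C\<ge>0. \<forall>f\<in>campanato s q k \<omega> X. \<forall>x\<in>X. \<forall>x'\<in>X. \<forall>r r' y. 0 < r \<longrightarrow> r \<le> r' \<longrightarrow> r' \<le> 2 * r \<longrightarrow>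
     y \<in> cube x (3 * r) \<longrightarrow> y \<in> cube x' (3 * r') \<longrightarrow> \<bar>proj x r f y - proj x' r' f y\<bar> \<le> C * Nf f * \<omega> r'"
proof -
  obtain C where C: "C \<ge> 0" "\<And>f x x' r R y. f \<in> campanato s q k \<omega> X \<Longrightarrow> x \<in> X \<Longrightarrow> x' \<in> X \<Longrightarrow> 0 < r \<Longrightarrow> r \<le> R \<Longrightarrow>
     R \<le> 10 * r \<Longrightarrow> ennreal R \<le> 4 * ediam X \<Longrightarrow> cube x r \<inter> X \<subseteq> cube x' R \<inter> X \<Longrightarrow> y \<in> cube x (3 * r) \<Longrightarrow>
     \<bar>proj x r f y - proj x' R f y\<bar> \<le> C * Nf f * \<omega> R"
    using proj_compare by blast
  have "\<bar>proj x r f y - proj x' r' f y\<bar> \<le> (2 * C * 10 ^ k) * Nf f * \<omega> r'"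
    if f: "f \<in> campanato s q k \<omega> X" and x: "x \<in> X" "x' \<in> X" and r: "0 < r" "r \<le> r'" "r' \<le> 2 * r"
      and y: "y \<in> cube x (3 * r)" "y \<in> cube x' (3 * r')" for f x x' r r' y
  proof -
    have \<omega>0: "\<omega> r' > 0" using quasipower_majorantD(1)[OF \<omega>, of r'] r by simp
    show ?thesis
    proof (cases "ediam X \<le> ennreal r")
      case True
      have "X \<subseteq> cube x r" using True r by (intro ediam_le_imp_subset x) auto
      moreover have "X \<subseteq> cube x' r'"
        by (rule ediam_le_imp_subset[OF x(2) order_trans[OF True ennreal_leI[OF r(2)]]]) (use r in simp)
      ultimately have "cube x r \<inter> X = cube x' r' \<inter> X" by blast
      then show ?thesis using C(1) \<omega>0 by simp
    next
      case False
      have dxx: "x \<in> cube x' (9 * r)"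
        using cube_trans[of x y "3 * r" x' "3 * r'" "9 * r"] y r by (simp add: cube_sym)
      have "\<exists>R. r' \<le> R \<and> R \<le> 10 * r \<and> ennreal R \<le> 4 * ediam X \<and> cube x r \<inter> X \<subseteq> cube x' R \<inter> X"
      proof (cases "ennreal (10 * r) \<le> 4 * ediam X")
        case True
        have "cube x r \<subseteq> cube x' (10 * r)" using cube_trans[OF _ dxx, of _ r "10 * r"] by auto
        then show ?thesis using True r by (intro exI[of _ "10 * r"]) auto
      next
        case large: False
        then obtain E where E: "ediam X = ennreal E" "E > 0" by (cases rule: ediam_cases) auto
        have "r < E" using False E r by (simp add: not_le)
        moreover have "4 * E < 10 * r" using large E ennreal_le_4_ediam[of E "10 * r"] by simp
        moreover have "X \<subseteq> cube x' (4 * E)" using E x by (intro ediam_le_imp_subset) (auto intro!: ennreal_leI)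
        ultimately show ?thesis
          using r E ennreal_le_4_ediam[of E "4 * E"] by (intro exI[of _ "4 * E"]) auto
      qed
      then obtain R where R: "r' \<le> R" "R \<le> 10 * r" "ennreal R \<le> 4 * ediam X" "cube x r \<inter> X \<subseteq> cube x' R \<inter> X" by blast
      have "\<bar>proj x r f y - proj x' R f y\<bar> \<le> C * Nf f * \<omega> R"
        using R r by (intro C(2)[OF f x]) (auto intro: y)
      moreover have "\<bar>proj x' r' f y - proj x' R f y\<bar> \<le> C * Nf f * \<omega> R"
        using R r cube_mono[OF R(1), of x'] by (intro C(2)[OF f x(2) x(2)]) (auto intro: y)
      ultimately have "\<bar>proj x r f y - proj x' r' f y\<bar> \<le> 2 * (C * Nf f * \<omega> R)" by linarith
      also have "\<omega> R \<le> 10 ^ k * \<omega> r'"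
        using quasipower_majorantD(2)[OF \<omega>, of R "10 * r'"] quasipower_majorant_scale[OF \<omega>, of r' 10] R r by simp
      then have "2 * (C * Nf f * \<omega> R) \<le> 2 * (C * Nf f * (10 ^ k * \<omega> r'))"
        using C(1) by (intro mult_left_mono) auto
      finally show ?thesis by (simp add: mult_ac)
    qed
  qed
  moreover have "2 * C * 10 ^ k \<ge> 0" using C(1) by simp
  ultimately show ?thesis by blast
qed

section \<open>The extension operator\<close>

text \<open>A maximal \<open>r\<close>-separated set: maximality gives the covering, and disjoint
  balls of radius \<open>r / 2\<close> inside the doubled cube bound its size. The restriction on
  \<open>R\<close> keeps the doubled cube within four diameters.\<close>

lemma separated_net:
  "\<exists>C\<ge>0. \<forall>x0\<in>X. \<forall>R>0. ennreal R \<le> 2 * ediam X \<longrightarrow> (\<forall>r>0. r \<le> R \<longrightarrow> (\<exists>D. finite D \<and> D \<subseteq> cube x0 R \<inter> X \<and>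
     real (card D) * r powr s \<le> C * R powr s \<and> cube x0 R \<inter> X \<subseteq> (\<Union>z\<in>D. cube z r)))"
proof -
  define C where "C = A1 * 4 powr s / b"
  have C: "C \<ge> 0" using A1_pos b by (simp add: C_def)
  have net: "\<exists>D. finite D \<and> D \<subseteq> cube x0 R \<inter> X \<and> real (card D) * r powr s \<le> C * R powr s \<and> cube x0 R \<inter> X \<subseteq> (\<Union>z\<in>D. cube z r)"
    if x0: "x0 \<in> X" and R: "R > 0" "ennreal R \<le> 2 * ediam X" and r: "r > 0" "r \<le> R" for x0 R r
  proof -
    define sep where "sep D \<longleftrightarrow> finite D \<and> D \<subseteq> cube x0 R \<inter> X \<and> (\<forall>z\<in>D. \<forall>z'\<in>D. z \<noteq> z' \<longrightarrow> r \<le> dist z z')" for D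
    have R2: "2 * R > 0" "ennreal (2 * R) \<le> 4 * ediam X"
    proof -
      have "ennreal (2 * R) = 2 * ennreal R" using R by (simp add: ennreal_mult)
      also have "\<dots> \<le> 2 * (2 * ediam X)" by (intro mult_left_mono R) auto
      finally show "ennreal (2 * R) \<le> 4 * ediam X" by (simp add: mult.assoc[symmetric])
    qed (use R in simp)
    have r2: "r / 2 > 0" "ennreal (r / 2) \<le> ediam X"
    proof -
      have "2 * ennreal (r / 2) = ennreal r" using r by (simp flip: ennreal_numeral ennreal_mult)
      also have "\<dots> \<le> 2 * ediam X" using ennreal_leI[OF r(2)] R(2) by (rule order_trans)
      finally show "ennreal (r / 2) \<le> ediam X" by (subst (asm) ennreal_mult_le_mult_iff) auto
    qed (use r in simp)
    have bound: "real (card D) * r powr s \<le> C * R powr s" if D: "sep D" for D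
    proof -
      let ?M = "H x0 (2 * R)"
      let ?F = "\<lambda>z. ball z (r / 2) \<inter> X"
      have sub: "?F z \<subseteq> cube x0 (2 * R) \<inter> X" if "z \<in> D" for z
      proof -
        have "z \<in> cube x0 R" using that D by (auto simp: sep_def)
        then have "cube z (r / 2) \<subseteq> cube x0 (2 * R)"
          using cube_trans[of _ z "r / 2" x0 R "2 * R"] r by auto
        then show ?thesis using ball_subset_cube[of z "r / 2"] by auto
      qed
      have sets: "?F z \<in> sets ?M" if "z \<in> D" for z
      proof -
        have "ball z (r / 2) \<inter> (cube x0 (2 * R) \<inter> X) = ?F z" using sub[OF that] by blast
        then show ?thesis using borel_in_sets_hausdorff_on[of "ball z (r / 2)" "cube x0 (2 * R) \<inter> X" s] by simp
      qed
      have disj: "disjoint_family_on ?F D"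
        unfolding disjoint_family_on_def
      proof (intro ballI impI)
        fix z z' assume z: "z \<in> D" "z' \<in> D" "z \<noteq> z'"
        have "r \<le> dist z z'" using D z by (auto simp: sep_def)
        then have "\<not> (dist z y < r / 2 \<and> dist z' y < r / 2)" for y
          using dist_triangle2[of z z' y] by linarith
        then show "?F z \<inter> ?F z' = {}" by auto
      qed
      have "ennreal (real (card D) * (b * (r / 2) powr s)) = (\<Sum>z\<in>D. ennreal (b * (r / 2) powr s))"
        using b by (simp add: ennreal_mult ennreal_of_nat_eq_real_of_nat)
      also have "\<dots> \<le> (\<Sum>z\<in>D. emeasure ?M (?F z))"
      proof (intro sum_mono)
        fix z assume z: "z \<in> D"
        then have "ennreal (b * (r / 2) powr s) \<le> hausdorff_outer s (?F z)"
          using D by (intro lower r2) (auto simp: sep_def)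
        then show "ennreal (b * (r / 2) powr s) \<le> emeasure ?M (?F z)"
          using emeasure_hausdorff_on[OF sets[OF z]] by simp
      qed
      also have "\<dots> = emeasure ?M (\<Union>z\<in>D. ?F z)"
        using D sets by (intro sum_emeasure disj) (auto simp: sep_def)
      also have "\<dots> \<le> emeasure ?M (space ?M)" by (rule emeasure_space)
      also have "\<dots> \<le> ennreal (A1 * (2 * R) powr s)" using emeasure_H[OF R2, of x0] by simp
      finally have "real (card D) * (b * (r / 2) powr s) \<le> A1 * (2 * R) powr s"
        using A1_pos by (subst (asm) ennreal_le_iff) auto
      moreover have "(r / 2) powr s * 2 powr s = r powr s" using r by (simp flip: powr_mult)
      moreover have "(2 * R) powr s * 2 powr s = 4 powr s * R powr s" using R by (simp add: powr_mult flip: powr_mult)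
      ultimately have "real (card D) * (b * r powr s) \<le> A1 * (4 powr s * R powr s)"
        by (metis (no_types, opaque_lifting) mult.assoc mult_right_mono powr_ge_zero)
      then show ?thesis using b by (simp add: C_def field_simps)
    qed
    \<comment> \<open>The counting bound limits the cardinality of separated sets, so one of largest
      cardinality exists.\<close>
    define nb where "nb = nat \<lfloor>C * R powr s / r powr s\<rfloor>"
    have "card D < Suc nb" if "sep D" for D
      using bound[OF that] r unfolding nb_def by (intro le_imp_less_Suc le_nat_floor) (simp add: pos_le_divide_eq)
    moreover have "sep {}" by (simp add: sep_def)
    ultimately obtain D where D: "sep D" "\<And>D'. sep D' \<Longrightarrow> card D' \<le> card D"
      using ex_has_greatest_nat[of sep "{}" card "Suc nb"] by (auto intro: less_imp_le)
    have "cube x0 R \<inter> X \<subseteq> (\<Union>z\<in>D. cube z r)"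
    proof
      fix y assume y: "y \<in> cube x0 R \<inter> X"
      show "y \<in> (\<Union>z\<in>D. cube z r)"
      proof (rule ccontr)
        assume "\<not> ?thesis"
        then have far: "r \<le> dist y z" if "z \<in> D" for z
          using that ball_subset_cube[of z r] by (force simp: dist_commute not_less[symmetric])
        then have "y \<notin> D" using r by force
        moreover have "sep (insert y D)"
          using D(1) y far unfolding sep_def by (auto simp: dist_commute)
        moreover have "finite D" using D(1) by (simp add: sep_def)
        ultimately show False using D(2)[of "insert y D"] by simp
      qed
    qed
    then show ?thesis using D(1) bound by (intro exI[of _ D]) (auto simp: sep_def)
  qed
  show ?thesis by (intro exI[of _ C] conjI ballI allI impI C net)
qed

text \<open>No differentiation theorem is needed: the mean deviation of \<open>f\<close> from \<open>F\<close> over cubes of radius \<open>r\<close>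
  is \<open>O(\<omega>(r))\<close> uniformly in the center, so covering by such cubes shows that the integral of
  \<open>\<bar>f - F\<bar>\<close> vanishes.\<close>

lemma ae_eq_if_small_means:
  assumes f: "f \<in> borel_measurable (hausdorff_on s X)" and F: "F \<in> borel_measurable (hausdorff_on s X)"
    and C: "C \<ge> 0"
    and mean: "\<And>x r. x \<in> X \<Longrightarrow> r > 0 \<Longrightarrow> ennreal r \<le> 4 * ediam X \<Longrightarrow>
      (\<integral>\<^sup>+w. ennreal \<bar>f w - F w\<bar> \<partial>H x r) \<le> ennreal (C * \<omega> r * r powr s)"
  shows "ae_eq_on s X f F"
proof -
  let ?M = "hausdorff_on s X"
  from separated_net obtain CN where CN': "CN \<ge> 0 \<and> (\<forall>x0\<in>X. \<forall>R>0. ennreal R \<le> 2 * ediam X \<longrightarrow> (\<forall>r>0. r \<le> R \<longrightarrow>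
    (\<exists>D. finite D \<and> D \<subseteq> cube x0 R \<inter> X \<and> real (card D) * r powr s \<le> CN * R powr s \<and>
      cube x0 R \<inter> X \<subseteq> (\<Union>z\<in>D. cube z r))))" ..
  note CN = conjunct1[OF CN'] conjunct2[OF CN', rule_format]
  have H_int: "(\<integral>\<^sup>+w. ennreal \<bar>f w - F w\<bar> \<partial>H x r) = (\<integral>\<^sup>+w. ennreal \<bar>f w - F w\<bar> * indicator (cube x r \<inter> X) w \<partial>?M)" for x r
  proof -
    have "cube x r \<inter> X \<inter> space ?M \<in> sets ?M"
      using cube_sets[of x r X] by simp
    moreover have "H x r = restrict_space ?M (cube x r \<inter> X)" by (rule H_restrict) auto
    ultimately show ?thesis by (simp only: nn_integral_restrict_space)
  qed
  have small: "AE w in ?M. w \<in> cube x0 R \<longrightarrow> f w = F w" if x0: "x0 \<in> X" and R: "R > 0" "ennreal R \<le> 2 * ediam X" for x0 R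
  proof -
    let ?I = "\<integral>\<^sup>+w. ennreal \<bar>f w - F w\<bar> * indicator (cube x0 R \<inter> X) w \<partial>?M"
    have R4: "ennreal r \<le> 4 * ediam X" if "r \<le> R" for r
    proof -
      have "ennreal r \<le> 2 * ediam X" using ennreal_leI[OF that] R(2) by (rule order_trans)
      also have "\<dots> \<le> 4 * ediam X" by (intro mult_right_mono) auto
      finally show ?thesis .
    qed
    \<comment> \<open>A net has at most \<open>CN * (R / r) powr s\<close> points and each cube
      costs \<open>C * \<omega> r * r powr s\<close>; the powers of \<open>r\<close> cancel and
      \<open>\<omega> r\<close> remains.\<close>
    have I: "?I \<le> ennreal (C * CN * R powr s * \<omega> r)" if r: "r > 0" "r \<le> R" for r
    proof -
      obtain D where D: "finite D" "D \<subseteq> cube x0 R \<inter> X" "real (card D) * r powr s \<le> CN * R powr s"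
        "cube x0 R \<inter> X \<subseteq> (\<Union>z\<in>D. cube z r)" using CN(2)[OF x0 R r] by blast
      have "?I \<le> (\<integral>\<^sup>+w. (\<Sum>z\<in>D. ennreal \<bar>f w - F w\<bar> * indicator (cube z r \<inter> X) w) \<partial>?M)"
      proof (rule nn_integral_mono)
        fix w assume "w \<in> space ?M"
        show "ennreal \<bar>f w - F w\<bar> * indicator (cube x0 R \<inter> X) w \<le> (\<Sum>z\<in>D. ennreal \<bar>f w - F w\<bar> * indicator (cube z r \<inter> X) w)"
        proof (cases "w \<in> cube x0 R \<inter> X")
          case True
          then obtain z where z: "z \<in> D" "w \<in> cube z r \<inter> X" using D(4) by blast
          have "ennreal \<bar>f w - F w\<bar> * indicator (cube z r \<inter> X) w \<le> (\<Sum>z\<in>D. ennreal \<bar>f w - F w\<bar> * indicator (cube z r \<inter> X) w)"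
            by (rule member_le_sum[OF z(1) _ D(1)]) auto
          then show ?thesis using True z by simp
        qed simp
      qed
      also have "\<dots> = (\<Sum>z\<in>D. \<integral>\<^sup>+w. ennreal \<bar>f w - F w\<bar> * indicator (cube z r \<inter> X) w \<partial>?M)"
        using f F cube_sets[OF Int_lower2 order_refl] by (intro nn_integral_sum) auto
      also have "\<dots> \<le> (\<Sum>z\<in>D. ennreal (C * \<omega> r * r powr s))"
        using D(2) r R4 by (intro sum_mono) (auto simp flip: H_int intro!: mean)
      also have "\<dots> = ennreal (real (card D) * (C * \<omega> r * r powr s))"
        using C quasipower_majorantD(1)[OF \<omega> r(1)] by (simp add: ennreal_mult ennreal_of_nat_eq_real_of_nat)
      also have "\<dots> \<le> ennreal (C * CN * R powr s * \<omega> r)"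
        using mult_left_mono[OF D(3), of "C * \<omega> r"] C quasipower_majorantD(1)[OF \<omega> r(1)]
        by (intro ennreal_leI) (simp add: mult_ac)
      finally show ?thesis .
    qed
    have "?I \<le> 0"
    proof (rule ennreal_le_epsilon)
      fix e :: real assume e: "e > 0"
      have "((\<lambda>r. C * CN * R powr s * \<omega> r) \<longlongrightarrow> C * CN * R powr s * 0) (at_right 0)"
        by (intro tendsto_mult_left quasipower_majorantD(4)[OF \<omega>])
      then have "eventually (\<lambda>r. C * CN * R powr s * \<omega> r < e \<and> r \<in> {0<..<R}) (at_right 0)"
        using e R(1) by (intro eventually_conj order_tendstoD(2)[where a = e] eventually_at_right_real) auto
      then obtain r where r: "C * CN * R powr s * \<omega> r < e" "r \<in> {0<..<R}"
        using eventually_happens'[OF trivial_limit_at_right_real] by blast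
      have "?I \<le> ennreal (C * CN * R powr s * \<omega> r)" using r(2) by (intro I) auto
      also have "\<dots> \<le> ennreal e" using r(1) by (intro ennreal_leI) auto
      finally show "?I \<le> 0 + ennreal e" by simp
    qed
    then have "?I = 0" by simp
    then have "AE w in ?M. ennreal \<bar>f w - F w\<bar> * indicator (cube x0 R \<inter> X) w = 0"
      using f F cube_sets[OF Int_lower2 order_refl] by (subst (asm) nn_integral_0_iff_AE) auto
    then show ?thesis using AE_space by eventually_elim (auto simp: indicator_def)
  qed
  obtain x0 where x0: "x0 \<in> X" using X_nonempty by blast
  have "AE w in ?M. w \<in> cube x0 (real N + 1) \<longrightarrow> f w = F w" for N
  proof (cases "ennreal (real N + 1) \<le> 2 * ediam X")
    case True
    then show ?thesis using x0 by (intro small) auto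
  next
    case False
    then obtain E where E: "ediam X = ennreal E" "E > 0"
      by (cases "ediam X") (use diam in \<open>auto simp: ennreal_mult_top\<close>)
    have XE: "X \<subseteq> cube x0 E" using E x0 by (intro ediam_le_imp_subset) auto
    have "ennreal E \<le> 2 * ediam X" unfolding E(1) using E(2) by (simp flip: ennreal_numeral ennreal_mult)
    then have "AE w in ?M. w \<in> cube x0 E \<longrightarrow> f w = F w" using x0 E by (intro small)
    then show ?thesis using AE_space by eventually_elim (use XE in auto)
  qed
  then have "AE w in ?M. \<forall>N. w \<in> cube x0 (real N + 1) \<longrightarrow> f w = F w" unfolding AE_all_countable by blast
  then show ?thesis
    unfolding ae_eq_on_def
  proof eventually_elim
    case (elim w)
    obtain N where "norm (w - x0) < real N" using reals_Archimedean2 by blast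
    then have "w \<in> ball x0 (real N + 1)" by (simp add: dist_norm norm_minus_commute)
    then show ?case using elim ball_subset_cube by blast
  qed
qed

lemma campanato_measurable: "f \<in> campanato s q k \<omega> X \<Longrightarrow> f \<in> borel_measurable (hausdorff_on s X)"
  by (simp add: campanato_def)

lemma ennreal_Nf: "f \<in> campanato s q k \<omega> X \<Longrightarrow> ennreal (Nf f) = campanato_seminorm s q k \<omega> X f"
  by (simp add: campanato_def)

lemma extension_operator_ex: "\<exists>T. extension_operator s q k \<omega> X T"
proof -
  from gluing_theorem[OF k \<omega>, where 'n = 'n]
  obtain \<beta> CG where CG: "CG \<ge> 0" and glue: "\<And>(X :: (real ^ 'n) set) P K. X \<noteq> {} \<Longrightarrow> K \<ge> 0 \<Longrightarrow>
    (\<forall>x\<in>X. \<forall>r>0. polyfun (k - 1) (P x r)) \<Longrightarrow>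
    (\<forall>x\<in>X. \<forall>x'\<in>X. \<forall>r r' y. 0 < r \<longrightarrow> r \<le> r' \<longrightarrow> r' \<le> 2 * r \<longrightarrow> y \<in> cube x (3 * r) \<longrightarrow> y \<in> cube x' (3 * r') \<longrightarrow>
       \<bar>P x r y - P x' r' y\<bar> \<le> K * \<omega> r') \<Longrightarrow>
    (\<forall>x\<in>X. \<forall>r>0. \<forall>y\<in>cube x r. \<bar>glued \<beta> X P y - P x r y\<bar> \<le> CG * K * \<omega> r) \<and>
    (\<forall>h y. h \<noteq> 0 \<longrightarrow> \<bar>finite_diff k h (glued \<beta> X P) y\<bar> \<le> CG * K * \<omega> (norm h)) \<and>
    (\<forall>y. convergent (\<lambda>N. glue \<beta> X P (\<lambda>_. 0) (2 * N) ((1 / 2) ^ N) y))"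
    by (elim exE conjE) blast
  from proj_coherent obtain CK where CK': "CK \<ge> 0 \<and> (\<forall>f\<in>campanato s q k \<omega> X. \<forall>x\<in>X. \<forall>x'\<in>X. \<forall>r r' y. 0 < r \<longrightarrow> r \<le> r' \<longrightarrow> r' \<le> 2 * r \<longrightarrow>
     y \<in> cube x (3 * r) \<longrightarrow> y \<in> cube x' (3 * r') \<longrightarrow> \<bar>proj x r f y - proj x' r' f y\<bar> \<le> CK * Nf f * \<omega> r')" ..
  note CK = conjunct1[OF CK'] and coh = conjunct2[OF CK', rule_format]
  from proj_approx obtain CA where CA': "CA \<ge> 0 \<and> (\<forall>f\<in>campanato s q k \<omega> X. \<forall>x\<in>X. \<forall>r>0. ennreal r \<le> 4 * ediam X \<longrightarrow>
     (LINT w|H x r. \<bar>f w - proj x r f w\<bar>) \<le> CA * Nf f * \<omega> r * r powr s)" ..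
  note CA = conjunct1[OF CA'] and approx = conjunct2[OF CA', rule_format]
  define P where "P f = (\<lambda>x r. proj x r f)" for f
  \<comment> \<open>The seminorm of \<open>f\<close> enters the bounds only, through
    \<open>K = CK * Nf f\<close>; \<open>T\<close> itself is assembled from projections, which are
    linear in \<open>f\<close>.\<close>
  define T where "T f = glued \<beta> X (P f)" for f
  define C where "C = CG * CK"
  have C: "C \<ge> 0" using CG CK by (simp add: C_def)
  have \<omega>0: "t > 0 \<Longrightarrow> \<omega> t > 0" for t by (rule quasipower_majorantD(1)[OF \<omega>])
  have props: "(\<forall>x\<in>X. \<forall>r>0. \<forall>y\<in>cube x r. \<bar>T f y - proj x r f y\<bar> \<le> CG * (CK * Nf f) * \<omega> r) \<and>
    (\<forall>h y. h \<noteq> 0 \<longrightarrow> \<bar>finite_diff k h (T f) y\<bar> \<le> CG * (CK * Nf f) * \<omega> (norm h)) \<and>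
    (\<forall>y. convergent (\<lambda>N. glue \<beta> X (P f) (\<lambda>_. 0) (2 * N) ((1 / 2) ^ N) y))"
    if f: "f \<in> campanato s q k \<omega> X" for f
    using glue[OF X_nonempty, of "CK * Nf f" "P f"] CK coh[OF f] polyfun_proj'
    unfolding T_def P_def by (simp add: mult.assoc)
  have close: "\<bar>T f y - proj x r f y\<bar> \<le> C * Nf f * \<omega> r"
    if "f \<in> campanato s q k \<omega> X" "x \<in> X" "r > 0" "y \<in> cube x r" for f x r y
    using props[OF that(1)] that by (simp add: C_def mult.assoc)
  have fd: "\<bar>finite_diff k h (T f) y\<bar> \<le> C * Nf f * \<omega> (norm h)"
    if "f \<in> campanato s q k \<omega> X" "h \<noteq> 0" for f h y
    using props[OF that(1)] that by (simp add: C_def mult.assoc)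
  have conv: "convergent (\<lambda>N. glue \<beta> X (P f) (\<lambda>_. 0) (2 * N) ((1 / 2) ^ N) y)"
    if "f \<in> campanato s q k \<omega> X" for f y using props[OF that] by blast
  have seminorm: "lipschitz_seminorm k \<omega> (T f) \<le> ennreal C * campanato_seminorm s q k \<omega> X f"
    if f: "f \<in> campanato s q k \<omega> X" for f
  proof -
    have "lipschitz_seminorm k \<omega> (T f) \<le> ennreal (C * Nf f)"
      unfolding lipschitz_seminorm_def
    proof (rule SUP_least, clarify)
      fix x h :: "real ^ 'n" assume "h \<noteq> 0"
      then show "ennreal (\<bar>finite_diff k h (T f) x\<bar> / \<omega> (norm h)) \<le> ennreal (C * Nf f)"
        using fd[OF f] \<omega>0[of "norm h"] by (intro ennreal_leI) (simp add: pos_divide_le_eq)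
    qed
    also have "\<dots> = ennreal C * campanato_seminorm s q k \<omega> X f"
      using C ennreal_Nf[OF f] by (simp add: ennreal_mult)
    finally show ?thesis .
  qed
  have lip: "T f \<in> lipschitz_space k \<omega>" if f: "f \<in> campanato s q k \<omega> X" for f
  proof -
    obtain x0 where x0: "x0 \<in> X" using X_nonempty by blast
    have "bounded (T f ` ball x 1)" for x
    proof -
      define r where "r = norm (x - x0) + 1"
      have r: "r > 0" by (simp add: r_def add_nonneg_pos)
      have "ball x 1 \<subseteq> cube x0 r"
      proof
        fix y assume "y \<in> ball x 1"
        then have "dist x0 y < r" using dist_triangle[of x0 y x] by (simp add: r_def dist_norm norm_minus_commute)
        then show "y \<in> cube x0 r" using ball_subset_cube[of x0 r] by auto
      qed
      moreover obtain B where "\<forall>y\<in>cube x0 r. \<bar>proj x0 r f y\<bar> \<le> B"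
        using polyfun_bounded[OF polyfun_proj'[OF x0 r]] by blast
      ultimately have "\<bar>T f y\<bar> \<le> B + C * Nf f * \<omega> r" if "y \<in> ball x 1" for y
        using close[OF f x0 r, of y] that by fastforce
      then show ?thesis unfolding bounded_iff by (intro exI[of _ "B + C * Nf f * \<omega> r"]) auto
    qed
    then have "\<forall>x. \<exists>r>0. bounded (T f ` ball x r)" using zero_less_one by blast
    moreover have "lipschitz_seminorm k \<omega> (T f) < \<infinity>"
      using seminorm[OF f] f by (auto simp: campanato_def ennreal_mult_less_top less_top intro: le_less_trans)
    ultimately show ?thesis by (simp add: lipschitz_space_def)
  qed
  have ae: "ae_eq_on s X (T f) f" if f: "f \<in> campanato s q k \<omega> X" for f
  proof -
    have meas: "T f \<in> borel_measurable (hausdorff_on s X)"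
      by (intro continuous_measurable_hausdorff_on lipschitz_space_continuous[OF k \<omega> lip[OF f]])
    \<comment> \<open>In the mean over a cube, \<open>f\<close> is close to its projection by
      \<open>proj_approx\<close>, and the projection is uniformly close to
      \<open>T f\<close>.\<close>
    have "ae_eq_on s X f (T f)"
    proof (rule ae_eq_if_small_means[OF campanato_measurable[OF f] meas])
      show "(CA + C * A1) * Nf f \<ge> 0" using CA C A1_pos by simp
      fix x r assume x: "x \<in> X" and r: "r > 0" "ennreal r \<le> 4 * ediam X"
      interpret finite_measure "H x r" by (rule finite_H[OF r])
      have int: "integrable (H x r) (\<lambda>w. \<bar>f w - proj x r f w\<bar>)"
        using campanatoD(2)[OF f x r] polyfun_integrable[OF polyfun_proj[OF r] r] by simp
      have "(\<integral>\<^sup>+w. ennreal \<bar>f w - T f w\<bar> \<partial>H x r) \<le> (\<integral>\<^sup>+w. ennreal (\<bar>f w - proj x r f w\<bar> + C * Nf f * \<omega> r) \<partial>H x r)"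
      proof (intro nn_integral_mono ennreal_leI)
        fix w assume "w \<in> space (H x r)"
        then show "\<bar>f w - T f w\<bar> \<le> \<bar>f w - proj x r f w\<bar> + C * Nf f * \<omega> r"
          using close[OF f x r(1), of w] by (auto simp: abs_if split: if_splits)
      qed
      also have "\<dots> = ennreal (LINT w|H x r. \<bar>f w - proj x r f w\<bar> + C * Nf f * \<omega> r)"
        using int C \<omega>0[OF r(1)] by (intro nn_integral_eq_integral) auto
      also have "(LINT w|H x r. \<bar>f w - proj x r f w\<bar> + C * Nf f * \<omega> r) =
          (LINT w|H x r. \<bar>f w - proj x r f w\<bar>) + measure (H x r) (cube x r \<inter> X) * (C * Nf f * \<omega> r)"
        using int by simp
      also have "\<dots> \<le> CA * Nf f * \<omega> r * r powr s + A1 * r powr s * (C * Nf f * \<omega> r)"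
        using approx[OF f x r] measure_H[OF r, of x] C \<omega>0[OF r(1)] by (intro add_mono mult_right_mono) auto
      also have "\<dots> = (CA + C * A1) * Nf f * \<omega> r * r powr s" by (simp add: algebra_simps)
      finally show "(\<integral>\<^sup>+w. ennreal \<bar>f w - T f w\<bar> \<partial>H x r) \<le> ennreal ((CA + C * A1) * Nf f * \<omega> r * r powr s)"
        by (simp add: ennreal_leI)
    qed
    then show ?thesis unfolding ae_eq_on_def by eventually_elim simp
  qed
  have linear: "T (\<lambda>x. c * f x + e * g x) = (\<lambda>x. c * T f x + e * T g x)"
    if f: "f \<in> campanato s q k \<omega> X" and g: "g \<in> campanato s q k \<omega> X" for f g c e
  proof
    fix y
    \<comment> \<open>Linearity of the projections is known for centres in \<open>X\<close> and
      positive radii; \<open>near_point\<close> supplies such centres, so the two recursions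
      agree.\<close>
    have P: "glue \<beta> X (P (\<lambda>x. c * f x + e * g x)) (\<lambda>_. 0) N \<delta> y =
        c * glue \<beta> X (P f) (\<lambda>_. 0) N \<delta> y + e * glue \<beta> X (P g) (\<lambda>_. 0) N \<delta> y" if "\<delta> > 0" for N \<delta>
    proof -
      have "glue \<beta> X (P (\<lambda>x. c * f x + e * g x)) (\<lambda>_. 0) N \<delta> y =
          glue \<beta> X (\<lambda>x r y. c * P f x r y + e * P g x r y) (\<lambda>_. 0) N \<delta> y"
        using that
      proof (induction N arbitrary: \<delta>)
        case (Suc N)
        have "P (\<lambda>x. c * f x + e * g x) (near_point X \<delta> m) \<delta> y =
            c * P f (near_point X \<delta> m) \<delta> y + e * P g (near_point X \<delta> m) \<delta> y" if "near X \<delta> m" for m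
          unfolding P_def using near_point[OF that] Suc.prems by (intro proj_lincomb' f g) auto
        then show ?case using Suc by (auto intro!: sum.cong)
      qed simp
      then show ?thesis by (simp add: glue_linear)
    qed
    have lim: "(\<lambda>N. glue \<beta> X (P f) (\<lambda>_. 0) (2 * N) ((1 / 2) ^ N) y) \<longlonglongrightarrow> T f y"
      if "f \<in> campanato s q k \<omega> X" for f
      using conv[OF that, of y] unfolding T_def glued_def by (simp add: convergent_LIMSEQ_iff)
    have "(\<lambda>N. glue \<beta> X (P (\<lambda>x. c * f x + e * g x)) (\<lambda>_. 0) (2 * N) ((1 / 2) ^ N) y) \<longlonglongrightarrow> c * T f y + e * T g y"
      by (subst P) (auto intro!: tendsto_add tendsto_mult_left lim f g)
    then show "T (\<lambda>x. c * f x + e * g x) y = c * T f y + e * T g y"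
      unfolding T_def[of "\<lambda>x. c * f x + e * g x"] glued_def by (rule limI)
  qed
  have local: "T f = T g" if "\<And>x. x \<in> X \<Longrightarrow> f x = g x" for f g
  proof -
    have "P f = P g" unfolding P_def by (intro ext) (simp only: proj_cong[of f g, OF that])
    then show ?thesis by (simp add: T_def)
  qed
  have "extension_operator s q k \<omega> X T"
    unfolding extension_operator_def using C lip seminorm ae linear local
    by (intro conjI ballI allI impI exI[of _ C]) blast+
  then show ?thesis by (rule exI[of _ T])
qed

section \<open>Traces of Lipschitz functions\<close>

text \<open>Whitney's polynomial competes in the best approximation and bounds the error uniformly,
  hence in every L_q mean. Allowing \<open>f\<close> to differ from \<open>g\<close> on a null set
  lets the isomorphism compare arbitrary representatives.\<close>

lemma trace_campanato:
  "\<exists>C\<ge>0. \<forall>g\<in>lipschitz_space k \<omega>. \<forall>f\<in>borel_measurable (hausdorff_on s X). ae_eq_on s X f g \<longrightarrow>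
     f \<in> campanato s q k \<omega> X \<and> campanato_seminorm s q k \<omega> X f \<le> ennreal C * lipschitz_seminorm k \<omega> g"
proof -
  from lipschitz_space_polyfun_approx[OF k \<omega>, where 'n = 'n]
  obtain C where C': "C \<ge> 0 \<and> (\<forall>(g :: real ^ 'n \<Rightarrow> real) \<in> lipschitz_space k \<omega>. \<forall>x r. r > 0 \<longrightarrow>
    (\<exists>p. polyfun (k - 1) p \<and> (\<forall>y\<in>cube x r. \<bar>g y - p y\<bar> \<le> C * enn2real (lipschitz_seminorm k \<omega> g) * \<omega> r)))" ..
  note C = conjunct1[OF C'] and approx = conjunct2[OF C', rule_format]
  have "f \<in> campanato s q k \<omega> X \<and> campanato_seminorm s q k \<omega> X f \<le> ennreal C * lipschitz_seminorm k \<omega> g"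
    if g: "g \<in> lipschitz_space k \<omega>" and f: "f \<in> borel_measurable (hausdorff_on s X)" and ae: "ae_eq_on s X f g" for f g
  proof -
    define K where "K = enn2real (lipschitz_seminorm k \<omega> g)"
    have local: "in_Lq q (H x r) f \<and> best_approx s q k X f x r \<le> C * K * \<omega> r"
      if x: "x \<in> X" and r: "r > 0" "ennreal r \<le> 4 * ediam X" for x r
    proof -
      interpret finite_measure "H x r" by (rule finite_H[OF r])
      have restr: "H x r = restrict_space (hausdorff_on s X) (cube x r \<inter> X)" by (rule H_restrict) auto
      have fm: "f \<in> borel_measurable (H x r)" unfolding restr by (rule measurable_restrict_space1[OF f])
      have ae': "AE w in H x r. f w = g w \<and> w \<in> cube x r"
      proof -
        have "cube x r \<inter> X \<inter> space (hausdorff_on s X) \<in> sets (hausdorff_on s X)"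
          using cube_sets[of x r X] by simp
        then have "AE w in H x r. f w = g w"
          using ae unfolding restr ae_eq_on_def by (subst AE_restrict_space_iff) (auto elim: eventually_mono)
        moreover have "AE w in H x r. w \<in> cube x r" by (rule AE_I2) simp
        ultimately show ?thesis by eventually_elim simp
      qed
      have \<omega>r: "\<omega> r > 0" by (rule quasipower_majorantD(1)[OF \<omega> r(1)])
      obtain p where p: "polyfun (k - 1) p" "\<And>y. y \<in> cube x r \<Longrightarrow> \<bar>g y - p y\<bar> \<le> C * K * \<omega> r"
        using approx[OF g r(1), of x] by (auto simp: K_def)
      obtain B where B: "B \<ge> 0" "\<forall>y\<in>cube x r. \<bar>p y\<bar> \<le> B" using polyfun_bounded[OF p(1)] by blast
      have CK: "C * K * \<omega> r \<ge> 0" using C \<omega>r by (simp add: K_def)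
      have "in_Lq q (H x r) f"
      proof (rule in_Lq_bounded[OF finite_measure_axioms fm, of "B + C * K * \<omega> r"])
        show "AE w in H x r. \<bar>f w\<bar> \<le> B + C * K * \<omega> r"
          using ae'
        proof eventually_elim
          case (elim w)
          then have "\<bar>p w\<bar> \<le> B" "\<bar>g w - p w\<bar> \<le> C * K * \<omega> r" "f w = g w" using B p(2) by auto
          then show ?case by linarith
        qed
      qed (use B CK in simp)
      moreover have "mean_Lq q (H x r) (\<lambda>y. f y - p y) \<le> C * K * \<omega> r"
      proof (rule mean_Lq_bounded[OF finite_measure_axioms q _ _ CK])
        show "(\<lambda>y. f y - p y) \<in> borel_measurable (H x r)" using fm polyfun_measurable[OF p(1)] by simp
        show "AE w in H x r. \<bar>f w - p w\<bar> \<le> C * K * \<omega> r"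
          using ae' by eventually_elim (use p(2) in auto)
      qed
      moreover have "best_approx s q k X f x r \<le> mean_Lq q (H x r) (\<lambda>y. f y - p y)"
        unfolding best_approx_def
      proof (rule cINF_lower)
        show "bdd_below ((\<lambda>p. mean_Lq q (H x r) (\<lambda>y. f y - p y)) ` polys (k - 1))"
          by (rule bdd_belowI[of _ 0]) (auto simp: mean_Lq_def)
        show "p \<in> polys (k - 1)" using p(1) by (simp add: polys_eq)
      qed
      ultimately show ?thesis by linarith
    qed
    have fin: "lipschitz_seminorm k \<omega> g < \<infinity>" using g by (simp add: lipschitz_space_def)
    have sem: "campanato_seminorm s q k \<omega> X f \<le> ennreal (C * K)"
      unfolding campanato_seminorm_def
    proof (rule SUP_least, clarify)
      fix x r assume "(x, r) \<in> cubes X"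
      then have xr: "x \<in> X" "r > 0" "ennreal r \<le> 4 * ediam X" by (auto simp: cubes_def)
      have "\<omega> r > 0" by (rule quasipower_majorantD(1)[OF \<omega> xr(2)])
      then show "ennreal (best_approx s q k X f x r / \<omega> r) \<le> ennreal (C * K)"
        using local[OF xr] by (intro ennreal_leI) (simp add: pos_divide_le_eq)
    qed
    also have "\<dots> = ennreal C * lipschitz_seminorm k \<omega> g"
      using C fin by (simp add: K_def ennreal_mult)
    finally have "campanato_seminorm s q k \<omega> X f \<le> ennreal C * lipschitz_seminorm k \<omega> g" .
    moreover have "campanato_seminorm s q k \<omega> X f < \<infinity>"
      using sem by (auto intro: le_less_trans)
    ultimately show ?thesis using f local by (auto simp: campanato_def cubes_def)
  qed
  with C show ?thesis by blast
qed

text \<open>A disagreement at a point of \<open>X\<close> would persist on a ball around it, and by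
  the lower bound of an s-set this ball has positive measure.\<close>

lemma continuous_ae_eq_imp_eq:
  assumes "continuous_on UNIV g" "continuous_on UNIV h" "ae_eq_on s X g h" "x \<in> X"
  shows "g x = h x"
proof (rule ccontr)
  assume ne: "g x \<noteq> h x"
  have "open {y. g y \<noteq> h y}" by (rule open_Collect_neq[OF assms(1,2)])
  then obtain e where e: "e > 0" "ball x e \<subseteq> {y. g y \<noteq> h y}"
    using ne by (auto simp: open_contains_ball)
  obtain r where r: "r > 0" "r \<le> e" "ennreal r \<le> ediam X"
  proof (cases rule: ediam_cases)
    case infinite
    have "ennreal e \<le> ediam X"
      using quarter_le_ediam[OF infinite[of "4 * e"]] e(1) by simp
    then show ?thesis using that[of e] e(1) by simp
  next
    case (finite E)
    then show ?thesis using that[of "min e E"] e(1) by (auto intro: ennreal_leI)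
  qed
  have sets: "ball x r \<inter> X \<in> sets (hausdorff_on s X)" by (rule borel_in_sets_hausdorff_on) simp
  have "AE y in hausdorff_on s X. y \<notin> ball x r \<inter> X"
    using assms(3) unfolding ae_eq_on_def
  proof eventually_elim
    case (elim y)
    have "ball x r \<subseteq> ball x e" using r(2) by (rule subset_ball)
    then show ?case using elim e(2) by blast
  qed
  then have "emeasure (hausdorff_on s X) (ball x r \<inter> X) = 0"
    using sets sets.sets_into_space[OF sets] by (subst (asm) AE_iff_measurable[OF sets]) auto
  moreover have "ennreal (b * r powr s) \<le> hausdorff_outer s (ball x r \<inter> X)" by (rule lower[OF assms(4) r(1,3)])
  ultimately show False using emeasure_hausdorff_on[OF sets] b r(1) by simp
qed

text \<open>For the lower estimate, every Lipschitz extension of \<open>h\<close> agrees with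
  \<open>f\<close> almost everywhere, so \<open>trace_campanato\<close> applies to it. For the upper
  one, \<open>T f\<close> and an extension of \<open>h\<close> are continuous, hence equal at all
  points of \<open>X\<close>, and \<open>T f\<close> competes in the infimum.\<close>

lemma trace_iso:
  assumes T: "extension_operator s q k \<omega> X T"
  shows "induces_iso (ae_eq_on s X) (campanato s q k \<omega> X) (campanato_seminorm s q k \<omega> X)
    (trace_space k \<omega> X) (trace_seminorm k \<omega> X) T"
proof -
  let ?E = "ae_eq_on s X" and ?V = "campanato s q k \<omega> X" and ?W = "trace_space k \<omega> X"
  have sym: "?E g f" if "?E f g" for f g using that unfolding ae_eq_on_def by eventually_elim simp
  have trans: "?E f h" if "?E f g" "?E g h" for f g h using that unfolding ae_eq_on_def by eventually_elim simp
  have on_X: "?E f g" if "\<And>x. x \<in> X \<Longrightarrow> f x = g x" for f g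
    unfolding ae_eq_on_def by (rule AE_I2) (use that in simp)
  have lip: "T f \<in> lipschitz_space k \<omega>" and ae: "?E (T f) f" if "f \<in> ?V" for f
    using T that unfolding extension_operator_def by blast+
  from T[unfolded extension_operator_def, THEN conjunct2, THEN conjunct2, THEN conjunct2, THEN conjunct1]
  obtain CT where CT': "CT \<ge> 0 \<and> (\<forall>f\<in>?V. lipschitz_seminorm k \<omega> (T f) \<le> ennreal CT * campanato_seminorm s q k \<omega> X f)" ..
  note CT = conjunct1[OF CT'] conjunct2[OF CT', rule_format]
  from trace_campanato obtain CW where CW': "CW \<ge> 0 \<and> (\<forall>g\<in>lipschitz_space k \<omega>. \<forall>f\<in>borel_measurable (hausdorff_on s X).
     ?E f g \<longrightarrow> f \<in> ?V \<and> campanato_seminorm s q k \<omega> X f \<le> ennreal CW * lipschitz_seminorm k \<omega> g)" ..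
  note CW = conjunct1[OF CW'] and trace = conjunct2[OF CW', rule_format]
  have cont: "continuous_on UNIV g" if "g \<in> lipschitz_space k \<omega>" for g :: "real ^ 'n \<Rightarrow> real"
    by (rule lipschitz_space_continuous[OF k \<omega> that])
  show ?thesis
    unfolding induces_iso_def
  proof (intro conjI ballI allI)
    fix f assume f: "f \<in> ?V"
    show "T f \<in> ?W" using lip[OF f] by (auto simp: trace_space_def)
    fix g assume g: "g \<in> ?V"
    show "?E (T f) (T g) \<longleftrightarrow> ?E f g" using ae[OF f] ae[OF g] sym trans by blast
    show "?E (T (\<lambda>x. c * f x + e * g x)) (\<lambda>x. c * T f x + e * T g x)" for c e
    proof -
      have "T (\<lambda>x. c * f x + e * g x) = (\<lambda>x. c * T f x + e * T g x)"
        using T f g unfolding extension_operator_def by blast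
      then show ?thesis by (intro on_X) simp
    qed
  next
    fix h assume "h \<in> ?W"
    then obtain g where g: "g \<in> lipschitz_space k \<omega>" "\<And>x. x \<in> X \<Longrightarrow> h x = g x" by (auto simp: trace_space_def)
    have "h \<in> borel_measurable (hausdorff_on s X)"
      using continuous_measurable_hausdorff_on[OF cont[OF g(1)]] g(2)
      by (subst measurable_cong[of _ _ g]) auto
    then have "h \<in> ?V" using trace[OF g(1) _ on_X] g(2) by blast
    then show "\<exists>f\<in>?V. ?E (T f) h" using ae by blast
  next
    \<comment> \<open>Adding 1 to \<open>CW\<close>, and to \<open>CT\<close> below, makes both
      constants positive.\<close>
    define c where "c = 1 / (CW + 1)"
    have c: "c > 0" using CW by (simp add: c_def)
    have "ennreal c * campanato_seminorm s q k \<omega> X f \<le> trace_seminorm k \<omega> X h \<and>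
        trace_seminorm k \<omega> X h \<le> ennreal (CT + 1) * campanato_seminorm s q k \<omega> X f"
      if f: "f \<in> ?V" and h: "h \<in> ?W" and E: "?E (T f) h" for f h
    proof
      show "ennreal c * campanato_seminorm s q k \<omega> X f \<le> trace_seminorm k \<omega> X h"
        unfolding trace_seminorm_def
      proof (rule INF_greatest)
        fix g assume "g \<in> {g \<in> lipschitz_space k \<omega>. \<forall>x\<in>X. h x = g x}"
        then have g: "g \<in> lipschitz_space k \<omega>" "\<And>x. x \<in> X \<Longrightarrow> h x = g x" by auto
        have "?E f g" using ae[OF f] E on_X[of h g, OF g(2)] sym trans by blast
        then have "campanato_seminorm s q k \<omega> X f \<le> ennreal CW * lipschitz_seminorm k \<omega> g"
          using trace[OF g(1) campanato_measurable[OF f]] by blast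
        then have "ennreal c * campanato_seminorm s q k \<omega> X f \<le> ennreal c * (ennreal CW * lipschitz_seminorm k \<omega> g)"
          by (rule mult_left_mono) simp
        also have "\<dots> = ennreal (c * CW) * lipschitz_seminorm k \<omega> g"
          using c CW by (simp add: ennreal_mult mult.assoc)
        also have "\<dots> \<le> 1 * lipschitz_seminorm k \<omega> g"
          using CW by (intro mult_right_mono) (auto simp: c_def divide_le_eq)
        finally show "ennreal c * campanato_seminorm s q k \<omega> X f \<le> lipschitz_seminorm k \<omega> g" by simp
      qed
      obtain g where g: "g \<in> lipschitz_space k \<omega>" "\<And>x. x \<in> X \<Longrightarrow> h x = g x" using h by (auto simp: trace_space_def)
      have "?E (T f) g" using E on_X[of h g, OF g(2)] trans by blast
      then have "h x = T f x" if "x \<in> X" for x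
        using continuous_ae_eq_imp_eq[OF cont[OF lip[OF f]] cont[OF g(1)]] g(2) that by simp
      then have "trace_seminorm k \<omega> X h \<le> lipschitz_seminorm k \<omega> (T f)"
        unfolding trace_seminorm_def using lip[OF f] by (intro INF_lower) auto
      also have "\<dots> \<le> ennreal CT * campanato_seminorm s q k \<omega> X f" by (rule CT(2)[OF f])
      also have "\<dots> \<le> ennreal (CT + 1) * campanato_seminorm s q k \<omega> X f"
        by (intro mult_right_mono ennreal_leI) auto
      finally show "trace_seminorm k \<omega> X h \<le> ennreal (CT + 1) * campanato_seminorm s q k \<omega> X f" .
    qed
    then show "\<exists>c>0. \<exists>C>0. \<forall>f\<in>?V. \<forall>h\<in>?W. ?E (T f) h \<longrightarrow>
        ennreal c * campanato_seminorm s q k \<omega> X f \<le> trace_seminorm k \<omega> X h \<and>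
        trace_seminorm k \<omega> X h \<le> ennreal C * campanato_seminorm s q k \<omega> X f"
      using c CT(1) by (intro exI[of _ c] exI[of _ "CT + 1"] conjI) (auto intro: add_nonneg_pos)
  qed
qed

end

text \<open>A set of diameter 0 is covered by a single point, at the cost
  \<open>0 powr s = 0\<close>.\<close>

lemma ediam_pos:
  assumes "0 < hausdorff_outer s X"
  shows "0 < ediam X"
proof (rule ccontr)
  assume "\<not> ?thesis"
  then have diam0: "ediam X = 0" by (simp add: not_less)
  have eq: "x = y" if "x \<in> X" "y \<in> X" for x y
  proof -
    have "ennreal (dist x y) \<le> ediam X" unfolding ediam_def using that by (intro SUP_upper2[of "(x, y)"]) auto
    then show ?thesis using diam0 by simp
  qed
  have sub: "X \<subseteq> {x}" if "x \<in> X" for x using eq that by blast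
  have "hausdorff_outer s X \<le> 0"
  proof (cases "X = {}")
    case False
    then obtain x where "X \<subseteq> {x}" using sub by blast
    then show ?thesis
      unfolding hausdorff_outer_def hausdorff_pre_def
      by (intro SUP_least INF_lower2[of "\<lambda>_. {x}"]) (auto simp: diameter_def)
  qed (simp add: hausdorff_outer_empty)
  with assms show False by simp
qed

theorem theorem2p11:
  fixes X :: "(real ^ 'n::finite) set"
    and s :: real and q :: ennreal and k :: nat and \<omega> :: "real \<Rightarrow> real"
  assumes "s_set s X"
    and "real CARD('n) - 1 < s" and "s \<le> real CARD('n)"
    and "0 < hausdorff_outer s X"
    and "1 \<le> k"
    and "1 \<le> q"
    and "quasipower_majorant k \<omega>"
  shows "(\<exists>T. extension_operator s q k \<omega> X T) \<and>
         (\<exists>\<Phi>. induces_iso (ae_eq_on s X)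
                 (campanato s q k \<omega> X) (campanato_seminorm s q k \<omega> X)
                 (trace_space k \<omega> X) (trace_seminorm k \<omega> X) \<Phi> \<and>
              (\<forall>f \<in> campanato s q k \<omega> X. ae_eq_on s X (\<Phi> f) f))"
proof -
  obtain a b where "campanato_set s X a b q k \<omega>"
    using assms ediam_pos[OF assms(4)] unfolding s_set_def campanato_set_def campanato_set_axioms_def ahlfors_set_def
    by blast
  then interpret campanato_set s X a b q k \<omega> .
  obtain T where T: "extension_operator s q k \<omega> X T" using extension_operator_ex by blast
  then have "\<forall>f \<in> campanato s q k \<omega> X. ae_eq_on s X (T f) f" unfolding extension_operator_def by blast
  \<comment> \<open>The extension operator itself serves as \<open>\<Phi>\<close>.\<close>
  with T trace_iso[OF T] show ?thesis by blast
qed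

end
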